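(* Let $T,r,R\in(0,\infty)$, $v,w,z,\mathbf{z},\theta\in[0,\infty)$, $\mathfrak{c}\in[1,\infty)$, $\mathbf{v},p\in[2,\infty)$. Let $\nu_d\colon\mathcal{B}(\mathbb{R}^d)\to[0,1]$, $d\in\mathbb{N}$, be probability measures with $\sup_{d\in\mathbb{N}}\big[d^{-\theta p}\int_{\mathbb{R}^d}\|x\|^{p\mathbf{v}}\,\nu_d(dx)\big]<\infty$. Let $\varphi_d\colon\mathbb{R}^d\to\mathbb{R}$, $d\in\mathbb{N}$, be continuous functions, and let $\mu_d\colon\mathbb{R}^d\to\mathbb{R}^d$ and $\sigma_d\colon\mathbb{R}^d\to\mathbb{R}^{d\times d}$, $d\in\mathbb{N}$, be functions which satisfy for all $d\in\mathbb{N}$, $x,y\in\mathbb{R}^d$, $\lambda\in\mathbb{R}$ that $$\mu_d(\lambda x+y)+\lambda\mu_d(0)=\lambda\mu_d(x)+\mu_d(y),\qquad\sigma_d(\lambda x+y)+\lambda\sigma_d(0)=\lambda\sigma_d(x)+\sigma_d(y),$$ and $\|\mu_d(x)\|+\|\sigma_d(x)\|_{\mathrm{HS}}\le\mathfrak{c}(1+\|x\|)$. Let $\mathbf{a}\in C(\mathbb{R},\mathbb{R})$, let $\mathcal{N},\mathcal{P},\mathcal{P}_{\mathrm{nz}},\mathcal{R}$ be the set of neural networks, the parameter-count functions, and the realization function (with activation $\mathbf{a}$) defined in the context, and let $(\phi_{d,\delta})_{d\in\mathbb{N},\,\delta\in(0,r]}\subseteq\mathcal{N}$ satisfy for all $d\in\mathbb{N}$,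 $\delta\in(0,r]$, $x\in\mathbb{R}^d$ that $\mathcal{P}(\phi_{d,\delta})\le\mathfrak{c}\,d^z\delta^{-\mathbf{z}}$, $\mathcal{R}(\phi_{d,\delta})\in C(\mathbb{R}^d,\mathbb{R})$, $|(\mathcal{R}(\phi_{d,\delta}))(x)|\le\mathfrak{c}\,d^v(1+\|x\|^{\mathbf{v}})$, and $$|\varphi_d(x)-(\mathcal{R}(\phi_{d,\delta}))(x)|\le\mathfrak{c}\,d^w\,\delta\,(1+\|x\|^{\mathbf{v}}).$$ Then: (i) There exist unique continuous functions $u_d\colon[0,T]\times\mathbb{R}^d\to\mathbb{R}$, $d\in\mathbb{N}$, which satisfy for all $d\in\mathbb{N}$, $x\in\mathbb{R}^d$ that $u_d(0,x)=\varphi_d(x)$, which satisfy for all $d\in\mathbb{N}$ that $\inf_{q\in(0,\infty)}\sup_{(t,x)\in[0,T]\times\mathbb{R}^d}\frac{|u_d(t,x)|}{1+\|x\|^q}<\infty$, and which satisfy for all $d\in\mathbb{N}$ that $u_d|_{(0,T)\times\mathbb{R}^d}$ is a viscosity solution of $$\big(\tfrac{\partial}{\partial t}u_d\big)(t,x)=\tfrac12\operatorname{Trace}\big(\sigma_d(x)[\sigma_d(x)]^*(\operatorname{Hess}_xu_d)(t,x)\big)+\langle(\nabla_xu_d)(t,x),\mu_d(x)\rangle$$ for $(t,x)\in(0,T)\times\mathbb{R}^d$. (ii) There exist $\mathfrak{C}\in(0,\infty)$ and $(\psi_{d,\varepsilon})_{d\in\mathbb{N},\,\varepsilon\in(0,R]}\subseteq\mathcal{N}$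 such that for all $d\in\mathbb{N}$, $\varepsilon\in(0,R]$ it holds that $$\mathcal{P}(\psi_{d,\varepsilon})\le\mathfrak{C}\,d^{(5+\mathbf{z})\theta+z+w\mathbf{z}+4v}\,\varepsilon^{-4-\mathbf{z}},\qquad\mathcal{P}_{\mathrm{nz}}(\psi_{d,\varepsilon})\le\mathfrak{C}\,d^{(5+\mathbf{z})\theta+z+w\mathbf{z}+2v}\,\varepsilon^{-2-\mathbf{z}},$$ $\mathcal{R}(\psi_{d,\varepsilon})\in C(\mathbb{R}^d,\mathbb{R})$, and $$\Big[\int_{\mathbb{R}^d}|u_d(T,x)-(\mathcal{R}(\psi_{d,\varepsilon}))(x)|^p\,\nu_d(dx)\Big]^{1/p}\le\varepsilon.$$
   Context: $\mathbb{N}=\{1,2,3,\dots\}$; $\|\cdot\|$ and $\langle\cdot,\cdot\rangle$ are the Euclidean norm and scalar product on $\mathbb{R}^d$; $\|\cdot\|_{\mathrm{HS}}$ is the Hilbert–Schmidt (Frobenius) norm on $\mathbb{R}^{d\times d}$; $M^*$ is the transpose of $M$. Neural networks: for $d\in\mathbb{N}$ let $\mathbf{A}_d\colon\mathbb{R}^d\to\mathbb{R}^d$, $\mathbf{A}_d(x_1,\dots,x_d)=(\mathbf{a}(x_1),\dots,\mathbf{a}(x_d))$. Let $$\mathcal{N}=\bigcup_{\mathcal{L}\in\{2,3,\dots\}}\ \bigcup_{(l_0,\dots,l_{\mathcal{L}})\in\mathbb{N}^{\mathcal{L}}\times\{1\}}\ \prod_{k=1}^{\mathcal{L}}\big(\mathbb{R}^{l_k\times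 l_{k-1}}\times\mathbb{R}^{l_k}\big).$$ For $\Phi=((W_1,B_1),\dots,(W_{\mathcal{L}},B_{\mathcal{L}}))\in\prod_{k=1}^{\mathcal{L}}(\mathbb{R}^{l_k\times l_{k-1}}\times\mathbb{R}^{l_k})$ set $\mathcal{P}(\Phi)=\sum_{k=1}^{\mathcal{L}}l_k(l_{k-1}+1)$ (total number of parameters), let $\mathcal{P}_{\mathrm{nz}}(\Phi)$ be the total number of nonzero entries of $W_1,B_1,\dots,W_{\mathcal{L}},B_{\mathcal{L}}$, and let $\mathcal{R}(\Phi)\in C(\mathbb{R}^{l_0},\mathbb{R})$ be given by $(\mathcal{R}(\Phi))(x_0)=W_{\mathcal{L}}x_{\mathcal{L}-1}+B_{\mathcal{L}}$, where $x_k=\mathbf{A}_{l_k}(W_kx_{k-1}+B_k)$ for $0<k<\mathcal{L}$. Viscosity solutions: a continuous $u\colon(0,T)\times\mathbb{R}^d\to\mathbb{R}$ is a viscosity solution of $\partial_tu=Gu$, where $(Gh)(t,x)=\frac12\operatorname{Trace}(\sigma(x)[\sigma(x)]^*(\operatorname{Hess}_xh)(t,x))+\langle(\nabla_xh)(t,x),\mu(x)\rangle$, if for every $(s,y)$: for every $C^2$ function $h$ on $(0,T)\times\mathbb{R}^d$ with $h\ge u$ and $h(s,y)=u(s,y)$ one has $(\partial_th)(s,y)\le(Gh)(s,y)$, and for every such $h$ with $h\le u$ and $h(s,y)=u(s,y)$ one has $(\partial_th)(s,y)\ge(Gh)(s,y)$. *)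

theory Defs
  imports "HOL-Probability.Probability" "Jordan_Normal_Form.Matrix"
begin

section \<open>The spaces \<open>\<real>\<^sup>d\<close>\<close>

text \<open>
  The dimension varies inside the statements, so \<open>\<real>\<^sup>d\<close> is the set of real sequences that vanish
  from index \<open>d\<close> on; coordinates are numbered from 0. The topology and the Borel sets are those
  induced by the product topology on \<^typ>\<open>nat \<Rightarrow> real\<close>, and \<^term>\<open>L2_set x {..<d}\<close> is the
  Euclidean norm. Matrices and the vectors inside neural networks are those of
  \<^theory>\<open>Jordan_Normal_Form.Matrix\<close>, where \<^term>\<open>Matrix.vec d x\<close> is the column with
  entries \<open>x 0, \<dots>, x (d - 1)\<close>.
\<close>

definition Rd :: "nat \<Rightarrow> (nat \<Rightarrow> real) set" where
  "Rd d = {x. \<forall>i\<ge>d. x i = 0}"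

abbreviation eucl_norm :: "nat \<Rightarrow> (nat \<Rightarrow> real) \<Rightarrow> real" where
  "eucl_norm d x \<equiv> L2_set x {..<d}"

definition HS_norm :: "real mat \<Rightarrow> real" where
  "HS_norm A = L2_set (\<lambda>ij. A $$ ij) ({..<dim_row A} \<times> {..<dim_col A})"

definition mat_trace :: "real mat \<Rightarrow> real" where
  "mat_trace A = (\<Sum>i<dim_row A. A $$ (i, i))"


section \<open>Neural networks\<close>

type_synonym network = "(real mat \<times> real Matrix.vec) list"

definition networks :: "network set" where
  "networks = {\<Phi>. \<exists>l :: nat list. 2 \<le> length \<Phi> \<and> length l = length \<Phi> + 1 \<and>
     (\<forall>n\<in>set l. 1 \<le> n) \<and> last l = 1 \<and>
     (\<forall>k<length \<Phi>. fst (\<Phi> ! k) \<in> carrier_mat (l ! Suc k) (l ! k) \<and>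
                    snd (\<Phi> ! k) \<in> carrier_vec (l ! Suc k))}"

text \<open>The input dimension \<open>l\<^sub>0\<close>.\<close>

definition input_dim :: "network \<Rightarrow> nat" where
  "input_dim \<Phi> = dim_col (fst (hd \<Phi>))"

definition param_count :: "network \<Rightarrow> nat" where
  "param_count \<Phi> = (\<Sum>(W, B)\<leftarrow>\<Phi>. dim_row W * (dim_col W + 1))"

definition nz_param_count :: "network \<Rightarrow> nat" where
  "nz_param_count \<Phi> = (\<Sum>(W, B)\<leftarrow>\<Phi>.
     card {(i, j). i < dim_row W \<and> j < dim_col W \<and> W $$ (i, j) \<noteq> 0} +
     card {i. i < dim_vec B \<and> vec_index B i \<noteq> 0})"

fun network_output :: "(real \<Rightarrow> real) \<Rightarrow> network \<Rightarrow> real Matrix.vec \<Rightarrow> real Matrix.vec" where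
  "network_output a [] x = x"
| "network_output a [(W, B)] x = W *\<^sub>v x + B"
| "network_output a ((W, B) # L # \<Phi>) x = network_output a (L # \<Phi>) (map_vec a (W *\<^sub>v x + B))"

definition realization :: "(real \<Rightarrow> real) \<Rightarrow> network \<Rightarrow> (nat \<Rightarrow> real) \<Rightarrow> real" where
  "realization a \<Phi> x = vec_index (network_output a \<Phi> (Matrix.vec (input_dim \<Phi>) x)) 0"

text \<open>
  \<open>\<R>(\<Phi>) \<in> C(\<real>\<^sup>d, \<real>)\<close>: as \<open>\<R>(\<Phi>)\<close> has domain \<open>\<real>\<close> to the power \<open>l\<^sub>0\<close>, this includes \<open>l\<^sub>0 = d\<close>.
\<close>

definition realization_in_C :: "(real \<Rightarrow> real) \<Rightarrow> network \<Rightarrow> nat \<Rightarrow> bool" where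
  "realization_in_C a \<Phi> d \<longleftrightarrow> input_dim \<Phi> = d \<and> continuous_on (Rd d) (realization a \<Phi>)"


section \<open>Partial derivatives and \<open>C\<^sup>2\<close> functions of \<open>(t, x)\<close>\<close>

text \<open>The coordinate directions: \<^term>\<open>None\<close> is time, \<^term>\<open>Some i\<close> the \<open>i\<close>-th space coordinate.\<close>

fun move :: "nat option \<Rightarrow> real \<Rightarrow> real \<times> (nat \<Rightarrow> real) \<Rightarrow> real \<times> (nat \<Rightarrow> real)" where
  "move None s (t, x) = (t + s, x)"
| "move (Some i) s (t, x) = (t, x(i := x i + s))"

definition partial :: "nat option \<Rightarrow> (real \<times> (nat \<Rightarrow> real) \<Rightarrow> real) \<Rightarrow> real \<times> (nat \<Rightarrow> real) \<Rightarrow> real" where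
  "partial k h p = deriv (\<lambda>s. h (move k s p)) 0"

text \<open>
  \<open>C\<^sup>n\<close> on \<open>(0,T) \<times> \<real>\<^sup>d\<close>: all iterated partial derivatives up to order \<open>n\<close> exist and are continuous.
\<close>

fun C_k_on :: "nat \<Rightarrow> nat \<Rightarrow> real \<Rightarrow> (real \<times> (nat \<Rightarrow> real) \<Rightarrow> real) \<Rightarrow> bool" where
  "C_k_on 0 d T h \<longleftrightarrow> continuous_on ({0<..<T} \<times> Rd d) h"
| "C_k_on (Suc n) d T h \<longleftrightarrow> continuous_on ({0<..<T} \<times> Rd d) h \<and>
     (\<forall>k\<in>insert None (Some ` {..<d}).
        (\<forall>p\<in>{0<..<T} \<times> Rd d. (\<lambda>s. h (move k s p)) field_differentiable at 0) \<and>
        C_k_on n d T (partial k h))"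

definition Hess_x :: "nat \<Rightarrow> (real \<times> (nat \<Rightarrow> real) \<Rightarrow> real) \<Rightarrow> real \<times> (nat \<Rightarrow> real) \<Rightarrow> real mat" where
  "Hess_x d h p = mat d d (\<lambda>(i, j). partial (Some i) (partial (Some j) h) p)"


section \<open>Kolmogorov equations\<close>

definition generator ::
  "nat \<Rightarrow> ((nat \<Rightarrow> real) \<Rightarrow> nat \<Rightarrow> real) \<Rightarrow> ((nat \<Rightarrow> real) \<Rightarrow> real mat) \<Rightarrow>
   (real \<times> (nat \<Rightarrow> real) \<Rightarrow> real) \<Rightarrow> real \<times> (nat \<Rightarrow> real) \<Rightarrow> real" where
  "generator d \<mu> \<sigma> h = (\<lambda>(t, x).
     1 / 2 * mat_trace (\<sigma> x * transpose_mat (\<sigma> x) * Hess_x d h (t, x)) +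
     (\<Sum>i<d. partial (Some i) h (t, x) * \<mu> x i))"

definition viscosity_solution ::
  "nat \<Rightarrow> real \<Rightarrow> ((nat \<Rightarrow> real) \<Rightarrow> nat \<Rightarrow> real) \<Rightarrow> ((nat \<Rightarrow> real) \<Rightarrow> real mat) \<Rightarrow>
   (real \<times> (nat \<Rightarrow> real) \<Rightarrow> real) \<Rightarrow> bool" where
  "viscosity_solution d T \<mu> \<sigma> u \<longleftrightarrow>
     continuous_on ({0<..<T} \<times> Rd d) u \<and>
     (\<forall>p\<in>{0<..<T} \<times> Rd d.
        (\<forall>h. C_k_on 2 d T h \<and> (\<forall>q\<in>{0<..<T} \<times> Rd d. h q \<ge> u q) \<and> h p = u p \<longrightarrow>
             partial None h p \<le> generator d \<mu> \<sigma> h p) \<and>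
        (\<forall>h. C_k_on 2 d T h \<and> (\<forall>q\<in>{0<..<T} \<times> Rd d. h q \<le> u q) \<and> h p = u p \<longrightarrow>
             partial None h p \<ge> generator d \<mu> \<sigma> h p))"

definition at_most_poly_growth :: "nat \<Rightarrow> real \<Rightarrow> (real \<times> (nat \<Rightarrow> real) \<Rightarrow> real) \<Rightarrow> bool" where
  "at_most_poly_growth d T u \<longleftrightarrow>
     (INF q\<in>{0<..}. SUP (t, x)\<in>{0..T} \<times> Rd d.
        ennreal (\<bar>u (t, x)\<bar> / (1 + eucl_norm d x powr q))) < \<infinity>"

definition kolmogorov_solution ::
  "nat \<Rightarrow> real \<Rightarrow> ((nat \<Rightarrow> real) \<Rightarrow> real) \<Rightarrow> ((nat \<Rightarrow> real) \<Rightarrow> nat \<Rightarrow> real) \<Rightarrow>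
   ((nat \<Rightarrow> real) \<Rightarrow> real mat) \<Rightarrow> (real \<times> (nat \<Rightarrow> real) \<Rightarrow> real) \<Rightarrow> bool" where
  "kolmogorov_solution d T \<phi> \<mu> \<sigma> u \<longleftrightarrow>
     continuous_on ({0..T} \<times> Rd d) u \<and>
     (\<forall>x\<in>Rd d. u (0, x) = \<phi> x) \<and>
     at_most_poly_growth d T u \<and>
     viscosity_solution d T \<mu> \<sigma> u"

end

(* Let P_h average a function over the 2d affine jumps x + h mu(x) + s sqrt(d h) sigma_k(x), s = 1 or -1,
   k < d. These jumps have the drift and the covariance of the diffusion, so (P_h - I)/h tends to the
   generator G, and, since mu and sigma have linear growth with constant c, iterates of P_h increase the
   weights (1 + |x|^2)^m by a factor that does not depend on d. Finite averages over
   compositions of such jumps take the place of stochastic integrals.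

   Existence and uniqueness. The functions x_i/(1 + |x|^2) and 1/(1 + |x|^2) generate an algebra which is
   closed under partial derivatives, and which is dense in the weighted sup norm by Stone-Weierstrass on the
   one-point compactification. For f in this algebra ((1 - tau) I + tau P_h)^N f with tau = t/(N h) is smooth
   in (t, x); because jumps are affine in x, its second and third derivatives along lines stay under
   control, so that it solves the equation up to a small error. Comparing a viscosity solution with these
   functions gives uniqueness, and shows that they converge to a solution.

   Networks. Hence u_d(T, .) is a limit of averages of phi_d over affine maps with dimension-free moment
   bounds. Replace phi_d by a network, and these averages by arithmetic means over n of the affine maps,
   chosen by the Monte Carlo argument with n of order d^(2 v + 2 theta) eps^(-2). The affine maps are absorbed
   in the first layer, and n copies of the network are put in parallel: this multiplies the number of
   parameters by n^2 but the number of nonzero parameters only by n. *)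

theory Submission
  imports Defs
begin

section \<open>Calculus on \<open>(0,T) \<times> \<real>\<^sup>d\<close>\<close>

text \<open>At a maximum of the difference of two merely continuous functions neither of them
  provides a test function. Here one of the two is always a scheme, hence C^2, and a scheme plus a
  smooth barrier is itself a test function for the other one. The price is that schemes must solve
  the equation up to an error that is small in a weighted sup norm, which calls for bounds on
  derivatives that survive iteration. The lazy power of (1 - \<tau>) I + \<tau> P is used instead of
  a power of P because it is a polynomial in \<tau>, so that the time derivative is exact algebra
  for real t. The degree of the weight rises by one in the density and comparison results: the extra
  factor 1 + |x|^2 controls everything far away and forces maxima into a compact set. Dimension
  enters in two different ways: moment bounds for the affine maps must not depend on d, whereas step
  sizes, derivative bounds and the number of iterations may depend on d arbitrarily, since they
  occur in no final estimate.\<close>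

abbreviation cyl :: "nat \<Rightarrow> real \<Rightarrow> (real \<times> (nat \<Rightarrow> real)) set" where
  "cyl d T \<equiv> {0<..<T} \<times> Rd d"

definition nsq :: "nat \<Rightarrow> (nat \<Rightarrow> real) \<Rightarrow> real" where
  "nsq d x = (\<Sum>i<d. (x i)\<^sup>2)"

lemma nsq_nonneg [simp]: "0 \<le> nsq d x"
  by (simp add: nsq_def sum_nonneg)

lemma eucl_norm_eq_sqrt_nsq: "eucl_norm d x = sqrt (nsq d x)"
  by (simp add: nsq_def L2_set_def)

lemma coord_sq_le_nsq: "i < d \<Longrightarrow> (x i)\<^sup>2 \<le> nsq d x"
  unfolding nsq_def by (rule member_le_sum) auto

lemma Rd_line: "x \<in> Rd d \<Longrightarrow> y \<in> Rd d \<Longrightarrow> (\<lambda>i. x i + s * y i) \<in> Rd d"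
  by (simp add: Rd_def)

lemma Rd_zero [simp]: "(\<lambda>_. 0) \<in> Rd d"
  by (simp add: Rd_def)

lemma Rd_upd: "x \<in> Rd d \<Longrightarrow> k < d \<Longrightarrow> x(k := a) \<in> Rd d"
  by (simp add: Rd_def)

lemma tendsto_fun_componentwise:
  fixes X :: "'c \<Rightarrow> 'a \<Rightarrow> 'b::topological_space"
  assumes "\<And>i. ((\<lambda>n. X n i) \<longlongrightarrow> l i) F"
  shows "(X \<longlongrightarrow> l) F"
proof -
  have "limitin (product_topology (\<lambda>i. euclidean) UNIV) X l F"
    using assms by (simp add: limitin_componentwise limitin_canonical_iff)
  then show ?thesis by (simp add: euclidean_product_topology limitin_canonical_iff)
qed

lemma continuous_on_coord: "continuous_on S (\<lambda>x::nat \<Rightarrow> real. x i)"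
  by (rule continuous_on_product_then_coordinatewise) (rule continuous_on_id)

lemma continuous_on_snd_coord: "continuous_on S (\<lambda>p::real \<times> (nat \<Rightarrow> real). snd p i)"
  using continuous_on_compose2[OF continuous_on_coord[of UNIV i] continuous_on_snd[OF continuous_on_id[of S]]]
  by auto

text \<open>A counterexample for each \<delta> = 1/(n+1) would give points converging to p in every
  coordinate, the coordinates from d on being 0 throughout; sequential continuity excludes this. It
  turns continuity in the product topology into the coordinatewise estimates used by mean value
  arguments.\<close>

lemma continuous_on_coord_delta:
  fixes f :: "real \<times> (nat \<Rightarrow> real) \<Rightarrow> real"
  assumes f: "continuous_on S f" and S: "S \<subseteq> UNIV \<times> Rd d" and p: "p \<in> S" and e: "0 < e"
  shows "\<exists>\<delta>>0. \<forall>q\<in>S. \<bar>fst q - fst p\<bar> < \<delta> \<longrightarrow> (\<forall>i<d. \<bar>snd q i - snd p i\<bar> < \<delta>) \<longrightarrow> \<bar>f q - f p\<bar> < e"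
proof (rule ccontr)
  assume "\<not> ?thesis"
  then have "\<forall>\<delta>>0. \<exists>q\<in>S. \<bar>fst q - fst p\<bar> < \<delta> \<and> (\<forall>i<d. \<bar>snd q i - snd p i\<bar> < \<delta>) \<and> \<not> \<bar>f q - f p\<bar> < e"
    by blast
  then have "\<forall>n. \<exists>q\<in>S. \<bar>fst q - fst p\<bar> < inverse (real (Suc n)) \<and>
      (\<forall>i<d. \<bar>snd q i - snd p i\<bar> < inverse (real (Suc n))) \<and> \<not> \<bar>f q - f p\<bar> < e"
    by simp
  then obtain q where q: "\<And>n. q n \<in> S" "\<And>n. \<bar>fst (q n) - fst p\<bar> < inverse (real (Suc n))"
      "\<And>n i. i < d \<Longrightarrow> \<bar>snd (q n) i - snd p i\<bar> < inverse (real (Suc n))"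
      "\<And>n. \<not> \<bar>f (q n) - f p\<bar> < e"
    by metis
  have lim0: "a \<longlonglongrightarrow> b" if "\<And>n. \<bar>a n - b\<bar> < inverse (real (Suc n))" for a :: "nat \<Rightarrow> real" and b
  proof -
    have "(\<lambda>n. a n - b) \<longlonglongrightarrow> 0"
      by (rule Lim_null_comparison[OF _ LIMSEQ_inverse_real_of_nat])
        (use that in \<open>auto intro!: always_eventually less_imp_le\<close>)
    then show ?thesis by (simp add: LIM_zero_iff)
  qed
  have "(\<lambda>n. snd (q n)) \<longlonglongrightarrow> snd p"
  proof (rule tendsto_fun_componentwise)
    fix i show "(\<lambda>n. snd (q n) i) \<longlonglongrightarrow> snd p i"
    proof (cases "i < d")
      case True then show ?thesis using q(3) by (intro lim0) auto
    next
      case False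
      then have "snd (q n) i = snd p i" for n using subsetD[OF S q(1)[of n]] subsetD[OF S p] by (auto simp: Rd_def mem_Times_iff)
      then show ?thesis by simp
    qed
  qed
  moreover have "(\<lambda>n. fst (q n)) \<longlonglongrightarrow> fst p" using q(2) by (intro lim0)
  ultimately have "(\<lambda>n. (fst (q n), snd (q n))) \<longlonglongrightarrow> (fst p, snd p)" by (intro tendsto_Pair)
  then have "q \<longlonglongrightarrow> p" by simp
  then have "(f \<circ> q) \<longlonglongrightarrow> f p" using f q(1) p unfolding continuous_on_sequentially by blast
  then have "(\<lambda>n. f (q n)) \<longlonglongrightarrow> f p" by (simp add: o_def)
  then have "\<forall>\<^sub>F n in sequentially. \<bar>f (q n) - f p\<bar> < e" using e by (simp add: tendsto_iff dist_real_def)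
  then show False using q(4) eventually_happens'[of sequentially] by fastforce
qed

text \<open>Finitely many radii have a positive minimum, and \<open>mono\<close> hands every
  property down to it.\<close>

lemma finite_uniform_delta:
  fixes Q :: "'a \<Rightarrow> real \<Rightarrow> bool"
  assumes "finite K" "\<And>k. k \<in> K \<Longrightarrow> \<exists>\<delta>>0. Q k \<delta>"
    and mono: "\<And>k \<delta> \<delta>'. Q k \<delta> \<Longrightarrow> \<delta>' \<le> \<delta> \<Longrightarrow> Q k \<delta>'"
  shows "\<exists>\<delta>>0. \<forall>k\<in>K. Q k \<delta>"
  using assms(1,2)
proof (induction K)
  case empty then show ?case by (auto intro: exI[of _ 1])
next
  case (insert k K)
  then obtain a b where "a > 0" "\<forall>k\<in>K. Q k a" "b > 0" "Q k b" by (meson insert_iff)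
  then have "min a b > 0 \<and> (\<forall>k\<in>insert k K. Q k (min a b))" using mono by (metis insert_iff min.cobounded1 min.cobounded2 min_less_iff_conj)
  then show ?case by blast
qed

lemma move_zero [simp]: "move k 0 p = p"
  by (cases p; cases k) auto

lemma cyl_move_eventually:
  assumes "p \<in> cyl d T" "k \<in> insert None (Some ` {..<d})"
  shows "\<forall>\<^sub>F s in nhds 0. move k s p \<in> cyl d T"
proof (cases k)
  case None
  obtain t x where p: "p = (t, x)" by force
  have "((\<lambda>s. t + s) \<longlongrightarrow> t + 0) (nhds 0)" by (intro tendsto_intros filterlim_ident)
  moreover have "open {0<..<T}" by simp
  moreover have "t + 0 \<in> {0<..<T}" using assms p by auto
  ultimately have "\<forall>\<^sub>F s in nhds 0. t + s \<in> {0<..<T}" by (rule topological_tendstoD)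
  then show ?thesis by eventually_elim (use assms p None in auto)
next
  case (Some i)
  then show ?thesis using assms by (auto intro!: always_eventually simp: Rd_def)
qed

section \<open>Closure properties of the spaces C^k\<close>

lemma C_k_on_imp_continuous: "C_k_on n d T f \<Longrightarrow> continuous_on (cyl d T) f"
  by (cases n) auto

lemma C_k_on_SucI:
  assumes "continuous_on (cyl d T) f"
    and "\<And>k p. k \<in> insert None (Some ` {..<d}) \<Longrightarrow> p \<in> cyl d T \<Longrightarrow>
           (\<lambda>s. f (move k s p)) field_differentiable at 0"
    and "\<And>k. k \<in> insert None (Some ` {..<d}) \<Longrightarrow> C_k_on n d T (partial k f)"
  shows "C_k_on (Suc n) d T f"
  using assms by simp

lemma C_k_on_partial:
  assumes "C_k_on (Suc n) d T f" "k \<in> insert None (Some ` {..<d})"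
  shows "C_k_on n d T (partial k f)"
  using assms by auto

text \<open>The time interval is open and moves of space coordinates stay in \<open>Rd d\<close>, so
  \<open>partial\<close> at a point of the cylinder depends on values inside the cylinder
  only.\<close>

lemma C_k_on_cong:
  assumes "C_k_on n d T f" "\<And>p. p \<in> cyl d T \<Longrightarrow> f p = g p"
  shows "C_k_on n d T g"
  using assms
proof (induction n arbitrary: f g)
  case 0 then show ?case using continuous_on_cong[of "cyl d T" "cyl d T" f g] by auto
next
  case (Suc n)
  have ev: "\<forall>\<^sub>F s in nhds 0. f (move k s p) = g (move k s p)"
    if "p \<in> cyl d T" "k \<in> insert None (Some ` {..<d})" for p k
    using cyl_move_eventually[OF that] by eventually_elim (use Suc.prems(2) in auto)
  have "(\<lambda>s. g (move k s p)) field_differentiable at 0 \<and> partial k f p = partial k g p"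
    if "p \<in> cyl d T" "k \<in> insert None (Some ` {..<d})" for p k
  proof
    have "(\<lambda>s. f (move k s p)) field_differentiable at 0" using Suc.prems(1) that by auto
    then show "(\<lambda>s. g (move k s p)) field_differentiable at 0"
      using ev[OF that] DERIV_cong_ev[OF refl ev[OF that] refl] unfolding field_differentiable_def by blast
    show "partial k f p = partial k g p" unfolding partial_def by (rule deriv_cong_ev[OF ev[OF that]]) simp
  qed
  moreover have "continuous_on (cyl d T) g" using Suc.prems continuous_on_cong[of "cyl d T" "cyl d T" f g] by auto
  moreover have "C_k_on n d T (partial k g)" if "k \<in> insert None (Some ` {..<d})" for k
    using Suc.IH[OF C_k_on_partial[OF Suc.prems(1) that]] calculation(1) that by blast
  ultimately show ?case by (intro C_k_on_SucI) auto
qed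

lemma partial_has_derivative:
  assumes "C_k_on (Suc n) d T f" "p \<in> cyl d T" "k \<in> insert None (Some ` {..<d})"
  shows "((\<lambda>s. f (move k s p)) has_real_derivative partial k f p) (at 0)"
  using assms unfolding partial_def by (auto simp: DERIV_deriv_iff_field_differentiable)

lemma partial_eqI:
  assumes "((\<lambda>s. f (move k s p)) has_real_derivative D) (at 0)"
  shows "partial k f p = D"
  using assms unfolding partial_def by (rule DERIV_imp_deriv)

lemma partial_add_scaled:
  assumes "C_k_on (Suc n) d T f" "C_k_on (Suc n) d T g" "p \<in> cyl d T" "k \<in> insert None (Some ` {..<d})"
  shows "partial k (\<lambda>q. f q + a * g q) p = partial k f p + a * partial k g p"
  by (rule partial_eqI)
    (rule DERIV_add[OF partial_has_derivative[OF assms(1,3,4)] DERIV_cmult[OF partial_has_derivative[OF assms(2,3,4)]]])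

lemma C_k_on_add_scaled:
  assumes "C_k_on n d T f" "C_k_on n d T g"
  shows "C_k_on n d T (\<lambda>q. f q + a * g q)"
  using assms
proof (induction n arbitrary: f g)
  case 0 then show ?case by (auto intro!: continuous_intros)
next
  case (Suc n)
  have "C_k_on n d T (partial k (\<lambda>q. f q + a * g q))" if k: "k \<in> insert None (Some ` {..<d})" for k
    by (rule C_k_on_cong[OF Suc.IH[OF C_k_on_partial[OF Suc.prems(1) k] C_k_on_partial[OF Suc.prems(2) k]]])
      (use partial_add_scaled[OF Suc.prems _ k] in auto)
  moreover have "(\<lambda>s. f (move k s p) + a * g (move k s p)) field_differentiable at 0"
    if "k \<in> insert None (Some ` {..<d})" "p \<in> cyl d T" for k p
    unfolding field_differentiable_def
    using DERIV_add[OF partial_has_derivative[OF Suc.prems(1) that(2,1)]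
        DERIV_cmult[OF partial_has_derivative[OF Suc.prems(2) that(2,1)], of a]] by blast
  moreover have "continuous_on (cyl d T) (\<lambda>q. f q + a * g q)"
    using Suc.prems by (auto intro!: continuous_intros)
  ultimately show ?case by (intro C_k_on_SucI) auto
qed

section \<open>Derivatives along lines in space\<close>

lemma DERIV_shift_0:
  fixes g :: "real \<Rightarrow> real"
  shows "((\<lambda>r. g (s + r)) has_real_derivative D) (at 0) \<longleftrightarrow> (g has_real_derivative D) (at s)"
  using DERIV_shift[of g D 0 s] by (simp add: add.commute)

lemma mvt_from_zero:
  fixes f :: "real \<Rightarrow> real"
  assumes "\<And>s. (f has_real_derivative f' s) (at s)"
  shows "\<exists>\<theta>. \<bar>\<theta>\<bar> \<le> \<bar>b\<bar> \<and> f b - f 0 = b * f' \<theta>"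
proof -
  consider "b = 0" | "b > 0" | "b < 0" by linarith
  then show ?thesis
  proof cases
    case 2
    then obtain z where "0 < z" "z < b" "f b - f 0 = (b - 0) * f' z" using MVT2[of 0 b f f'] assms by blast
    then show ?thesis by (intro exI[of _ z]) auto
  next
    case 3
    then obtain z where "b < z" "z < 0" "f 0 - f b = (0 - b) * f' z" using MVT2[of b 0 f f'] assms by blast
    then show ?thesis by (intro exI[of _ z]) auto
  qed auto
qed

text \<open>\<open>dir1\<close> pairs the spatial gradient of f at p with y, and \<open>dir2\<close>
  is the Hessian quadratic form at y. All second order terms are expressed by these two until the
  equation itself is translated.\<close>

definition dir1 :: "nat \<Rightarrow> (real \<times> (nat \<Rightarrow> real) \<Rightarrow> real) \<Rightarrow> real \<times> (nat \<Rightarrow> real) \<Rightarrow> (nat \<Rightarrow> real) \<Rightarrow> real" where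
  "dir1 d f p y = (\<Sum>i<d. y i * partial (Some i) f p)"

definition dir2 :: "nat \<Rightarrow> (real \<times> (nat \<Rightarrow> real) \<Rightarrow> real) \<Rightarrow> real \<times> (nat \<Rightarrow> real) \<Rightarrow> (nat \<Rightarrow> real) \<Rightarrow> real" where
  "dir2 d f p y = (\<Sum>i<d. y i * dir1 d (partial (Some i) f) p y)"

text \<open>Continuity of the first partial derivatives makes this work: the increment from x to x +
  r y is telescoped over points that differ in a single coordinate, and the mean value theorem
  replaces each difference by a partial derivative at a point close to x.\<close>

lemma line_derivative_0:
  assumes f: "C_k_on (Suc n) d T f" and p: "(t, x) \<in> cyl d T" and y: "y \<in> Rd d"
  shows "((\<lambda>s. f (t, \<lambda>i. x i + s * y i)) has_real_derivative dir1 d f (t, x) y) (at 0)"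
  unfolding DERIV_def
proof (rule LIM_I)
  fix e :: real assume e: "0 < e"
  \<comment> \<open>The summand 1 keeps \<open>A\<close> positive and makes the final estimate
    \<open>(A - 1) * (e / A) < e\<close> strict.\<close>
  define A where "A = (\<Sum>i<d. \<bar>y i\<bar>) + 1"
  have A: "A > 0" "\<And>k. k < d \<Longrightarrow> \<bar>y k\<bar> \<le> A"
    unfolding A_def using member_le_sum[of _ "{..<d}" "\<lambda>i. \<bar>y i\<bar>"] 
    by (auto intro!: add_nonneg_pos sum_nonneg) force
  have x: "x \<in> Rd d" and t: "t \<in> {0<..<T}" using p by auto
  have "\<exists>\<delta>>0. \<forall>k\<in>{..<d}. \<forall>z\<in>Rd d. (\<forall>i<d. \<bar>z i - x i\<bar> < \<delta>) \<longrightarrow>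
      \<bar>partial (Some k) f (t, z) - partial (Some k) f (t, x)\<bar> < e / A"
  proof (rule finite_uniform_delta)
    fix k assume "k \<in> {..<d}"
    then have "continuous_on (cyl d T) (partial (Some k) f)"
      using C_k_on_partial[OF f, of "Some k"] C_k_on_imp_continuous by auto
    from continuous_on_coord_delta[OF this _ p, of d "e / A"] obtain \<delta> where "\<delta> > 0"
      "\<forall>q\<in>cyl d T. \<bar>fst q - t\<bar> < \<delta> \<longrightarrow> (\<forall>i<d. \<bar>snd q i - x i\<bar> < \<delta>) \<longrightarrow>
        \<bar>partial (Some k) f q - partial (Some k) f (t, x)\<bar> < e / A"
      using e A by auto
    then show "\<exists>\<delta>>0. \<forall>z\<in>Rd d. (\<forall>i<d. \<bar>z i - x i\<bar> < \<delta>) \<longrightarrow>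
      \<bar>partial (Some k) f (t, z) - partial (Some k) f (t, x)\<bar> < e / A"
      using t by (intro exI[of _ \<delta>]) auto
  qed (auto intro: less_le_trans)
  then obtain \<delta> where \<delta>: "\<delta> > 0" "\<And>k z. k < d \<Longrightarrow> z \<in> Rd d \<Longrightarrow> (\<And>i. i < d \<Longrightarrow> \<bar>z i - x i\<bar> < \<delta>) \<Longrightarrow>
      \<bar>partial (Some k) f (t, z) - partial (Some k) f (t, x)\<bar> < e / A"
    by (metis lessThan_iff)
  show "\<exists>s>0. \<forall>r. r \<noteq> 0 \<and> norm (r - 0) < s \<longrightarrow>
      norm ((f (t, \<lambda>i. x i + (0 + r) * y i) - f (t, \<lambda>i. x i + 0 * y i)) / r - dir1 d f (t, x) y) < e"
  proof (intro exI[of _ "\<delta> / A"] conjI allI impI)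
    show "0 < \<delta> / A" using \<delta> A by simp
    fix r :: real assume r: "r \<noteq> 0 \<and> norm (r - 0) < \<delta> / A"
    \<comment> \<open>\<open>X k\<close> has its first k coordinates moved already, so
      \<open>X 0\<close> is x and \<open>X d\<close> is x + r y.\<close>
    define X where "X k = (\<lambda>i. if i < k then x i + r * y i else x i)" for k
    have XRd: "X k \<in> Rd d" for k using x y by (auto simp: X_def Rd_def)
    have small: "\<bar>r * y k\<bar> < \<delta>" if "k < d" for k
    proof -
      have "\<bar>r * y k\<bar> \<le> \<bar>r\<bar> * A" using A(2)[OF that] by (simp add: abs_mult mult_left_mono)
      also have "\<dots> < \<delta>" using r A by (simp add: pos_less_divide_eq)
      finally show ?thesis .
    qed
    have step: "\<bar>f (t, X (Suc k)) - f (t, X k) - r * (y k * partial (Some k) f (t, x))\<bar> \<le> \<bar>r\<bar> * (\<bar>y k\<bar> * (e / A))"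
      if k: "k < d" for k
    proof -
      let ?g = "\<lambda>s. f (t, (X k)(k := x k + s))"
      have "(?g has_real_derivative partial (Some k) f (t, (X k)(k := x k + s))) (at s)" for s
        using partial_has_derivative[OF f, of "(t, (X k)(k := x k + s))" "Some k"] t k Rd_upd[OF XRd k]
        by (subst DERIV_shift_0[symmetric]) (simp add: add.assoc)
      then obtain \<theta> where th: "\<bar>\<theta>\<bar> \<le> \<bar>r * y k\<bar>"
          "?g (r * y k) - ?g 0 = (r * y k) * partial (Some k) f (t, (X k)(k := x k + \<theta>))"
        using mvt_from_zero[of ?g "\<lambda>s. partial (Some k) f (t, (X k)(k := x k + s))" "r * y k"] by blast
      have "(X k)(k := x k + r * y k) = X (Suc k)" "(X k)(k := x k) = X k" by (auto simp: X_def)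
      then have eq: "f (t, X (Suc k)) - f (t, X k) = (r * y k) * partial (Some k) f (t, (X k)(k := x k + \<theta>))"
        using th(2) by simp
      have "\<bar>partial (Some k) f (t, (X k)(k := x k + \<theta>)) - partial (Some k) f (t, x)\<bar> < e / A"
      proof (rule \<delta>(2)[OF k Rd_upd[OF XRd k]])
        fix i assume "i < d"
        then show "\<bar>((X k)(k := x k + \<theta>)) i - x i\<bar> < \<delta>" using small th(1) \<delta>(1) by (auto simp: X_def le_less_trans)
      qed
      then have "\<bar>r * y k\<bar> * \<bar>partial (Some k) f (t, (X k)(k := x k + \<theta>)) - partial (Some k) f (t, x)\<bar>
          \<le> \<bar>r * y k\<bar> * (e / A)" by (intro mult_left_mono) auto
      then show ?thesis unfolding eq abs_mult[symmetric] by (simp add: algebra_simps abs_mult)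
    qed
    have "f (t, \<lambda>i. x i + r * y i) - f (t, x) = (\<Sum>k<d. f (t, X (Suc k)) - f (t, X k))"
    proof -
      have "X d = (\<lambda>i. x i + r * y i)" "X 0 = x" using y by (auto simp: X_def Rd_def)
      then show ?thesis by (simp add: sum_lessThan_telescope[of "\<lambda>k. f (t, X k)"])
    qed
    then have "\<bar>f (t, \<lambda>i. x i + r * y i) - f (t, x) - r * dir1 d f (t, x) y\<bar>
        = \<bar>\<Sum>k<d. f (t, X (Suc k)) - f (t, X k) - r * (y k * partial (Some k) f (t, x))\<bar>"
      by (simp add: dir1_def sum_subtractf sum_distrib_left)
    also have "\<dots> \<le> (\<Sum>k<d. \<bar>r\<bar> * (\<bar>y k\<bar> * (e / A)))"
      by (rule order_trans[OF sum_abs sum_mono]) (use step in auto)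
    also have "\<dots> = \<bar>r\<bar> * ((A - 1) * (e / A))" by (simp add: A_def sum_distrib_left sum_distrib_right sum_divide_distrib)
    also have "\<dots> < \<bar>r\<bar> * e" 
      using r A e by (intro mult_strict_left_mono) (auto simp: field_simps)
    finally have "\<bar>f (t, \<lambda>i. x i + r * y i) - f (t, x) - r * dir1 d f (t, x) y\<bar> / \<bar>r\<bar> < e"
      using r by (simp add: divide_less_eq mult.commute)
    then show "norm ((f (t, \<lambda>i. x i + (0 + r) * y i) - f (t, \<lambda>i. x i + 0 * y i)) / r - dir1 d f (t, x) y) < e"
      using r by (simp add: abs_divide[symmetric] diff_divide_distrib)
  qed
qed

lemma line_derivative:
  assumes f: "C_k_on (Suc n) d T f" and p: "(t, x) \<in> cyl d T" and y: "y \<in> Rd d"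
  shows "((\<lambda>s. f (t, \<lambda>i. x i + s * y i)) has_real_derivative dir1 d f (t, \<lambda>i. x i + s * y i) y) (at s)"
proof -
  have "((\<lambda>r. f (t, \<lambda>i. (x i + s * y i) + r * y i)) has_real_derivative dir1 d f (t, \<lambda>i. x i + s * y i) y) (at 0)"
    using line_derivative_0[OF f _ y] p Rd_line[of x d y s] y by auto
  moreover have "(\<lambda>i. (x i + s * y i) + r * y i) = (\<lambda>i. x i + (s + r) * y i)" for r
    by (auto simp: algebra_simps)
  ultimately show ?thesis by (subst DERIV_shift_0[symmetric]) simp
qed

lemma line_derivative2:
  assumes f: "C_k_on (Suc (Suc n)) d T f" and p: "(t, x) \<in> cyl d T" and y: "y \<in> Rd d"
  shows "((\<lambda>s. dir1 d f (t, \<lambda>i. x i + s * y i) y) has_real_derivative dir2 d f (t, \<lambda>i. x i + s * y i) y) (at s)"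
  unfolding dir1_def[of d f] dir2_def
  by (rule DERIV_sum, rule DERIV_cmult, rule line_derivative[OF C_k_on_partial[OF f] p y]) auto

lemma taylor_line:
  assumes f: "C_k_on 2 d T f" and p: "(t, x) \<in> cyl d T" and y: "y \<in> Rd d"
  shows "\<exists>\<theta>. \<bar>\<theta>\<bar> \<le> 1 \<and> f (t, \<lambda>i. x i + y i) = f (t, x) + dir1 d f (t, x) y + dir2 d f (t, \<lambda>i. x i + \<theta> * y i) y / 2"
proof -
  define g where "g = (\<lambda>m::nat. if m = 0 then (\<lambda>s. f (t, \<lambda>i. x i + s * y i)) else if m = 1 then (\<lambda>s. dir1 d f (t, \<lambda>i. x i + s * y i) y)
      else (\<lambda>s. dir2 d f (t, \<lambda>i. x i + s * y i) y))"
  have f': "C_k_on (Suc (Suc 0)) d T f" using f by (simp only: numeral_2_eq_2)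
  have "\<exists>\<theta>>0. \<theta> \<le> 1 \<and> g 0 1 = (\<Sum>m<2. g m 0 / fact m * 1 ^ m) + g 2 \<theta> / fact 2 * 1 ^ 2"
  proof (rule Maclaurin2)
    show "\<forall>m t. m < 2 \<and> 0 \<le> t \<and> t \<le> 1 \<longrightarrow> (g m has_real_derivative g (Suc m) t) (at t)"
      using line_derivative[OF f' p y] line_derivative2[OF f' p y] by (auto simp: g_def less_2_cases_iff)
  qed auto
  then obtain \<theta> where "0 < \<theta>" "\<theta> \<le> 1" "g 0 1 = (\<Sum>m<2. g m 0 / fact m * 1 ^ m) + g 2 \<theta> / fact 2 * 1 ^ 2" by blast
  then show ?thesis by (intro exI[of _ \<theta>]) (auto simp: g_def numeral_2_eq_2)
qed

text \<open>Test functions, barriers and schemes are all built by these operations. Derivatives stay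
  in the class, so membership yields C^k for every k at once. The reciprocal asks for nonvanishing
  on the open cylinder only, which admits the barrier 1/(T - t), singular at t = T.\<close>

inductive_set elem :: "nat \<Rightarrow> real \<Rightarrow> (real \<times> (nat \<Rightarrow> real) \<Rightarrow> real) set" for d T where
  elem_const: "(\<lambda>_. c) \<in> elem d T"
| elem_time: "fst \<in> elem d T"
| elem_coord: "i < d \<Longrightarrow> (\<lambda>p. snd p i) \<in> elem d T"
| elem_add: "f \<in> elem d T \<Longrightarrow> g \<in> elem d T \<Longrightarrow> (\<lambda>p. f p + g p) \<in> elem d T"
| elem_mult: "f \<in> elem d T \<Longrightarrow> g \<in> elem d T \<Longrightarrow> (\<lambda>p. f p * g p) \<in> elem d T"
| elem_inverse: "f \<in> elem d T \<Longrightarrow> (\<And>p. p \<in> cyl d T \<Longrightarrow> f p \<noteq> 0) \<Longrightarrow> (\<lambda>p. inverse (f p)) \<in> elem d T"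
| elem_exp: "f \<in> elem d T \<Longrightarrow> (\<lambda>p. exp (f p)) \<in> elem d T"

lemma elem_sum: "finite I \<Longrightarrow> (\<And>i. i \<in> I \<Longrightarrow> f i \<in> elem d T) \<Longrightarrow> (\<lambda>p. \<Sum>i\<in>I. f i p) \<in> elem d T"
  by (induction I rule: finite_induct) (auto intro: elem_const elem_add)

lemma elem_power: "f \<in> elem d T \<Longrightarrow> (\<lambda>p. f p ^ n) \<in> elem d T"
  by (induction n) (auto intro: elem_const elem_mult)

lemma elem_scale: "f \<in> elem d T \<Longrightarrow> (\<lambda>p. c * f p) \<in> elem d T"
  by (rule elem_mult[OF elem_const])

lemma elem_diff: "f \<in> elem d T \<Longrightarrow> g \<in> elem d T \<Longrightarrow> (\<lambda>p. f p - g p) \<in> elem d T"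
  using elem_add[OF _ elem_scale[of g d T "-1"], of f] by simp

lemma elem_continuous: "f \<in> elem d T \<Longrightarrow> continuous_on (cyl d T) f"
proof (induction rule: elem.induct)
  case (elem_coord i) show ?case by (rule continuous_on_snd_coord)
qed (auto intro!: continuous_intros)

lemma elem_derivative:
  assumes "f \<in> elem d T" "k \<in> insert None (Some ` {..<d})"
  shows "\<exists>f'\<in>elem d T. \<forall>p\<in>cyl d T. ((\<lambda>s. f (move k s p)) has_real_derivative f' p) (at 0)"
  using assms(1)
proof (induction rule: elem.induct)
  case (elem_const c) then show ?case by (intro bexI[of _ "\<lambda>_. 0"] elem.elem_const) auto
next
  case elem_time
  show ?case
  proof (cases k)
    case None
    have "((\<lambda>s. fst (move k s p)) has_real_derivative 1) (at 0)" for p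
      unfolding None by (cases p) (auto intro!: derivative_eq_intros)
    then show ?thesis by (intro bexI[of _ "\<lambda>_. 1"] elem.elem_const) auto
  next
    case (Some i)
    have "(\<lambda>s. fst (move k s p)) = (\<lambda>s. fst p)" for p unfolding Some by (cases p) auto
    then show ?thesis by (intro bexI[of _ "\<lambda>_. 0"] elem.elem_const) auto
  qed
next
  case (elem_coord i)
  show ?case
  proof (cases "k = Some i")
    case True
    have "((\<lambda>s. snd (move k s p) i) has_real_derivative 1) (at 0)" for p
      unfolding True by (cases p) (auto intro!: derivative_eq_intros)
    then show ?thesis by (intro bexI[of _ "\<lambda>_. 1"] elem.elem_const) auto
  next
    case False
    then have "(\<lambda>s. snd (move k s p) i) = (\<lambda>s. snd p i)" for p by (cases p; cases k) auto
    then show ?thesis by (intro bexI[of _ "\<lambda>_. 0"] elem.elem_const) auto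
  qed
next
  case (elem_add f g)
  then obtain f' g' where "f' \<in> elem d T" "g' \<in> elem d T"
    "\<And>p. p\<in>cyl d T \<Longrightarrow> ((\<lambda>s. f (move k s p)) has_real_derivative f' p) (at 0)"
    "\<And>p. p\<in>cyl d T \<Longrightarrow> ((\<lambda>s. g (move k s p)) has_real_derivative g' p) (at 0)" by blast
  then show ?case by (intro bexI[of _ "\<lambda>p. f' p + g' p"] elem.elem_add ballI DERIV_add) auto
next
  case (elem_mult f g)
  then obtain f' g' where fg: "f' \<in> elem d T" "g' \<in> elem d T"
    "\<And>p. p\<in>cyl d T \<Longrightarrow> ((\<lambda>s. f (move k s p)) has_real_derivative f' p) (at 0)"
    "\<And>p. p\<in>cyl d T \<Longrightarrow> ((\<lambda>s. g (move k s p)) has_real_derivative g' p) (at 0)" by blast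
  have "((\<lambda>s. f (move k s p) * g (move k s p)) has_real_derivative (f' p * g p + g' p * f p)) (at 0)"
    if "p \<in> cyl d T" for p
    using DERIV_mult[OF fg(3,4)[OF that]] by simp
  then show ?case using fg(1,2) elem_mult.hyps
    by (intro bexI[of _ "\<lambda>p. f' p * g p + g' p * f p"] elem.elem_add elem.elem_mult) auto
next
  case (elem_inverse f)
  then obtain f' where f': "f' \<in> elem d T" 
    "\<And>p. p\<in>cyl d T \<Longrightarrow> ((\<lambda>s. f (move k s p)) has_real_derivative f' p) (at 0)" by blast
  have "((\<lambda>s. inverse (f (move k s p))) has_real_derivative (-1) * (inverse (f p) * f' p * inverse (f p))) (at 0)"
    if "p \<in> cyl d T" for p
    using DERIV_inverse'[OF f'(2)[OF that]] elem_inverse.hyps(2)[OF that] by simp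
  then show ?case using f'(1) elem_inverse.hyps
    by (intro bexI[of _ "\<lambda>p. (-1) * (inverse (f p) * f' p * inverse (f p))"] elem.intros) auto
next
  case (elem_exp f)
  then obtain f' where f': "f' \<in> elem d T" 
    "\<And>p. p\<in>cyl d T \<Longrightarrow> ((\<lambda>s. f (move k s p)) has_real_derivative f' p) (at 0)" by blast
  have "((\<lambda>s. exp (f (move k s p))) has_real_derivative exp (f p) * f' p) (at 0)"
    if "p \<in> cyl d T" for p
    using DERIV_chain2[OF DERIV_exp f'(2)[OF that]] by simp
  then show ?case using f'(1) elem_exp.hyps
    by (intro bexI[of _ "\<lambda>p. exp (f p) * f' p"] elem.intros) auto
qed

lemma elem_C_k_on: "f \<in> elem d T \<Longrightarrow> C_k_on n d T f"
proof (induction n arbitrary: f)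
  case 0 then show ?case by (simp add: elem_continuous)
next
  case (Suc n)
  show ?case
  proof (rule C_k_on_SucI)
    fix k assume "k \<in> insert None (Some ` {..<d})"
    then obtain f' where f': "f' \<in> elem d T" "\<And>p. p\<in>cyl d T \<Longrightarrow> ((\<lambda>s. f (move k s p)) has_real_derivative f' p) (at 0)"
      using elem_derivative[OF Suc.prems] by blast
    show "(\<lambda>s. f (move k s p)) field_differentiable at 0" if "p \<in> cyl d T" for p
      using f'(2)[OF that] unfolding field_differentiable_def by blast
    show "C_k_on n d T (partial k f)"
      by (rule C_k_on_cong[OF Suc.IH[OF f'(1)]]) (metis partial_eqI f'(2))
  qed (use Suc.prems elem_continuous in blast)
qed

section \<open>Affine maps of \<open>\<real>\<^sup>d\<close>\<close>

text \<open>Coordinates from d on are ignored in the argument and set to 0 in the value. Hence every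
  such map sends all sequences into \<open>Rd d\<close>, and the identity is represented by
  truncation, which agrees with it on \<open>Rd d\<close>.\<close>

definition aff :: "nat \<Rightarrow> (nat \<Rightarrow> nat \<Rightarrow> real) \<Rightarrow> (nat \<Rightarrow> real) \<Rightarrow> (nat \<Rightarrow> real) \<Rightarrow> nat \<Rightarrow> real" where
  "aff d A b x = (\<lambda>i. if i < d then b i + (\<Sum>j<d. A i j * x j) else 0)"

definition is_affine :: "nat \<Rightarrow> ((nat \<Rightarrow> real) \<Rightarrow> nat \<Rightarrow> real) \<Rightarrow> bool" where
  "is_affine d F \<longleftrightarrow> (\<exists>A b. F = aff d A b)"

lemma is_affine_Rd: "is_affine d F \<Longrightarrow> F x \<in> Rd d"
  by (auto simp: is_affine_def aff_def Rd_def)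

lemma is_affine_lin_comb:
  assumes "is_affine d F" "is_affine d G"
  shows "is_affine d (\<lambda>x i. a * F x i + b * G x i)"
proof -
  obtain A u B w where FG: "F = aff d A u" "G = aff d B w" using assms by (auto simp: is_affine_def)
  have "(\<lambda>x i. a * F x i + b * G x i) = aff d (\<lambda>i j. a * A i j + b * B i j) (\<lambda>i. a * u i + b * w i)"
    by (auto simp: FG aff_def fun_eq_iff algebra_simps sum.distrib sum_distrib_left)
  then show ?thesis by (auto simp: is_affine_def)
qed

lemma is_affine_trunc: "is_affine d (\<lambda>x i. if i < d then x i else 0)"
proof -
  have "(\<lambda>x i. if i < d then x i else 0) = aff d (\<lambda>i j. if j = i then 1 else 0) (\<lambda>_. 0)"
    by (auto simp: aff_def fun_eq_iff if_distrib[of "\<lambda>z. z * _"] cong: if_cong)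
  then show ?thesis by (auto simp: is_affine_def)
qed

lemma is_affine_compose:
  assumes "is_affine d F" "is_affine d G"
  shows "is_affine d (\<lambda>x. F (G x))"
proof -
  obtain A u B w where FG: "F = aff d A u" "G = aff d B w" using assms by (auto simp: is_affine_def)
  have *: "(\<Sum>l<d. A i l * (\<Sum>j<d. B l j * x j)) = (\<Sum>j<d. (\<Sum>l<d. A i l * B l j) * x j)" for i and x :: "nat \<Rightarrow> real"
    by (simp add: sum_distrib_left sum_distrib_right mult.assoc) (rule sum.swap)
  have "(\<lambda>x. F (G x)) = aff d (\<lambda>i j. \<Sum>l<d. A i l * B l j) (\<lambda>i. u i + (\<Sum>l<d. A i l * w l))"
    by (auto simp: FG aff_def fun_eq_iff distrib_left sum.distrib *)
  then show ?thesis by (auto simp: is_affine_def)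
qed

lemma is_affine_line:
  assumes "is_affine d F"
  shows "F (\<lambda>i. x i + s * y i) = (\<lambda>i. F x i + s * (F y i - F (\<lambda>_. 0) i))"
proof -
  obtain A u where F: "F = aff d A u" using assms by (auto simp: is_affine_def)
  show ?thesis by (auto simp: F aff_def algebra_simps sum.distrib sum_distrib_left)
qed

lemma is_affine_continuous:
  assumes "is_affine d F" shows "continuous_on S F"
proof -
  obtain A u where F: "F = aff d A u" using assms by (auto simp: is_affine_def)
  show ?thesis unfolding F aff_def
  proof (rule continuous_on_coordinatewise_then_product)
    fix i show "continuous_on S (\<lambda>x. if i < d then u i + (\<Sum>j<d. A i j * x j) else 0)"
      by (cases "i < d") (auto intro!: continuous_intros continuous_on_coord)
  qed
qed

text \<open>The constant is the squared Frobenius norm of the linear part, by Cauchy-Schwarz in each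
  row. It may depend on d.\<close>

lemma is_affine_linear_bound:
  assumes "is_affine d F"
  shows "\<exists>C\<ge>0. \<forall>y. nsq d (\<lambda>i. F y i - F (\<lambda>_. 0) i) \<le> C * nsq d y"
proof -
  obtain A u where F: "F = aff d A u" using assms by (auto simp: is_affine_def)
  have "nsq d (\<lambda>i. F y i - F (\<lambda>_. 0) i) \<le> (\<Sum>i<d. \<Sum>j<d. (A i j)\<^sup>2) * nsq d y" for y
  proof -
    have "nsq d (\<lambda>i. F y i - F (\<lambda>_. 0) i) = (\<Sum>i<d. (\<Sum>j<d. A i j * y j)\<^sup>2)"
      by (auto simp: nsq_def F aff_def)
    also have "\<dots> \<le> (\<Sum>i<d. (\<Sum>j<d. (A i j)\<^sup>2) * (\<Sum>j<d. (y j)\<^sup>2))"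
      by (intro sum_mono Cauchy_Schwarz_ineq_sum)
    finally show ?thesis by (simp add: nsq_def sum_distrib_right)
  qed
  then show ?thesis by (intro exI[of _ "\<Sum>i<d. \<Sum>j<d. (A i j)\<^sup>2"]) (auto intro!: sum_nonneg)
qed

text \<open>Each iteration of the scheme substitutes affine jumps into the previous iterate; this
  keeps the iterates smooth.\<close>

lemma elem_subst_affine:
  assumes "f \<in> elem d T" "is_affine d F"
  shows "(\<lambda>p. f (fst p, F (snd p))) \<in> elem d T"
  using assms(1)
proof (induction rule: elem.induct)
  case elem_time
  have "(\<lambda>p. fst (fst p, F (snd p))) = (fst :: real \<times> (nat \<Rightarrow> real) \<Rightarrow> real)" by auto
  then show ?case using elem.elem_time by simp
next
  case (elem_coord i)
  obtain A u where F: "F = aff d A u" using assms by (auto simp: is_affine_def)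
  show ?case using elem_coord unfolding F aff_def
    by (auto intro!: elem.elem_add elem.elem_const elem_sum elem_scale elem.elem_coord)
next
  case (elem_inverse f)
  show ?case using elem_inverse is_affine_Rd[OF assms(2)] by (intro elem.elem_inverse) auto
qed (auto intro: elem.intros)

section \<open>Averages of networks composed with affine maps\<close>

text \<open>Recursive counterpart of the list of layer widths in \<open>networks\<close>: the
  argument \<open>c\<close> is the width of the incoming layer. This form supports induction over
  layers; the demand for at least two layers is kept outside.\<close>

fun wf_net :: "nat \<Rightarrow> network \<Rightarrow> bool" where
  "wf_net c [] \<longleftrightarrow> False"
| "wf_net c [(W, B)] \<longleftrightarrow> W \<in> carrier_mat 1 c \<and> B \<in> carrier_vec 1"
| "wf_net c ((W, B) # L # \<Phi>) \<longleftrightarrow> dim_col W = c \<and> B \<in> carrier_vec (dim_row W) \<and> 1 \<le> dim_row W \<and> wf_net (dim_row W) (L # \<Phi>)"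

lemma wf_net_iff:
  assumes "\<Phi> \<noteq> []"
  shows "wf_net c \<Phi> \<longleftrightarrow> (\<exists>l. length l = length \<Phi> \<and> (\<forall>n\<in>set l. 1 \<le> n) \<and> last l = 1 \<and>
     (\<forall>k<length \<Phi>. fst (\<Phi> ! k) \<in> carrier_mat (l ! k) ((c # l) ! k) \<and> snd (\<Phi> ! k) \<in> carrier_vec (l ! k)))"
  using assms
proof (induction c \<Phi> rule: wf_net.induct)
  case (2 c W B)
  show ?case
  proof
    assume "wf_net c [(W, B)]"
    then show "\<exists>l. length l = length [(W, B)] \<and> (\<forall>n\<in>set l. 1 \<le> n) \<and> last l = 1 \<and>
     (\<forall>k<length [(W, B)]. fst ([(W, B)] ! k) \<in> carrier_mat (l ! k) ((c # l) ! k) \<and> snd ([(W, B)] ! k) \<in> carrier_vec (l ! k))"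
      by (intro exI[of _ "[1]"]) auto
  next
    assume "\<exists>l. length l = length [(W, B)] \<and> (\<forall>n\<in>set l. 1 \<le> n) \<and> last l = 1 \<and>
     (\<forall>k<length [(W, B)]. fst ([(W, B)] ! k) \<in> carrier_mat (l ! k) ((c # l) ! k) \<and> snd ([(W, B)] ! k) \<in> carrier_vec (l ! k))"
    then show "wf_net c [(W, B)]" by (auto simp: length_Suc_conv)
  qed
next
  case (3 c W B L \<Phi>)
  let ?P = "\<lambda>c \<Phi> l. length l = length \<Phi> \<and> (\<forall>n\<in>set l. 1 \<le> n) \<and> last l = 1 \<and>
     (\<forall>k<length \<Phi>. fst (\<Phi> ! k) \<in> carrier_mat (l ! k) ((c # l) ! k) \<and> snd (\<Phi> ! k) \<in> carrier_vec (l ! k))"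
  have IH: "wf_net (dim_row W) (L # \<Phi>) \<longleftrightarrow> (\<exists>l. ?P (dim_row W) (L # \<Phi>) l)" using "3.IH" by simp
  show ?case
  proof
    assume w: "wf_net c ((W, B) # L # \<Phi>)"
    then obtain l where l: "?P (dim_row W) (L # \<Phi>) l" using IH by auto
    have "?P c ((W, B) # L # \<Phi>) (dim_row W # l)"
    proof (intro conjI allI impI)
      fix k assume "k < length ((W, B) # L # \<Phi>)"
      then show "fst (((W, B) # L # \<Phi>) ! k) \<in> carrier_mat ((dim_row W # l) ! k) ((c # dim_row W # l) ! k)"
        "snd (((W, B) # L # \<Phi>) ! k) \<in> carrier_vec ((dim_row W # l) ! k)"
        using w l by (cases k; fastforce)+
    qed (use w l in auto)
    then show "\<exists>l. ?P c ((W, B) # L # \<Phi>) l" by blast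
  next
    assume "\<exists>l. ?P c ((W, B) # L # \<Phi>) l"
    then obtain l where l: "?P c ((W, B) # L # \<Phi>) l" by blast
    then obtain r l' where rl: "l = r # l'" by (cases l) auto
    have l0: "fst (((W, B) # L # \<Phi>) ! 0) \<in> carrier_mat (l ! 0) ((c # l) ! 0) \<and> snd (((W, B) # L # \<Phi>) ! 0) \<in> carrier_vec (l ! 0)"
      using l by blast
    then have W: "W \<in> carrier_mat r c" "B \<in> carrier_vec r" by (auto simp: rl)
    have "?P (dim_row W) (L # \<Phi>) l'"
    proof (intro conjI allI impI)
      fix k assume "k < length (L # \<Phi>)"
      then have "Suc k < length ((W, B) # L # \<Phi>)" by simp
      then have "fst (((W, B) # L # \<Phi>) ! Suc k) \<in> carrier_mat (l ! Suc k) ((c # l) ! Suc k)"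
        "snd (((W, B) # L # \<Phi>) ! Suc k) \<in> carrier_vec (l ! Suc k)" using l by blast+
      then show "fst ((L # \<Phi>) ! k) \<in> carrier_mat (l' ! k) ((dim_row W # l') ! k)"
        "snd ((L # \<Phi>) ! k) \<in> carrier_vec (l' ! k)" using W by (auto simp: rl)
    qed (use l rl in \<open>auto split: if_splits\<close>)
    then have "wf_net (dim_row W) (L # \<Phi>)" using IH by blast
    moreover have "1 \<le> dim_row W" using l rl W by auto
    ultimately show "wf_net c ((W, B) # L # \<Phi>)" using W by auto
  qed
qed simp

lemma networks_iff:
  "\<Phi> \<in> networks \<longleftrightarrow> 2 \<le> length \<Phi> \<and> 1 \<le> input_dim \<Phi> \<and> wf_net (input_dim \<Phi>) \<Phi>"
proof
  assume "\<Phi> \<in> networks"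
  then obtain l where l: "2 \<le> length \<Phi>" "length l = length \<Phi> + 1" "\<forall>n\<in>set l. 1 \<le> n" "last l = 1"
     "\<forall>k<length \<Phi>. fst (\<Phi> ! k) \<in> carrier_mat (l ! Suc k) (l ! k) \<and> snd (\<Phi> ! k) \<in> carrier_vec (l ! Suc k)"
    unfolding networks_def by blast
  then obtain c l' where cl: "l = c # l'" by (cases l) auto
  have ne: "\<Phi> \<noteq> []" using l(1) by auto
  have "fst (\<Phi> ! 0) \<in> carrier_mat (l ! Suc 0) (l ! 0)" using l(1,5) by fastforce
  then have c: "input_dim \<Phi> = c" using ne by (auto simp: input_dim_def hd_conv_nth cl)
  have "wf_net c \<Phi>" unfolding wf_net_iff[OF ne]
    using l by (intro exI[of _ l']) (auto simp: cl split: if_splits)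
  then show "2 \<le> length \<Phi> \<and> 1 \<le> input_dim \<Phi> \<and> wf_net (input_dim \<Phi>) \<Phi>" using c l cl by auto
next
  assume a: "2 \<le> length \<Phi> \<and> 1 \<le> input_dim \<Phi> \<and> wf_net (input_dim \<Phi>) \<Phi>"
  then have ne: "\<Phi> \<noteq> []" by auto
  from a obtain l where l: "length l = length \<Phi>" "\<forall>n\<in>set l. 1 \<le> n" "last l = 1"
     "\<forall>k<length \<Phi>. fst (\<Phi> ! k) \<in> carrier_mat (l ! k) ((input_dim \<Phi> # l) ! k) \<and> snd (\<Phi> ! k) \<in> carrier_vec (l ! k)"
    unfolding wf_net_iff[OF ne] by blast
  then show "\<Phi> \<in> networks" unfolding networks_def using a ne
    by (intro CollectI exI[of _ "input_dim \<Phi> # l"]) auto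
qed

section \<open>Parallel copies of a network\<close>

definition stack :: "nat \<Rightarrow> nat \<Rightarrow> (nat \<Rightarrow> real Matrix.vec) \<Rightarrow> real Matrix.vec" where
  "stack n r xs = Matrix.vec (n * r) (\<lambda>i. vec_index (xs (i div r)) (i mod r))"

text \<open>The block diagonal matrix with n copies of W; quotients of the indices name the block
  and remainders the position in it.\<close>

definition par_mid :: "nat \<Rightarrow> real mat \<Rightarrow> real mat" where
  "par_mid n W = mat (n * dim_row W) (n * dim_col W)
     (\<lambda>(i, j). if i div dim_row W = j div dim_col W then W $$ (i mod dim_row W, j mod dim_col W) else 0)"

text \<open>The row of n copies of W, divided by n. Taking the arithmetic mean in the output weights
  leaves the output bias unchanged, since n equal biases average to themselves.\<close>

definition par_last :: "nat \<Rightarrow> real mat \<Rightarrow> real mat" where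
  "par_last n W = mat 1 (n * dim_col W) (\<lambda>(i, j). W $$ (0, j mod dim_col W) / real n)"

fun par_tail :: "nat \<Rightarrow> network \<Rightarrow> network" where
  "par_tail n [] = []"
| "par_tail n [(W, B)] = [(par_last n W, B)]"
| "par_tail n ((W, B) # L # \<Phi>) = (par_mid n W, stack n (dim_row W) (\<lambda>_. B)) # par_tail n (L # \<Phi>)"

lemma div_mod_bounds:
  fixes i n r :: nat
  assumes "i < n * r" shows "i div r < n" "i mod r < r" "0 < r"
  using assms by (auto simp: less_mult_imp_div_less intro!: mod_less_divisor) (metis gr0I mult_0_right not_less0)+

lemma sum_div_mod:
  fixes g :: "nat \<Rightarrow> nat \<Rightarrow> real"
  assumes "0 < c"
  shows "(\<Sum>j<n * c. g (j div c) (j mod c)) = (\<Sum>k<n. \<Sum>j<c. g k j)"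
proof -
  have "(\<Sum>j<n * c. g (j div c) (j mod c)) = (\<Sum>m<n. sum (\<lambda>j. g (j div c) (j mod c)) {m * c..<m * c + c})"
    by (rule sum.nat_group[symmetric])
  also have "\<dots> = (\<Sum>k<n. \<Sum>j<c. g k j)"
  proof (rule sum.cong[OF refl])
    fix m
    have "sum (\<lambda>j. g (j div c) (j mod c)) {m * c..<m * c + c} = sum (\<lambda>j. g ((j + m * c) div c) ((j + m * c) mod c)) {0..<c}"
      using sum.shift_bounds_nat_ivl[of "\<lambda>j. g (j div c) (j mod c)" 0 "m * c" c] by (simp add: add.commute)
    also have "\<dots> = (\<Sum>j<c. g m j)" using assms by (auto simp: lessThan_atLeast0 intro!: sum.cong)
    finally show "sum (\<lambda>j. g (j div c) (j mod c)) {m * c..<m * c + c} = (\<Sum>j<c. g m j)" .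
  qed
  finally show ?thesis .
qed

lemma index_mult_add_vec:
  assumes "W \<in> carrier_mat r c" "x \<in> carrier_vec c" "B \<in> carrier_vec r" "i < r"
  shows "vec_index (W *\<^sub>v x + B) i = (\<Sum>j<c. W $$ (i, j) * vec_index x j) + vec_index B i"
  using assms by (auto simp: scalar_prod_def lessThan_atLeast0 intro!: sum.cong)

lemma par_mid_stack:
  assumes W: "W \<in> carrier_mat r c" and B: "B \<in> carrier_vec r" and xs: "\<And>k. k < n \<Longrightarrow> xs k \<in> carrier_vec c" and c: "0 < c"
  shows "par_mid n W *\<^sub>v stack n c xs + stack n r (\<lambda>_. B) = stack n r (\<lambda>k. W *\<^sub>v xs k + B)"
proof (rule eq_vecI)
  fix i assume "i < dim_vec (stack n r (\<lambda>k. W *\<^sub>v xs k + B))"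
  then have i: "i < n * r" by (simp add: stack_def)
  note b = div_mod_bounds[OF i]
  have "vec_index (par_mid n W *\<^sub>v stack n c xs + stack n r (\<lambda>_. B)) i
      = (\<Sum>j<n * c. par_mid n W $$ (i, j) * vec_index (stack n c xs) j) + vec_index (stack n r (\<lambda>_. B)) i"
    by (rule index_mult_add_vec) (use W i in \<open>auto simp: par_mid_def stack_def\<close>)
  also have "(\<Sum>j<n * c. par_mid n W $$ (i, j) * vec_index (stack n c xs) j)
      = (\<Sum>j<n * c. (\<lambda>k j. (if i div r = k then W $$ (i mod r, j) else 0) * vec_index (xs k) j) (j div c) (j mod c))"
    using W i by (intro sum.cong) (auto simp: par_mid_def stack_def)
  also have "\<dots> = (\<Sum>k<n. \<Sum>j<c. (if i div r = k then W $$ (i mod r, j) else 0) * vec_index (xs k) j)"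
    by (rule sum_div_mod[OF c])
  also have "\<dots> = (\<Sum>k<n. if i div r = k then (\<Sum>j<c. W $$ (i mod r, j) * vec_index (xs k) j) else 0)"
    by (intro sum.cong) auto
  also have "\<dots> = (\<Sum>j<c. W $$ (i mod r, j) * vec_index (xs (i div r)) j)" using b by simp
  finally show "vec_index (par_mid n W *\<^sub>v stack n c xs + stack n r (\<lambda>_. B)) i = vec_index (stack n r (\<lambda>k. W *\<^sub>v xs k + B)) i"
    using index_mult_add_vec[OF W xs[OF b(1)] B b(2)] i by (simp add: stack_def)
qed (use W in \<open>simp add: par_mid_def stack_def\<close>)

lemma par_last_stack:
  assumes W: "W \<in> carrier_mat 1 c" and B: "B \<in> carrier_vec 1" and xs: "\<And>k. k < n \<Longrightarrow> xs k \<in> carrier_vec c" and c: "0 < c" and n: "0 < n"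
  shows "vec_index (par_last n W *\<^sub>v stack n c xs + B) 0 = (\<Sum>k<n. vec_index (W *\<^sub>v xs k + B) 0) / real n"
proof -
  have "vec_index (par_last n W *\<^sub>v stack n c xs + B) 0 = (\<Sum>j<n * c. par_last n W $$ (0, j) * vec_index (stack n c xs) j) + vec_index B 0"
    by (rule index_mult_add_vec[of _ 1]) (use W B in \<open>auto simp: par_last_def stack_def\<close>)
  also have "(\<Sum>j<n * c. par_last n W $$ (0, j) * vec_index (stack n c xs) j)
      = (\<Sum>j<n * c. (\<lambda>k j. W $$ (0, j) / real n * vec_index (xs k) j) (j div c) (j mod c))"
    using W by (intro sum.cong) (auto simp: par_last_def stack_def)
  also have "\<dots> = (\<Sum>k<n. \<Sum>j<c. W $$ (0, j) / real n * vec_index (xs k) j)"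
    by (rule sum_div_mod[OF c])
  also have "\<dots> = (\<Sum>k<n. \<Sum>j<c. W $$ (0, j) * vec_index (xs k) j) / real n"
    by (simp add: sum_divide_distrib)
  finally have "vec_index (par_last n W *\<^sub>v stack n c xs + B) 0
      = (\<Sum>k<n. \<Sum>j<c. W $$ (0, j) * vec_index (xs k) j) / real n + vec_index B 0" .
  also have "\<dots> = (\<Sum>k<n. (\<Sum>j<c. W $$ (0, j) * vec_index (xs k) j) + vec_index B 0) / real n"
    using n by (simp add: sum.distrib add_divide_distrib)
  also have "\<dots> = (\<Sum>k<n. vec_index (W *\<^sub>v xs k + B) 0) / real n"
    using index_mult_add_vec[OF W xs B] by (intro arg_cong2[where f = "(/)"] sum.cong) auto
  finally show ?thesis .
qed

lemma map_stack: "(\<And>k. k < n \<Longrightarrow> xs k \<in> carrier_vec r) \<Longrightarrow> map_vec a (stack n r xs) = stack n r (\<lambda>k. map_vec a (xs k))"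
proof (rule eq_vecI)
  fix i assume xs: "\<And>k. k < n \<Longrightarrow> xs k \<in> carrier_vec r" and "i < dim_vec (stack n r (\<lambda>k. map_vec a (xs k)))"
  then have i: "i < n * r" by (simp add: stack_def)
  note b = div_mod_bounds[OF i]
  show "vec_index (map_vec a (stack n r xs)) i = vec_index (stack n r (\<lambda>k. map_vec a (xs k))) i"
    using i b xs[OF b(1)] by (simp add: stack_def)
qed (simp add: stack_def)

lemma par_tail_output:
  assumes "wf_net c \<Phi>" "\<And>k. k < n \<Longrightarrow> xs k \<in> carrier_vec c" "0 < c" "0 < n"
  shows "vec_index (network_output a (par_tail n \<Phi>) (stack n c xs)) 0 = (\<Sum>k<n. vec_index (network_output a \<Phi> (xs k)) 0) / real n"
  using assms
proof (induction c \<Phi> arbitrary: xs rule: wf_net.induct)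
  case (2 c W B)
  then show ?case by (simp add: par_last_stack)
next
  case (3 c W B L \<Phi>)
  define r where "r = dim_row W"
  have W: "W \<in> carrier_mat r c" and B: "B \<in> carrier_vec r" and r: "0 < r" and wf: "wf_net r (L # \<Phi>)"
    using "3.prems"(1) by (auto simp: r_def)
  let ?zs = "\<lambda>k. W *\<^sub>v xs k + B"
  have zs: "?zs k \<in> carrier_vec r" for k using B by (intro carrier_vecI) simp
  then have ys: "map_vec a (?zs k) \<in> carrier_vec r" for k by (metis carrier_vecI carrier_vecD index_map_vec(2))
  have "par_tail n (L # \<Phi>) \<noteq> []" by (cases "(n, L # \<Phi>)" rule: par_tail.cases) auto
  then obtain L' \<Phi>' where p: "par_tail n (L # \<Phi>) = L' # \<Phi>'" by (cases "par_tail n (L # \<Phi>)") auto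
  have "network_output a (par_tail n ((W, B) # L # \<Phi>)) (stack n c xs)
     = network_output a (par_tail n (L # \<Phi>)) (map_vec a (par_mid n W *\<^sub>v stack n c xs + stack n r (\<lambda>_. B)))"
    by (simp add: p r_def)
  also have "par_mid n W *\<^sub>v stack n c xs + stack n r (\<lambda>_. B) = stack n r ?zs"
    by (rule par_mid_stack[OF W B "3.prems"(2,3)])
  also have "map_vec a (stack n r ?zs) = stack n r (\<lambda>k. map_vec a (?zs k))"
    by (rule map_stack[OF zs])
  finally have "network_output a (par_tail n ((W, B) # L # \<Phi>)) (stack n c xs)
    = network_output a (par_tail n (L # \<Phi>)) (stack n r (\<lambda>k. map_vec a (?zs k)))" .
  then show ?case using "3.IH"[folded r_def, OF wf ys r "3.prems"(4)] by simp
qed simp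

lemma wf_par_tail:
  assumes "wf_net c \<Phi>" "0 < n"
  shows "wf_net (n * c) (par_tail n \<Phi>)"
  using assms
proof (induction c \<Phi> rule: wf_net.induct)
  case (2 c W B) then show ?case by (auto simp: par_last_def)
next
  case (3 c W B L \<Phi>)
  have "par_tail n (L # \<Phi>) \<noteq> []" by (cases "(n, L # \<Phi>)" rule: par_tail.cases) auto
  then obtain L' \<Phi>' where p: "par_tail n (L # \<Phi>) = L' # \<Phi>'" by (cases "par_tail n (L # \<Phi>)") auto
  show ?case using 3 by (auto simp: p par_mid_def stack_def)
qed simp

section \<open>Numbers of parameters of the parallel network\<close>

lemma param_count_Cons: "param_count ((W, B) # \<Phi>) = dim_row W * (dim_col W + 1) + param_count \<Phi>"
  by (simp add: param_count_def)

lemma nz_param_count_Cons: "nz_param_count ((W, B) # \<Phi>) = (card {(i, j). i < dim_row W \<and> j < dim_col W \<and> W $$ (i, j) \<noteq> 0} +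
     card {i. i < dim_vec B \<and> vec_index B i \<noteq> 0}) + nz_param_count \<Phi>"
  by (simp add: nz_param_count_def)

lemma card_nz_vec_le: "card {i. i < n \<and> P i} \<le> (n::nat)"
  using card_mono[of "{..<n}" "{i. i < n \<and> P i}"] by auto

lemma card_nz_mat_le: "card {(i, j). i < r \<and> j < c \<and> P i j} \<le> r * (c::nat)" for r :: nat
proof -
  have "card {(i, j). i < r \<and> j < c \<and> P i j} \<le> card ({..<r} \<times> {..<c})" by (intro card_mono) auto
  then show ?thesis by simp
qed

text \<open>In each row only the c columns of the matching block count. The row i determines the
  block, so reducing j modulo c is injective on these positions.\<close>

lemma card_nz_block_le: "card {(i, j). i < n * r \<and> j < n * c \<and> i div r = j div c \<and> P i j} \<le> n * r * (c::nat)" for n r :: nat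
proof -
  let ?S = "{(i, j). i < n * r \<and> j < n * c \<and> i div r = j div c \<and> P i j}"
  have "inj_on (\<lambda>(i, j). (i, j mod c)) ?S"
    by (auto simp: inj_on_def) (metis div_mult_mod_eq)
  moreover have "(\<lambda>(i, j). (i, j mod c)) ` ?S \<subseteq> {..<n * r} \<times> {..<c}"
    using div_mod_bounds(2) by auto
  ultimately have "card ?S \<le> card ({..<n * r} \<times> {..<c})" by (intro card_inj_on_le) auto
  then show ?thesis by simp
qed

lemma par_tail_counts:
  assumes "wf_net c \<Phi>" "1 \<le> n"
  shows "param_count (par_tail n \<Phi>) \<le> n\<^sup>2 * param_count \<Phi>" "nz_param_count (par_tail n \<Phi>) \<le> n * param_count \<Phi>"
proof -
  have nn: "n \<le> n\<^sup>2" using assms(2) by (simp add: power2_eq_square)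
  have "param_count (par_tail n \<Phi>) \<le> n\<^sup>2 * param_count \<Phi> \<and> nz_param_count (par_tail n \<Phi>) \<le> n * param_count \<Phi>"
    using assms(1)
  proof (induction c \<Phi> rule: wf_net.induct)
    case (2 c W B)
    then have W: "dim_row W = 1" "dim_col W = c" "dim_vec B = 1" by auto
    have "n * c \<le> n\<^sup>2 * c" using nn by (rule mult_le_mono1)
    then have "n * c + 1 \<le> n\<^sup>2 * (c + 1)" using nn assms(2) unfolding distrib_left by linarith
    moreover have "card {(i, j). i < dim_row (par_last n W) \<and> j < dim_col (par_last n W) \<and> par_last n W $$ (i, j) \<noteq> 0}
        \<le> dim_row (par_last n W) * dim_col (par_last n W)" by (rule card_nz_mat_le)
    then have "card {(i, j). i < dim_row (par_last n W) \<and> j < dim_col (par_last n W) \<and> par_last n W $$ (i, j) \<noteq> 0} \<le> n * c"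
      using W by (simp add: par_last_def)
    moreover have "card {i. i < dim_vec B \<and> vec_index B i \<noteq> 0} \<le> 1" using card_nz_vec_le[of "dim_vec B"] W by simp
    ultimately show ?case using W assms(2) by (simp add: param_count_def nz_param_count_def par_last_def)
  next
    case (3 c W B L \<Phi>)
    let ?r = "dim_row W"
    have W: "dim_col W = c" "dim_vec B = ?r" and wf: "wf_net ?r (L # \<Phi>)" using 3(2) by auto
    have IH: "param_count (par_tail n (L # \<Phi>)) \<le> n\<^sup>2 * param_count (L # \<Phi>)" "nz_param_count (par_tail n (L # \<Phi>)) \<le> n * param_count (L # \<Phi>)"
      using 3(1)[OF wf] by auto
    have dims: "dim_row (par_mid n W) = n * ?r" "dim_col (par_mid n W) = n * c" using W by (auto simp: par_mid_def)
    have "n * ?r * (n * c + 1) \<le> n\<^sup>2 * (?r * (c + 1))"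
    proof -
      have "n * ?r \<le> n\<^sup>2 * ?r" using nn by (rule mult_le_mono1)
      then show ?thesis by (simp add: algebra_simps power2_eq_square)
    qed
    then have 1: "param_count (par_tail n ((W, B) # L # \<Phi>)) \<le> n\<^sup>2 * param_count ((W, B) # L # \<Phi>)"
      using IH(1) W by (simp add: param_count_Cons dims distrib_left)
    have "card {(i, j). i < dim_row (par_mid n W) \<and> j < dim_col (par_mid n W) \<and> par_mid n W $$ (i, j) \<noteq> 0}
       \<le> card {(i, j). i < n * ?r \<and> j < n * c \<and> i div ?r = j div c \<and> par_mid n W $$ (i, j) \<noteq> 0}"
    proof (rule card_mono)
      show "finite {(i, j). i < n * ?r \<and> j < n * c \<and> i div ?r = j div c \<and> par_mid n W $$ (i, j) \<noteq> 0}"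
        by (rule finite_subset[of _ "{..<n * ?r} \<times> {..<n * c}"]) auto
    qed (use W in \<open>auto simp: par_mid_def split: if_splits\<close>)
    also have "\<dots> \<le> n * ?r * c" by (rule card_nz_block_le)
    finally have a: "card {(i, j). i < dim_row (par_mid n W) \<and> j < dim_col (par_mid n W) \<and> par_mid n W $$ (i, j) \<noteq> 0} \<le> n * ?r * c" .
    have "card {i. i < dim_vec (stack n ?r (\<lambda>_. B)) \<and> vec_index (stack n ?r (\<lambda>_. B)) i \<noteq> 0} \<le> dim_vec (stack n ?r (\<lambda>_. B))"
      by (rule card_nz_vec_le)
    then have b: "card {i. i < dim_vec (stack n ?r (\<lambda>_. B)) \<and> vec_index (stack n ?r (\<lambda>_. B)) i \<noteq> 0} \<le> n * ?r" by (simp add: stack_def)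
    have "nz_param_count (par_tail n ((W, B) # L # \<Phi>)) \<le> (n * ?r * c + n * ?r) + n * param_count (L # \<Phi>)"
      unfolding par_tail.simps nz_param_count_Cons by (intro add_mono a b IH)
    also have "\<dots> = n * param_count ((W, B) # L # \<Phi>)" using W by (simp add: param_count_Cons algebra_simps)
    finally show ?case using 1 by blast
  qed simp
  then show "param_count (par_tail n \<Phi>) \<le> n\<^sup>2 * param_count \<Phi>" "nz_param_count (par_tail n \<Phi>) \<le> n * param_count \<Phi>" by auto
qed

text \<open>There are at least two layers, so the layer that absorbs the affine maps differs from
  the one that averages. The nonzero parameters are bounded through the full count of \<Phi>,
  because the product of W with the matrix of an affine map may fill the first layer
  completely.\<close>

theorem average_network_exists:
  assumes \<Phi>: "\<Phi> \<in> networks" "input_dim \<Phi> = d" and n: "1 \<le> n" and F: "\<And>k. k < n \<Longrightarrow> is_affine d (F k)"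
  shows "\<exists>\<Psi>\<in>networks. input_dim \<Psi> = d \<and> param_count \<Psi> \<le> n\<^sup>2 * param_count \<Phi> \<and> nz_param_count \<Psi> \<le> n * param_count \<Phi> \<and>
    (\<forall>x. realization a \<Psi> x = (\<Sum>k<n. realization a \<Phi> (F k x)) / real n)"
proof -
  have wf: "wf_net d \<Phi>" and len: "2 \<le> length \<Phi>" and d: "1 \<le> d" using \<Phi> networks_iff by auto
  obtain W B L \<Phi>' where P: "\<Phi> = (W, B) # L # \<Phi>'"
    using len by (cases \<Phi>; cases "tl \<Phi>") auto
  define r where "r = dim_row W"
  have W: "W \<in> carrier_mat r d" and B: "B \<in> carrier_vec r" and r: "1 \<le> r" and wf': "wf_net r (L # \<Phi>')"
    using wf by (auto simp: r_def P)
  have "\<exists>A b. k < n \<longrightarrow> F k = aff d A b" for k using F by (auto simp: is_affine_def)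
  then obtain A b where Ab: "\<And>k. k < n \<Longrightarrow> F k = aff d (A k) (b k)" by metis
  define MA where "MA k = mat d d (\<lambda>(i, j). A k i j)" for k
  define vb where "vb k = Matrix.vec d (b k)" for k
  have MA: "MA k \<in> carrier_mat d d" and vb: "vb k \<in> carrier_vec d" for k by (auto simp: MA_def vb_def)
  have vecF: "Matrix.vec d (F k x) = MA k *\<^sub>v Matrix.vec d x + vb k" if "k < n" for k x
    by (rule eq_vecI) (auto simp: Ab[OF that] aff_def MA_def vb_def scalar_prod_def lessThan_atLeast0 algebra_simps intro!: sum.cong)
  \<comment> \<open>The first layer stacks its n blocks vertically rather than diagonally: all
    copies read the same x, and the input dimension remains d.\<close>
  define W' where "W' = mat (n * r) d (\<lambda>(i, j). (W * MA (i div r)) $$ (i mod r, j))"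
  define B' where "B' = stack n r (\<lambda>k. W *\<^sub>v vb k + B)"
  define \<Psi> where "\<Psi> = (W', B') # par_tail n (L # \<Phi>')"
  have "par_tail n (L # \<Phi>') \<noteq> []" by (cases "(n, L # \<Phi>')" rule: par_tail.cases) auto
  then obtain L'' \<Phi>'' where p: "par_tail n (L # \<Phi>') = L'' # \<Phi>''" by (cases "par_tail n (L # \<Phi>')") auto
  have W': "W' \<in> carrier_mat (n * r) d" and B': "B' \<in> carrier_vec (n * r)" by (auto simp: W'_def B'_def stack_def)
  have id: "input_dim \<Psi> = d" using W' by (simp add: \<Psi>_def input_dim_def)
  have "wf_net d \<Psi>" using wf_par_tail[OF wf', of n] n r W' B' by (simp add: \<Psi>_def p)
  then have net: "\<Psi> \<in> networks" using id d by (simp add: networks_iff) (simp add: \<Psi>_def p)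
  have first: "W' *\<^sub>v Matrix.vec d x + B' = stack n r (\<lambda>k. W *\<^sub>v Matrix.vec d (F k x) + B)" for x
  proof (rule eq_vecI)
    fix i assume "i < dim_vec (stack n r (\<lambda>k. W *\<^sub>v Matrix.vec d (F k x) + B))"
    then have i: "i < n * r" by (simp add: stack_def)
    note bd = div_mod_bounds[OF i]
    let ?k = "i div r"
    have "W *\<^sub>v Matrix.vec d (F ?k x) + B = (W * MA ?k) *\<^sub>v Matrix.vec d x + (W *\<^sub>v vb ?k + B)"
    proof -
      have "W *\<^sub>v (MA ?k *\<^sub>v Matrix.vec d x + vb ?k) = W *\<^sub>v (MA ?k *\<^sub>v Matrix.vec d x) + W *\<^sub>v vb ?k"
        by (rule mult_add_distrib_mat_vec[OF W _ vb], rule carrier_vecI, simp add: MA_def)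
      also have "W *\<^sub>v (MA ?k *\<^sub>v Matrix.vec d x) = (W * MA ?k) *\<^sub>v Matrix.vec d x"
        using W MA by (intro assoc_mult_mat_vec[symmetric]) auto
      finally show ?thesis unfolding vecF[OF bd(1)]
        by (simp only:) (rule assoc_add_vec[of _ r], (rule carrier_vecI, use W B in simp)+)
    qed
    moreover have "vec_index (W' *\<^sub>v Matrix.vec d x + B') i = (\<Sum>j<d. W' $$ (i, j) * vec_index (Matrix.vec d x) j) + vec_index B' i"
      by (rule index_mult_add_vec[OF W' _ B' i]) simp
    moreover have "(\<Sum>j<d. W' $$ (i, j) * vec_index (Matrix.vec d x) j) = (\<Sum>j<d. (W * MA ?k) $$ (i mod r, j) * vec_index (Matrix.vec d x) j)"
      using i by (intro sum.cong) (auto simp: W'_def)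
    moreover have "vec_index ((W * MA ?k) *\<^sub>v Matrix.vec d x + (W *\<^sub>v vb ?k + B)) (i mod r)
       = (\<Sum>j<d. (W * MA ?k) $$ (i mod r, j) * vec_index (Matrix.vec d x) j) + vec_index (W *\<^sub>v vb ?k + B) (i mod r)"
      by (rule index_mult_add_vec[OF _ _ _ bd(2)]) (use W MA vb B in auto)
    ultimately show "vec_index (W' *\<^sub>v Matrix.vec d x + B') i = vec_index (stack n r (\<lambda>k. W *\<^sub>v Matrix.vec d (F k x) + B)) i"
      using i by (simp add: stack_def B'_def)
  qed (use W' B' in \<open>simp add: stack_def\<close>)
  have "realization a \<Psi> x = (\<Sum>k<n. realization a \<Phi> (F k x)) / real n" for x
  proof -
    let ?zs = "\<lambda>k. W *\<^sub>v Matrix.vec d (F k x) + B"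
    let ?ys = "\<lambda>k. map_vec a (?zs k)"
    have zs: "?zs k \<in> carrier_vec r" for k using B by (intro carrier_vecI) simp
    then have ys: "?ys k \<in> carrier_vec r" for k by (metis carrier_vecI carrier_vecD index_map_vec(2))
    have "network_output a \<Psi> (Matrix.vec d x) = network_output a (par_tail n (L # \<Phi>')) (map_vec a (W' *\<^sub>v Matrix.vec d x + B'))"
      by (simp add: \<Psi>_def p)
    also have "map_vec a (W' *\<^sub>v Matrix.vec d x + B') = stack n r ?ys"
      unfolding first by (rule map_stack[OF zs])
    finally have "realization a \<Psi> x = (\<Sum>k<n. vec_index (network_output a (L # \<Phi>') (?ys k)) 0) / real n"
      using par_tail_output[OF wf' ys, of n a] r n by (simp add: realization_def id)
    then show ?thesis by (simp add: realization_def \<Phi>(2)) (simp add: P)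
  qed
  moreover have "param_count \<Psi> \<le> n\<^sup>2 * param_count \<Phi>"
  proof -
    have "n * (r * (d + 1)) \<le> n\<^sup>2 * (r * (d + 1))" using n by (intro mult_le_mono1) (simp add: power2_eq_square)
    then have "n * r * (d + 1) \<le> n\<^sup>2 * (r * (d + 1))" by (simp only: mult.assoc)
    then show ?thesis using par_tail_counts(1)[OF wf' n] W W' unfolding P \<Psi>_def param_count_Cons[of W] param_count_Cons[of W']
      by (simp add: distrib_left)
  qed
  moreover have "nz_param_count \<Psi> \<le> n * param_count \<Phi>"
  proof -
    have "nz_param_count \<Psi> \<le> (dim_row W' * dim_col W' + dim_vec B') + n * param_count (L # \<Phi>')"
      unfolding \<Psi>_def nz_param_count_Cons by (intro add_mono card_nz_mat_le card_nz_vec_le par_tail_counts(2)[OF wf' n])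
    also have "\<dots> = n * param_count \<Phi>" using W W' B' unfolding P param_count_Cons[of W] by (simp add: algebra_simps)
    finally show ?thesis .
  qed
  ultimately show ?thesis using net id by blast
qed

section \<open>Monte Carlo averages\<close>

text \<open>The expectation of G over n independent draws with weights q, written as an iterated
  finite sum.\<close>

fun expect :: "'i set \<Rightarrow> ('i \<Rightarrow> real) \<Rightarrow> nat \<Rightarrow> ('i list \<Rightarrow> real) \<Rightarrow> real" where
  "expect I q 0 G = G []"
| "expect I q (Suc n) G = (\<Sum>i\<in>I. q i * expect I q n (\<lambda>l. G (i # l)))"

text \<open>The recursion mirrors the induction in \<open>centered_even_moment_le\<close>:
  \<open>4 ^ Suc m\<close> bounds the binomial coefficients, the previous constant comes from the
  second order term, and 1 from the term of top order.\<close>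

fun moment_const :: "nat \<Rightarrow> real" where
  "moment_const 0 = 1"
| "moment_const (Suc m) = 4 ^ Suc m * (moment_const m + 1)"

lemma moment_const_ge_1: "1 \<le> moment_const m"
proof (induction m)
  case (Suc m)
  have "1 * 1 \<le> 4 ^ Suc m * (moment_const m + 1)" using Suc by (intro mult_mono one_le_power) auto
  then show ?case by simp
qed simp

text \<open>Terms of order 0 and 1 in b are kept exactly, because the linear one vanishes in the
  mean for centered b. Every later term is dominated by a^(2m) b^2 if |b| <= |a| and by b^(2m+2)
  otherwise, and the binomial coefficients sum to at most 2^(2m+2).\<close>

lemma even_power_add_le:
  fixes a b :: real
  shows "(b + a) ^ (2 * Suc m) \<le> a ^ (2 * Suc m) + real (2 * Suc m) * b * a ^ (2 * m + 1)
    + 4 ^ Suc m * (a ^ (2 * m) * b\<^sup>2 + b ^ (2 * Suc m))"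
proof -
  let ?n = "2 * m"
  let ?t = "\<lambda>k. real (Suc (Suc ?n) choose k) * b ^ k * a ^ (Suc (Suc ?n) - k)"
  let ?D = "a ^ (2 * m) * b\<^sup>2 + b ^ (2 * Suc m)"
  have ev: "2 * Suc m = Suc (Suc ?n)" by simp
  have e1: "0 \<le> a ^ (2 * m) * b\<^sup>2" by (intro mult_nonneg_nonneg zero_le_even_power) simp_all
  have e2: "0 \<le> b ^ (2 * Suc m)" by (rule zero_le_even_power) simp
  have D0: "0 \<le> ?D" by (intro add_nonneg_nonneg mult_nonneg_nonneg zero_le_even_power) simp_all
  have "\<bar>b ^ Suc (Suc k) * a ^ (?n - k)\<bar> \<le> ?D" if "k \<le> ?n" for k
  proof (cases "\<bar>b\<bar> \<le> \<bar>a\<bar>")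
    case True
    have "\<bar>b ^ Suc (Suc k) * a ^ (?n - k)\<bar> = \<bar>b\<bar>\<^sup>2 * (\<bar>b\<bar> ^ k * \<bar>a\<bar> ^ (?n - k))"
      by (simp add: abs_mult power_abs power2_eq_square)
    also have "\<dots> \<le> \<bar>b\<bar>\<^sup>2 * (\<bar>a\<bar> ^ k * \<bar>a\<bar> ^ (?n - k))"
      using True by (intro mult_left_mono mult_right_mono power_mono) auto
    also have "\<bar>a\<bar> ^ k * \<bar>a\<bar> ^ (?n - k) = a ^ ?n" using that by (simp add: power_add[symmetric] power_even_abs)
    also have "\<bar>b\<bar>\<^sup>2 * a ^ ?n = a ^ (2 * m) * b\<^sup>2" by (simp only: power2_abs mult.commute)
    finally show ?thesis using e2 by linarith
  next
    case False
    have "\<bar>b ^ Suc (Suc k) * a ^ (?n - k)\<bar> = \<bar>b\<bar> ^ Suc (Suc k) * \<bar>a\<bar> ^ (?n - k)"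
      by (simp add: abs_mult power_abs)
    also have "\<dots> \<le> \<bar>b\<bar> ^ Suc (Suc k) * \<bar>b\<bar> ^ (?n - k)"
      using False by (intro mult_left_mono power_mono) auto
    also have "\<dots> = \<bar>b\<bar> ^ (2 * Suc m)" using that by (simp add: power_add[symmetric])
    also have "\<dots> = b ^ (2 * Suc m)" by (simp add: power_even_abs)
    finally show ?thesis using e1 by linarith
  qed
  then have t: "?t (Suc (Suc k)) \<le> real (Suc (Suc ?n) choose Suc (Suc k)) * ?D" if "k \<le> ?n" for k
    using that by (simp only: mult.assoc diff_Suc_Suc) (intro mult_left_mono; fastforce simp: abs_le_iff)
  have "(b + a) ^ (2 * Suc m) = (\<Sum>k\<le>Suc (Suc ?n). ?t k)" unfolding ev by (rule binomial_ring)
  also have "\<dots> = ?t 0 + (?t 1 + (\<Sum>k\<le>?n. ?t (Suc (Suc k))))"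
    by (simp only: sum.atMost_Suc_shift One_nat_def)
  also have "\<dots> \<le> ?t 0 + (?t 1 + (\<Sum>k\<le>?n. real (Suc (Suc ?n) choose Suc (Suc k)) * ?D))"
    using t by (intro add_left_mono sum_mono) auto
  also have "(\<Sum>k\<le>?n. real (Suc (Suc ?n) choose Suc (Suc k)) * ?D) = (\<Sum>k\<le>?n. real (Suc (Suc ?n) choose Suc (Suc k))) * ?D"
    by (simp only: sum_distrib_right)
  also have "\<dots> \<le> 4 ^ Suc m * ?D"
  proof (rule mult_right_mono[OF _ D0])
    have "(\<Sum>k\<le>Suc (Suc ?n). real (Suc (Suc ?n) choose k)) = real (2 ^ Suc (Suc ?n))"
      using choose_row_sum[of "Suc (Suc ?n)"] by (simp only: of_nat_sum[symmetric])
    then have "1 + (real (Suc (Suc ?n) choose 1) + (\<Sum>k\<le>?n. real (Suc (Suc ?n) choose Suc (Suc k)))) = 2 ^ (2 * Suc m)"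
      by (simp only: sum.atMost_Suc_shift One_nat_def ev) simp
    then show "(\<Sum>k\<le>?n. real (Suc (Suc ?n) choose Suc (Suc k))) \<le> 4 ^ Suc m"
      by (simp add: power_mult)
  qed
  finally show ?thesis by (simp add: algebra_simps)
qed

text \<open>The right side is the tangent at s of the concave power function with exponent \<alpha>,
  and Young's inequality is the statement that the graph lies below it. Averaged, with s a bound for
  the mean, it gives Jensen's inequality for \<open>expect\<close> and for finite sums.\<close>

lemma powr_le_tangent:
  fixes a s \<alpha> :: real
  assumes "0 \<le> a" "0 < s" "0 \<le> \<alpha>" "\<alpha> \<le> 1"
  shows "a powr \<alpha> \<le> \<alpha> * s powr (\<alpha> - 1) * a + (1 - \<alpha>) * s powr \<alpha>"
proof -
  have "a powr \<alpha> * s powr (1 - \<alpha>) \<le> \<alpha> * a + (1 - \<alpha>) * s"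
    using assms Youngs_inequality_0[of \<alpha> "1 - \<alpha>" a s]
    by (cases "a = 0") auto
  then have "a powr \<alpha> * s powr (1 - \<alpha>) * s powr (\<alpha> - 1) \<le> (\<alpha> * a + (1 - \<alpha>) * s) * s powr (\<alpha> - 1)"
    by (rule mult_right_mono) simp
  moreover have "s powr (1 - \<alpha>) * s powr (\<alpha> - 1) = 1" using assms by (simp add: powr_add[symmetric])
  moreover have "s * s powr (\<alpha> - 1) = s powr \<alpha>" using assms by (simp add: powr_mult_base)
  ultimately show ?thesis by (simp add: algebra_simps)
qed

section \<open>Independent draws from a finite distribution\<close>

locale finite_distribution =
  fixes I :: "'i set" and q :: "'i \<Rightarrow> real"
  assumes finite_I: "finite I" and q_nonneg: "\<And>i. i \<in> I \<Longrightarrow> 0 \<le> q i" and q_sum: "(\<Sum>i\<in>I. q i) = 1"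
begin

lemma expect_add: "expect I q n (\<lambda>l. G l + H l) = expect I q n G + expect I q n H"
  by (induction n arbitrary: G H) (simp_all add: sum.distrib distrib_left)

lemma expect_cmult: "expect I q n (\<lambda>l. c * G l) = c * expect I q n G"
  by (induction n arbitrary: G) (simp_all add: sum_distrib_left mult.left_commute)

lemma expect_const: "expect I q n (\<lambda>_. c) = c"
  by (induction n) (simp_all add: sum_distrib_right[symmetric] q_sum)

lemma expect_mono:
  "(\<And>l. length l = n \<Longrightarrow> set l \<subseteq> I \<Longrightarrow> G l \<le> H l) \<Longrightarrow> expect I q n G \<le> expect I q n H"
proof (induction n arbitrary: G H)
  case (Suc n)
  show ?case unfolding expect.simps by (intro sum_mono mult_left_mono Suc.IH Suc.prems q_nonneg) auto
qed simp

lemma mean_le_imp_exists: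
  assumes "(\<Sum>i\<in>I. q i * g i) \<le> c" shows "\<exists>i\<in>I. g i \<le> c"
proof (rule ccontr)
  assume "\<not> ?thesis"
  then have g: "\<And>i. i \<in> I \<Longrightarrow> c < g i" by (simp add: not_le)
  have "\<exists>i\<in>I. 0 < q i" using q_sum q_nonneg by (metis less_eq_real_def sum.neutral zero_neq_one)
  then obtain i where i: "i \<in> I" "0 < q i" by blast
  have "(\<Sum>i\<in>I. q i * c) < (\<Sum>i\<in>I. q i * g i)"
  proof (rule sum_strict_mono_ex1)
    show "\<forall>i\<in>I. q i * c \<le> q i * g i" using g q_nonneg by (auto intro!: mult_left_mono simp: less_imp_le)
    show "\<exists>i\<in>I. q i * c < q i * g i" using i g by (intro bexI[of _ i] mult_strict_left_mono) auto
  qed (rule finite_I)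
  then show False using assms by (simp add: sum_distrib_right[symmetric] q_sum)
qed

lemma expect_le_imp_exists:
  "expect I q n G \<le> c \<Longrightarrow> \<exists>l. length l = n \<and> set l \<subseteq> I \<and> G l \<le> c"
proof (induction n arbitrary: G)
  case (Suc n)
  then obtain i where "i \<in> I" "expect I q n (\<lambda>l. G (i # l)) \<le> c" using mean_le_imp_exists by fastforce
  then obtain l where "length l = n" "set l \<subseteq> I" "G (i # l) \<le> c" using Suc.IH by blast
  then show ?case using \<open>i \<in> I\<close> by (intro exI[of _ "i # l"]) auto
qed simp

lemma expect_powr_le:
  assumes "\<And>l. 0 \<le> G l" "expect I q n G \<le> s" "0 < s" "0 \<le> \<alpha>" "\<alpha> \<le> 1"
  shows "expect I q n (\<lambda>l. G l powr \<alpha>) \<le> s powr \<alpha>"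
proof -
  have "expect I q n (\<lambda>l. G l powr \<alpha>) \<le> expect I q n (\<lambda>l. \<alpha> * s powr (\<alpha> - 1) * G l + (1 - \<alpha>) * s powr \<alpha>)"
    using assms by (intro expect_mono powr_le_tangent) auto
  also have "\<dots> = \<alpha> * s powr (\<alpha> - 1) * expect I q n G + (1 - \<alpha>) * s powr \<alpha>"
    by (simp only: expect_add expect_cmult expect_const)
  also have "\<dots> \<le> \<alpha> * s powr (\<alpha> - 1) * s + (1 - \<alpha>) * s powr \<alpha>"
    using assms by (intro add_right_mono mult_left_mono) auto
  also have "\<dots> = s powr \<alpha>" using assms powr_mult_base[of s "\<alpha> - 1"] by (simp add: algebra_simps)
  finally show ?thesis .
qed

lemma mean_powr_le:
  assumes "\<And>i. i \<in> I \<Longrightarrow> 0 \<le> g i" "(\<Sum>i\<in>I. q i * g i) \<le> s" "0 < s" "0 \<le> \<alpha>" "\<alpha> \<le> 1"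
  shows "(\<Sum>i\<in>I. q i * g i powr \<alpha>) \<le> s powr \<alpha>"
proof -
  have "(\<Sum>i\<in>I. q i * g i powr \<alpha>) \<le> (\<Sum>i\<in>I. q i * (\<alpha> * s powr (\<alpha> - 1) * g i + (1 - \<alpha>) * s powr \<alpha>))"
    using assms q_nonneg by (intro sum_mono mult_left_mono powr_le_tangent) auto
  also have "\<dots> = \<alpha> * s powr (\<alpha> - 1) * (\<Sum>i\<in>I. q i * g i) + (\<Sum>i\<in>I. q i) * ((1 - \<alpha>) * s powr \<alpha>)"
    by (simp only: distrib_left sum.distrib sum_distrib_left sum_distrib_right mult.left_commute)
  also have "\<dots> \<le> \<alpha> * s powr (\<alpha> - 1) * s + (1 - \<alpha>) * s powr \<alpha>"
    using assms by (simp add: q_sum mult_left_mono)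
  also have "\<dots> = s powr \<alpha>" using assms powr_mult_base[of s "\<alpha> - 1"] by (simp add: algebra_simps)
  finally show ?thesis .
qed

text \<open>The outer induction raises the moment, the inner one adds a draw. In the expansion
  around the sum of the other draws, centering removes the linear term, so that only even moments
  enter. What remains grows like n^m instead of n^(2m), which is the gain behind the Monte Carlo
  rate.\<close>

lemma centered_even_moment_le:
  assumes Y0: "(\<Sum>i\<in>I. q i * Y i) = 0" and B: "0 \<le> B"
    and Y: "\<And>j. 1 \<le> j \<Longrightarrow> j \<le> m \<Longrightarrow> (\<Sum>i\<in>I. q i * Y i ^ (2 * j)) \<le> B ^ j"
  shows "expect I q n (\<lambda>l. sum_list (map Y l) ^ (2 * m)) \<le> moment_const m * real n ^ m * B ^ m"
  using Y
proof (induction m arbitrary: n)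
  case 0 then show ?case by (simp add: expect_const)
next
  case (Suc m)
  let ?S = "\<lambda>l. sum_list (map Y l)"
  note prems = Suc.prems
  have IHm: "expect I q n (\<lambda>l. ?S l ^ (2 * m)) \<le> moment_const m * real n ^ m * B ^ m" for n
    using Suc.IH Suc.prems by simp
  show ?case
  proof (induction n)
    case (Suc n)
    let ?M = "2 * Suc m"
    let ?e = "expect I q n (\<lambda>l. ?S l ^ ?M)"
    let ?e1 = "expect I q n (\<lambda>l. ?S l ^ (2 * m + 1))"
    let ?e2 = "expect I q n (\<lambda>l. ?S l ^ (2 * m))"
    have linear: "(\<Sum>i\<in>I. q i * (a0 + r * Y i * a1 + c * ((Y i)\<^sup>2 * a2 + Y i ^ ?M))) = (\<Sum>i\<in>I. q i) * a0 + r * a1 * (\<Sum>i\<in>I. q i * Y i)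
        + c * (a2 * (\<Sum>i\<in>I. q i * Y i ^ (2 * 1)) + (\<Sum>i\<in>I. q i * Y i ^ ?M))" for a0 a1 a2 r c
      by (simp add: sum.distrib distrib_left sum_distrib_left sum_distrib_right mult_ac)
    have "expect I q (Suc n) (\<lambda>l. ?S l ^ ?M) = (\<Sum>i\<in>I. q i * expect I q n (\<lambda>l. (Y i + ?S l) ^ ?M))" by simp
    also have "\<dots> \<le> (\<Sum>i\<in>I. q i * expect I q n (\<lambda>l. ?S l ^ ?M + real ?M * Y i * ?S l ^ (2 * m + 1)
        + 4 ^ Suc m * ((Y i)\<^sup>2 * ?S l ^ (2 * m) + Y i ^ ?M)))"
      by (intro sum_mono mult_left_mono expect_mono q_nonneg)
        (use even_power_add_le[of _ _ m] in \<open>simp add: mult.commute[of "(_ :: real)\<^sup>2"]\<close>)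
    also have "\<dots> = (\<Sum>i\<in>I. q i * (?e + real ?M * Y i * ?e1 + 4 ^ Suc m * ((Y i)\<^sup>2 * ?e2 + Y i ^ ?M)))"
      unfolding expect_add expect_cmult expect_const ..
    also have "\<dots> = (\<Sum>i\<in>I. q i) * ?e + real ?M * ?e1 * (\<Sum>i\<in>I. q i * Y i)
        + 4 ^ Suc m * (?e2 * (\<Sum>i\<in>I. q i * Y i ^ (2 * 1)) + (\<Sum>i\<in>I. q i * Y i ^ ?M))"
      by (rule linear)
    also have "\<dots> = ?e + 4 ^ Suc m * (?e2 * (\<Sum>i\<in>I. q i * Y i ^ (2 * 1)) + (\<Sum>i\<in>I. q i * Y i ^ ?M))"
      by (simp only: q_sum Y0)
    also have "\<dots> \<le> moment_const (Suc m) * real n ^ Suc m * B ^ Suc m + 4 ^ Suc m * ((moment_const m * real n ^ m * B ^ m) * B ^ 1 + B ^ Suc m)"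
    proof (intro add_mono Suc.IH mult_left_mono mult_mono IHm)
      show "0 \<le> moment_const m * real n ^ m * B ^ m" using moment_const_ge_1[of m] B by simp
      show "0 \<le> (\<Sum>i\<in>I. q i * Y i ^ (2 * 1))" using q_nonneg by (intro sum_nonneg mult_nonneg_nonneg) auto
    qed (use prems[of 1] prems[of "Suc m"] in auto)
    also have "\<dots> \<le> moment_const (Suc m) * B ^ Suc m * (real n ^ Suc m + real (Suc n) ^ m)"
    proof -
      have "real n ^ m \<le> real (Suc n) ^ m" "1 \<le> real (Suc n) ^ m" by (auto intro!: power_mono one_le_power)
      then have "moment_const m * real n ^ m + 1 \<le> moment_const m * real (Suc n) ^ m + 1 * real (Suc n) ^ m"
        using moment_const_ge_1[of m] by (intro add_mono mult_left_mono) auto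
      then have "4 ^ Suc m * B ^ Suc m * (moment_const m * real n ^ m + 1) \<le> 4 ^ Suc m * B ^ Suc m * ((moment_const m + 1) * real (Suc n) ^ m)"
        using B by (intro mult_left_mono) (auto simp: algebra_simps)
      then show ?thesis by (simp add: algebra_simps)
    qed
    also have "\<dots> \<le> moment_const (Suc m) * B ^ Suc m * real (Suc n) ^ Suc m"
    proof (rule mult_left_mono)
      have "real n * real n ^ m \<le> real n * real (Suc n) ^ m" by (intro mult_left_mono power_mono) auto
      then show "real n ^ Suc m + real (Suc n) ^ m \<le> real (Suc n) ^ Suc m" by (simp add: algebra_simps)
    qed (use moment_const_ge_1[of m] B in auto)
    finally show ?case by (simp only: mult_ac)
  qed simp
qed

lemma integral_expect:
  assumes "\<And>l. length l = n \<Longrightarrow> set l \<subseteq> I \<Longrightarrow> integrable M (h l)"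
  shows "integrable M (\<lambda>x. expect I q n (\<lambda>l. h l x)) \<and> expect I q n (\<lambda>l. \<integral>x. h l x \<partial>M) = (\<integral>x. expect I q n (\<lambda>l. h l x) \<partial>M)"
  using assms
proof (induction n arbitrary: h)
  case (Suc n)
  have *: "integrable M (\<lambda>x. expect I q n (\<lambda>l. h (i # l) x)) \<and> expect I q n (\<lambda>l. \<integral>x. h (i # l) x \<partial>M) = (\<integral>x. expect I q n (\<lambda>l. h (i # l) x) \<partial>M)"
    if "i \<in> I" for i
    using that Suc.prems by (intro Suc.IH) auto
  then show ?case by (simp add: Bochner_Integration.integral_sum)
qed simp

text \<open>The exponent p is reached from the even exponent 2m by Jensen's inequality with p/(2m)
  <= 1. After integration in x, some list of draws does no worse than the mean over all lists, so
  one choice serves all x at once. The bound \<open>B\<close> varies with x to allow samples whose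
  spread grows with x.\<close>

theorem monte_carlo:
  fixes g :: "'i \<Rightarrow> 'x \<Rightarrow> real" and mean B :: "'x \<Rightarrow> real" and p :: real
  assumes mean: "\<And>x. x \<in> space M \<Longrightarrow> mean x = (\<Sum>i\<in>I. q i * g i x)"
    and B: "\<And>x. x \<in> space M \<Longrightarrow> 0 < B x"
    and Y: "\<And>x j. x \<in> space M \<Longrightarrow> 1 \<le> j \<Longrightarrow> j \<le> m \<Longrightarrow> (\<Sum>i\<in>I. q i * (g i x - mean x) ^ (2 * j)) \<le> B x ^ j"
    and p: "0 < p" "p \<le> 2 * real m" and n: "1 \<le> n"
    and int: "\<And>l. length l = n \<Longrightarrow> set l \<subseteq> I \<Longrightarrow> integrable M (\<lambda>x. \<bar>sum_list (map (\<lambda>i. g i x) l) / real n - mean x\<bar> powr p)"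
    and Bint: "integrable M (\<lambda>x. B x powr (p / 2))"
  shows "\<exists>l. length l = n \<and> set l \<subseteq> I \<and>
    (\<integral>x. \<bar>sum_list (map (\<lambda>i. g i x) l) / real n - mean x\<bar> powr p \<partial>M)
      \<le> moment_const m powr (p / (2 * real m)) * real n powr (- p / 2) * (\<integral>x. B x powr (p / 2) \<partial>M)"
proof (rule expect_le_imp_exists)
  have m: "0 < real m" using p by linarith
  let ?h = "\<lambda>l x. \<bar>sum_list (map (\<lambda>i. g i x) l) / real n - mean x\<bar> powr p"
  let ?c = "moment_const m powr (p / (2 * real m)) * real n powr (- p / 2)"
  have pt: "expect I q n (\<lambda>l. ?h l x) \<le> ?c * B x powr (p / 2)" if x: "x \<in> space M" for x
  proof -
    let ?Y = "\<lambda>i. g i x - mean x"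
    let ?S = "\<lambda>l. sum_list (map ?Y l)"
    have "(\<Sum>i\<in>I. q i * ?Y i) = 0"
      using mean[OF x] by (simp add: right_diff_distrib sum_subtractf sum_distrib_right[symmetric] q_sum)
    then have le: "expect I q n (\<lambda>l. ?S l ^ (2 * m)) \<le> moment_const m * real n ^ m * B x ^ m"
      using B[OF x] Y[OF x] by (intro centered_even_moment_le) auto
    have eq: "?h l x = real n powr (- p) * (?S l ^ (2 * m)) powr (p / (2 * real m))" if "length l = n" for l
    proof -
      have "?S l = sum_list (map (\<lambda>i. g i x) l) - real (length l) * mean x"
        by (induction l) (auto simp: algebra_simps)
      then have "sum_list (map (\<lambda>i. g i x) l) / real n - mean x = ?S l / real n" using that n by (simp add: field_simps)
      then have "?h l x = (\<bar>?S l\<bar> / real n) powr p" by (simp add: abs_divide)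
      also have "\<dots> = real n powr (- p) * \<bar>?S l\<bar> powr p" by (subst powr_divide) (auto simp: powr_minus divide_inverse mult.commute)
      also have "\<bar>?S l\<bar> powr p = (?S l ^ (2 * m)) powr (p / (2 * real m))"
      proof (cases "?S l = 0")
        case True
        have "0 < m" using m by simp
        then have "(0::real) ^ (2 * m) = 0" by simp
        then show ?thesis using True by simp
      next
        case False
        have "?S l ^ (2 * m) = \<bar>?S l\<bar> powr real (2 * m)" using False by (subst powr_realpow) (auto simp: power_even_abs)
        then show ?thesis using m by (simp add: powr_powr)
      qed
      finally show ?thesis .
    qed
    have "expect I q n (\<lambda>l. ?h l x) \<le> expect I q n (\<lambda>l. real n powr (- p) * (?S l ^ (2 * m)) powr (p / (2 * real m)))"
      by (intro expect_mono) (simp add: eq)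
    also have "\<dots> \<le> real n powr (- p) * (moment_const m * real n ^ m * B x ^ m) powr (p / (2 * real m))"
      unfolding expect_cmult
    proof (intro mult_left_mono expect_powr_le le)
      show "0 < moment_const m * real n ^ m * B x ^ m" using moment_const_ge_1[of m] n B[OF x] by simp
      show "p / (2 * real m) \<le> 1" using p m by simp
      show "0 \<le> ?S l ^ (2 * m)" for l by (simp add: power_mult)
    qed (use p m in auto)
    also have "\<dots> = ?c * B x powr (p / 2)"
    proof -
      have a: "(real n ^ m) powr (p / (2 * real m)) = real n powr (p / 2)" "(B x ^ m) powr (p / (2 * real m)) = B x powr (p / 2)"
        using n B[OF x] m by (simp_all add: powr_realpow[symmetric] powr_powr)
      have b: "real n powr (- p) * real n powr (p / 2) = real n powr (- p / 2)"
        by (simp add: powr_add[symmetric])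
      have "(moment_const m * real n ^ m * B x ^ m) powr (p / (2 * real m))
         = moment_const m powr (p / (2 * real m)) * real n powr (p / 2) * B x powr (p / 2)"
        using moment_const_ge_1[of m] B[OF x] by (simp add: powr_mult a)
      then have "real n powr (- p) * (moment_const m * real n ^ m * B x ^ m) powr (p / (2 * real m))
         = moment_const m powr (p / (2 * real m)) * (real n powr (- p) * real n powr (p / 2)) * B x powr (p / 2)"
        by (simp only: mult_ac)
      then show ?thesis by (simp only: b)
    qed
    finally show ?thesis .
  qed
  have ie: "integrable M (\<lambda>x. expect I q n (\<lambda>l. ?h l x))" "expect I q n (\<lambda>l. \<integral>x. ?h l x \<partial>M) = (\<integral>x. expect I q n (\<lambda>l. ?h l x) \<partial>M)"
    using integral_expect[where h = ?h, OF int] by auto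
  have "(\<integral>x. expect I q n (\<lambda>l. ?h l x) \<partial>M) \<le> (\<integral>x. ?c * B x powr (p / 2) \<partial>M)"
    by (rule integral_mono[OF ie(1) _ pt]) (use Bint in auto)
  then show "expect I q n (\<lambda>l. \<integral>x. ?h l x \<partial>M) \<le> ?c * (\<integral>x. B x powr (p / 2) \<partial>M)"
    unfolding ie(2) by simp
qed

end

section \<open>One step of the random scheme\<close>

lemma one_plus_power_le:
  fixes z :: real
  assumes "\<bar>z\<bar> \<le> 1"
  shows "(1 + z) ^ m \<le> 1 + real m * z + 3 ^ m * z\<^sup>2"
proof (induction m)
  case (Suc m)
  have m: "real m \<le> 3 ^ m"
  proof (induction m)
    case (Suc m)
    have "(1::real) \<le> 3 ^ m" by simp
    then show ?case using Suc unfolding power_Suc of_nat_Suc by linarith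
  qed simp
  have "(1 + z) ^ Suc m \<le> (1 + z) * (1 + real m * z + 3 ^ m * z\<^sup>2)"
    using Suc assms by (simp add: mult_left_mono)
  also have "\<dots> = 1 + real (Suc m) * z + (real m + 3 ^ m + 3 ^ m * z) * z\<^sup>2"
    by (simp add: algebra_simps power2_eq_square)
  also have "\<dots> \<le> 1 + real (Suc m) * z + (3 ^ m + 3 ^ m + 3 ^ m * 1) * z\<^sup>2"
    using m assms by (intro add_left_mono mult_right_mono add_mono mult_left_mono) auto
  finally show ?case by simp
qed simp

text \<open>This is the power 3/2 of 1 + z, needed for the cube of a Euclidean length in terms of
  its square.\<close>

lemma one_plus_mult_sqrt_le:
  fixes z :: real
  assumes "\<bar>z\<bar> \<le> 1"
  shows "(1 + z) * sqrt (1 + z) \<le> 1 + 3 / 2 * z + z\<^sup>2 / 2"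
proof -
  have "sqrt (1 + z) \<le> 1 + z / 2"
    using assms by (intro real_le_lsqrt) (auto simp: power2_eq_square algebra_simps)
  then have "(1 + z) * sqrt (1 + z) \<le> (1 + z) * (1 + z / 2)" using assms by (intro mult_left_mono) auto
  also have "\<dots> = 1 + 3 / 2 * z + z\<^sup>2 / 2" by (simp add: field_simps power2_eq_square)
  finally show ?thesis .
qed

text \<open>An integer power of 1 + |x|^2 is a polynomial, so that it can serve inside smooth
  barriers.\<close>

definition weight :: "nat \<Rightarrow> nat \<Rightarrow> (nat \<Rightarrow> real) \<Rightarrow> real" where
  "weight d m x = (1 + nsq d x) ^ m"

lemma weight_ge_1 [simp]: "1 \<le> weight d m x"
  by (simp add: weight_def one_le_power)

lemma weight_pos [simp]: "0 < weight d m x" using weight_ge_1[of d m x] by linarith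

lemma weight_mono: "m \<le> n \<Longrightarrow> weight d m x \<le> weight d n x"
  by (simp add: weight_def power_increasing)

section \<open>Moments of a single random displacement\<close>

locale dimension =
  fixes d :: nat
  assumes d_pos: "1 \<le> d"
begin

text \<open>A jump is labelled by a column of the diffusion matrix and a sign. Since the uniform
  average picks a given column with probability 1/d only, the displacement along it carries a factor
  sqrt d.\<close>

definition idx :: "(nat \<times> real) set" where
  "idx = {..<d} \<times> {-1, 1}"

definition avg :: "(nat \<times> real \<Rightarrow> real) \<Rightarrow> real" where
  "avg g = (\<Sum>j\<in>idx. g j) / (2 * real d)"

text \<open>Averaged over \<open>j\<close>, these displacements have mean \<open>h b\<close> and second moment
  \<open>h\<^sup>2 b b\<^sup>* + h (\<Sum>k. a k (a k)\<^sup>*)\<close>.\<close>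

definition displ :: "real \<Rightarrow> (nat \<Rightarrow> real) \<Rightarrow> (nat \<Rightarrow> nat \<Rightarrow> real) \<Rightarrow> nat \<times> real \<Rightarrow> nat \<Rightarrow> real" where
  "displ h b a j = (\<lambda>i. h * b i + snd j * sqrt (real d * h) * a (fst j) i)"

lemma finite_idx [simp]: "finite idx" by (simp add: idx_def)

lemma card_idx: "card idx = 2 * d" by (simp add: idx_def card_cartesian_product)

lemma avg_split: "avg g = (\<Sum>k<d. g (k, -1) + g (k, 1)) / (2 * real d)"
  unfolding avg_def idx_def by (simp add: sum.cartesian_product')

lemma avg_const [simp]: "avg (\<lambda>_. c) = c" using d_pos by (simp add: avg_def card_idx)

lemma avg_add: "avg (\<lambda>j. f j + g j) = avg f + avg g" by (simp add: avg_def sum.distrib add_divide_distrib)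

lemma avg_diff: "avg (\<lambda>j. f j - g j) = avg f - avg g" by (simp add: avg_def sum_subtractf diff_divide_distrib)

lemma avg_cmult: "avg (\<lambda>j. c * f j) = c * avg f" by (simp add: avg_def sum_distrib_left)

lemma avg_sum: "avg (\<lambda>j. \<Sum>i\<in>I. f i j) = (\<Sum>i\<in>I. avg (f i))"
  by (simp add: avg_def sum.swap[of _ I] sum_divide_distrib)

lemma avg_mono: "(\<And>j. j \<in> idx \<Longrightarrow> f j \<le> g j) \<Longrightarrow> avg f \<le> avg g"
  by (simp add: avg_def divide_right_mono sum_mono)

lemma avg_cong: "(\<And>j. j \<in> idx \<Longrightarrow> f j = g j) \<Longrightarrow> avg f = avg g"
  by (simp add: avg_def)

lemma abs_avg_le: "\<bar>avg f\<bar> \<le> avg (\<lambda>j. \<bar>f j\<bar>)"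
  by (simp add: avg_def abs_divide divide_right_mono)

lemma avg_displ: "avg (\<lambda>j. displ h b a j i) = h * b i"
  using d_pos by (simp add: avg_split displ_def)

lemma avg_displ_mult:
  assumes "0 \<le> h"
  shows "avg (\<lambda>j. displ h b a j i * displ h b a j l) = h\<^sup>2 * (b i * b l) + h * (\<Sum>k<d. a k i * a k l)"
proof -
  have *: "displ h b a (k, -1) i * displ h b a (k, -1) l + displ h b a (k, 1) i * displ h b a (k, 1) l
      = 2 * (h\<^sup>2 * (b i * b l)) + 2 * real d * (h * (a k i * a k l))" for k
  proof -
    have s: "sqrt (real d * h) * sqrt (real d * h) = real d * h" using assms by simp
    have "displ h b a (k, -1) i * displ h b a (k, -1) l + displ h b a (k, 1) i * displ h b a (k, 1) l
      = 2 * (h\<^sup>2 * (b i * b l)) + 2 * (sqrt (real d * h) * sqrt (real d * h)) * (a k i * a k l)"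
      by (simp add: displ_def algebra_simps power2_eq_square del: real_sqrt_mult_self)
    then show ?thesis unfolding s by simp
  qed
  show ?thesis
    unfolding avg_split * using d_pos
    by (simp add: sum.distrib add_divide_distrib sum_distrib_left[symmetric])
qed

lemma avg_dir1_displ: "avg (\<lambda>j. dir1 d f p (displ h b a j)) = h * dir1 d f p b"
proof -
  have "avg (\<lambda>j. dir1 d f p (displ h b a j)) = (\<Sum>i<d. avg (\<lambda>j. partial (Some i) f p * displ h b a j i))"
    by (simp add: dir1_def avg_sum mult.commute)
  also have "\<dots> = h * dir1 d f p b"
    by (simp add: avg_cmult avg_displ dir1_def sum_distrib_left mult_ac)
  finally show ?thesis .
qed

lemma avg_dir2_displ:
  assumes "0 \<le> h"
  shows "avg (\<lambda>j. dir2 d f p (displ h b a j)) = h\<^sup>2 * dir2 d f p b + h * (\<Sum>k<d. dir2 d f p (a k))"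
proof -
  let ?H = "\<lambda>i l. partial (Some l) (partial (Some i) f) p"
  have e: "dir2 d f p y = (\<Sum>i<d. \<Sum>l<d. ?H i l * (y i * y l))" for y
    by (simp add: dir2_def dir1_def sum_distrib_left mult_ac)
  have "avg (\<lambda>j. dir2 d f p (displ h b a j)) = (\<Sum>i<d. \<Sum>l<d. ?H i l * avg (\<lambda>j. displ h b a j i * displ h b a j l))"
    by (simp add: e avg_sum avg_cmult)
  also have "\<dots> = h\<^sup>2 * dir2 d f p b + h * (\<Sum>i<d. \<Sum>l<d. \<Sum>k<d. ?H i l * (a k i * a k l))"
    by (simp add: avg_displ_mult[OF assms] e algebra_simps sum.distrib sum_distrib_left)
  also have "(\<Sum>i<d. \<Sum>l<d. \<Sum>k<d. ?H i l * (a k i * a k l)) = (\<Sum>k<d. dir2 d f p (a k))"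
    unfolding e by (subst (2) sum.swap, subst sum.swap) (rule refl)
  finally show ?thesis .
qed

lemma avg_nsq_displ:
  assumes "0 \<le> h"
  shows "avg (\<lambda>j. nsq d (displ h b a j)) = h\<^sup>2 * nsq d b + h * (\<Sum>k<d. nsq d (a k))"
proof -
  have "avg (\<lambda>j. nsq d (displ h b a j)) = (\<Sum>i<d. avg (\<lambda>j. displ h b a j i * displ h b a j i))"
    by (simp add: nsq_def avg_sum power2_eq_square)
  also have "\<dots> = h\<^sup>2 * nsq d b + h * (\<Sum>i<d. \<Sum>k<d. (a k i)\<^sup>2)"
    by (simp add: avg_displ_mult[OF assms] nsq_def sum.distrib sum_distrib_left power2_eq_square)
  also have "(\<Sum>i<d. \<Sum>k<d. (a k i)\<^sup>2) = (\<Sum>k<d. nsq d (a k))"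
    unfolding nsq_def by (rule sum.swap)
  finally show ?thesis .
qed

text \<open>Compared with the mean in \<open>avg_nsq_displ\<close>, the pointwise bound loses a
  factor d. It serves to keep single jumps short, so d restricts the step size but does not enter
  the growth rates.\<close>

lemma nsq_displ_le:
  assumes "0 \<le> h" "j \<in> idx"
  shows "nsq d (displ h b a j) \<le> 2 * h\<^sup>2 * nsq d b + 2 * (real d * h) * (\<Sum>k<d. nsq d (a k))"
proof -
  have j: "fst j < d" "(snd j)\<^sup>2 = 1" using assms(2) by (auto simp: idx_def)
  have "(displ h b a j i)\<^sup>2 \<le> 2 * h\<^sup>2 * (b i)\<^sup>2 + 2 * (real d * h) * (a (fst j) i)\<^sup>2" for i
  proof -
    have "(u + w)\<^sup>2 \<le> 2 * u\<^sup>2 + 2 * w\<^sup>2" for u w :: real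
      using zero_le_power2[of "u - w"] by (simp add: power2_eq_square algebra_simps)
    from this[of "h * b i" "snd j * sqrt (real d * h) * a (fst j) i"]
    show ?thesis using assms(1) j(2) by (simp add: displ_def power_mult_distrib)
  qed
  then have "nsq d (displ h b a j) \<le> (\<Sum>i<d. 2 * h\<^sup>2 * (b i)\<^sup>2 + 2 * (real d * h) * (a (fst j) i)\<^sup>2)"
    unfolding nsq_def by (intro sum_mono)
  also have "\<dots> = 2 * h\<^sup>2 * nsq d b + 2 * (real d * h) * nsq d (a (fst j))"
    by (simp add: nsq_def sum.distrib sum_distrib_left)
  also have "nsq d (a (fst j)) \<le> (\<Sum>k<d. nsq d (a k))"
    using j(1) by (intro member_le_sum) auto
  finally show ?thesis using assms(1) by (simp add: mult_left_mono)
qed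

text \<open>Here \<zeta> is the relative change of \<rho> = \<kappa> + |x|^2 under a jump. The noise
  has mean zero, so only the drift and the squared length of the jump contribute to the mean, and
  both are of order h. The offset \<kappa> is 1 for the weights and 0 for the linear parts of the
  jumps.\<close>

lemma relative_increment_bounds:
  fixes \<kappa> \<rho> B h :: real and x b :: "nat \<Rightarrow> real" and a :: "nat \<Rightarrow> nat \<Rightarrow> real"
  assumes \<kappa>: "0 \<le> \<kappa>" and \<rho>: "\<rho> = \<kappa> + nsq d x" "0 < \<rho>" and B: "1 \<le> B"
    and b: "nsq d b \<le> B * \<rho>" and a: "(\<Sum>k<d. nsq d (a k)) \<le> B * \<rho>"
    and h: "0 < h" "h \<le> 1 / (64 * real d * B)"
  defines "\<zeta> \<equiv> \<lambda>j. (\<kappa> + nsq d (\<lambda>i. x i + displ h b a j i)) / \<rho> - 1"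
  shows "\<And>j. j \<in> idx \<Longrightarrow> \<bar>\<zeta> j\<bar> \<le> 1" "avg \<zeta> \<le> (1 + 3 * B) * h" "avg (\<lambda>j. (\<zeta> j)\<^sup>2) \<le> 20 * B * h"
proof -
  let ?y = "displ h b a"
  define ip where "ip y = (\<Sum>i<d. x i * y i)" for y
  have dB: "1 \<le> real d * B" using d_pos B by (metis mult_mono' mult_1 of_nat_1 of_nat_le_iff zero_le_one)
  have hdB: "64 * (real d * B) * h \<le> 1"
    using h(2) dB by (simp add: pos_le_divide_eq mult_ac)
  have hB: "B * h \<le> 1" "h \<le> 1"
  proof -
    have "1 * (B * h) \<le> real d * (B * h)" using d_pos h B by (intro mult_right_mono) auto
    moreover have "0 \<le> real d * (B * h)" using h B by simp
    ultimately show *: "B * h \<le> 1" using hdB by (simp add: mult_ac)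
    have "1 * h \<le> B * h" using h B by (intro mult_right_mono) auto
    then show "h \<le> 1" using * by simp
  qed
  have nsqx: "nsq d x \<le> \<rho>" using \<rho> \<kappa> by simp
  have \<zeta>: "\<zeta> j = (2 * ip (?y j) + nsq d (?y j)) / \<rho>" for j
  proof -
    have "nsq d (\<lambda>i. x i + ?y j i) = nsq d x + 2 * ip (?y j) + nsq d (?y j)"
      by (simp add: nsq_def ip_def power2_sum sum.distrib sum_distrib_left mult_ac)
    then show ?thesis using \<rho> by (simp add: \<zeta>_def field_simps)
  qed
  have ip2: "(ip y)\<^sup>2 \<le> \<rho> * nsq d y" for y
  proof -
    have "(ip y)\<^sup>2 \<le> nsq d x * nsq d y" unfolding ip_def nsq_def by (rule Cauchy_Schwarz_ineq_sum)
    also have "\<dots> \<le> \<rho> * nsq d y" using nsqx by (intro mult_right_mono) auto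
    finally show ?thesis .
  qed
  \<comment> \<open>The 64 in the step size gives |y|^2 <= \<rho>/16; Cauchy-Schwarz then gives 2
    |<x, y>| <= \<rho>/2, and both together stay below \<rho>.\<close>
  have small: "nsq d (?y j) \<le> \<rho> / 16" if "j \<in> idx" for j
  proof -
    have "nsq d (?y j) \<le> 2 * h\<^sup>2 * nsq d b + 2 * (real d * h) * (\<Sum>k<d. nsq d (a k))"
      using nsq_displ_le that h by auto
    also have "\<dots> \<le> 2 * (real d * h) * (B * \<rho>) + 2 * (real d * h) * (B * \<rho>)"
    proof (intro add_mono mult_mono mult_left_mono)
      show "h\<^sup>2 \<le> real d * h" using h hB d_pos by (simp add: power2_eq_square mult_right_mono)
    qed (use a b h in \<open>auto intro!: sum_nonneg\<close>)
    also have "\<dots> = (64 * (real d * B) * h) * (\<rho> / 16)" by (simp add: algebra_simps)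
    also have "\<dots> \<le> 1 * (\<rho> / 16)" using hdB \<rho> by (intro mult_right_mono) auto
    finally show ?thesis by simp
  qed
  have ip_small: "\<bar>2 * ip (?y j)\<bar> \<le> \<rho> / 2" if "j \<in> idx" for j
  proof -
    have "(2 * ip (?y j))\<^sup>2 \<le> 4 * (\<rho> * nsq d (?y j))" using ip2[of "?y j"] by (simp add: power_mult_distrib)
    also have "\<dots> \<le> 4 * (\<rho> * (\<rho> / 16))" using small[OF that] \<rho> by (intro mult_left_mono) auto
    also have "\<dots> = (\<rho> / 2)\<^sup>2" by (simp add: power2_eq_square)
    finally show ?thesis using \<rho> by (metis abs_le_square_iff abs_of_pos half_gt_zero)
  qed
  show "\<bar>\<zeta> j\<bar> \<le> 1" if "j \<in> idx" for j
  proof -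
    have "\<bar>2 * ip (?y j) + nsq d (?y j)\<bar> \<le> \<rho>"
      using ip_small[OF that] small[OF that] \<rho> nsq_nonneg[of d "?y j"] by linarith
    then show ?thesis using \<rho> by (simp add: \<zeta> abs_divide)
  qed
  have avgn: "avg (\<lambda>j. nsq d (?y j)) \<le> 2 * h * B * \<rho>"
  proof -
    have "avg (\<lambda>j. nsq d (?y j)) = h\<^sup>2 * nsq d b + h * (\<Sum>k<d. nsq d (a k))" using avg_nsq_displ h by simp
    also have "\<dots> \<le> h * (B * \<rho>) + h * (B * \<rho>)"
      using h hB a b B \<rho> by (intro add_mono mult_mono) (auto simp: power2_eq_square mult_left_le intro!: sum_nonneg)
    finally show ?thesis by (simp add: algebra_simps)
  qed
  have ipb: "2 * ip b \<le> (1 + B) * \<rho>"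
  proof -
    have "2 * ip b \<le> nsq d x + nsq d b"
      unfolding ip_def nsq_def sum_distrib_left sum.distrib[symmetric]
      by (intro sum_mono) (use sum_squares_bound in \<open>auto simp: mult.assoc\<close>)
    then show ?thesis using nsqx b by (simp add: algebra_simps)
  qed
  show "avg \<zeta> \<le> (1 + 3 * B) * h"
  proof -
    have "avg (\<lambda>j. ip (?y j)) = h * ip b"
      by (simp add: ip_def avg_sum avg_cmult avg_displ sum_distrib_left mult_ac)
    then have "avg \<zeta> = (h * (2 * ip b) + avg (\<lambda>j. nsq d (?y j))) / \<rho>"
      using avg_cmult[of "1/\<rho>" "\<lambda>j. 2 * ip (?y j) + nsq d (?y j)"]
      by (simp add: \<zeta>[abs_def] avg_add avg_cmult)
    also have "\<dots> \<le> (h * ((1 + B) * \<rho>) + 2 * h * B * \<rho>) / \<rho>"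
      using ipb avgn h \<rho> by (intro divide_right_mono add_mono mult_left_mono) auto
    also have "\<dots> = (1 + 3 * B) * h" using \<rho> by (simp add: field_simps)
    finally show ?thesis .
  qed
  show "avg (\<lambda>j. (\<zeta> j)\<^sup>2) \<le> 20 * B * h"
  proof -
    have "(\<zeta> j)\<^sup>2 \<le> (10 / \<rho>) * nsq d (?y j)" if "j \<in> idx" for j
    proof -
      have "(u + w)\<^sup>2 \<le> 2 * u\<^sup>2 + 2 * w\<^sup>2" for u w :: real
        using zero_le_power2[of "u - w"] by (simp add: power2_eq_square algebra_simps)
      then have "(2 * ip (?y j) + nsq d (?y j))\<^sup>2 \<le> 2 * (2 * ip (?y j))\<^sup>2 + 2 * (nsq d (?y j))\<^sup>2" .
      also have "\<dots> \<le> 8 * (\<rho> * nsq d (?y j)) + 2 * (\<rho> * nsq d (?y j))"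
        using ip2[of "?y j"] small[OF that] \<rho>
        by (intro add_mono) (auto simp: power_mult_distrib power2_eq_square intro!: mult_right_mono)
      finally have q: "(2 * ip (?y j) + nsq d (?y j))\<^sup>2 \<le> 10 * (\<rho> * nsq d (?y j))" by simp
      have "(\<zeta> j)\<^sup>2 = (2 * ip (?y j) + nsq d (?y j))\<^sup>2 / \<rho>\<^sup>2" by (simp add: \<zeta> power_divide)
      also have "\<dots> \<le> 10 * (\<rho> * nsq d (?y j)) / \<rho>\<^sup>2" using q by (intro divide_right_mono) auto
      also have "\<dots> = (10 / \<rho>) * nsq d (?y j)" using \<rho>(2) by (simp add: power2_eq_square)
      finally show ?thesis .
    qed
    then have "avg (\<lambda>j. (\<zeta> j)\<^sup>2) \<le> (10 / \<rho>) * avg (\<lambda>j. nsq d (?y j))"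
      unfolding avg_cmult[symmetric] by (intro avg_mono)
    also have "\<dots> \<le> (10 / \<rho>) * (2 * h * B * \<rho>)" using avgn \<rho> by (intro mult_left_mono) auto
    also have "\<dots> = 20 * B * h" using \<rho> by (simp add: field_simps)
    finally show ?thesis .
  qed
qed

text \<open>The first summand comes from the mean of the relative increment, the second from its
  second moment through the remainder 3^m z^2 in \<open>one_plus_power_le\<close>. Independence of d
  is essential: it makes the moments of the sampled affine maps dimension-free.\<close>

definition growth_rate :: "real \<Rightarrow> nat \<Rightarrow> real" where
  "growth_rate B m = real m * (1 + 3 * B) + 3 ^ m * (20 * B)"

lemma growth_rate_nonneg: "1 \<le> B \<Longrightarrow> 0 \<le> growth_rate B m"
  by (simp add: growth_rate_def)

lemma avg_power_le:
  assumes "0 \<le> \<kappa>" "\<rho> = \<kappa> + nsq d x" "0 < \<rho>" "1 \<le> B"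
    "nsq d b \<le> B * \<rho>" "(\<Sum>k<d. nsq d (a k)) \<le> B * \<rho>" "0 < h" "h \<le> 1 / (64 * real d * B)"
  shows "avg (\<lambda>j. (\<kappa> + nsq d (\<lambda>i. x i + displ h b a j i)) ^ m) \<le> (1 + growth_rate B m * h) * \<rho> ^ m"
proof -
  define \<zeta> where "\<zeta> = (\<lambda>j. (\<kappa> + nsq d (\<lambda>i. x i + displ h b a j i)) / \<rho> - 1)"
  have z: "\<And>j. j \<in> idx \<Longrightarrow> \<bar>\<zeta> j\<bar> \<le> 1" "avg \<zeta> \<le> (1 + 3 * B) * h" "avg (\<lambda>j. (\<zeta> j)\<^sup>2) \<le> 20 * B * h"
    unfolding \<zeta>_def using relative_increment_bounds[OF assms] by blast+
  have e: "(\<kappa> + nsq d (\<lambda>i. x i + displ h b a j i)) ^ m = \<rho> ^ m * (1 + \<zeta> j) ^ m" for j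
    using assms(3) by (simp add: \<zeta>_def power_mult_distrib[symmetric])
  have "avg (\<lambda>j. (1 + \<zeta> j) ^ m) \<le> avg (\<lambda>j. 1 + real m * \<zeta> j + 3 ^ m * (\<zeta> j)\<^sup>2)"
    by (intro avg_mono one_plus_power_le z(1))
  also have "\<dots> = 1 + real m * avg \<zeta> + 3 ^ m * avg (\<lambda>j. (\<zeta> j)\<^sup>2)"
    by (simp add: avg_add avg_cmult)
  also have "\<dots> \<le> 1 + real m * ((1 + 3 * B) * h) + 3 ^ m * (20 * B * h)"
    by (intro add_mono mult_left_mono z(2,3)) auto
  also have "\<dots> = 1 + growth_rate B m * h" by (simp add: growth_rate_def algebra_simps)
  finally show ?thesis using assms(3) unfolding e avg_cmult by (simp add: mult.commute)
qed

text \<open>The argument for integer powers is repeated with the exponent 3/2 of the squared length;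
  \<open>growth_rate B 2\<close> is a convenient majorant of the resulting rate.\<close>

lemma avg_cube_le:
  assumes "0 < nsq d x" "1 \<le> B"
    "nsq d b \<le> B * nsq d x" "(\<Sum>k<d. nsq d (a k)) \<le> B * nsq d x" "0 < h" "h \<le> 1 / (64 * real d * B)"
  shows "avg (\<lambda>j. nsq d (\<lambda>i. x i + displ h b a j i) * sqrt (nsq d (\<lambda>i. x i + displ h b a j i)))
    \<le> (1 + growth_rate B 2 * h) * (nsq d x * sqrt (nsq d x))"
proof -
  define \<rho> where "\<rho> = nsq d x"
  define \<zeta> where "\<zeta> = (\<lambda>j. (0 + nsq d (\<lambda>i. x i + displ h b a j i)) / \<rho> - 1)"
  have \<rho>: "\<rho> = 0 + nsq d x" "0 < \<rho>" using assms by (auto simp: \<rho>_def)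
  have z: "\<And>j. j \<in> idx \<Longrightarrow> \<bar>\<zeta> j\<bar> \<le> 1" "avg \<zeta> \<le> (1 + 3 * B) * h" "avg (\<lambda>j. (\<zeta> j)\<^sup>2) \<le> 20 * B * h"
    unfolding \<zeta>_def using relative_increment_bounds[OF order_refl \<rho> assms(2-)[folded \<rho>_def]] by blast+
  have e: "nsq d (\<lambda>i. x i + displ h b a j i) = \<rho> * (1 + \<zeta> j)" for j
    using \<rho> by (simp add: \<zeta>_def)
  have e': "nsq d (\<lambda>i. x i + displ h b a j i) * sqrt (nsq d (\<lambda>i. x i + displ h b a j i))
      = (\<rho> * sqrt \<rho>) * ((1 + \<zeta> j) * sqrt (1 + \<zeta> j))" for j
    unfolding e by (simp add: real_sqrt_mult)
  have "avg (\<lambda>j. (1 + \<zeta> j) * sqrt (1 + \<zeta> j)) \<le> avg (\<lambda>j. 1 + 3/2 * \<zeta> j + (1/2) * (\<zeta> j)\<^sup>2)"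
    by (intro avg_mono) (use one_plus_mult_sqrt_le[OF z(1)] in auto)
  also have "\<dots> = 1 + 3/2 * avg \<zeta> + (1/2) * avg (\<lambda>j. (\<zeta> j)\<^sup>2)"
    unfolding avg_add avg_cmult avg_const ..
  also have "\<dots> \<le> 1 + 3/2 * ((1 + 3 * B) * h) + (1/2) * (20 * B * h)"
    by (intro add_mono mult_left_mono z(2,3)) auto
  also have "\<dots> \<le> 1 + growth_rate B 2 * h"
  proof -
    have "1 + growth_rate B 2 * h - (1 + 3/2 * ((1 + 3 * B) * h) + (1/2) * (20 * B * h)) = h / 2 + (343 / 2) * (B * h)"
      by (simp add: growth_rate_def algebra_simps)
    moreover have "0 \<le> h / 2 + (343 / 2) * (B * h)" using assms(2,5) by simp
    ultimately show ?thesis by linarith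
  qed
  finally show ?thesis using \<rho> unfolding e' avg_cmult \<rho>_def[symmetric] by (simp add: mult.commute)
qed

end

section \<open>The generator as a limit of difference quotients\<close>

lemma sum_triple_product:
  fixes u :: "'a \<Rightarrow> real"
  shows "(\<Sum>i\<in>I. \<Sum>l\<in>I. u i * (u l * c)) = c * (\<Sum>i\<in>I. u i)\<^sup>2"
    and "(\<Sum>i\<in>I. \<Sum>l\<in>I. \<Sum>m\<in>I. u i * (u l * (u m * c))) = c * ((\<Sum>i\<in>I. u i)\<^sup>2 * (\<Sum>i\<in>I. u i))"
proof -
  have "(\<Sum>i\<in>I. \<Sum>l\<in>I. u i * (u l * c)) = (\<Sum>i\<in>I. u i) * ((\<Sum>i\<in>I. u i) * c)"
    by (simp only: sum_distrib_left[symmetric] sum_distrib_right[symmetric])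
  then show "(\<Sum>i\<in>I. \<Sum>l\<in>I. u i * (u l * c)) = c * (\<Sum>i\<in>I. u i)\<^sup>2"
    by (simp add: power2_eq_square)
  have "(\<Sum>i\<in>I. \<Sum>l\<in>I. \<Sum>m\<in>I. u i * (u l * (u m * c))) = (\<Sum>i\<in>I. u i) * ((\<Sum>i\<in>I. u i) * ((\<Sum>i\<in>I. u i) * c))"
    by (simp only: sum_distrib_left[symmetric] sum_distrib_right[symmetric])
  then show "(\<Sum>i\<in>I. \<Sum>l\<in>I. \<Sum>m\<in>I. u i * (u l * (u m * c))) = c * ((\<Sum>i\<in>I. u i)\<^sup>2 * (\<Sum>i\<in>I. u i))"
    by (simp add: power2_eq_square)
qed

lemma abs_sum_sq_le: "(\<Sum>i<d. \<bar>y i\<bar>)\<^sup>2 \<le> real d * nsq d y"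
  using Cauchy_Schwarz_ineq_sum[of "\<lambda>_. 1" "\<lambda>i. \<bar>y i\<bar>" "{..<d}"] by (simp add: nsq_def)

text \<open>\<open>L\<close> is the drift and \<open>S k\<close> the k-th column of the diffusion
  coefficient, so the sum in \<open>S_growth\<close> is a squared Hilbert-Schmidt norm. The constant
  \<open>C\<close> bounds squares.\<close>

locale affine_coeffs = dimension +
  fixes L :: "(nat \<Rightarrow> real) \<Rightarrow> nat \<Rightarrow> real" and S :: "nat \<Rightarrow> (nat \<Rightarrow> real) \<Rightarrow> nat \<Rightarrow> real" and C :: real
  assumes L_affine: "is_affine d L" and S_affine: "\<And>k. k < d \<Longrightarrow> is_affine d (S k)"
    and C_ge_1: "1 \<le> C"
    and L_growth: "\<And>x. x \<in> Rd d \<Longrightarrow> nsq d (L x) \<le> C * (1 + nsq d x)"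
    and S_growth: "\<And>x. x \<in> Rd d \<Longrightarrow> (\<Sum>k<d. nsq d (S k x)) \<le> C * (1 + nsq d x)"
begin

definition jump :: "real \<Rightarrow> nat \<times> real \<Rightarrow> (nat \<Rightarrow> real) \<Rightarrow> nat \<Rightarrow> real" where
  "jump h j x = (\<lambda>i. (if i < d then x i else 0) + displ h (L x) (\<lambda>k. S k x) j i)"

text \<open>The sum of the Hessian forms over the columns \<open>S k\<close> is the trace of
  \<sigma>\<sigma>^T times the Hessian, written without matrices.\<close>

definition gen :: "(real \<times> (nat \<Rightarrow> real) \<Rightarrow> real) \<Rightarrow> real \<times> (nat \<Rightarrow> real) \<Rightarrow> real" where
  "gen f p = dir1 d f p (L (snd p)) + (\<Sum>k<d. dir2 d f p (S k (snd p))) / 2"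

lemma jump_affine:
  assumes "j \<in> idx" shows "is_affine d (jump h j)"
proof -
  have "fst j < d" using assms by (auto simp: idx_def)
  from is_affine_lin_comb[OF is_affine_trunc is_affine_lin_comb[OF L_affine S_affine[OF this], of h "snd j * sqrt (real d * h)"], of 1 1]
  show ?thesis unfolding jump_def displ_def by simp
qed

lemma jump_Rd: "j \<in> idx \<Longrightarrow> jump h j x \<in> Rd d"
  by (rule is_affine_Rd[OF jump_affine])

lemma jump_eq: "x \<in> Rd d \<Longrightarrow> jump h j x = (\<lambda>i. x i + displ h (L x) (\<lambda>k. S k x) j i)"
  by (auto simp: jump_def Rd_def)

lemma displ_Rd: "j \<in> idx \<Longrightarrow> displ h (L x) (\<lambda>k. S k y) j \<in> Rd d"
  using is_affine_Rd[OF L_affine, of x] is_affine_Rd[OF S_affine, of "fst j" y]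
  by (auto simp: displ_def Rd_def idx_def)

definition h_max :: real where "h_max = 1 / (64 * real d * C)"

lemma h_max_pos: "0 < h_max" using d_pos C_ge_1 by (simp add: h_max_def)

lemma avg_weight_jump_le:
  assumes "x \<in> Rd d" "0 < h" "h \<le> h_max"
  shows "avg (\<lambda>j. weight d m (jump h j x)) \<le> (1 + growth_rate C m * h) * weight d m x"
  unfolding weight_def jump_eq[OF assms(1)]
  by (rule avg_power_le)
    (use assms L_growth S_growth C_ge_1 in \<open>auto simp: h_max_def add_pos_nonneg\<close>)

text \<open>By the first two moments of the displacements, the averaged second order Taylor
  polynomial equals f + h \<open>gen f\<close> plus h^2/2 times the Hessian form at the drift,
  exactly. The last term and the mean of the Taylor remainders are the only errors.\<close>

lemma abs_taylor_remainder_le: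
  assumes h: "0 < h" and p: "(t, x) \<in> cyl d T"
    and R: "\<And>j. j \<in> idx \<Longrightarrow> \<bar>f (t, jump h j x) - f (t, x) - dir1 d f (t, x) (displ h (L x) (\<lambda>k. S k x) j)
        - dir2 d f (t, x) (displ h (L x) (\<lambda>k. S k x) j) / 2\<bar> \<le> R j"
  shows "\<bar>(avg (\<lambda>j. f (t, jump h j x)) - f (t, x)) / h - gen f (t, x)\<bar>
    \<le> avg R / h + h * \<bar>dir2 d f (t, x) (L x)\<bar> / 2"
proof -
  let ?y = "displ h (L x) (\<lambda>k. S k x)"
  have "avg (\<lambda>j. f (t, jump h j x) - f (t, x) - dir1 d f (t, x) (?y j) - (1/2) * dir2 d f (t, x) (?y j))
      = avg (\<lambda>j. f (t, jump h j x)) - f (t, x) - h * dir1 d f (t, x) (L x)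
        - (1/2) * (h\<^sup>2 * dir2 d f (t, x) (L x) + h * (\<Sum>k<d. dir2 d f (t, x) (S k x)))"
    unfolding avg_diff avg_const avg_cmult using h by (simp add: avg_dir1_displ avg_dir2_displ)
  also have "\<dots> = avg (\<lambda>j. f (t, jump h j x)) - f (t, x) - h * gen f (t, x) - h\<^sup>2 * dir2 d f (t, x) (L x) / 2"
    by (simp add: gen_def algebra_simps)
  finally have "avg (\<lambda>j. f (t, jump h j x)) - f (t, x) - h * gen f (t, x) =
    avg (\<lambda>j. f (t, jump h j x) - f (t, x) - dir1 d f (t, x) (?y j) - (1/2) * dir2 d f (t, x) (?y j)) + h\<^sup>2 * dir2 d f (t, x) (L x) / 2"
    by simp
  moreover have "\<bar>avg (\<lambda>j. f (t, jump h j x) - f (t, x) - dir1 d f (t, x) (?y j) - (1/2) * dir2 d f (t, x) (?y j))\<bar> \<le> avg R"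
    by (rule order_trans[OF abs_avg_le avg_mono]) (use R in simp)
  moreover have "\<bar>h\<^sup>2 * dir2 d f (t, x) (L x) / 2\<bar> = h * (h * \<bar>dir2 d f (t, x) (L x)\<bar> / 2)"
    using h by (simp add: abs_mult power2_eq_square)
  ultimately have "\<bar>avg (\<lambda>j. f (t, jump h j x)) - f (t, x) - h * gen f (t, x)\<bar>
      \<le> avg R + h * (h * \<bar>dir2 d f (t, x) (L x)\<bar> / 2)" by linarith
  moreover have "(avg (\<lambda>j. f (t, jump h j x)) - f (t, x)) / h - gen f (t, x)
     = (avg (\<lambda>j. f (t, jump h j x)) - f (t, x) - h * gen f (t, x)) / h"
    using h by (simp add: field_simps)
  ultimately show ?thesis using h by (simp add: abs_divide divide_le_eq algebra_simps)
qed

text \<open>The Lagrange remainder compares the Hessian at an intermediate point with that at x.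
  Jumps have length of order sqrt h, so continuity of the second derivatives makes the remainder
  o(h) in the mean. Properties of \<open>gen\<close> are then read off from averages.\<close>

lemma gen_tendsto:
  assumes f: "C_k_on 2 d T f" and p: "(t, x) \<in> cyl d T"
  shows "((\<lambda>h. (avg (\<lambda>j. f (t, jump h j x)) - f (t, x)) / h) \<longlongrightarrow> gen f (t, x)) (at_right 0)"
proof (rule tendstoI)
  fix e :: real assume e: "0 < e"
  have f': "C_k_on (Suc (Suc 0)) d T f" using f by (simp only: numeral_2_eq_2)
  have x: "x \<in> Rd d" using p by simp
  define M where "M = nsq d (L x) + (\<Sum>k<d. nsq d (S k x))"
  have M: "0 \<le> M" unfolding M_def by (intro add_nonneg_nonneg sum_nonneg) auto
  define e' where "e' = e / (real d * (M + 1))"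
  have e': "0 < e'" using e M d_pos by (simp add: e'_def)
  let ?Q = "\<lambda>(i, l) \<delta>. \<forall>z\<in>Rd d. (\<forall>i<d. \<bar>z i - x i\<bar> < \<delta>) \<longrightarrow>
      \<bar>partial (Some l) (partial (Some i) f) (t, z) - partial (Some l) (partial (Some i) f) (t, x)\<bar> < e'"
  have "\<exists>\<delta>>0. \<forall>il\<in>{..<d} \<times> {..<d}. ?Q il \<delta>"
  proof (rule finite_uniform_delta)
    fix il assume "il \<in> {..<d} \<times> {..<d}"
    then obtain i l where il: "il = (i, l)" "i < d" "l < d" by auto
    have "continuous_on (cyl d T) (partial (Some l) (partial (Some i) f))"
      using C_k_on_partial[OF C_k_on_partial[OF f', of "Some i"], of "Some l"] il C_k_on_imp_continuous by auto
    from continuous_on_coord_delta[OF this _ p, of d e'] obtain \<delta> where "\<delta> > 0"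
      "\<forall>q\<in>cyl d T. \<bar>fst q - t\<bar> < \<delta> \<longrightarrow> (\<forall>i<d. \<bar>snd q i - x i\<bar> < \<delta>) \<longrightarrow>
        \<bar>partial (Some l) (partial (Some i) f) q - partial (Some l) (partial (Some i) f) (t, x)\<bar> < e'"
      using e' by auto
    then show "\<exists>\<delta>>0. ?Q il \<delta>" using p il(1) by (intro exI[of _ \<delta>]) auto
  qed (auto intro: less_le_trans)
  then obtain \<delta> where \<delta>: "\<delta> > 0" "\<And>i l z. i < d \<Longrightarrow> l < d \<Longrightarrow> z \<in> Rd d \<Longrightarrow> (\<And>i. i < d \<Longrightarrow> \<bar>z i - x i\<bar> < \<delta>) \<Longrightarrow>
      \<bar>partial (Some l) (partial (Some i) f) (t, z) - partial (Some l) (partial (Some i) f) (t, x)\<bar> < e'"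
    by fastforce
  \<comment> \<open>The three terms of the minimum give h < 1, jumps shorter than \<delta> in each
    coordinate, and a small contribution of the Hessian form at the drift.\<close>
  define b where "b = min 1 (min (\<delta>\<^sup>2 / (2 * real d * (M + 1))) (e / (\<bar>dir2 d f (t, x) (L x)\<bar> + 1)))"
  have b: "0 < b" using \<delta>(1) M d_pos e by (simp add: b_def)
  show "\<forall>\<^sub>F h in at_right 0. dist ((avg (\<lambda>j. f (t, jump h j x)) - f (t, x)) / h) (gen f (t, x)) < e"
    unfolding eventually_at_right_field
  proof (intro exI[of _ b] conjI allI impI b)
    fix h assume h: "0 < h" "h < b"
    let ?y = "displ h (L x) (\<lambda>k. S k x)"
    have h1: "h < 1" "h < \<delta>\<^sup>2 / (2 * real d * (M + 1))" "h < e / (\<bar>dir2 d f (t, x) (L x)\<bar> + 1)"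
      using h by (auto simp: b_def)
    have small: "\<bar>?y j i\<bar> < \<delta>" if j: "j \<in> idx" and i: "i < d" for i j
    proof -
      have "h\<^sup>2 \<le> real d * h" using h(1) h1(1) d_pos by (simp add: power2_eq_square mult_right_mono)
      then have "2 * h\<^sup>2 * nsq d (L x) \<le> 2 * (real d * h) * nsq d (L x)"
        by (intro mult_right_mono) auto
      then have "(?y j i)\<^sup>2 \<le> 2 * (real d * h) * M"
        using coord_sq_le_nsq[OF i, of "?y j"] nsq_displ_le[OF less_imp_le[OF h(1)] j, of "L x" "\<lambda>k. S k x"]
        by (simp add: M_def algebra_simps)
      also have "\<dots> \<le> h * (2 * real d * (M + 1))" using h(1) by (simp add: algebra_simps)
      also have "\<dots> < \<delta>\<^sup>2" using h1(2) d_pos M by (simp add: pos_less_divide_eq)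
      finally show ?thesis using \<delta>(1) by (metis abs_of_pos power2_less_imp_less power2_abs abs_ge_zero less_imp_le)
    qed
    have rem: "\<bar>f (t, jump h j x) - f (t, x) - dir1 d f (t, x) (?y j) - dir2 d f (t, x) (?y j) / 2\<bar> \<le> e' * real d / 2 * nsq d (?y j)"
      if j: "j \<in> idx" for j
    proof -
      obtain \<theta> where th: "\<bar>\<theta>\<bar> \<le> 1"
        "f (t, \<lambda>i. x i + ?y j i) = f (t, x) + dir1 d f (t, x) (?y j) + dir2 d f (t, \<lambda>i. x i + \<theta> * ?y j i) (?y j) / 2"
        using taylor_line[OF f p displ_Rd[OF j, of h x x]] by blast
      let ?z = "\<lambda>i. x i + \<theta> * ?y j i"
      have z: "?z \<in> Rd d" using Rd_line[OF x displ_Rd[OF j]] .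
      have zc: "\<bar>?z i - x i\<bar> < \<delta>" if "i < d" for i
      proof -
        have "\<bar>\<theta>\<bar> * \<bar>?y j i\<bar> \<le> 1 * \<bar>?y j i\<bar>" using th(1) by (intro mult_right_mono) auto
        then show ?thesis using small[OF j that] by (simp add: abs_mult)
      qed
      let ?D = "\<lambda>i l. partial (Some l) (partial (Some i) f) (t, ?z) - partial (Some l) (partial (Some i) f) (t, x)"
      have eq: "dir2 d f (t, ?z) (?y j) - dir2 d f (t, x) (?y j) = (\<Sum>i<d. \<Sum>l<d. ?y j i * (?y j l * ?D i l))"
        by (simp add: dir2_def dir1_def sum_subtractf[symmetric] sum_distrib_left right_diff_distrib)
      have "\<bar>dir2 d f (t, ?z) (?y j) - dir2 d f (t, x) (?y j)\<bar> \<le> (\<Sum>i<d. \<Sum>l<d. \<bar>?y j i\<bar> * (\<bar>?y j l\<bar> * e'))"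
        unfolding eq
      proof (rule order_trans[OF sum_abs sum_mono], rule order_trans[OF sum_abs sum_mono])
        fix i l assume "i \<in> {..<d}" "l \<in> {..<d}"
        then have "\<bar>?D i l\<bar> \<le> e'" using \<delta>(2)[OF _ _ z zc] by (simp add: less_imp_le)
        then show "\<bar>?y j i * (?y j l * ?D i l)\<bar> \<le> \<bar>?y j i\<bar> * (\<bar>?y j l\<bar> * e')"
          by (simp add: abs_mult mult_left_mono)
      qed
      also have "\<dots> = e' * (\<Sum>i<d. \<bar>?y j i\<bar>)\<^sup>2"
        by (rule sum_triple_product(1))
      also have "\<dots> \<le> e' * (real d * nsq d (?y j))" using e' by (intro mult_left_mono abs_sum_sq_le) auto
      finally have bd: "\<bar>dir2 d f (t, ?z) (?y j) - dir2 d f (t, x) (?y j)\<bar> \<le> e' * (real d * nsq d (?y j))" .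
      have eq2: "f (t, jump h j x) - f (t, x) - dir1 d f (t, x) (?y j) - dir2 d f (t, x) (?y j) / 2
          = (dir2 d f (t, ?z) (?y j) - dir2 d f (t, x) (?y j)) / 2"
        unfolding jump_eq[OF x] th(2) by (simp add: field_simps)
      show ?thesis unfolding eq2 using bd by (simp add: abs_divide)
    qed
    have "\<bar>(avg (\<lambda>j. f (t, jump h j x)) - f (t, x)) / h - gen f (t, x)\<bar>
        \<le> avg (\<lambda>j. e' * real d / 2 * nsq d (?y j)) / h + h * \<bar>dir2 d f (t, x) (L x)\<bar> / 2"
      by (rule abs_taylor_remainder_le[where T = T]) (use h p rem in auto)
    also have "\<dots> < e / 2 + e / 2"
    proof (rule add_le_less_mono)
      have "avg (\<lambda>j. nsq d (?y j)) \<le> h * M"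
        using h(1) h1(1) by (simp add: avg_nsq_displ M_def algebra_simps power2_eq_square mult_left_le mult_left_le_one_le)
      then have "e' * real d / 2 * avg (\<lambda>j. nsq d (?y j)) \<le> e' * real d / 2 * (h * M)"
        using e' by (intro mult_left_mono) auto
      also have "\<dots> \<le> e' * real d / 2 * (h * (M + 1))" using e' h(1) by (intro mult_left_mono) auto
      also have "\<dots> = h * (e' * (real d * (M + 1)) / 2)" by (simp add: mult_ac)
      also have "e' * (real d * (M + 1)) = e" using d_pos M by (simp add: e'_def)
      finally show "avg (\<lambda>j. e' * real d / 2 * nsq d (?y j)) / h \<le> e / 2"
        using h(1) by (simp only: avg_cmult) (simp add: divide_le_eq mult.commute)
      have "h * (\<bar>dir2 d f (t, x) (L x)\<bar> + 1) < e" using h1(3) by (simp add: pos_less_divide_eq)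
      then show "h * \<bar>dir2 d f (t, x) (L x)\<bar> / 2 < e / 2" using h(1) by (simp add: algebra_simps)
    qed
    finally show "dist ((avg (\<lambda>j. f (t, jump h j x)) - f (t, x)) / h) (gen f (t, x)) < e"
      by (simp add: dist_real_def)
  qed
qed

text \<open>Averages are linear and limits are unique, so linearity is inherited from the difference
  quotients.\<close>

lemma gen_add_scaled:
  assumes "C_k_on 2 d T f" "C_k_on 2 d T g" "p \<in> cyl d T"
  shows "gen (\<lambda>q. f q + c * g q) p = gen f p + c * gen g p"
proof -
  obtain t x where p: "p = (t, x)" by force
  have fg: "C_k_on 2 d T (\<lambda>q. f q + c * g q)" using C_k_on_add_scaled assms by blast
  have "((\<lambda>h. (avg (\<lambda>j. f (t, jump h j x)) - f (t, x)) / h + c * ((avg (\<lambda>j. g (t, jump h j x)) - g (t, x)) / h))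
      \<longlongrightarrow> gen f (t, x) + c * gen g (t, x)) (at_right 0)"
    by (intro tendsto_intros gen_tendsto[OF assms(1)] gen_tendsto[OF assms(2)]) (use assms p in auto)
  then have "((\<lambda>h. (avg (\<lambda>j. f (t, jump h j x) + c * g (t, jump h j x)) - (f (t, x) + c * g (t, x))) / h)
      \<longlongrightarrow> gen f (t, x) + c * gen g (t, x)) (at_right 0)"
    by (rule Lim_transform_eventually)
      (auto simp: avg_add avg_cmult diff_divide_distrib add_divide_distrib algebra_simps intro!: always_eventually)
  then show ?thesis using tendsto_unique[OF _ gen_tendsto[OF fg]] assms p by auto
qed

lemma jump_tendsto:
  assumes "j \<in> idx" "x \<in> Rd d"
  shows "((\<lambda>h. jump h j x) \<longlongrightarrow> x) (at_right 0)"
proof (rule tendsto_fun_componentwise)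
  fix i
  have "((\<lambda>h. x i + (h * L x i + snd j * sqrt (real d * h) * S (fst j) x i)) \<longlongrightarrow> x i + (0 * L x i + snd j * sqrt (real d * 0) * S (fst j) x i)) (at_right 0)"
    by (intro tendsto_intros)
  then show "((\<lambda>h. jump h j x i) \<longlongrightarrow> x i) (at_right 0)"
    by (simp add: jump_eq[OF assms(2)] displ_def)
qed

text \<open>The jumps shrink with \<open>h\<close>, so a maximum over a neighbourhood suffices.\<close>

lemma gen_nonpos_at_max:
  assumes f: "C_k_on 2 d T f" and p: "(t, x) \<in> cyl d T"
    and r: "0 < r" and max: "\<And>y. y \<in> Rd d \<Longrightarrow> (\<And>i. i < d \<Longrightarrow> \<bar>y i - x i\<bar> < r) \<Longrightarrow> f (t, y) \<le> f (t, x)"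
  shows "gen f (t, x) \<le> 0"
proof (rule tendsto_upperbound[OF gen_tendsto[OF f p]])
  have x: "x \<in> Rd d" using p by simp
  have "\<forall>\<^sub>F h in at_right 0. \<forall>j\<in>idx. \<forall>i\<in>{..<d}. \<bar>jump h j x i - x i\<bar> < r"
  proof (intro eventually_ball_finite ballI)
    fix j i assume j: "j \<in> idx"
    have "((\<lambda>h. jump h j x i) \<longlongrightarrow> x i) (at_right 0)"
      using continuous_on_tendsto_compose[OF continuous_on_coord[of UNIV i] jump_tendsto[OF j x]] by simp
    from tendstoD[OF this r] show "\<forall>\<^sub>F h in at_right 0. \<bar>jump h j x i - x i\<bar> < r" by (simp add: dist_real_def)
  qed auto
  moreover have "\<forall>\<^sub>F h in at_right 0. (0::real) < h" by (rule eventually_at_right_less)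
  ultimately show "\<forall>\<^sub>F h in at_right 0. (avg (\<lambda>j. f (t, jump h j x)) - f (t, x)) / h \<le> 0"
  proof eventually_elim
    case (elim h)
    have "avg (\<lambda>j. f (t, jump h j x)) \<le> avg (\<lambda>j. f (t, x))"
      by (intro avg_mono max jump_Rd) (use elim in auto)
    then show ?case using elim by (simp add: divide_nonpos_pos)
  qed
qed simp

text \<open>The one-step growth bound for the weights is divided by h and passes to the limit, so
  the rate remains free of d.\<close>

lemma gen_weight_le:
  assumes f: "C_k_on 2 d T f" and p: "(t, x) \<in> cyl d T" and fW: "\<And>y. y \<in> Rd d \<Longrightarrow> f (t, y) = a * weight d m y" and a: "0 \<le> a"
  shows "gen f (t, x) \<le> growth_rate C m * (a * weight d m x)"
proof (rule tendsto_upperbound[OF gen_tendsto[OF f p]])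
  have x: "x \<in> Rd d" using p by simp
  have "\<forall>\<^sub>F h in at_right 0. h \<le> h_max" using h_max_pos by (auto simp: eventually_at_right_field intro: less_imp_le)
  moreover have "\<forall>\<^sub>F h in at_right 0. (0::real) < h" by (rule eventually_at_right_less)
  ultimately show "\<forall>\<^sub>F h in at_right 0. (avg (\<lambda>j. f (t, jump h j x)) - f (t, x)) / h \<le> growth_rate C m * (a * weight d m x)"
  proof eventually_elim
    case (elim h)
    have "avg (\<lambda>j. f (t, jump h j x)) = a * avg (\<lambda>j. weight d m (jump h j x))"
      unfolding avg_cmult[symmetric] by (intro avg_cong fW jump_Rd)
    also have "\<dots> \<le> a * ((1 + growth_rate C m * h) * weight d m x)"
      using avg_weight_jump_le[OF x elim(2,1)] a by (rule mult_left_mono)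
    finally show ?case using elim fW[OF x] by (simp add: divide_le_eq algebra_simps)
  qed
qed simp

lemma gen_continuous:
  assumes f: "C_k_on 2 d T f"
  shows "continuous_on (cyl d T) (gen f)"
proof -
  have f': "C_k_on (Suc (Suc 0)) d T f" using f by (simp only: numeral_2_eq_2)
  have c: "continuous_on (cyl d T) (\<lambda>p. F (snd p) i)" if "is_affine d F" for F i
  proof -
    have "continuous_on (cyl d T) (\<lambda>p. F (snd p))"
      by (rule continuous_on_compose2[OF is_affine_continuous[OF that, of UNIV] continuous_on_snd[OF continuous_on_id]]) simp
    from continuous_on_compose2[OF continuous_on_coord[of UNIV i] this] show ?thesis by auto
  qed
  have c1: "continuous_on (cyl d T) (partial (Some i) f)" if "i < d" for i
    using C_k_on_imp_continuous[OF C_k_on_partial[OF f', of "Some i"]] that by auto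
  have c2: "continuous_on (cyl d T) (partial (Some l) (partial (Some i) f))" if "i < d" "l < d" for i l
    using C_k_on_imp_continuous[OF C_k_on_partial[OF C_k_on_partial[OF f', of "Some i"], of "Some l"]] that by auto
  show ?thesis unfolding gen_def dir1_def dir2_def
    by (intro continuous_intros c c1 c2 L_affine S_affine) auto
qed

end

section \<open>An algebra of bounded functions with bounded derivatives\<close>

text \<open>The generators are bounded and extend continuously to the compactified space, so all
  members do. They are functions of (t, x) that ignore t, which makes \<open>partial\<close> and
  \<open>elem\<close> applicable.\<close>

inductive_set Dalg :: "nat \<Rightarrow> (real \<times> (nat \<Rightarrow> real) \<Rightarrow> real) set" for d where
  Dalg_const: "(\<lambda>_. c) \<in> Dalg d"
| Dalg_inv: "(\<lambda>p. inverse (1 + nsq d (snd p))) \<in> Dalg d"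
| Dalg_coord: "i < d \<Longrightarrow> (\<lambda>p. snd p i * inverse (1 + nsq d (snd p))) \<in> Dalg d"
| Dalg_add: "f \<in> Dalg d \<Longrightarrow> g \<in> Dalg d \<Longrightarrow> (\<lambda>p. f p + g p) \<in> Dalg d"
| Dalg_mult: "f \<in> Dalg d \<Longrightarrow> g \<in> Dalg d \<Longrightarrow> (\<lambda>p. f p * g p) \<in> Dalg d"

lemma one_plus_nsq_pos [simp]: "0 < 1 + nsq d x"
  using nsq_nonneg[of d x] by linarith

lemma one_plus_nsq_nz [simp]: "1 + nsq d x \<noteq> 0"
  using one_plus_nsq_pos[of d x] by linarith

lemma nsq_elem: "(\<lambda>p. nsq d (snd p)) \<in> elem d T"
  unfolding nsq_def by (intro elem_sum elem_power elem_coord) auto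

lemma weight_elem: "(\<lambda>p. weight d m (snd p)) \<in> elem d T"
  unfolding weight_def by (intro elem_power elem_add elem_const nsq_elem)

lemma Dalg_elem: "f \<in> Dalg d \<Longrightarrow> f \<in> elem d T"
proof (induction rule: Dalg.induct)
  case Dalg_inv show ?case by (intro elem_inverse elem_add elem_const nsq_elem) simp
next
  case (Dalg_coord i) then show ?case by (intro elem_mult elem_coord elem_inverse elem_add elem_const nsq_elem) simp_all
qed (auto intro: elem.intros)

lemma Dalg_snd: "f \<in> Dalg d \<Longrightarrow> f (t, x) = f (s, x)"
  by (induction rule: Dalg.induct) auto

lemma abs_coord_le: "i < d \<Longrightarrow> \<bar>x i\<bar> \<le> 1 + nsq d x"
proof -
  assume "i < d"
  have "\<bar>x i\<bar> \<le> 1 + (x i)\<^sup>2" using zero_le_power2[of "\<bar>x i\<bar> - 1"] zero_le_power2[of "x i"] 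
    by (simp add: power2_eq_square algebra_simps)
  then show ?thesis using coord_sq_le_nsq[OF \<open>i < d\<close>, of x] by linarith
qed

lemma Dalg_bounded: "f \<in> Dalg d \<Longrightarrow> \<exists>M. \<forall>p. \<bar>f p\<bar> \<le> M"
proof (induction rule: Dalg.induct)
  case Dalg_inv
  show ?case by (intro exI[of _ 1]) (auto simp: inverse_eq_divide divide_le_eq_1)
next
  case (Dalg_coord i)
  then show ?case using abs_coord_le
    by (intro exI[of _ 1]) (auto simp: inverse_eq_divide divide_le_eq_1 abs_divide)
next
  case (Dalg_add f g)
  then obtain M N where "\<forall>p. \<bar>f p\<bar> \<le> M" "\<forall>p. \<bar>g p\<bar> \<le> N" by blast
  then show ?case by (intro exI[of _ "M + N"]) (meson abs_triangle_ineq add_mono order_trans)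
next
  case (Dalg_mult f g)
  then obtain M N where "\<forall>p. \<bar>f p\<bar> \<le> M" "\<forall>p. \<bar>g p\<bar> \<le> N" by blast
  then show ?case by (intro exI[of _ "M * N"]) (metis abs_ge_zero abs_mult mult_mono order_trans)
qed auto

lemma DERIV_nsq_move:
  assumes "k < d"
  shows "((\<lambda>s. nsq d (snd (move (Some k) s p))) has_real_derivative 2 * snd p k) (at 0)"
proof -
  obtain t x where p: "p = (t, x)" by force
  have "nsq d (x(k := x k + s)) = (\<Sum>i\<in>{..<d}-{k}. (x i)\<^sup>2) + (x k + s)\<^sup>2" for s
    unfolding nsq_def using assms by (subst sum.remove[of _ k]) auto
  then show ?thesis unfolding p by (auto intro!: derivative_eq_intros)
qed

lemma Dalg_cmult: "f \<in> Dalg d \<Longrightarrow> (\<lambda>p. c * f p) \<in> Dalg d"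
  by (rule Dalg_mult[OF Dalg_const])

lemma DERIV_inv_nsq_move:
  assumes "k < d"
  shows "((\<lambda>s. inverse (1 + nsq d (snd (move (Some k) s p)))) has_real_derivative
     (- 2) * ((snd p k * inverse (1 + nsq d (snd p))) * inverse (1 + nsq d (snd p)))) (at 0)"
proof -
  have "((\<lambda>s. 1 + nsq d (snd (move (Some k) s p))) has_real_derivative 2 * snd p k) (at 0)"
    using DERIV_add[OF DERIV_const DERIV_nsq_move[OF assms]] by simp
  from DERIV_inverse'[OF this] show ?thesis by (simp add: mult_ac)
qed

lemma DERIV_coord_move:
  "((\<lambda>s. snd (move (Some k) s p) i) has_real_derivative (if i = k then 1 else 0)) (at 0)"
  by (cases p) (auto intro!: derivative_eq_intros)

text \<open>Differentiating a generator produces only sums of products of generators. With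
  \<open>Dalg_bounded\<close>, space derivatives of every order are therefore bounded on the whole
  space.\<close>

lemma Dalg_partial:
  assumes "f \<in> Dalg d" "k < d"
  shows "partial (Some k) f \<in> Dalg d"
proof -
  have "\<exists>f'\<in>Dalg d. \<forall>p. ((\<lambda>s. f (move (Some k) s p)) has_real_derivative f' p) (at 0)"
    using assms(1)
  proof (induction rule: Dalg.induct)
    case (Dalg_const c) then show ?case by (intro bexI[of _ "\<lambda>_. 0"] Dalg.Dalg_const) auto
  next
    case Dalg_inv
    show ?case by (rule bexI[of _ "\<lambda>p. (- 2) * ((snd p k * inverse (1 + nsq d (snd p))) * inverse (1 + nsq d (snd p)))"])
       (use DERIV_inv_nsq_move[OF assms(2)] Dalg_cmult Dalg.Dalg_mult Dalg.Dalg_inv Dalg.Dalg_coord assms(2) in blast)+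
  next
    case (Dalg_coord i)
    let ?s = "\<lambda>p. inverse (1 + nsq d (snd p))"
    let ?c = "if i = k then 1 else 0::real"
    have "(\<lambda>p. ?c * ?s p + ((- 2) * ((snd p k * ?s p) * (snd p i * ?s p)))) \<in> Dalg d"
      using Dalg_coord assms(2) by (intro Dalg.Dalg_add Dalg_cmult Dalg.Dalg_mult Dalg.Dalg_inv Dalg.Dalg_coord)
    moreover have "((\<lambda>s. snd (move (Some k) s p) i * ?s (move (Some k) s p)) has_real_derivative
        ?c * ?s p + ((- 2) * ((snd p k * ?s p) * (snd p i * ?s p)))) (at 0)" for p
      using DERIV_mult[OF DERIV_coord_move[of k p i] DERIV_inv_nsq_move[OF assms(2), of p]] by (simp add: mult_ac)
    ultimately show ?case by (intro bexI) auto
  next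
    case (Dalg_add f g)
    then obtain f' g' where "f' \<in> Dalg d" "g' \<in> Dalg d"
      "\<And>p. ((\<lambda>s. f (move (Some k) s p)) has_real_derivative f' p) (at 0)"
      "\<And>p. ((\<lambda>s. g (move (Some k) s p)) has_real_derivative g' p) (at 0)" by blast
    then show ?case by (intro bexI[of _ "\<lambda>p. f' p + g' p"] Dalg.Dalg_add allI DERIV_add) auto
  next
    case (Dalg_mult f g)
    then obtain f' g' where fg: "f' \<in> Dalg d" "g' \<in> Dalg d"
      "\<And>p. ((\<lambda>s. f (move (Some k) s p)) has_real_derivative f' p) (at 0)"
      "\<And>p. ((\<lambda>s. g (move (Some k) s p)) has_real_derivative g' p) (at 0)" by blast
    have "((\<lambda>s. f (move (Some k) s p) * g (move (Some k) s p)) has_real_derivative (f' p * g p + g' p * f p)) (at 0)" for p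
      using DERIV_mult[OF fg(3,4)] by simp
    then show ?case using fg(1,2) Dalg_mult.hyps
      by (intro bexI[of _ "\<lambda>p. f' p * g p + g' p * f p"] Dalg.Dalg_add Dalg.Dalg_mult) auto
  qed
  then obtain f' where "f' \<in> Dalg d" "\<And>p. ((\<lambda>s. f (move (Some k) s p)) has_real_derivative f' p) (at 0)" by blast
  moreover from this(2) have "partial (Some k) f = f'" using partial_eqI by blast
  ultimately show ?thesis by simp
qed

text \<open>Bounds on the second and third derivatives along lines; unlike bounds on partial derivatives,
  they are inherited by averages of compositions with affine maps without loss.\<close>

definition line_bounded :: "nat \<Rightarrow> real \<Rightarrow> ((nat \<Rightarrow> real) \<Rightarrow> real) \<Rightarrow> bool" where
  "line_bounded d M g \<longleftrightarrow> (\<forall>x\<in>Rd d. \<forall>y\<in>Rd d. \<exists>g1 g2 g3.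
     (\<forall>s. ((\<lambda>s. g (\<lambda>i. x i + s * y i)) has_real_derivative g1 s) (at s)) \<and>
     (\<forall>s. (g1 has_real_derivative g2 s) (at s)) \<and>
     (\<forall>s. (g2 has_real_derivative g3 s) (at s)) \<and>
     (\<forall>s. \<bar>g2 s\<bar> \<le> M * nsq d y \<and> \<bar>g3 s\<bar> \<le> M * (nsq d y * sqrt (nsq d y))))"

lemma Dalg_line_bounded:
  assumes "f \<in> Dalg d"
  shows "\<exists>M\<ge>0. line_bounded d M (\<lambda>x. f (0, x))"
proof -
  let ?P3 = "\<lambda>i l m. partial (Some m) (partial (Some l) (partial (Some i) f))"
  let ?P2 = "\<lambda>i l. partial (Some l) (partial (Some i) f)"
  have "\<exists>M. \<forall>p. \<bar>?P3 i l m p\<bar> \<le> M" if "i < d" "l < d" "m < d" for i l m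
    by (rule Dalg_bounded[OF Dalg_partial[OF Dalg_partial[OF Dalg_partial[OF assms that(1)] that(2)] that(3)]])
  then have "\<exists>B. \<forall>i l m p. i < d \<longrightarrow> l < d \<longrightarrow> m < d \<longrightarrow> \<bar>?P3 i l m p\<bar> \<le> B i l m" by metis
  then obtain B3 where B3: "\<And>i l m p. i < d \<Longrightarrow> l < d \<Longrightarrow> m < d \<Longrightarrow> \<bar>?P3 i l m p\<bar> \<le> B3 i l m" by blast
  have "\<exists>M. \<forall>p. \<bar>?P2 i l p\<bar> \<le> M" if "i < d" "l < d" for i l
    by (rule Dalg_bounded[OF Dalg_partial[OF Dalg_partial[OF assms that(1)] that(2)]])
  then have "\<exists>B. \<forall>i l p. i < d \<longrightarrow> l < d \<longrightarrow> \<bar>?P2 i l p\<bar> \<le> B i l" by metis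
  then obtain B2 where B2: "\<And>i l p. i < d \<Longrightarrow> l < d \<Longrightarrow> \<bar>?P2 i l p\<bar> \<le> B2 i l" by blast
  define K where "K = (\<Sum>i<d. \<Sum>l<d. \<Sum>m<d. \<bar>B3 i l m\<bar>) + (\<Sum>i<d. \<Sum>l<d. \<bar>B2 i l\<bar>)"
  have K0: "0 \<le> K" unfolding K_def by (intro add_nonneg_nonneg sum_nonneg) auto
  have K2: "\<bar>?P2 i l p\<bar> \<le> K" if "i < d" "l < d" for i l p
  proof -
    have "\<bar>B2 i l\<bar> \<le> (\<Sum>l<d. \<bar>B2 i l\<bar>)" using that by (intro member_le_sum) auto
    also have "\<dots> \<le> (\<Sum>i<d. \<Sum>l<d. \<bar>B2 i l\<bar>)" using that by (intro member_le_sum) (auto intro!: sum_nonneg)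
    also have "\<dots> \<le> K" unfolding K_def by (simp add: sum_nonneg)
    finally show ?thesis using B2[OF that, of p] by linarith
  qed
  have K3: "\<bar>?P3 i l m p\<bar> \<le> K" if "i < d" "l < d" "m < d" for i l m p
  proof -
    have "\<bar>B3 i l m\<bar> \<le> (\<Sum>m<d. \<bar>B3 i l m\<bar>)" using that by (intro member_le_sum) auto
    also have "\<dots> \<le> (\<Sum>l<d. \<Sum>m<d. \<bar>B3 i l m\<bar>)" using that by (intro member_le_sum) (auto intro!: sum_nonneg)
    also have "\<dots> \<le> (\<Sum>i<d. \<Sum>l<d. \<Sum>m<d. \<bar>B3 i l m\<bar>)" using that by (intro member_le_sum) (auto intro!: sum_nonneg)
    also have "\<dots> \<le> K" unfolding K_def by (simp add: sum_nonneg)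
    finally show ?thesis using B3[OF that, of p] by linarith
  qed
  \<comment> \<open>Each factor sqrt d pays for replacing one sum of |y i| by the Euclidean length;
    there are two of them in the second and three in the third derivative.\<close>
  define M where "M = K * real d + K * (real d * sqrt (real d))"
  have "line_bounded d M (\<lambda>x. f (0, x))"
    unfolding line_bounded_def
  proof (intro ballI)
    fix x y assume x: "x \<in> Rd d" and y: "y \<in> Rd d"
    \<comment> \<open>Any cylinder containing time 1 will do: f does not depend on time, and the
      line calculus is stated for inner times.\<close>
    define T :: real where "T = 2"
    have p: "(1, x) \<in> cyl d T" using x by (simp add: T_def)
    have C: "C_k_on n d T g" if "g \<in> Dalg d" for g n by (rule elem_C_k_on[OF Dalg_elem[OF that]])
    let ?X = "\<lambda>s. (1, \<lambda>i. x i + s * y i)"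
    let ?g1 = "\<lambda>s. dir1 d f (?X s) y"
    let ?g2 = "\<lambda>s. dir2 d f (?X s) y"
    let ?g3 = "\<lambda>s. \<Sum>i<d. y i * dir2 d (partial (Some i) f) (?X s) y"
    have "((\<lambda>s. f (?X s)) has_real_derivative ?g1 s) (at s)" for s
      by (rule line_derivative[OF C[OF assms, of "Suc 0"] p y])
    then have d1: "((\<lambda>s. f (0, \<lambda>i. x i + s * y i)) has_real_derivative ?g1 s) (at s)" for s
      using Dalg_snd[OF assms, of 1 _ 0] by simp
    have d2: "(?g1 has_real_derivative ?g2 s) (at s)" for s
      by (rule line_derivative2[OF C[OF assms, of "Suc (Suc 0)"] p y])
    have d3: "(?g2 has_real_derivative ?g3 s) (at s)" for s
      unfolding dir2_def[of d f]
      by (rule DERIV_sum, rule DERIV_cmult, rule line_derivative2[OF C p y], rule Dalg_partial[OF assms]) auto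
    have l1: "(\<Sum>i<d. \<bar>y i\<bar>) \<le> sqrt (real d) * sqrt (nsq d y)"
      using abs_sum_sq_le[of y d] by (simp add: real_le_rsqrt real_sqrt_mult[symmetric])
    have "\<bar>?g2 s\<bar> \<le> M * nsq d y" for s
    proof -
      have "\<bar>?g2 s\<bar> \<le> (\<Sum>i<d. \<Sum>l<d. \<bar>y i\<bar> * (\<bar>y l\<bar> * K))"
        unfolding dir2_def dir1_def sum_distrib_left
        by (rule order_trans[OF sum_abs sum_mono], rule order_trans[OF sum_abs sum_mono])
          (auto simp: abs_mult intro!: mult_left_mono K2)
      also have "\<dots> = K * (\<Sum>i<d. \<bar>y i\<bar>)\<^sup>2" by (rule sum_triple_product(1))
      also have "\<dots> \<le> K * (real d * nsq d y)" using K0 by (intro mult_left_mono abs_sum_sq_le)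
      also have "\<dots> \<le> M * nsq d y" using K0 by (simp add: M_def algebra_simps)
      finally show ?thesis .
    qed
    moreover have "\<bar>?g3 s\<bar> \<le> M * (nsq d y * sqrt (nsq d y))" for s
    proof -
      have "\<bar>?g3 s\<bar> \<le> (\<Sum>i<d. \<Sum>l<d. \<Sum>m<d. \<bar>y i\<bar> * (\<bar>y l\<bar> * (\<bar>y m\<bar> * K)))"
        unfolding dir2_def dir1_def sum_distrib_left
        by (rule order_trans[OF sum_abs sum_mono], rule order_trans[OF sum_abs sum_mono], rule order_trans[OF sum_abs sum_mono])
          (auto simp: abs_mult intro!: mult_left_mono K3)
      also have "\<dots> = K * ((\<Sum>i<d. \<bar>y i\<bar>)\<^sup>2 * (\<Sum>i<d. \<bar>y i\<bar>))"
        by (rule sum_triple_product(2))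
      also have "\<dots> \<le> K * ((real d * nsq d y) * (sqrt (real d) * sqrt (nsq d y)))"
        using K0 by (intro mult_left_mono mult_mono abs_sum_sq_le l1) (auto intro!: sum_nonneg)
      also have "\<dots> = K * (real d * sqrt (real d)) * (nsq d y * sqrt (nsq d y))" by (simp add: mult_ac)
      also have "\<dots> \<le> M * (nsq d y * sqrt (nsq d y))" using K0 by (intro mult_right_mono) (auto simp: M_def)
      finally show ?thesis .
    qed
    ultimately show "\<exists>g1 g2 g3.
     (\<forall>s. ((\<lambda>s. f (0, \<lambda>i. x i + s * y i)) has_real_derivative g1 s) (at s)) \<and>
     (\<forall>s. (g1 has_real_derivative g2 s) (at s)) \<and>
     (\<forall>s. (g2 has_real_derivative g3 s) (at s)) \<and>
     (\<forall>s. \<bar>g2 s\<bar> \<le> M * nsq d y \<and> \<bar>g3 s\<bar> \<le> M * (nsq d y * sqrt (nsq d y)))"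
      using d1 d2 d3 by (intro exI[of _ ?g1] exI[of _ ?g2] exI[of _ ?g3]) blast
  qed
  moreover have "0 \<le> M" using K0 by (simp add: M_def)
  ultimately show ?thesis by blast
qed

section \<open>Approximate classical solutions\<close>

context affine_coeffs
begin

text \<open>\<open>it h \<tau> k f\<close> is \<open>((1 - \<tau>) I + \<tau> P\<^sub>h)\<^sup>k f\<close>, where \<open>P\<^sub>h\<close> averages over one jump; with
  \<open>\<tau> = t / (N h)\<close> and \<open>k = N\<close> it approximates \<open>exp (t (P\<^sub>h - I) / h) f\<close>.\<close>

fun it :: "real \<Rightarrow> real \<Rightarrow> nat \<Rightarrow> ((nat \<Rightarrow> real) \<Rightarrow> real) \<Rightarrow> (nat \<Rightarrow> real) \<Rightarrow> real" where
  "it h \<tau> 0 f x = f x"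
| "it h \<tau> (Suc k) f x = (1 - \<tau>) * it h \<tau> k f x + \<tau> * avg (\<lambda>j. it h \<tau> k f (jump h j x))"

text \<open>This is (P - I) g for the one-jump average P with step h; divided by h it approximates
  \<open>gen\<close>.\<close>

definition incr :: "real \<Rightarrow> ((nat \<Rightarrow> real) \<Rightarrow> real) \<Rightarrow> (nat \<Rightarrow> real) \<Rightarrow> real" where
  "incr h g x = avg (\<lambda>j. g (jump h j x)) - g x"

lemma incr_add_scaled: "incr h (\<lambda>x. f x + c * g x) x = incr h f x + c * incr h g x"
  by (simp add: incr_def avg_add avg_cmult algebra_simps)

lemma it_Suc: "it h \<tau> (Suc k) f x = it h \<tau> k f x + \<tau> * incr h (it h \<tau> k f) x"
  by (simp add: incr_def algebra_simps)

text \<open>Expanding the power gives one term for each sequence of choices: \<open>None\<close>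
  keeps the point, with weight 1 - \<tau>, and \<open>Some j\<close> jumps, each with weight
  \<tau>/(2 d). The newest choice acts before the earlier maps. One mixture serves all f, hence it
  applies to a function and to its weight alike.\<close>

lemma it_mixture:
  assumes "0 \<le> \<tau>" "\<tau> \<le> 1"
  shows "\<exists>(I :: (nat \<times> real) option list set) q F. finite I \<and> (\<forall>i\<in>I. 0 \<le> q i \<and> is_affine d (F i)) \<and> (\<Sum>i\<in>I. q i) = 1 \<and>
    (\<forall>f. \<forall>x\<in>Rd d. it h \<tau> k f x = (\<Sum>i\<in>I. q i * f (F i x)))"
proof (induction k)
  case 0
  have "(\<lambda>i. if i < d then x i else 0) = x" if "x \<in> Rd d" for x using that by (auto simp: Rd_def)
  then show ?case
    by (intro exI[of _ "{[]}"] exI[of _ "\<lambda>_. 1"] exI[of _ "\<lambda>_ x i. if i < d then x i else 0"])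
      (auto simp: is_affine_trunc)
next
  case (Suc k)
  then obtain I :: "(nat \<times> real) option list set" and q F where I: "finite I" "\<And>i. i \<in> I \<Longrightarrow> 0 \<le> q i" "\<And>i. i \<in> I \<Longrightarrow> is_affine d (F i)"
    "(\<Sum>i\<in>I. q i) = 1" "\<And>f x. x \<in> Rd d \<Longrightarrow> it h \<tau> k f x = (\<Sum>i\<in>I. q i * f (F i x))" by blast
  define J where "J = insert None (Some ` idx)"
  define I' where "I' = (\<lambda>(o', l). o' # l) ` (J \<times> I)"
  define w where "w = (\<lambda>o' :: (nat \<times> real) option. case o' of None \<Rightarrow> 1 - \<tau> | Some _ \<Rightarrow> \<tau> / (2 * real d))"
  define G where "G = (\<lambda>o' :: (nat \<times> real) option. case o' of None \<Rightarrow> (\<lambda>x i. if i < d then x i else 0) | Some j \<Rightarrow> jump h j)"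
  define q' where "q' = (\<lambda>l :: (nat \<times> real) option list. w (hd l) * q (tl l))"
  define F' where "F' = (\<lambda>(l :: (nat \<times> real) option list) x. F (tl l) (G (hd l) x))"
  have w: "0 \<le> w o'" for o' using assms by (auto simp: w_def split: option.split)
  have G: "is_affine d (G o')" if "o' \<in> J" for o' using that by (auto simp: G_def J_def is_affine_trunc jump_affine)
  have sumI': "(\<Sum>l\<in>I'. g l) = (\<Sum>o'\<in>J. \<Sum>l\<in>I. g (o' # l))" for g :: "(nat \<times> real) option list \<Rightarrow> real"
  proof -
    have "inj_on (\<lambda>(o', l). o' # l) (J \<times> I)" by (auto simp: inj_on_def)
    then show ?thesis unfolding I'_def by (simp add: sum.reindex sum.cartesian_product' )
  qed
  have sumJ: "(\<Sum>o'\<in>J. g o') = g None + (\<Sum>j\<in>idx. g (Some j))" for g :: "(nat \<times> real) option \<Rightarrow> real"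
    unfolding J_def by (subst sum.insert) (auto simp: sum.reindex)
  have "finite I'" unfolding I'_def J_def using I(1) by auto
  moreover have "\<forall>i\<in>I'. 0 \<le> q' i \<and> is_affine d (F' i)"
    unfolding I'_def q'_def F'_def using I(2) w is_affine_compose[OF I(3) G] by auto
  moreover have "(\<Sum>i\<in>I'. q' i) = 1"
  proof -
    have "(\<Sum>i\<in>I'. q' i) = (\<Sum>o'\<in>J. w o')" unfolding sumI' by (simp add: q'_def sum_distrib_left[symmetric] I(4))
    also have "\<dots> = 1" unfolding sumJ using d_pos by (simp add: w_def card_idx)
    finally show ?thesis .
  qed
  moreover have "it h \<tau> (Suc k) f x = (\<Sum>i\<in>I'. q' i * f (F' i x))" if x: "x \<in> Rd d" for f x
  proof -
    have tr: "(\<lambda>i. if i < d then x i else 0) = x" using x by (auto simp: Rd_def)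
    have "(\<Sum>i\<in>I'. q' i * f (F' i x)) = (\<Sum>o'\<in>J. w o' * (\<Sum>l\<in>I. q l * f (F l (G o' x))))"
      unfolding sumI' by (simp add: q'_def F'_def sum_distrib_left mult.assoc)
    also have "\<dots> = (1 - \<tau>) * it h \<tau> k f x + (\<Sum>j\<in>idx. \<tau> / (2 * real d) * it h \<tau> k f (jump h j x))"
      unfolding sumJ by (simp add: w_def G_def tr I(5)[OF x] I(5)[OF jump_Rd])
    also have "\<dots> = it h \<tau> (Suc k) f x" by (simp add: avg_def sum_distrib_left sum_divide_distrib)
    finally show ?thesis by simp
  qed
  ultimately show ?case by blast
qed

lemma abs_it_diff_le:
  assumes "0 \<le> \<tau>" "\<tau> \<le> 1" "x \<in> Rd d" "\<And>y. y \<in> Rd d \<Longrightarrow> \<bar>f y - g y\<bar> \<le> e * V y"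
  shows "\<bar>it h \<tau> k f x - it h \<tau> k g x\<bar> \<le> e * it h \<tau> k V x"
proof -
  obtain I :: "(nat \<times> real) option list set" and q F where I: "finite I" "\<And>i. i \<in> I \<Longrightarrow> 0 \<le> q i" "\<And>i. i \<in> I \<Longrightarrow> is_affine d (F i)"
    "\<And>f x. x \<in> Rd d \<Longrightarrow> it h \<tau> k f x = (\<Sum>i\<in>I. q i * f (F i x))"
    using it_mixture[OF assms(1,2), of h k] by blast
  have "\<bar>it h \<tau> k f x - it h \<tau> k g x\<bar> = \<bar>\<Sum>i\<in>I. q i * (f (F i x) - g (F i x))\<bar>"
    by (simp add: I(4)[OF assms(3)] sum_subtractf right_diff_distrib)
  also have "\<dots> \<le> (\<Sum>i\<in>I. q i * (e * V (F i x)))"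
    by (rule order_trans[OF sum_abs sum_mono])
      (use I(2,3) assms(4) is_affine_Rd in \<open>auto simp: abs_mult intro!: mult_left_mono\<close>)
  also have "\<dots> = e * it h \<tau> k V x" by (simp add: I(4)[OF assms(3)] sum_distrib_left mult_ac)
  finally show ?thesis .
qed

lemma abs_it_le:
  assumes "0 \<le> \<tau>" "\<tau> \<le> 1" "\<And>x. x \<in> Rd d \<Longrightarrow> \<bar>f x\<bar> \<le> B" "x \<in> Rd d"
  shows "\<bar>it h \<tau> k f x\<bar> \<le> B"
proof -
  have c: "it h \<tau> k (\<lambda>_. c) y = c" for c y by (induction k arbitrary: y) (simp_all add: algebra_simps)
  show ?thesis using abs_it_diff_le[OF assms(1,2,4), of f "\<lambda>_. 0" B "\<lambda>_. 1" h k] assms(3) by (simp add: c)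
qed

lemma it_weight_le:
  assumes "0 \<le> \<tau>" "\<tau> \<le> 1" "0 < h" "h \<le> h_max" "x \<in> Rd d"
  shows "it h \<tau> k (weight d m) x \<le> (1 + \<tau> * growth_rate C m * h) ^ k * weight d m x"
  using assms(5)
proof (induction k arbitrary: x)
  case (Suc k)
  let ?K = "1 + \<tau> * growth_rate C m * h"
  have K: "0 \<le> ?K" using assms growth_rate_nonneg[OF C_ge_1, of m] by simp
  have "it h \<tau> (Suc k) (weight d m) x \<le> (1 - \<tau>) * (?K ^ k * weight d m x) + \<tau> * avg (\<lambda>j. ?K ^ k * weight d m (jump h j x))"
    unfolding it.simps using assms Suc.IH Suc.prems jump_Rd
    by (intro add_mono mult_left_mono avg_mono) auto
  also have "\<dots> \<le> (1 - \<tau>) * (?K ^ k * weight d m x) + \<tau> * (?K ^ k * ((1 + growth_rate C m * h) * weight d m x))"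
    unfolding avg_cmult using K assms Suc.prems by (intro add_left_mono mult_left_mono avg_weight_jump_le) auto
  also have "\<dots> = ?K ^ Suc k * weight d m x" by (simp add: algebra_simps)
  finally show ?case .
qed simp

text \<open>The time step t/(N h) times h is t/N, so the growth over the whole time is bounded by
  exp(K t), whatever h and N are.\<close>

lemma one_plus_scaled_power_le_exp:
  fixes K h t :: real
  assumes "0 \<le> K" "0 \<le> t" "0 < h" "0 < N"
  shows "(1 + t / (real N * h) * K * h) ^ N \<le> exp (K * t)"
proof -
  have "t / (real N * h) * K * h = K * t / real N" using assms by simp
  moreover have "(1 + K * t / real N) ^ N \<le> exp (K * t / real N) ^ N"
    using assms by (intro power_mono exp_ge_add_one_self) auto
  moreover have "exp (K * t / real N) ^ N = exp (K * t)"
    using assms by (simp add: exp_of_nat_mult[symmetric])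
  ultimately show ?thesis by simp
qed

text \<open>With A = P - I this is the derivative k A (I + \<tau> A)^(k-1) of (I + \<tau> A)^k. The
  induction uses that A commutes with I + \<tau> A. For k = 0 the index k - 1 is 0 and the factor k
  vanishes.\<close>

lemma DERIV_it:
  "((\<lambda>\<tau>. it h \<tau> k f x) has_real_derivative real k * incr h (it h \<tau> (k - 1) f) x) (at \<tau>)"
proof (induction k arbitrary: x)
  case (Suc k)
  have D: "((\<lambda>\<tau>. avg (\<lambda>j. it h \<tau> k f (jump h j x))) has_real_derivative
      avg (\<lambda>j. real k * incr h (it h \<tau> (k - 1) f) (jump h j x))) (at \<tau>)"
    unfolding avg_def by (intro DERIV_cdivide DERIV_sum Suc.IH)
  let ?D = "real k * incr h (it h \<tau> (k - 1) f) x"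
  let ?E = "avg (\<lambda>j. real k * incr h (it h \<tau> (k - 1) f) (jump h j x))"
  have "((\<lambda>\<tau>. (1 - \<tau>) * it h \<tau> k f x + \<tau> * avg (\<lambda>j. it h \<tau> k f (jump h j x))) has_real_derivative
     ((0 - 1) * it h \<tau> k f x + ?D * (1 - \<tau>)) + (1 * avg (\<lambda>j. it h \<tau> k f (jump h j x)) + ?E * \<tau>)) (at \<tau>)"
    by (rule DERIV_add[OF DERIV_mult[OF DERIV_diff[OF DERIV_const DERIV_ident] Suc.IH] DERIV_mult[OF DERIV_ident D]])
  moreover have "((0 - 1) * it h \<tau> k f x + ?D * (1 - \<tau>)) + (1 * avg (\<lambda>j. it h \<tau> k f (jump h j x)) + ?E * \<tau>)
      = real (Suc k) * incr h (it h \<tau> k f) x"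
  proof (cases k)
    case 0 then show ?thesis by (simp add: incr_def)
  next
    case (Suc n)
    have "it h \<tau> k f = (\<lambda>x. it h \<tau> n f x + \<tau> * incr h (it h \<tau> n f) x)" by (rule ext) (simp only: Suc it_Suc)
    then have "incr h (it h \<tau> k f) x = incr h (it h \<tau> n f) x + \<tau> * (avg (\<lambda>j. incr h (it h \<tau> n f) (jump h j x)) - incr h (it h \<tau> n f) x)"
      by (simp only: incr_add_scaled incr_def[of h "incr h (it h \<tau> n f)"])
    then have "real k * incr h (it h \<tau> k f) x = (1 - \<tau>) * ?D + \<tau> * ?E"
      unfolding avg_cmult Suc by (simp only: diff_Suc_1) (simp add: algebra_simps)
    then show ?thesis by (simp add: incr_def[of h "it h \<tau> k f"] algebra_simps)
  qed
  ultimately show ?case by simp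
qed simp

lemma it_elem:
  assumes "(\<lambda>p. f (snd p)) \<in> elem d T"
  shows "(\<lambda>p. it h (c * fst p) k f (snd p)) \<in> elem d T"
proof (induction k)
  case (Suc k)
  have 1: "(\<lambda>p. it h (c * fst p) k f (jump h j (snd p))) \<in> elem d T" if "j \<in> idx" for j
    using elem_subst_affine[OF Suc jump_affine[OF that]] by simp
  have 2: "(\<lambda>p. avg (\<lambda>j. it h (c * fst p) k f (jump h j (snd p)))) \<in> elem d T"
    unfolding avg_def divide_inverse by (intro elem_mult elem_sum elem_const 1) auto
  show ?case unfolding it.simps
    by (intro elem_add elem_mult elem_diff elem_const elem_scale elem_time Suc 2)
qed (use assms in simp)

text \<open>The linear part of the jump: it maps the direction of a line to the direction of the
  image line.\<close>

definition lin_jump :: "real \<Rightarrow> nat \<times> real \<Rightarrow> (nat \<Rightarrow> real) \<Rightarrow> nat \<Rightarrow> real" where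
  "lin_jump h j y = (\<lambda>i. jump h j y i - jump h j (\<lambda>_. 0) i)"

text \<open>Linear parts of the jumps are jumps for the linear parts of L and S, which are bounded
  by a multiple of the length of y alone. So the one-step estimates apply with offset 0, except at y
  = 0, where everything is 0. Both \<open>K\<close> and \<open>h0\<close> may depend on d.\<close>

lemma lin_jump_moments:
  "\<exists>K h0. 0 \<le> K \<and> 0 < h0 \<and> (\<forall>h y. 0 < h \<and> h \<le> h0 \<and> y \<in> Rd d \<longrightarrow>
     avg (\<lambda>j. nsq d (lin_jump h j y)) \<le> (1 + K * h) * nsq d y \<and>
     avg (\<lambda>j. nsq d (lin_jump h j y) * sqrt (nsq d (lin_jump h j y))) \<le> (1 + K * h) * (nsq d y * sqrt (nsq d y)))"
proof -
  have "\<forall>k. \<exists>B. k < d \<longrightarrow> 0 \<le> B \<and> (\<forall>y. nsq d (\<lambda>i. S k y i - S k (\<lambda>_. 0) i) \<le> B * nsq d y)"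
    using is_affine_linear_bound[OF S_affine] by blast
  then obtain B where B: "\<And>k. k < d \<Longrightarrow> 0 \<le> B k" "\<And>k y. k < d \<Longrightarrow> nsq d (\<lambda>i. S k y i - S k (\<lambda>_. 0) i) \<le> B k * nsq d y"
    by metis
  obtain B0 where B0: "0 \<le> B0" "\<And>y. nsq d (\<lambda>i. L y i - L (\<lambda>_. 0) i) \<le> B0 * nsq d y"
    using is_affine_linear_bound[OF L_affine] by blast
  define A where "A = 1 + B0 + (\<Sum>k<d. B k)"
  have A: "1 \<le> A" "B0 \<le> A" "(\<Sum>k<d. B k) \<le> A" using B0(1) sum_nonneg[of "{..<d}" B] B(1) by (auto simp: A_def)
  let ?L = "\<lambda>y i. L y i - L (\<lambda>_. 0) i"
  let ?S = "\<lambda>k y i. S k y i - S k (\<lambda>_. 0) i"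
  have bL: "nsq d (?L y) \<le> A * nsq d y" for y
    using order_trans[OF B0(2) mult_right_mono[OF A(2)]] by simp
  have bS: "(\<Sum>k<d. nsq d (?S k y)) \<le> A * nsq d y" for y
  proof -
    have "(\<Sum>k<d. nsq d (?S k y)) \<le> (\<Sum>k<d. B k) * nsq d y"
      unfolding sum_distrib_right by (intro sum_mono B(2)) auto
    then show ?thesis using mult_right_mono[OF A(3), of "nsq d y"] by simp
  qed
  have lj: "lin_jump h j y = (\<lambda>i. y i + displ h (?L y) (\<lambda>k. ?S k y) j i)" if "y \<in> Rd d" for h j y
    unfolding lin_jump_def jump_eq[OF that] jump_eq[OF Rd_zero] by (auto simp: displ_def algebra_simps)
  define K where "K = growth_rate A 1 + growth_rate A 2"
  have K: "growth_rate A 1 \<le> K" "growth_rate A 2 \<le> K" "0 \<le> K"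
    using growth_rate_nonneg[OF A(1)] by (auto simp: K_def)
  define h0 where "h0 = 1 / (64 * real d * A)"
  have main: "avg (\<lambda>j. nsq d (lin_jump h j y)) \<le> (1 + K * h) * nsq d y \<and>
     avg (\<lambda>j. nsq d (lin_jump h j y) * sqrt (nsq d (lin_jump h j y))) \<le> (1 + K * h) * (nsq d y * sqrt (nsq d y))"
    if h: "0 < h" "h \<le> h0" and y: "y \<in> Rd d" for h y
  proof (cases "nsq d y = 0")
    case True
    have "y i = 0" for i
    proof (cases "i < d")
      case i: True then show ?thesis using coord_sq_le_nsq[OF i, of y] True by simp
    qed (use y in \<open>auto simp: Rd_def\<close>)
    then have "y = (\<lambda>_. 0)" by auto
    then have "nsq d (lin_jump h j y) = 0" for j by (simp add: lin_jump_def nsq_def)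
    then show ?thesis using True by simp
  next
    case False
    then have pos: "0 < nsq d y" using nsq_nonneg[of d y] by linarith
    have "avg (\<lambda>j. (0 + nsq d (\<lambda>i. y i + displ h (?L y) (\<lambda>k. ?S k y) j i)) ^ 1) \<le> (1 + growth_rate A 1 * h) * nsq d y ^ 1"
      by (rule avg_power_le[OF order_refl _ pos A(1) bL bS h[unfolded h0_def]]) simp
    also have "\<dots> \<le> (1 + K * h) * nsq d y" using K h by (simp add: mult_right_mono)
    finally have 1: "avg (\<lambda>j. nsq d (lin_jump h j y)) \<le> (1 + K * h) * nsq d y" by (simp add: lj[OF y])
    have "avg (\<lambda>j. nsq d (lin_jump h j y) * sqrt (nsq d (lin_jump h j y))) \<le> (1 + growth_rate A 2 * h) * (nsq d y * sqrt (nsq d y))"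
      unfolding lj[OF y] by (rule avg_cube_le[OF pos A(1) bL bS h[unfolded h0_def]])
    also have "\<dots> \<le> (1 + K * h) * (nsq d y * sqrt (nsq d y))" using K h by (intro mult_right_mono) auto
    finally show ?thesis using 1 by blast
  qed
  have "0 < h0" using A d_pos by (simp add: h0_def)
  then show ?thesis using K(3) main by (intro exI[of _ K] exI[of _ h0] conjI allI impI) simp_all
qed

text \<open>Affine maps carry lines to lines, so derivatives of the average along y are averages of
  derivatives along the directions \<open>lin_jump h j y\<close>. The mean squared and cubed lengths
  of these grow by at most 1 + K h, hence the constant grows by 1 + \<tau> K h per iteration and
  stays bounded over a fixed time horizon.\<close>

lemma line_bounded_it:
  assumes mom: "\<And>y. y \<in> Rd d \<Longrightarrow> avg (\<lambda>j. nsq d (lin_jump h j y)) \<le> (1 + K * h) * nsq d y"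
      "\<And>y. y \<in> Rd d \<Longrightarrow> avg (\<lambda>j. nsq d (lin_jump h j y) * sqrt (nsq d (lin_jump h j y))) \<le> (1 + K * h) * (nsq d y * sqrt (nsq d y))"
    and K: "0 \<le> K" "0 < h" and \<tau>: "0 \<le> \<tau>" "\<tau> \<le> 1" and M: "0 \<le> M" and f: "line_bounded d M f"
  shows "line_bounded d (M * (1 + \<tau> * K * h) ^ k) (it h \<tau> k f)"
proof (induction k)
  case 0
  have "it h \<tau> 0 f = f" by auto
  then show ?case using f by simp
next
  case (Suc k)
  let ?M = "M * (1 + \<tau> * K * h) ^ k"
  have M': "0 \<le> ?M" using M K \<tau> by simp
  show ?case unfolding line_bounded_def
  proof (intro ballI)
    fix x y assume x: "x \<in> Rd d" and y: "y \<in> Rd d"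
    let ?g = "it h \<tau> k f"
    have lRd: "lin_jump h j y \<in> Rd d" if "j \<in> idx" for j
      using jump_Rd[OF that] by (auto simp: lin_jump_def Rd_def)
    have lj: "jump h j (\<lambda>i. x i + s * y i) = (\<lambda>i. jump h j x i + s * lin_jump h j y i)" if "j \<in> idx" for j s
      unfolding lin_jump_def by (rule is_affine_line[OF jump_affine[OF that]])
    from Suc[unfolded line_bounded_def, rule_format, OF x y] obtain a1 a2 a3 where
      a: "\<And>s. ((\<lambda>s. ?g (\<lambda>i. x i + s * y i)) has_real_derivative a1 s) (at s)"
       "\<And>s. (a1 has_real_derivative a2 s) (at s)" "\<And>s. (a2 has_real_derivative a3 s) (at s)"
       "\<And>s. \<bar>a2 s\<bar> \<le> ?M * nsq d y" "\<And>s. \<bar>a3 s\<bar> \<le> ?M * (nsq d y * sqrt (nsq d y))" by blast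
    define Q where "Q j g1 g2 g3 \<longleftrightarrow>
     (\<forall>s. ((\<lambda>s. ?g (\<lambda>i. jump h j x i + s * lin_jump h j y i)) has_real_derivative g1 s) (at s)) \<and>
     (\<forall>s. (g1 has_real_derivative g2 s) (at s)) \<and>
     (\<forall>s. (g2 has_real_derivative g3 s) (at s)) \<and>
     (\<forall>s. \<bar>g2 s\<bar> \<le> ?M * nsq d (lin_jump h j y) \<and> \<bar>g3 s\<bar> \<le> ?M * (nsq d (lin_jump h j y) * sqrt (nsq d (lin_jump h j y))))"
      for j g1 g2 g3
    have "\<exists>g1 g2 g3. Q j g1 g2 g3" if "j \<in> idx" for j
      unfolding Q_def by (rule Suc[unfolded line_bounded_def, rule_format, OF jump_Rd[OF that] lRd[OF that]])
    then obtain b1 b2 b3 where "\<And>j. j \<in> idx \<Longrightarrow> Q j (b1 j) (b2 j) (b3 j)" by metis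
    then have b:
      "\<And>j s. j \<in> idx \<Longrightarrow> ((\<lambda>s. ?g (\<lambda>i. jump h j x i + s * lin_jump h j y i)) has_real_derivative b1 j s) (at s)"
      "\<And>j s. j \<in> idx \<Longrightarrow> (b1 j has_real_derivative b2 j s) (at s)"
      "\<And>j s. j \<in> idx \<Longrightarrow> (b2 j has_real_derivative b3 j s) (at s)"
      "\<And>j s. j \<in> idx \<Longrightarrow> \<bar>b2 j s\<bar> \<le> ?M * nsq d (lin_jump h j y)"
      "\<And>j s. j \<in> idx \<Longrightarrow> \<bar>b3 j s\<bar> \<le> ?M * (nsq d (lin_jump h j y) * sqrt (nsq d (lin_jump h j y)))"
      unfolding Q_def by blast+
    let ?c = "\<lambda>a b s. (1 - \<tau>) * a s + \<tau> * avg (\<lambda>j. b j s)"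
    have D: "((\<lambda>s. ?c u v s) has_real_derivative ?c u' v' s) (at s)"
      if "(u has_real_derivative u' s) (at s)" "\<And>j. j \<in> idx \<Longrightarrow> (v j has_real_derivative v' j s) (at s)" for u v u' v' s
      unfolding avg_def by (intro DERIV_add DERIV_cmult DERIV_cdivide DERIV_sum that)
    have bound: "\<bar>?c u v s\<bar> \<le> M * (1 + \<tau> * K * h) ^ Suc k * V y"
      if "\<bar>u s\<bar> \<le> ?M * V y" "\<And>j. j \<in> idx \<Longrightarrow> \<bar>v j s\<bar> \<le> ?M * V (lin_jump h j y)"
        "avg (\<lambda>j. V (lin_jump h j y)) \<le> (1 + K * h) * V y" for u v s and V :: "(nat \<Rightarrow> real) \<Rightarrow> real"
    proof -
      have "\<bar>avg (\<lambda>j. v j s)\<bar> \<le> avg (\<lambda>j. ?M * V (lin_jump h j y))"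
        by (rule order_trans[OF abs_avg_le avg_mono]) (use that(2) in auto)
      also have "\<dots> \<le> ?M * ((1 + K * h) * V y)" unfolding avg_cmult using that(3) M' by (intro mult_left_mono) auto
      finally have v: "\<bar>avg (\<lambda>j. v j s)\<bar> \<le> ?M * ((1 + K * h) * V y)" .
      have "\<bar>?c u v s\<bar> \<le> \<bar>(1 - \<tau>) * u s\<bar> + \<bar>\<tau> * avg (\<lambda>j. v j s)\<bar>" by (rule abs_triangle_ineq)
      also have "\<dots> = (1 - \<tau>) * \<bar>u s\<bar> + \<tau> * \<bar>avg (\<lambda>j. v j s)\<bar>" using \<tau> by (simp add: abs_mult)
      also have "\<dots> \<le> (1 - \<tau>) * (?M * V y) + \<tau> * (?M * ((1 + K * h) * V y))"
        using \<tau> that(1) v by (intro add_mono mult_left_mono) auto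
      also have "\<dots> = M * (1 + \<tau> * K * h) ^ Suc k * V y" by (simp add: algebra_simps)
      finally show ?thesis .
    qed
    have eq: "(\<lambda>s. it h \<tau> (Suc k) f (\<lambda>i. x i + s * y i))
        = (\<lambda>s. ?c (\<lambda>s. ?g (\<lambda>i. x i + s * y i)) (\<lambda>j s. ?g (\<lambda>i. jump h j x i + s * lin_jump h j y i)) s)"
      by (rule ext) (simp add: lj cong: avg_cong)
    show "\<exists>g1 g2 g3.
     (\<forall>s. ((\<lambda>s. it h \<tau> (Suc k) f (\<lambda>i. x i + s * y i)) has_real_derivative g1 s) (at s)) \<and>
     (\<forall>s. (g1 has_real_derivative g2 s) (at s)) \<and>
     (\<forall>s. (g2 has_real_derivative g3 s) (at s)) \<and>
     (\<forall>s. \<bar>g2 s\<bar> \<le> M * (1 + \<tau> * K * h) ^ Suc k * nsq d y \<and> \<bar>g3 s\<bar> \<le> M * (1 + \<tau> * K * h) ^ Suc k * (nsq d y * sqrt (nsq d y)))"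
      unfolding eq
    proof (rule exI[of _ "?c a1 b1"], rule exI[of _ "?c a2 b2"], rule exI[of _ "?c a3 b3"], intro conjI allI)
      fix s
      show "((\<lambda>s. ?c (\<lambda>s. ?g (\<lambda>i. x i + s * y i)) (\<lambda>j s. ?g (\<lambda>i. jump h j x i + s * lin_jump h j y i)) s) has_real_derivative ?c a1 b1 s) (at s)"
        by (rule D) (use a b in auto)
      show "(?c a1 b1 has_real_derivative ?c a2 b2 s) (at s)" by (rule D) (use a b in auto)
      show "(?c a2 b2 has_real_derivative ?c a3 b3 s) (at s)" by (rule D) (use a b in auto)
      show "\<bar>?c a2 b2 s\<bar> \<le> M * (1 + \<tau> * K * h) ^ Suc k * nsq d y"
        by (rule bound[of a2 s "nsq d" b2]) (use a b mom y in auto)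
      show "\<bar>?c a3 b3 s\<bar> \<le> M * (1 + \<tau> * K * h) ^ Suc k * (nsq d y * sqrt (nsq d y))"
        by (rule bound[of a3 s "\<lambda>y. nsq d y * sqrt (nsq d y)" b3]) (use a b mom y in auto)
    qed
  qed
qed

end

section \<open>Density of the algebra in weighted sup norms\<close>

inductive_set polyfun :: "nat \<Rightarrow> ((nat \<Rightarrow> real) \<Rightarrow> real) set" for d where
  polyfun_const: "(\<lambda>_. c) \<in> polyfun d"
| polyfun_coord: "i \<le> d \<Longrightarrow> (\<lambda>y. y i) \<in> polyfun d"
| polyfun_add: "f \<in> polyfun d \<Longrightarrow> g \<in> polyfun d \<Longrightarrow> (\<lambda>p. f p + g p) \<in> polyfun d"
| polyfun_mult: "f \<in> polyfun d \<Longrightarrow> g \<in> polyfun d \<Longrightarrow> (\<lambda>p. f p * g p) \<in> polyfun d"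

lemma polyfun_continuous: "f \<in> polyfun d \<Longrightarrow> continuous_on S f"
  by (induction rule: polyfun.induct) (auto intro!: continuous_intros continuous_on_coord)

text \<open>The coordinates of the compactification of \<open>\<real>\<^sup>d\<close> by a point at infinity, which becomes the origin.\<close>

definition compactify :: "nat \<Rightarrow> (nat \<Rightarrow> real) \<Rightarrow> nat \<Rightarrow> real" where
  "compactify d x = (\<lambda>i. if i < d then x i * inverse (1 + nsq d x) else if i = d then inverse (1 + nsq d x) else 0)"

lemma polyfun_compactify_Dalg: "f \<in> polyfun d \<Longrightarrow> (\<lambda>p. f (compactify d (snd p))) \<in> Dalg d"
proof (induction rule: polyfun.induct)
  case (polyfun_coord i)
  then consider "i < d" | "i = d" by linarith
  then show ?case
  proof cases
    case 1 then show ?thesis using Dalg_coord[of i d] by (simp add: compactify_def)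
  next
    case 2 then show ?thesis using Dalg_inv[of d] by (simp add: compactify_def)
  qed
qed (auto intro: Dalg.intros)

text \<open>A product of compact intervals, and of single points from index d on, is compact by
  Tychonoff's theorem.\<close>

lemma compact_coord_box:
  "compact {x \<in> Rd d. \<forall>i<d. \<bar>x i - a i\<bar> \<le> r}"
proof -
  let ?K = "\<lambda>i. if i < d then {a i - r .. a i + r} else {0::real}"
  have "compactin (product_topology (\<lambda>i. euclidean) UNIV) (PiE UNIV ?K)"
    unfolding compactin_PiE by (auto simp: compactin_euclidean_iff)
  then have "compact (PiE UNIV ?K)"
    by (simp add: euclidean_product_topology compactin_euclidean_iff)
  moreover have "PiE UNIV ?K = {x \<in> Rd d. \<forall>i<d. \<bar>x i - a i\<bar> \<le> r}"
  proof (rule equalityI; rule subsetI)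
    fix x assume x: "x \<in> PiE UNIV ?K"
    have "x i \<in> ?K i" for i using x by (auto simp: PiE_def Pi_def)
    then have "i < d \<Longrightarrow> a i - r \<le> x i \<and> x i \<le> a i + r" "\<not> i < d \<Longrightarrow> x i = 0" for i
      by (metis atLeastAtMost_iff, metis singletonD)
    then show "x \<in> {x \<in> Rd d. \<forall>i<d. \<bar>x i - a i\<bar> \<le> r}" by (force simp: Rd_def abs_le_iff)
  next
    fix x assume "x \<in> {x \<in> Rd d. \<forall>i<d. \<bar>x i - a i\<bar> \<le> r}"
    then show "x \<in> PiE UNIV ?K" by (auto simp: Rd_def abs_le_iff PiE_def Pi_def) 
  qed
  ultimately show ?thesis by simp
qed

text \<open>In the d + 1 coordinates y of \<open>compactify\<close>, the point x is recovered as y i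
  / y d. A cutoff removes a neighbourhood of infinity, that is of y d = 0; there \<phi> is small
  against the weight of degree \<open>Suc m\<close>. What is left is continuous on a compact box,
  where polynomials are dense.\<close>

lemma Dalg_dense:
  assumes \<phi>: "continuous_on (Rd d) \<phi>" and A: "\<And>x. x \<in> Rd d \<Longrightarrow> \<bar>\<phi> x\<bar> \<le> A * weight d m x" and e: "0 < e"
  shows "\<exists>f\<in>Dalg d. \<forall>x\<in>Rd d. \<bar>f (0, x) - \<phi> x\<bar> \<le> e * weight d (Suc m) x"
proof -
  \<comment> \<open>Where r = 1/(1 + |x|^2) is below \<open>s1\<close>, the assumed bound gives
    |\<phi>| <= |A| r \<open>weight d (Suc m) x\<close>, hence at most e/2 times that
    weight.\<close>
  define s1 where "s1 = e / (2 * (\<bar>A\<bar> + 1))"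
  define s0 where "s0 = s1 / 2"
  have "0 < s1" using e by (simp add: s1_def)
  then have s: "0 < s0" "s0 < s1" "0 < s1" by (auto simp: s0_def)
  define cut where "cut = (\<lambda>r::real. max 0 (min 1 ((r - s0) / (s1 - s0))))"
  define K where "K = {y \<in> Rd (Suc d). \<forall>i<Suc d. \<bar>y i - 0\<bar> \<le> 1}"
  \<comment> \<open>The maximum with \<open>s0\<close> keeps the quotient continuous on all of
    \<open>K\<close>; it is active only where the cutoff vanishes.\<close>
  define g where "g = (\<lambda>y. cut (y d) * \<phi> (\<lambda>i. if i < d then y i / max (y d) s0 else 0))"
  have cont: "continuous_on K g"
  proof -
    have nz: "max (y d) s0 \<noteq> 0" for y :: "nat \<Rightarrow> real" using s by (metis less_max_iff_disj less_irrefl)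
    have "continuous_on K (\<lambda>y. (\<lambda>i. if i < d then y i / max (y d) s0 else 0))"
    proof (rule continuous_on_coordinatewise_then_product)
      fix i show "continuous_on K (\<lambda>y. if i < d then y i / max (y d) s0 else 0)"
        using nz by (cases "i < d") (auto intro!: continuous_intros continuous_on_coord)
    qed
    then have "continuous_on K (\<lambda>y. \<phi> (\<lambda>i. if i < d then y i / max (y d) s0 else 0))"
      by (rule continuous_on_compose2[OF \<phi>]) (auto simp: Rd_def)
    moreover have "continuous_on K (\<lambda>y. cut (y d))"
      unfolding cut_def using s by (auto intro!: continuous_intros continuous_on_coord)
    ultimately show ?thesis unfolding g_def by (intro continuous_intros)
  qed
  have "function_ring_on (polyfun d) K"
  proof
    show "compact K" unfolding K_def by (rule compact_coord_box)
    fix x y assume "x \<in> K" "y \<in> K" "x \<noteq> y"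
    then obtain i where "x i \<noteq> y i" "i \<le> d" unfolding K_def Rd_def by (auto simp: fun_eq_iff) (metis not_less_eq_eq)
    then show "\<exists>f\<in>polyfun d. f x \<noteq> f y" by (intro bexI[of _ "\<lambda>y. y i"] polyfun_coord)
  qed (auto intro: polyfun.intros polyfun_continuous)
  from function_ring_on.Stone_Weierstrass_basic[OF this cont, of "e / 2"] e
  obtain q where q: "q \<in> polyfun d" "\<And>y. y \<in> K \<Longrightarrow> \<bar>g y - q y\<bar> < e / 2" by auto
  have "\<bar>q (compactify d x) - \<phi> x\<bar> \<le> e * weight d (Suc m) x" if x: "x \<in> Rd d" for x
  proof -
    define r where "r = inverse (1 + nsq d x)"
    have r: "0 < r" "r \<le> 1" by (auto simp: r_def inverse_le_1_iff)
    have "compactify d x \<in> K"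
    proof -
      have "\<bar>x i * r\<bar> \<le> 1" if "i < d" for i
        using abs_coord_le[OF that, of x] one_plus_nsq_pos[of d x]
        by (simp add: r_def abs_mult inverse_eq_divide divide_le_eq_1)
      then show ?thesis using r unfolding K_def compactify_def r_def[symmetric] by (auto simp: Rd_def)
    qed
    from q(2)[OF this] have 1: "\<bar>g (compactify d x) - q (compactify d x)\<bar> < e / 2" .
    have c: "cut r = 0" if "r \<le> s0"
    proof -
      have "(r - s0) / (s1 - s0) \<le> 0" using that s by (intro divide_nonpos_pos) auto
      then show ?thesis by (simp add: cut_def)
    qed
    have c1: "cut r = 1" if "s1 \<le> r" using that s by (auto simp: cut_def max_def min_def divide_simps)
    have c01: "0 \<le> cut r" "cut r \<le> 1" by (auto simp: cut_def)
    have "g (compactify d x) = cut r * \<phi> x"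
    proof (cases "r \<le> s0")
      case True then show ?thesis by (simp add: g_def compactify_def r_def[symmetric] c)
    next
      case False
      then have m: "max r s0 = r" by simp
      have "(\<lambda>i. if i < d then compactify d x i / max (compactify d x d) s0 else 0) = x"
        using r x by (auto simp: Rd_def compactify_def r_def[symmetric] m fun_eq_iff)
      then show ?thesis by (simp add: g_def) (simp add: compactify_def r_def)
    qed
    moreover have "\<bar>cut r * \<phi> x - \<phi> x\<bar> \<le> e / 2 * weight d (Suc m) x"
    proof (cases "s1 \<le> r")
      case True then show ?thesis using e c1 by (simp add: less_imp_le)
    next
      case False
      have "cut r * \<phi> x - \<phi> x = - ((1 - cut r) * \<phi> x)" by (simp add: algebra_simps)
      then have "\<bar>cut r * \<phi> x - \<phi> x\<bar> = (1 - cut r) * \<bar>\<phi> x\<bar>"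
        using c01 by (simp only: abs_minus_cancel abs_mult abs_of_nonneg diff_ge_0_iff_ge)
      also have "\<dots> \<le> 1 * \<bar>\<phi> x\<bar>" using c01 by (intro mult_right_mono) auto
      also have "\<dots> \<le> \<bar>A\<bar> * weight d m x" using A[OF x] mult_right_mono[OF abs_ge_self[of A] less_imp_le[OF weight_pos[of d m x]]] by linarith
      also have "\<dots> \<le> (\<bar>A\<bar> + 1) * weight d m x" by (simp add: less_imp_le mult_right_mono)
      also have "\<dots> = (\<bar>A\<bar> + 1) * (r * weight d (Suc m) x)" by (simp add: weight_def r_def)
      also have "\<dots> \<le> (\<bar>A\<bar> + 1) * (s1 * weight d (Suc m) x)"
        using False by (intro mult_left_mono mult_right_mono) (auto simp: less_imp_le)
      also have "\<dots> = ((\<bar>A\<bar> + 1) * s1) * weight d (Suc m) x" by (simp only: mult.assoc)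
      also have "(\<bar>A\<bar> + 1) * s1 = e / 2"
      proof -
        have "a * (e / (2 * a)) = e / 2" if "0 < a" for a :: real using that by simp
        from this[of "\<bar>A\<bar> + 1"] show ?thesis by (simp add: s1_def)
      qed
      finally show ?thesis .
    qed
    moreover have "e / 2 * 1 \<le> e / 2 * weight d (Suc m) x" using e by (intro mult_left_mono weight_ge_1) auto
    ultimately have "\<bar>q (compactify d x) - \<phi> x\<bar> \<le> e / 2 * weight d (Suc m) x + e / 2 * weight d (Suc m) x"
      using 1 by linarith
    then show ?thesis by simp
  qed
  then show ?thesis using polyfun_compactify_Dalg[OF q(1)] by (intro bexI[of _ "\<lambda>p. q (compactify d (snd p))"]) auto
qed

lemma Dalg_continuous: "f \<in> Dalg d \<Longrightarrow> continuous_on S f"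
proof (induction rule: Dalg.induct)
  have n: "continuous_on S (\<lambda>p. 1 + nsq d (snd p))" for S :: "(real \<times> (nat \<Rightarrow> real)) set"
    unfolding nsq_def by (intro continuous_intros continuous_on_snd_coord)
  { case Dalg_inv show ?case by (intro continuous_intros n) simp }
  { case (Dalg_coord i) show ?case by (intro continuous_intros n continuous_on_snd_coord) simp }
qed (auto intro!: continuous_intros)

section \<open>Error of the scheme in the equation\<close>

lemma taylor3:
  fixes g :: "real \<Rightarrow> real"
  assumes "\<And>s. (g has_real_derivative g1 s) (at s)" "\<And>s. (g1 has_real_derivative g2 s) (at s)"
    "\<And>s. (g2 has_real_derivative g3 s) (at s)"
  shows "\<exists>\<theta>. g 1 = g 0 + g1 0 + g2 0 / 2 + g3 \<theta> / 6"
proof -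
  define D where "D = (\<lambda>m::nat. if m = 0 then g else if m = 1 then g1 else if m = 2 then g2 else g3)"
  have "\<exists>t. \<bar>t\<bar> \<le> \<bar>1\<bar> \<and> D 0 1 = (\<Sum>m<3. D m 0 / fact m * 1 ^ m) + D 3 t / fact 3 * 1 ^ 3"
  proof (rule Maclaurin_bi_le[of D "D 0" 3 1])
    show "\<forall>m t. m < 3 \<and> \<bar>t\<bar> \<le> \<bar>1\<bar> \<longrightarrow> (D m has_real_derivative D (Suc m) t) (at t)"
      using assms by (auto simp: D_def numeral_3_eq_3 less_Suc_eq)
  qed simp
  then show ?thesis by (auto simp: D_def eval_nat_numeral)
qed

context affine_coeffs
begin

lemma it_continuous:
  assumes "continuous_on UNIV f"
  shows "continuous_on UNIV (\<lambda>p. it h (c * fst p) k f (snd p))"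
proof (induction k)
  case 0
  show ?case using continuous_on_compose2[OF assms continuous_on_snd[OF continuous_on_id]] by simp
next
  case (Suc k)
  have j: "continuous_on UNIV (\<lambda>p. it h (c * fst p) k f (jump h j (snd p)))" if "j \<in> idx" for j
  proof -
    have "continuous_on UNIV (\<lambda>p::real \<times> (nat \<Rightarrow> real). (fst p, jump h j (snd p)))"
      by (intro continuous_on_Pair continuous_on_fst continuous_on_id
          continuous_on_compose2[OF is_affine_continuous[OF jump_affine[OF that], of UNIV] continuous_on_snd[OF continuous_on_id]]) simp
    from continuous_on_compose2[OF Suc this] show ?thesis by simp
  qed
  show ?case unfolding it.simps avg_def by (intro continuous_intros Suc j) (use d_pos in auto)
qed

text \<open>The third order Taylor remainder along a jump is of order h^(3/2), so sqrt h is left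
  after division by h. Its growth in x is \<rho>^(3/2) with \<rho> = 1 + |x|^2, rounded up to degree
  2. The constant may depend on d, as only its product with sqrt h has to be small.\<close>

lemma abs_generator_error_le:
  assumes w: "C_k_on 2 d T w" and p: "(t, x) \<in> cyl d T" and lb: "line_bounded d M (\<lambda>x. w (t, x))" and M: "0 \<le> M"
    and h: "0 < h" "h \<le> 1"
  shows "\<bar>incr h (\<lambda>x. w (t, x)) x / h - gen w (t, x)\<bar> \<le> sqrt h * (M * ((4 * real d * C)\<^sup>2 + C)) * weight d 2 x"
proof -
  have w': "C_k_on (Suc (Suc 0)) d T w" using w by (simp only: numeral_2_eq_2)
  have x: "x \<in> Rd d" using p by simp
  define \<rho> where "\<rho> = 1 + nsq d x"
  have \<rho>: "1 \<le> \<rho>" by (simp add: \<rho>_def)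
  let ?D = "4 * real d * C"
  have D: "1 \<le> ?D" using d_pos C_ge_1 mult_mono[of 1 "real d" 1 C] by simp
  have line: "\<bar>dir2 d w (t, x) y\<bar> \<le> M * nsq d y \<and>
      \<bar>w (t, \<lambda>i. x i + y i) - w (t, x) - dir1 d w (t, x) y - dir2 d w (t, x) y / 2\<bar> \<le> M * (nsq d y * sqrt (nsq d y)) / 6"
    if y: "y \<in> Rd d" for y
  proof -
    from lb[unfolded line_bounded_def, rule_format, OF x y] obtain g1 g2 g3 where g:
     "\<And>s. ((\<lambda>s. w (t, \<lambda>i. x i + s * y i)) has_real_derivative g1 s) (at s)"
     "\<And>s. (g1 has_real_derivative g2 s) (at s)"  "\<And>s. (g2 has_real_derivative g3 s) (at s)"
     "\<And>s. \<bar>g2 s\<bar> \<le> M * nsq d y" "\<And>s. \<bar>g3 s\<bar> \<le> M * (nsq d y * sqrt (nsq d y))" by blast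
    have g1: "g1 = (\<lambda>s. dir1 d w (t, \<lambda>i. x i + s * y i) y)"
      using DERIV_unique[OF g(1) line_derivative[OF w' p y]] by auto
    have g2: "g2 = (\<lambda>s. dir2 d w (t, \<lambda>i. x i + s * y i) y)"
      using DERIV_unique[OF g(2)[unfolded g1] line_derivative2[OF w' p y]] by auto
    obtain \<theta> where "w (t, \<lambda>i. x i + 1 * y i) = w (t, \<lambda>i. x i + 0 * y i) + g1 0 + g2 0 / 2 + g3 \<theta> / 6"
      using taylor3[OF g(1-3)] by blast
    then have eq: "w (t, \<lambda>i. x i + y i) - w (t, x) - dir1 d w (t, x) y - dir2 d w (t, x) y / 2 = g3 \<theta> / 6"
      by (simp add: g1 g2)
    show ?thesis using g(4)[of 0] g(5)[of \<theta>] unfolding eq by (simp add: g2)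
  qed
  let ?y = "displ h (L x) (\<lambda>k. S k x)"
  let ?q = "?D * h * \<rho>"
  have q: "nsq d (?y j) \<le> ?q" if "j \<in> idx" for j
  proof -
    have "nsq d (?y j) \<le> 2 * h\<^sup>2 * nsq d (L x) + 2 * (real d * h) * (\<Sum>k<d. nsq d (S k x))"
      using nsq_displ_le that h by auto
    also have "\<dots> \<le> 2 * (real d * h) * (C * \<rho>) + 2 * (real d * h) * (C * \<rho>)"
    proof (intro add_mono mult_mono mult_left_mono)
      show "h\<^sup>2 \<le> real d * h" using h d_pos by (simp add: power2_eq_square mult_right_mono)
    qed (use L_growth[OF x] S_growth[OF x] h in \<open>auto intro!: sum_nonneg simp: \<rho>_def\<close>)
    also have "\<dots> = ?q" by simp
    finally show ?thesis .
  qed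
  have "\<bar>(avg (\<lambda>j. w (t, jump h j x)) - w (t, x)) / h - gen w (t, x)\<bar>
      \<le> avg (\<lambda>j. M * (?q * sqrt ?q) / 6) / h + h * \<bar>dir2 d w (t, x) (L x)\<bar> / 2"
  proof (rule abs_taylor_remainder_le[where T = T])
    fix j assume j: "j \<in> idx"
    have "M * (nsq d (?y j) * sqrt (nsq d (?y j))) / 6 \<le> M * (?q * sqrt ?q) / 6"
      using q[OF j] M h \<rho> C_ge_1 by (intro divide_right_mono mult_left_mono mult_mono real_sqrt_le_mono) auto
    then show "\<bar>w (t, jump h j x) - w (t, x) - dir1 d w (t, x) (?y j) - dir2 d w (t, x) (?y j) / 2\<bar> \<le> M * (?q * sqrt ?q) / 6"
      unfolding jump_eq[OF x] using line[OF displ_Rd[OF j, of h x x]] by linarith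
  qed (use h p in auto)
  also have "avg (\<lambda>j. M * (?q * sqrt ?q) / 6) / h \<le> sqrt h * (M * ?D\<^sup>2) * \<rho>\<^sup>2"
  proof -
    have "?q * sqrt ?q = h * sqrt h * ((?D * \<rho>) * sqrt (?D * \<rho>))" by (simp add: real_sqrt_mult)
    also have "\<dots> \<le> h * sqrt h * ((?D * \<rho>) * (?D * \<rho>))"
    proof (intro mult_left_mono)
      have "1 * 1 \<le> ?D * \<rho>" using C_ge_1 by (intro mult_mono D \<rho>) auto
      then have "1 \<le> ?D * \<rho>" by (simp only: mult_1)
      then show "sqrt (?D * \<rho>) \<le> ?D * \<rho>" by (intro real_le_lsqrt self_le_power; linarith)
    qed (use h D \<rho> C_ge_1 in auto)
    finally have "M * (?q * sqrt ?q) / 6 \<le> M * (h * sqrt h * ((?D * \<rho>) * (?D * \<rho>))) / 6"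
      using M by (intro divide_right_mono mult_left_mono) auto
    also have "\<dots> \<le> M * (h * sqrt h * ((?D * \<rho>) * (?D * \<rho>)))" using M h \<rho> C_ge_1 by simp
    also have "\<dots> = (sqrt h * (M * ?D\<^sup>2) * \<rho>\<^sup>2) * h" by (simp add: power2_eq_square mult_ac)
    finally show ?thesis using h by (simp only: avg_const pos_divide_le_eq)
  qed
  also have "h * \<bar>dir2 d w (t, x) (L x)\<bar> / 2 \<le> sqrt h * (M * C) * \<rho>\<^sup>2"
  proof -
    have hs: "h \<le> sqrt h" using h by (intro real_le_rsqrt) (simp add: power2_eq_square mult_left_le)
    have "\<bar>dir2 d w (t, x) (L x)\<bar> \<le> M * (C * \<rho>)"
      using line[OF is_affine_Rd[OF L_affine, of x]] mult_left_mono[OF L_growth[OF x] M] by (simp add: \<rho>_def)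
    also have "\<dots> \<le> M * (C * \<rho>\<^sup>2)" using M C_ge_1 \<rho> by (intro mult_left_mono) (auto simp: self_le_power)
    finally have "h * \<bar>dir2 d w (t, x) (L x)\<bar> \<le> sqrt h * (M * (C * \<rho>\<^sup>2))"
      using hs h by (intro mult_mono) auto
    moreover have "0 \<le> h * \<bar>dir2 d w (t, x) (L x)\<bar>" using h by simp
    ultimately show ?thesis by (simp add: mult.assoc)
  qed
  finally show ?thesis by (simp add: incr_def weight_def \<rho>_def[symmetric] algebra_simps)
qed

lemma line_bounded_mono:
  assumes "line_bounded d M g" "M \<le> N" shows "line_bounded d N g"
  unfolding line_bounded_def
proof (intro ballI)
  fix x y assume "x \<in> Rd d" "y \<in> Rd d"
  from assms(1)[unfolded line_bounded_def, rule_format, OF this] obtain g1 g2 g3 where g: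
     "\<And>s. ((\<lambda>s. g (\<lambda>i. x i + s * y i)) has_real_derivative g1 s) (at s)"
     "\<And>s. (g1 has_real_derivative g2 s) (at s)"  "\<And>s. (g2 has_real_derivative g3 s) (at s)"
     "\<And>s. \<bar>g2 s\<bar> \<le> M * nsq d y" "\<And>s. \<bar>g3 s\<bar> \<le> M * (nsq d y * sqrt (nsq d y))" by blast
  have "M * nsq d y \<le> N * nsq d y" "M * (nsq d y * sqrt (nsq d y)) \<le> N * (nsq d y * sqrt (nsq d y))"
    using assms(2) by (auto intro!: mult_right_mono)
  then have "\<And>s. \<bar>g2 s\<bar> \<le> N * nsq d y" "\<And>s. \<bar>g3 s\<bar> \<le> N * (nsq d y * sqrt (nsq d y))"
    using g(4,5) order_trans by blast+
  then show "\<exists>g1 g2 g3.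
     (\<forall>s. ((\<lambda>s. g (\<lambda>i. x i + s * y i)) has_real_derivative g1 s) (at s)) \<and>
     (\<forall>s. (g1 has_real_derivative g2 s) (at s)) \<and>
     (\<forall>s. (g2 has_real_derivative g3 s) (at s)) \<and>
     (\<forall>s. \<bar>g2 s\<bar> \<le> N * nsq d y \<and> \<bar>g3 s\<bar> \<le> N * (nsq d y * sqrt (nsq d y)))"
    using g(1-3) by blast
qed

definition scheme :: "real \<Rightarrow> nat \<Rightarrow> ((nat \<Rightarrow> real) \<Rightarrow> real) \<Rightarrow> real \<times> (nat \<Rightarrow> real) \<Rightarrow> real" where
  "scheme h N f = (\<lambda>p. it h (1 / (real N * h) * fst p) N f (snd p))"

text \<open>Two errors occur. The time derivative involves the iterate of index N - 1 instead of N,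
  which differs by \<tau> times a second increment and is small for large N. The quotient of
  \<open>incr\<close> by h differs from \<open>gen\<close> by a multiple of sqrt h that is uniform
  in N. Hence h is fixed before N.\<close>

lemma scheme_approximate_solution:
  assumes F: "F \<in> Dalg d" and T: "0 < T" and e: "0 < e"
  shows "\<exists>h N. 0 < h \<and> h \<le> h_max \<and> 0 < N \<and> T \<le> real N * h \<and>
    (\<forall>p\<in>cyl d T. \<bar>partial None (scheme h N (\<lambda>x. F (0, x))) p - gen (scheme h N (\<lambda>x. F (0, x))) p\<bar> \<le> e * weight d 2 (snd p))"
proof -
  let ?f = "\<lambda>x. F (0, x)"
  obtain B0 where B0: "\<And>p. \<bar>F p\<bar> \<le> B0" using Dalg_bounded[OF F] by blast
  then have B: "0 \<le> B0" by (meson abs_ge_zero order_trans)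
  obtain M where M: "0 \<le> M" "line_bounded d M ?f" using Dalg_line_bounded[OF F] by blast
  obtain K h0 where K: "0 \<le> K" "0 < h0" and mom: "\<And>h y. 0 < h \<Longrightarrow> h \<le> h0 \<Longrightarrow> y \<in> Rd d \<Longrightarrow>
     avg (\<lambda>j. nsq d (lin_jump h j y)) \<le> (1 + K * h) * nsq d y"
     "\<And>h y. 0 < h \<Longrightarrow> h \<le> h0 \<Longrightarrow> y \<in> Rd d \<Longrightarrow> avg (\<lambda>j. nsq d (lin_jump h j y) * sqrt (nsq d (lin_jump h j y))) \<le> (1 + K * h) * (nsq d y * sqrt (nsq d y))"
    using lin_jump_moments by blast
  define M' where "M' = M * exp (K * T)"
  have M': "0 \<le> M'" using M by (simp add: M'_def)
  define E where "E = M' * ((4 * real d * C)\<^sup>2 + C)"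
  have E: "0 \<le> E" using M' C_ge_1 by (simp add: E_def)
  define h where "h = min (min h0 h_max) (min 1 ((e / 2 / (E + 1))\<^sup>2))"
  have h: "0 < h" "h \<le> h0" "h \<le> h_max" "h \<le> 1" "h \<le> (e / 2 / (E + 1))\<^sup>2"
    using K h_max_pos e E by (auto simp: h_def)
  have hE: "sqrt h * E \<le> e / 2"
  proof -
    have "sqrt h \<le> e / 2 / (E + 1)" using h(5) e E by (intro real_le_lsqrt) auto
    then have "sqrt h * E \<le> e / 2 / (E + 1) * E" using E by (rule mult_right_mono)
    also have "\<dots> \<le> e / 2" using e E by (simp add: field_simps)
    finally show ?thesis .
  qed
  \<comment> \<open>The first summand yields T <= N h, that is \<tau> <= 1; the second makes the
    discrepancy between the indices N - 1 and N at most e/2.\<close>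
  obtain N where N: "T / h + 8 * B0 * T / (h\<^sup>2 * e) < real N" using reals_Archimedean2 by blast
  have Tp: "0 < T / h" "0 \<le> 8 * B0 * T / (h\<^sup>2 * e)" using T h B e by auto
  have N0: "0 < N" using N Tp by (metis add_pos_nonneg of_nat_0_less_iff order.strict_trans)
  have NT: "T \<le> real N * h" using N Tp h(1) by (simp add: pos_divide_less_eq[symmetric] less_imp_le)
  have Ne: "4 * B0 * T / (real N * h\<^sup>2) \<le> e / 2"
  proof -
    have "8 * B0 * T / (h\<^sup>2 * e) \<le> real N" using N Tp by linarith
    then have "8 * B0 * T \<le> real N * (h\<^sup>2 * e)" using h e by (simp add: pos_divide_le_eq)
    then show ?thesis using N0 h by (simp add: divide_le_eq mult_ac)
  qed
  let ?w = "scheme h N ?f"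
  let ?c = "1 / (real N * h)"
  have el: "?w \<in> elem d T"
  proof -
    have "(\<lambda>p. ?f (snd p)) = F" using Dalg_snd[OF F] by (auto simp: fun_eq_iff)
    then have "(\<lambda>p. ?f (snd p)) \<in> elem d T" using Dalg_elem[OF F] by simp
    then show ?thesis unfolding scheme_def by (rule it_elem)
  qed
  have "\<bar>partial None ?w p - gen ?w p\<bar> \<le> e * weight d 2 (snd p)" if p: "p \<in> cyl d T" for p
  proof -
    obtain t x where tx: "p = (t, x)" by force
    have t: "0 < t" "t < T" and x: "x \<in> Rd d" using p tx by auto
    define \<tau> where "\<tau> = ?c * t"
    have \<tau>: "0 \<le> \<tau>" "\<tau> \<le> T / (real N * h)" using t h by (auto simp: \<tau>_def divide_right_mono)
    have \<tau>1: "\<tau> \<le> 1" using \<tau>(2) NT h N0 by (simp add: order_trans[OF _ iffD2[OF divide_le_eq_1_pos]])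
    let ?g = "it h \<tau> (N - 1) ?f"
    have gB: "\<bar>?g y\<bar> \<le> B0" if "y \<in> Rd d" for y by (rule abs_it_le[OF \<tau>(1) \<tau>1 _ that]) (use B0 in blast)
    have incB: "\<bar>incr h u y\<bar> \<le> 2 * b" if "\<And>y. y \<in> Rd d \<Longrightarrow> \<bar>u y\<bar> \<le> b" "y \<in> Rd d" for u y b
    proof -
      have "\<bar>avg (\<lambda>j. u (jump h j y))\<bar> \<le> avg (\<lambda>j. b)"
        by (rule order_trans[OF abs_avg_le avg_mono]) (use that jump_Rd in auto)
      then show ?thesis using that(1)[OF that(2)] unfolding incr_def by simp
    qed
    have ii: "\<bar>incr h (incr h ?g) x\<bar> \<le> 4 * B0" using incB[OF incB[OF gB] x] by simp
    have pt: "partial None ?w p = incr h ?g x / h"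
    proof (rule partial_eqI)
      have "((\<lambda>\<tau>. it h \<tau> N ?f x) has_real_derivative real N * incr h ?g x) (at (?c * (t + 0)))"
        using DERIV_it[of h N ?f x] by (simp add: \<tau>_def)
      moreover have "((\<lambda>s. ?c * (t + s)) has_real_derivative ?c * 1) (at 0)"
        by (rule DERIV_cmult) (auto intro!: derivative_eq_intros)
      ultimately have "((\<lambda>s. it h (?c * (t + s)) N ?f x) has_real_derivative real N * incr h ?g x * (?c * 1)) (at 0)"
        by (rule DERIV_chain2[where f = "\<lambda>\<tau>. it h \<tau> N ?f x" and g = "\<lambda>s. ?c * (t + s)" and x = 0 and s = UNIV and Db = "?c * 1"])
      moreover have "real N * incr h ?g x * (?c * 1) = incr h ?g x / h" using N0 by simp
      ultimately show "((\<lambda>s. ?w (move None s p)) has_real_derivative incr h ?g x / h) (at 0)"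
        by (simp add: scheme_def tx)
    qed
    have wt: "(\<lambda>x. ?w (t, x)) = it h \<tau> N ?f" by (simp add: scheme_def \<tau>_def)
    have "line_bounded d (M * (1 + \<tau> * K * h) ^ N) (it h \<tau> N ?f)"
      by (rule line_bounded_it) (use mom[OF h(1,2)] K h \<tau> \<tau>1 M in auto)
    moreover have "M * (1 + \<tau> * K * h) ^ N \<le> M'"
    proof -
      have "(1 + t / (real N * h) * K * h) ^ N \<le> exp (K * t)"
        by (rule one_plus_scaled_power_le_exp) (use K h t N0 in auto)
      also have "\<dots> \<le> exp (K * T)" using K t by (simp add: mult_left_mono)
      finally show ?thesis using M by (simp add: M'_def \<tau>_def mult_left_mono)
    qed
    ultimately have lb: "line_bounded d M' (\<lambda>x. ?w (t, x))" unfolding wt by (rule line_bounded_mono)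
    have "\<bar>incr h (\<lambda>x. ?w (t, x)) x / h - gen ?w (t, x)\<bar> \<le> sqrt h * E * weight d 2 x"
      unfolding E_def using abs_generator_error_le[OF elem_C_k_on[OF el] _ lb M' h(1,4)] p tx by simp
    also have "\<dots> \<le> e / 2 * weight d 2 x" using hE by (intro mult_right_mono) (auto simp: less_imp_le)
    finally have 1: "\<bar>incr h (it h \<tau> N ?f) x / h - gen ?w (t, x)\<bar> \<le> e / 2 * weight d 2 x" unfolding wt .
    have "it h \<tau> N ?f = (\<lambda>x. ?g x + \<tau> * incr h ?g x)" using it_Suc[of h \<tau> "N - 1" ?f] N0 by (auto simp: fun_eq_iff)
    then have "incr h (it h \<tau> N ?f) x = incr h ?g x + \<tau> * incr h (incr h ?g) x" by (simp only: incr_add_scaled)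
    then have "\<bar>incr h (it h \<tau> N ?f) x / h - incr h ?g x / h\<bar> = \<tau> * \<bar>incr h (incr h ?g) x\<bar> / h"
      using h \<tau>(1) by (simp add: add_divide_distrib abs_mult)
    also have "\<dots> \<le> T / (real N * h) * (4 * B0) / h"
      using ii h \<tau> T by (intro divide_right_mono mult_mono) auto
    also have "\<dots> \<le> e / 2" using Ne by (simp add: power2_eq_square mult_ac)
    also have "\<dots> \<le> e / 2 * weight d 2 x" using e weight_ge_1[of d 2 x] by simp
    finally have 2: "\<bar>incr h (it h \<tau> N ?f) x / h - incr h ?g x / h\<bar> \<le> e / 2 * weight d 2 x" .
    show ?thesis using 1 2 unfolding pt by (simp only: tx snd_conv)
  qed
  then show ?thesis using h N0 NT by blast
qed

end

section \<open>Comparison\<close>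

lemma le_of_le_add_scaled_epsilon:
  fixes X Y Z :: real
  assumes "0 \<le> Z" "\<And>\<eta>. 0 < \<eta> \<Longrightarrow> X \<le> Y + \<eta> * Z"
  shows "X \<le> Y"
proof (rule field_le_epsilon)
  fix e :: real assume e: "0 < e"
  have "X \<le> Y + e / (Z + 1) * Z" using e assms(1) assms(2)[of "e / (Z + 1)"] by simp
  also have "e / (Z + 1) * Z \<le> e" using e assms(1) by (simp add: field_simps)
  finally show "X \<le> Y + e" by simp
qed

lemma partial_None_zero_at_max:
  assumes f: "C_k_on 2 d T f" and p: "(t, x) \<in> cyl d T" and r: "0 < r"
    and max: "\<And>s. \<bar>s - t\<bar> < r \<Longrightarrow> s \<in> {0<..<T} \<Longrightarrow> f (s, x) \<le> f (t, x)"
  shows "partial None f (t, x) = 0"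
proof -
  have f': "C_k_on (Suc 1) d T f" using f by (simp only: numeral_2_eq_2 One_nat_def)
  have D: "((\<lambda>s. f (t + s, x)) has_real_derivative partial None f (t, x)) (at 0)"
    using partial_has_derivative[OF f' p, of None] by simp
  have t: "0 < t" "t < T" using p by auto
  show ?thesis
  proof (rule DERIV_local_max[OF D, of "min r (min t (T - t))"])
    show "\<forall>y. \<bar>0 - y\<bar> < min r (min t (T - t)) \<longrightarrow> f (t + y, x) \<le> f (t + 0, x)"
    proof (intro allI impI)
      fix y assume "\<bar>0 - y\<bar> < min r (min t (T - t))"
      then show "f (t + y, x) \<le> f (t + 0, x)" using max[of "t + y"] t by (auto simp: abs_less_iff)
    qed
  qed (use r t in auto)
qed

context affine_coeffs
begin

text \<open>Viscosity subsolution up to an error e times a weight. Supersolutions are treated as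
  subsolutions after a change of sign, which the linear equation permits.\<close>

definition subsol :: "real \<Rightarrow> real \<Rightarrow> nat \<Rightarrow> (real \<times> (nat \<Rightarrow> real) \<Rightarrow> real) \<Rightarrow> bool" where
  "subsol T e m u \<longleftrightarrow> (\<forall>p\<in>cyl d T. \<forall>h. C_k_on 2 d T h \<and> (\<forall>q\<in>cyl d T. h q \<ge> u q) \<and> h p = u p \<longrightarrow>
     partial None h p \<le> gen h p + e * weight d m (snd p))"

definition approx_sol :: "real \<Rightarrow> real \<Rightarrow> nat \<Rightarrow> (real \<times> (nat \<Rightarrow> real) \<Rightarrow> real) \<Rightarrow> bool" where
  "approx_sol T e m w \<longleftrightarrow> C_k_on 2 d T w \<and> (\<forall>p\<in>cyl d T. \<bar>partial None w p - gen w p\<bar> \<le> e * weight d m (snd p))"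

lemma partial_None_diff:
  assumes "C_k_on 2 d T f" "C_k_on 2 d T g" "p \<in> cyl d T"
  shows "partial None (\<lambda>q. f q + c * g q) p = partial None f p + c * partial None g p"
  using partial_add_scaled[of 1 d T f g p None c] assms by (simp add: numeral_2_eq_2)

lemma C2_uminus:
  assumes w: "C_k_on 2 d T w"
  shows "C_k_on 2 d T (\<lambda>p. - w p)" "\<And>p. p \<in> cyl d T \<Longrightarrow> partial None (\<lambda>q. - w q) p = - partial None w p"
    "\<And>p. p \<in> cyl d T \<Longrightarrow> gen (\<lambda>q. - w q) p = - gen w p"
proof -
  have z: "C_k_on 2 d T (\<lambda>_. 0)" by (rule elem_C_k_on[OF elem_const])
  have z0: "gen (\<lambda>_. 0) p = 0" for p
  proof -
    have "partial k (\<lambda>_. 0) = (\<lambda>_. 0)" for k by (rule ext, rule partial_eqI) simp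
    then show ?thesis by (simp add: gen_def dir1_def dir2_def)
  qed
  have z1: "partial None (\<lambda>_. 0) p = 0" for p by (rule partial_eqI) simp
  show "C_k_on 2 d T (\<lambda>p. - w p)" using C_k_on_add_scaled[OF z w, of "-1"] by simp
  show "partial None (\<lambda>q. - w q) p = - partial None w p" "gen (\<lambda>q. - w q) p = - gen w p"
    if "p \<in> cyl d T" for p
    using partial_None_diff[OF z w that, of "-1"] gen_add_scaled[OF z w that, of "-1"] by (simp_all add: z0 z1)
qed

lemma approx_sol_uminus:
  assumes "approx_sol T e m w" shows "approx_sol T e m (\<lambda>p. - w p)"
proof -
  have w: "C_k_on 2 d T w" using assms by (simp add: approx_sol_def)
  show ?thesis using assms C2_uminus[OF w] by (auto simp: approx_sol_def abs_minus_commute)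
qed

lemma approx_sol_imp_subsol:
  assumes "approx_sol T e m w" shows "subsol T e m w"
  unfolding subsol_def
proof (intro ballI allI impI)
  fix p h assume p: "p \<in> cyl d T" and h: "C_k_on 2 d T h \<and> (\<forall>q\<in>cyl d T. h q \<ge> w q) \<and> h p = w p"
  obtain t x where tx: "p = (t, x)" by force
  have w: "C_k_on 2 d T w" and ap: "\<bar>partial None w p - gen w p\<bar> \<le> e * weight d m (snd p)"
    using assms p by (auto simp: approx_sol_def)
  let ?f = "\<lambda>q. w q + (-1) * h q"
  have f: "C_k_on 2 d T ?f" using w h by (intro C_k_on_add_scaled) auto
  have max: "?f q \<le> ?f (t, x)" if "q \<in> cyl d T" for q using h that tx by auto
  have "partial None ?f (t, x) = 0"
    by (rule partial_None_zero_at_max[OF f, of _ _ 1]) (use p tx max in auto)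
  moreover have "gen ?f (t, x) \<le> 0"
    by (rule gen_nonpos_at_max[OF f, of _ _ 1]) (use p tx max in auto)
  moreover have "partial None ?f p = partial None w p + (-1) * partial None h p" "gen ?f p = gen w p + (-1) * gen h p"
    using partial_None_diff[OF w _ p] gen_add_scaled[OF w _ p] h by blast+
  ultimately show "partial None h p \<le> gen h p + e * weight d m (snd p)" using ap tx by auto
qed

theorem comparison:
  fixes m :: nat and A A' E e0 e1 e2 T :: real
  defines "K \<equiv> growth_rate C (Suc m)"
  assumes T: "0 < T"
    and u: "continuous_on ({0..T} \<times> Rd d) u" "\<And>p. p \<in> {0..T} \<times> Rd d \<Longrightarrow> \<bar>u p\<bar> \<le> A * weight d m (snd p)"
      "subsol T e1 (Suc m) u"
    and w: "continuous_on ({0..T} \<times> Rd d) w" "\<And>p. p \<in> {0..T} \<times> Rd d \<Longrightarrow> \<bar>w p\<bar> \<le> A' * weight d m (snd p)"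
      "approx_sol T e2 (Suc m) w"
    and init: "\<And>x. x \<in> Rd d \<Longrightarrow> u (0, x) - w (0, x) \<le> e0 * weight d (Suc m) x"
    and E: "0 \<le> E" "e0 \<le> E" "e1 + e2 \<le> E" and tx: "t \<in> {0..T}" "x \<in> Rd d"
  shows "u (t, x) - w (t, x) \<le> E * ((1 + T) * exp (K * T)) * weight d (Suc m) x"
proof -
  have K: "0 \<le> K" unfolding K_def by (rule growth_rate_nonneg[OF C_ge_1])
  have wC: "C_k_on 2 d T w" using w(3) by (simp add: approx_sol_def)
  have AA: "0 \<le> A + A'"
  proof -
    have "(0, \<lambda>_. 0) \<in> {0..T} \<times> Rd d" using T by auto
    then have "0 \<le> (A + A') * weight d m (\<lambda>_. 0)"
      using u(2)[of "(0, \<lambda>_. 0)"] w(2)[of "(0, \<lambda>_. 0)"] by (auto simp: algebra_simps)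
    then show ?thesis using weight_pos[of d m "\<lambda>_. 0"] by (simp add: zero_le_mult_iff)
  qed
  have main: "u (t, x) - w (t, x) \<le> (E + \<eta>) * (1 + t) * exp (K * t) * weight d (Suc m) x + \<eta> / (T - t)"
    if \<eta>: "0 < \<eta>" and tx: "t \<in> {0..<T}" "x \<in> Rd d" for \<eta> t x
  proof (rule ccontr)
    \<comment> \<open>The exponential offsets the growth of the weight under the generator, the
      factor 1 + t produces the surplus (E + \<eta>) exp(K t) times the weight, and \<eta> > 0 makes
      the barrier dominate u - w at infinity, its degree being larger by one.\<close>
    define Ba where "Ba = (\<lambda>p. (E + \<eta>) * (1 + fst p) * exp (K * fst p) * weight d (Suc m) (snd p))"
    define zz where "zz = (\<lambda>p. u p - w p - Ba p - \<eta> / (T - fst p))"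
    assume "\<not> ?thesis"
    then have z0: "0 < zz (t, x)" by (simp add: zz_def Ba_def)
    \<comment> \<open>Where \<open>zz\<close> is positive, \<eta>/(T - s) stays below
      \<open>G\<close>, so the maximum keeps a positive distance from T. The summand 1 makes
      \<open>G\<close> positive.\<close>
    define G where "G = (A + A') * ((A + A') / \<eta>) ^ m + 1"
    have G: "1 \<le> G" using AA \<eta> by (simp add: G_def)
    define Q where "Q = {0..T - \<eta> / G} \<times> {x \<in> Rd d. \<forall>i<d. \<bar>x i - 0\<bar> \<le> (A + A') / \<eta>}"
    have inQ: "q \<in> Q" if q: "q \<in> {0..<T} \<times> Rd d" and zq: "0 < zz q" for q
    proof -
      obtain s y where sy: "q = (s, y)" "0 \<le> s" "s < T" "y \<in> Rd d" using q by auto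
      have "u q - w q \<le> (A + A') * weight d m y"
        using u(2)[of q] w(2)[of q] sy by (auto simp: algebra_simps)
      moreover have B1: "\<eta> * weight d (Suc m) y \<le> Ba q"
      proof -
        have "\<eta> * 1 * 1 * weight d (Suc m) y \<le> (E + \<eta>) * (1 + s) * exp (K * s) * weight d (Suc m) y"
          using \<eta> E K sy by (intro mult_right_mono mult_mono) (auto simp: less_imp_le)
        then show ?thesis by (simp add: Ba_def sy)
      qed
      moreover have Tp: "0 < \<eta> / (T - s)" using \<eta> sy by simp
      ultimately have lt: "\<eta> * weight d (Suc m) y + \<eta> / (T - s) < (A + A') * weight d m y"
        using zq by (simp add: zz_def sy)
      then have "(\<eta> * (1 + nsq d y)) * weight d m y < (A + A') * weight d m y" using Tp by (simp add: weight_def algebra_simps)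
      then have "\<eta> * (1 + nsq d y) < A + A'" using weight_pos[of d m y] by (simp add: mult_less_cancel_right)
      then have ny: "1 + nsq d y \<le> (A + A') / \<eta>" using \<eta> by (simp add: pos_le_divide_eq mult.commute)
      have "\<eta> / (T - s) < (A + A') * weight d m y" using lt \<eta> weight_pos[of d "Suc m" y] by (smt (verit) mult_pos_pos)
      also have "\<dots> \<le> (A + A') * ((A + A') / \<eta>) ^ m"
        unfolding weight_def using ny AA by (intro mult_left_mono power_mono) auto
      also have "\<dots> \<le> G" by (simp add: G_def)
      finally have "\<eta> < G * (T - s)" using sy by (simp add: pos_divide_less_eq)
      then have "\<eta> / G < T - s" using G by (simp add: pos_divide_less_eq mult.commute)
      moreover have "\<bar>y i\<bar> \<le> (A + A') / \<eta>" if "i < d" for i using abs_coord_le[OF that, of y] ny by linarith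
      ultimately show ?thesis using sy by (simp add: Q_def)
    qed
    have QT: "Q \<subseteq> {0..<T} \<times> Rd d" using \<eta> G by (auto simp: Q_def) (smt (verit) divide_pos_pos)
    have "compact Q" unfolding Q_def by (intro compact_Times compact_coord_box compact_Icc)
    moreover have "continuous_on Q zz"
    proof -
      have Wc: "continuous_on Q (\<lambda>p. weight d (Suc m) (snd p))"
        unfolding weight_def nsq_def by (intro continuous_intros continuous_on_snd_coord)
      have "Q \<subseteq> {0..T} \<times> Rd d" using QT by force
      then show ?thesis unfolding zz_def Ba_def
        by (intro continuous_intros Wc continuous_on_subset[OF u(1)] continuous_on_subset[OF w(1)]) (use QT in auto)
    qed
    moreover have "(t, x) \<in> Q" using inQ z0 tx by auto
    ultimately obtain p where p: "p \<in> Q" "\<And>q. q \<in> Q \<Longrightarrow> zz q \<le> zz p"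
      using continuous_attains_sup[of Q zz] by blast
    have zp: "0 < zz p" using p(2)[OF \<open>(t, x) \<in> Q\<close>] z0 by linarith
    have pmax: "zz q \<le> zz p" if "q \<in> {0..<T} \<times> Rd d" for q
      using inQ[OF that] p(2)[of q] zp by linarith
    obtain s y where sy: "p = (s, y)" by force
    have s: "0 \<le> s" "s < T" and y: "y \<in> Rd d" using p(1) QT sy by auto
    have "s \<noteq> 0"
    proof
      assume s0: "s = 0"
      have "u p - w p \<le> e0 * weight d (Suc m) y" using init[OF y] sy s0 by simp
      also have "\<dots> \<le> (E + \<eta>) * weight d (Suc m) y" using E \<eta> by (intro mult_right_mono) (auto simp: less_imp_le)
      also have "\<dots> = Ba p" by (simp add: Ba_def sy s0)
      finally have "zz p \<le> - (\<eta> / T)" by (simp add: zz_def sy s0)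
      moreover have "0 < \<eta> / T" using \<eta> T by simp
      ultimately show False using zp by linarith
    qed
    then have pc: "p \<in> cyl d T" using s y sy by auto
    \<comment> \<open>Constant in space, so its generator is at most 0; the additive constant makes
      the test function equal to u at p.\<close>
    define Bb where "Bb = (\<lambda>p :: real \<times> (nat \<Rightarrow> real). \<eta> * inverse (T - fst p) + zz (s, y))"
    have Ba_el: "Ba \<in> elem d T" unfolding Ba_def
      by (intro elem_mult elem_add elem_const elem_time elem_exp weight_elem)
    have Bb_el: "Bb \<in> elem d T" unfolding Bb_def
      by (intro elem_mult elem_add elem_const elem_inverse elem_diff elem_time) auto
    have BaC: "C_k_on 2 d T Ba" and BbC: "C_k_on 2 d T Bb" using Ba_el Bb_el elem_C_k_on by auto
    have wBa: "C_k_on 2 d T (\<lambda>q. w q + 1 * Ba q)" by (rule C_k_on_add_scaled[OF wC BaC])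
    let ?H = "\<lambda>q. (w q + 1 * Ba q) + 1 * Bb q"
    have HC: "C_k_on 2 d T ?H" by (rule C_k_on_add_scaled[OF wBa BbC])
    have "u q \<le> ?H q" if "q \<in> cyl d T" for q
      using pmax[of q] that by (auto simp: zz_def Bb_def sy divide_inverse)
    moreover have "?H p = u p" by (simp add: zz_def Bb_def sy divide_inverse)
    ultimately have "partial None ?H p \<le> gen ?H p + e1 * weight d (Suc m) (snd p)"
      using u(3) pc HC unfolding subsol_def by blast
    moreover have "partial None ?H p = partial None w p + partial None Ba p + partial None Bb p"
      using partial_None_diff[OF wBa BbC pc, of 1] partial_None_diff[OF wC BaC pc, of 1] by simp
    moreover have "gen ?H p = gen w p + gen Ba p + gen Bb p"
      using gen_add_scaled[OF wBa BbC pc, of 1] gen_add_scaled[OF wC BaC pc, of 1] by simp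
    moreover have "gen Bb p \<le> 0"
      unfolding sy by (rule gen_nonpos_at_max[OF BbC, of _ _ 1]) (use pc sy in \<open>auto simp: Bb_def\<close>)
    moreover have "gen Ba p \<le> K * ((E + \<eta>) * (1 + s) * exp (K * s) * weight d (Suc m) y)"
      unfolding sy K_def[of] by (rule gen_weight_le[OF BaC]) (use pc sy E \<eta> s in \<open>auto simp: Ba_def K_def\<close>)
    moreover have "partial None Bb p = \<eta> * (inverse (T - s) * inverse (T - s))"
    proof (rule partial_eqI)
      have "((\<lambda>r. \<eta> * inverse (T - (s + r)) + zz (s, y)) has_real_derivative \<eta> * (inverse (T - s) * inverse (T - s))) (at 0)"
        using s by (auto intro!: derivative_eq_intros simp: power2_eq_square)
      then show "((\<lambda>r. Bb (move None r p)) has_real_derivative \<eta> * (inverse (T - s) * inverse (T - s))) (at 0)"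
        by (simp add: Bb_def sy)
    qed
    moreover have "partial None Ba p = ((E + \<eta>) * exp (K * s) + K * ((E + \<eta>) * (1 + s) * exp (K * s))) * weight d (Suc m) y"
    proof (rule partial_eqI)
      have "((\<lambda>r. (E + \<eta>) * (1 + (s + r)) * exp (K * (s + r)) * weight d (Suc m) y) has_real_derivative
          ((E + \<eta>) * exp (K * s) + K * ((E + \<eta>) * (1 + s) * exp (K * s))) * weight d (Suc m) y) (at 0)"
        by (auto intro!: derivative_eq_intros simp: algebra_simps)
      then show "((\<lambda>r. Ba (move None r p)) has_real_derivative
          ((E + \<eta>) * exp (K * s) + K * ((E + \<eta>) * (1 + s) * exp (K * s))) * weight d (Suc m) y) (at 0)"
        by (simp add: Ba_def sy)
    qed
    moreover have "gen w p \<le> partial None w p + e2 * weight d (Suc m) y"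
    proof -
      have "\<bar>partial None w p - gen w p\<bar> \<le> e2 * weight d (Suc m) (snd p)" using w(3) pc unfolding approx_sol_def by blast
      then show ?thesis unfolding abs_le_iff by (simp add: sy)
    qed
    ultimately have "(E + \<eta>) * exp (K * s) * weight d (Suc m) y + \<eta> * (inverse (T - s) * inverse (T - s)) \<le> (e1 + e2) * weight d (Suc m) y"
      by (simp add: sy algebra_simps)
    moreover have "(e1 + e2) * weight d (Suc m) y \<le> (E + \<eta>) * exp (K * s) * weight d (Suc m) y"
    proof (rule mult_right_mono)
      have "e1 + e2 \<le> (E + \<eta>) * 1" using E \<eta> by simp
      also have "\<dots> \<le> (E + \<eta>) * exp (K * s)" using E \<eta> K s by (intro mult_left_mono) auto
      finally show "e1 + e2 \<le> (E + \<eta>) * exp (K * s)" .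
    qed (simp add: less_imp_le)
    moreover have "0 < \<eta> * (inverse (T - s) * inverse (T - s))" using \<eta> s by simp
    ultimately show False by linarith
  qed
  have lt: "u (t, x) - w (t, x) \<le> E * ((1 + T) * exp (K * T)) * weight d (Suc m) x"
    if t: "t \<in> {0..<T}" for t
  proof -
    have "u (t, x) - w (t, x) \<le> E * ((1 + t) * exp (K * t)) * weight d (Suc m) x"
    proof (rule le_of_le_add_scaled_epsilon)
      show "0 \<le> (1 + t) * exp (K * t) * weight d (Suc m) x + 1 / (T - t)" using t by (auto simp: less_imp_le)
      fix \<eta> :: real assume "0 < \<eta>"
      from main[OF this t tx(2)]
      show "u (t, x) - w (t, x) \<le> E * ((1 + t) * exp (K * t)) * weight d (Suc m) x + \<eta> * ((1 + t) * exp (K * t) * weight d (Suc m) x + 1 / (T - t))"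
        by (simp add: algebra_simps)
    qed
    also have "\<dots> \<le> E * ((1 + T) * exp (K * T)) * weight d (Suc m) x"
      using t E K by (intro mult_right_mono mult_left_mono mult_mono) (auto simp: less_imp_le mult_left_mono)
    finally show ?thesis .
  qed
  show ?thesis
  proof (cases "t = T")
    case False then show ?thesis using lt tx by auto
  next
    case True
    \<comment> \<open>The barrier is singular at T, so the terminal time is reached by continuity of
      u - w.\<close>
    define tn where "tn = (\<lambda>n. T - T * inverse (real (Suc n)))"
    have tn: "tn n \<in> {0..<T}" for n using T by (auto simp: tn_def field_simps)
    have "tn \<longlonglongrightarrow> T - T * 0" unfolding tn_def by (intro tendsto_intros LIMSEQ_inverse_real_of_nat)
    then have lim: "(\<lambda>n. (tn n, x)) \<longlonglongrightarrow> (T, x)" by (intro tendsto_Pair) auto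
    have "continuous_on ({0..T} \<times> Rd d) (\<lambda>p. u p - w p)" by (intro continuous_intros u w)
    then have "((\<lambda>p. u p - w p) \<circ> (\<lambda>n. (tn n, x))) \<longlonglongrightarrow> u (T, x) - w (T, x)"
      using lim tn tx T unfolding continuous_on_sequentially by (force simp: less_imp_le)
    then show ?thesis unfolding True using lt[OF tn] by (intro LIMSEQ_le_const2[where X = "\<lambda>n. u (tn n, x) - w (tn n, x)"]) (auto simp: o_def)
  qed
qed

end

section \<open>Existence and uniqueness\<close>

context affine_coeffs
begin

text \<open>A penalty that makes a contact strict without being felt by the equation there: the
  square in time has zero derivative at t0, and the fourth power of |x - x0| has zero gradient and
  Hessian at x0. The latter is seen from its restriction s^4 |y|^4 to lines.\<close>

lemma quartic_bump:
  fixes t0 :: real and x0 :: "nat \<Rightarrow> real"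
  defines "g \<equiv> \<lambda>p. (fst p - t0)\<^sup>2 + (\<Sum>i<d. (snd p i - x0 i)\<^sup>2)\<^sup>2"
  assumes p: "(t0, x0) \<in> cyl d T"
  shows "g \<in> elem d T" "partial None g (t0, x0) = 0" "gen g (t0, x0) = 0"
proof -
  show el: "g \<in> elem d T" unfolding g_def
    by (intro elem_add elem_power elem_sum elem_diff elem_time elem_const elem_coord) auto
  show "partial None g (t0, x0) = 0"
    by (rule partial_eqI) (auto intro!: derivative_eq_intros simp: g_def)
  have "dir1 d g (t0, \<lambda>i. x0 i + s * y i) y = 4 * s ^ 3 * (nsq d y)\<^sup>2" if "y \<in> Rd d" for y s
  proof -
    have e: "g (t0, \<lambda>i. x0 i + s * y i) = s ^ 4 * (nsq d y)\<^sup>2" for s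
      by (simp add: g_def nsq_def power_mult_distrib sum_distrib_left[symmetric])
    have "((\<lambda>s. g (t0, \<lambda>i. x0 i + s * y i)) has_real_derivative 4 * s ^ 3 * (nsq d y)\<^sup>2) (at s)"
      unfolding e by (auto intro!: derivative_eq_intros)
    then show ?thesis using DERIV_unique line_derivative[OF elem_C_k_on[OF el, of "Suc 0"] p that, of s] by blast
  qed
  note d1 = this
  have d1z: "dir1 d g (t0, x0) y = 0" if "y \<in> Rd d" for y using d1[OF that, of 0] by simp
  have d2z: "dir2 d g (t0, x0) y = 0" if "y \<in> Rd d" for y
  proof -
    have "((\<lambda>s. 4 * s ^ 3 * (nsq d y)\<^sup>2) has_real_derivative 0) (at 0)" by (auto intro!: derivative_eq_intros)
    moreover have "((\<lambda>s. 4 * s ^ 3 * (nsq d y)\<^sup>2) has_real_derivative dir2 d g (t0, x0) y) (at 0)"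
      using line_derivative2[OF elem_C_k_on[OF el, of "Suc (Suc 0)"] p that, of 0] unfolding d1[OF that] by simp
    ultimately show ?thesis using DERIV_unique by blast
  qed
  show "gen g (t0, x0) = 0" by (simp add: gen_def d1z d2z is_affine_Rd L_affine S_affine)
qed

lemma weight_bounded_on_box: "\<exists>B. \<forall>x. (\<forall>i<d. \<bar>x i - y i\<bar> \<le> r) \<longrightarrow> weight d m x \<le> B"
proof -
  have "weight d m x \<le> (1 + (\<Sum>i<d. (\<bar>y i\<bar> + \<bar>r\<bar>)\<^sup>2)) ^ m" if "\<forall>i<d. \<bar>x i - y i\<bar> \<le> r" for x
    unfolding weight_def nsq_def
  proof (rule power_mono, intro add_left_mono sum_mono)
    fix i assume "i \<in> {..<d}"
    then have "\<bar>x i - y i\<bar> \<le> r" using that by auto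
    then have "\<bar>x i\<bar> \<le> \<bar>y i\<bar> + \<bar>r\<bar>" by linarith
    then show "(x i)\<^sup>2 \<le> (\<bar>y i\<bar> + \<bar>r\<bar>)\<^sup>2" by (metis abs_ge_zero power2_abs power_mono)
  qed (simp add: add_nonneg_nonneg sum_nonneg)
  then show ?thesis by blast
qed

text \<open>The bump makes the contact at p strict, so for a large n the maximum of
  \<open>w n\<close> - \<open>H\<close> over a small box lies in its interior. There the approximate
  equation of \<open>w n\<close> nearly gives the test inequality, which by continuity fails by a
  fixed amount on the whole box.\<close>

lemma subsol_limit:
  assumes w: "\<And>n. approx_sol T (e n) m (w n)" and e: "e \<longlonglongrightarrow> 0" and e0: "\<And>n. 0 \<le> e n" and D: "0 \<le> D"
    and conv: "\<And>n p. p \<in> cyl d T \<Longrightarrow> \<bar>w n p - u p\<bar> \<le> e n * D * weight d m (snd p)"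
  shows "subsol T 0 m u"
  unfolding subsol_def
proof (intro ballI allI impI)
  fix p h assume p: "p \<in> cyl d T" and h: "C_k_on 2 d T h \<and> (\<forall>q\<in>cyl d T. h q \<ge> u q) \<and> h p = u p"
  obtain t0 x0 where tx: "p = (t0, x0)" by force
  have t0: "0 < t0" "t0 < T" and x0: "x0 \<in> Rd d" and pc: "(t0, x0) \<in> cyl d T" using p tx by auto
  define g where "g = (\<lambda>p. (fst p - t0)\<^sup>2 + (\<Sum>i<d. (snd p i - x0 i)\<^sup>2)\<^sup>2)"
  note g = quartic_bump[OF pc, folded g_def]
  have gC: "C_k_on n d T g" for n by (rule elem_C_k_on[OF g(1)])
  define H where "H = (\<lambda>q. h q + 1 * g q)"
  have HC: "C_k_on 2 d T H" unfolding H_def using h gC by (intro C_k_on_add_scaled) auto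
  have pH: "partial None H p = partial None h p" "gen H p = gen h p"
    unfolding H_def using partial_None_diff[of T h g p 1] gen_add_scaled[of T h g p 1] h gC p g(2,3) tx by auto
  show "partial None h p \<le> gen h p + 0 * weight d m (snd p)"
  proof (rule ccontr)
    assume neg: "\<not> ?thesis"
    define c where "c = (partial None H p - gen H p) / 2"
    have c: "0 < c" using neg by (simp add: c_def pH)
    have "continuous_on (cyl d T) (\<lambda>q. partial None H q - gen H q)"
      using C_k_on_imp_continuous[OF C_k_on_partial[of 1 d T H None]] HC gen_continuous[OF HC]
      by (intro continuous_intros) (auto simp: numeral_2_eq_2)
    moreover have "cyl d T \<subseteq> UNIV \<times> Rd d" by auto
    ultimately obtain \<delta> where d0: "0 < \<delta>" "\<forall>q\<in>cyl d T. \<bar>fst q - fst p\<bar> < \<delta> \<longrightarrow> (\<forall>i<d. \<bar>snd q i - snd p i\<bar> < \<delta>) \<longrightarrow>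
        \<bar>(partial None H q - gen H q) - (partial None H p - gen H p)\<bar> < c"
      using continuous_on_coord_delta[OF _ _ p c] by blast
    then have \<delta>: "0 < \<delta>" "\<And>q. q \<in> cyl d T \<Longrightarrow> \<bar>fst q - t0\<bar> < \<delta> \<Longrightarrow> (\<And>i. i < d \<Longrightarrow> \<bar>snd q i - x0 i\<bar> < \<delta>) \<Longrightarrow>
        \<bar>(partial None H q - gen H q) - (partial None H p - gen H p)\<bar> < c"
      unfolding tx fst_conv snd_conv by blast+
    define r where "r = min \<delta> (min t0 (T - t0)) / 2"
    have r: "0 < r" "r < \<delta>" "r < t0" "r < T - t0" using \<delta>(1) t0 by (auto simp: r_def min_def)
    define Q where "Q = {t0 - r..t0 + r} \<times> {x \<in> Rd d. \<forall>i<d. \<bar>x i - x0 i\<bar> \<le> r}"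
    have Qc: "Q \<subseteq> cyl d T" using r by (auto simp: Q_def)
    have pQ: "p \<in> Q" using r x0 by (auto simp: Q_def tx)
    obtain B where B: "\<And>x. (\<forall>i<d. \<bar>x i - x0 i\<bar> \<le> r) \<Longrightarrow> weight d m x \<le> B" using weight_bounded_on_box[of x0 r m] by blast
    have B1: "1 \<le> B" using order_trans[OF weight_ge_1 B[of x0]] r by simp
    \<comment> \<open>A lower bound for the bump on the boundary of the box: r^2 where the time is
      extremal, r^4 where a space coordinate is.\<close>
    define g0 where "g0 = min (r\<^sup>2) (r ^ 4)"
    have g0: "0 < g0" using r by (simp add: g0_def)
    \<comment> \<open>The distance of u and \<open>w n\<close> costs a third of \<open>g0\<close> at
      p and another at the maximum, less than the bump gains at the boundary. The error in the
      equation is at most c/2, against a gap of 2 c at p that stays above c on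
      \<open>Q\<close>.\<close>
    define b where "b = min (g0 / 3) (c / 2)"
    have b: "0 < b" using g0 c by (simp add: b_def)
    have "\<forall>\<^sub>F n in sequentially. e n * ((D + 1) * B) < b"
    proof -
      have "(\<lambda>n. e n * ((D + 1) * B)) \<longlonglongrightarrow> 0 * ((D + 1) * B)" by (intro tendsto_intros e)
      then show ?thesis using b by (simp add: order_tendstoD)
    qed
    then obtain n where n: "e n * ((D + 1) * B) < b" using eventually_happens'[OF sequentially_bot] by blast
    have eW: "e n * weight d m (snd q) \<le> b" "e n * D * weight d m (snd q) \<le> b" if "q \<in> Q" for q
    proof -
      have WB: "weight d m (snd q) \<le> B" using that B by (auto simp: Q_def)
      have "e n * (1 * weight d m (snd q)) \<le> e n * ((D + 1) * B)"
        using e0 D WB by (intro mult_left_mono mult_mono) (auto simp: less_imp_le)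
      then show "e n * weight d m (snd q) \<le> b" using n by simp
      have "e n * (D * weight d m (snd q)) \<le> e n * ((D + 1) * B)"
        using e0 D WB by (intro mult_left_mono mult_mono) (auto simp: less_imp_le)
      then show "e n * D * weight d m (snd q) \<le> b" using n by simp
    qed
    let ?v = "w n"
    have vC: "C_k_on 2 d T ?v" using w by (simp add: approx_sol_def)
    define f where "f = (\<lambda>q. ?v q + (-1) * H q)"
    have fC: "C_k_on 2 d T f" unfolding f_def by (rule C_k_on_add_scaled[OF vC HC])
    have "compact Q" unfolding Q_def by (intro compact_Times compact_coord_box compact_Icc)
    then obtain q where q: "q \<in> Q" "\<And>q'. q' \<in> Q \<Longrightarrow> f q' \<le> f q"
      using continuous_attains_sup[of Q f] pQ continuous_on_subset[OF C_k_on_imp_continuous[OF fC] Qc] by blast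
    obtain s y where sy: "q = (s, y)" by force
    have qc: "(s, y) \<in> cyl d T" using q(1) Qc sy by auto
    have yb: "\<bar>y i - x0 i\<bar> \<le> r" if "i < d" for i using q(1) that by (auto simp: Q_def sy)
    have yR: "y \<in> Rd d" using qc by auto
    have lower: "- (g0 / 3) \<le> f q"
    proof -
      have "\<bar>?v p - u p\<bar> \<le> g0 / 3" using conv[OF p, of n] eW(2)[OF pQ] by (simp add: b_def)
      moreover have "H p = u p" using h by (simp add: H_def g_def tx)
      ultimately show ?thesis using q(2)[OF pQ] unfolding f_def by linarith
    qed
    have upper: "f q \<le> g0 / 3 - g q"
    proof -
      have "\<bar>?v q - u q\<bar> \<le> g0 / 3" using conv[of q n] Qc q(1) eW(2)[OF q(1)] by (auto simp: b_def)
      moreover have "u q \<le> h q" using h Qc q(1) by blast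
      moreover have "f q = ?v q - h q - g q" by (simp add: f_def H_def)
      ultimately show ?thesis using abs_ge_self[of "?v q - u q"] by linarith
    qed
    have gq: "g q < g0" using lower upper g0 by linarith
    have int_t: "\<bar>s - t0\<bar> < r"
    proof (rule ccontr)
      assume "\<not> ?thesis"
      then have "r\<^sup>2 \<le> (s - t0)\<^sup>2" using r by (metis abs_le_square_iff abs_of_pos not_less)
      also have "\<dots> \<le> g q" by (simp add: g_def sy)
      finally show False using gq by (simp add: g0_def)
    qed
    have int_x: "\<bar>y i - x0 i\<bar> < r" if "i < d" for i
    proof (rule ccontr)
      assume "\<not> ?thesis"
      then have "r\<^sup>2 \<le> (y i - x0 i)\<^sup>2" using r by (metis abs_le_square_iff abs_of_pos not_less)
      also have "\<dots> \<le> (\<Sum>i<d. (y i - x0 i)\<^sup>2)" using that by (intro member_le_sum) auto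
      finally have "(r\<^sup>2)\<^sup>2 \<le> (\<Sum>i<d. (y i - x0 i)\<^sup>2)\<^sup>2" by (intro power_mono) auto
      also have "\<dots> \<le> g q" by (simp add: g_def sy)
      finally show False using gq by (simp add: g0_def power_mult[symmetric])
    qed
    have "\<exists>\<rho>>0. \<forall>i\<in>{..<d}. \<bar>y i - x0 i\<bar> + \<rho> \<le> r"
      by (rule finite_uniform_delta) (use int_x in \<open>auto intro!: exI[of _ "r - \<bar>y _ - x0 _\<bar>"]\<close>)
    then obtain \<rho> where \<rho>: "0 < \<rho>" "\<And>i. i < d \<Longrightarrow> \<bar>y i - x0 i\<bar> + \<rho> \<le> r" by auto
    have "partial None f (s, y) = 0"
    proof (rule partial_None_zero_at_max[OF fC qc, of "r - \<bar>s - t0\<bar>"])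
      fix s' assume "\<bar>s' - s\<bar> < r - \<bar>s - t0\<bar>"
      then have "(s', y) \<in> Q" using yb yR by (auto simp: Q_def abs_le_iff) 
      then show "f (s', y) \<le> f (s, y)" using q(2) sy by simp
    qed (use int_t in simp)
    moreover have "gen f (s, y) \<le> 0"
    proof (rule gen_nonpos_at_max[OF fC qc \<rho>(1)])
      fix y' assume y': "y' \<in> Rd d" "\<And>i. i < d \<Longrightarrow> \<bar>y' i - y i\<bar> < \<rho>"
      have "\<bar>y' i - x0 i\<bar> \<le> r" if "i < d" for i using y'(2)[OF that] \<rho>(2)[OF that] by linarith
      then have "(s, y') \<in> Q" using y' int_t by (auto simp: Q_def abs_less_iff)
      then show "f (s, y') \<le> f (s, y)" using q(2) sy by simp
    qed
    moreover have "partial None f (s, y) = partial None ?v (s, y) + (-1) * partial None H (s, y)"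
      "gen f (s, y) = gen ?v (s, y) + (-1) * gen H (s, y)"
      unfolding f_def using partial_None_diff[OF vC HC qc] gen_add_scaled[OF vC HC qc] by blast+
    moreover have "\<bar>partial None ?v (s, y) - gen ?v (s, y)\<bar> \<le> e n * weight d m (snd (s, y))"
      using w[of n] qc unfolding approx_sol_def by blast
    moreover have "e n * weight d m (snd (s, y)) \<le> c / 2" using eW(1)[OF q(1)] by (simp add: sy b_def)
    ultimately have "partial None H (s, y) - gen H (s, y) \<le> c / 2" by (simp add: abs_le_iff)
    moreover have "\<bar>(partial None H (s, y) - gen H (s, y)) - (partial None H p - gen H p)\<bar> < c"
      by (rule \<delta>(2)[OF qc]) (use int_t int_x r in \<open>auto intro: less_trans\<close>)
    ultimately show False using c by (simp add: c_def abs_less_iff)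
  qed
qed

section \<open>Solutions as limits of schemes\<close>

lemma it_zero [simp]: "it h 0 k f x = f x"
  by (induction k) auto

lemma scheme_0: "scheme h N f (0, x) = f x"
  by (simp add: scheme_def)

text \<open>Solutions of growth degree m, with the supersolution property phrased for -u, so that
  \<open>comparison\<close> applies to u and to -u alike.\<close>

definition is_solution :: "real \<Rightarrow> ((nat \<Rightarrow> real) \<Rightarrow> real) \<Rightarrow> nat \<Rightarrow> (real \<times> (nat \<Rightarrow> real) \<Rightarrow> real) \<Rightarrow> bool" where
  "is_solution T \<phi> m u \<longleftrightarrow> continuous_on ({0..T} \<times> Rd d) u \<and> (\<forall>x\<in>Rd d. u (0, x) = \<phi> x) \<and>
     (\<exists>A. \<forall>p\<in>{0..T} \<times> Rd d. \<bar>u p\<bar> \<le> A * weight d m (snd p)) \<and> subsol T 0 (Suc m) u \<and> subsol T 0 (Suc m) (\<lambda>p. - u p)"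

definition stab :: "real \<Rightarrow> nat \<Rightarrow> real" where
  "stab T m = (1 + T) * exp (growth_rate C (Suc m) * T)"

text \<open>The initial function and the equation are approximated with the same accuracy e, which
  by \<open>comparison\<close> then controls the distance of the scheme to any solution.\<close>

definition good :: "real \<Rightarrow> ((nat \<Rightarrow> real) \<Rightarrow> real) \<Rightarrow> nat \<Rightarrow> real \<Rightarrow> (real \<times> (nat \<Rightarrow> real) \<Rightarrow> real) \<Rightarrow> real \<Rightarrow> nat \<Rightarrow> bool" where
  "good T \<phi> m e F h N \<longleftrightarrow> F \<in> Dalg d \<and> 0 < h \<and> h \<le> h_max \<and> 0 < N \<and> T \<le> real N * h \<and>
    (\<forall>x\<in>Rd d. \<bar>F (0, x) - \<phi> x\<bar> \<le> e * weight d (Suc m) x) \<and> approx_sol T e (Suc m) (scheme h N (\<lambda>x. F (0, x)))"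

lemma good_exists:
  assumes T: "0 < T" and \<phi>: "continuous_on (Rd d) \<phi>" "\<And>x. x \<in> Rd d \<Longrightarrow> \<bar>\<phi> x\<bar> \<le> A * weight d m x" and m: "1 \<le> m" and e: "0 < e"
  shows "\<exists>F h N. good T \<phi> m e F h N"
proof -
  obtain F where F: "F \<in> Dalg d" "\<And>x. x \<in> Rd d \<Longrightarrow> \<bar>F (0, x) - \<phi> x\<bar> \<le> e * weight d (Suc m) x"
    using Dalg_dense[OF \<phi> e] by blast
  obtain h N where hN: "0 < h" "h \<le> h_max" "0 < N" "T \<le> real N * h"
    "\<And>p. p\<in>cyl d T \<Longrightarrow> \<bar>partial None (scheme h N (\<lambda>x. F (0, x))) p - gen (scheme h N (\<lambda>x. F (0, x))) p\<bar> \<le> e * weight d 2 (snd p)"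
    using scheme_approximate_solution[OF F(1) T e] by blast
  have "(\<lambda>p. F (0, snd p)) = F" using Dalg_snd[OF F(1)] by (auto simp: fun_eq_iff)
  then have "scheme h N (\<lambda>x. F (0, x)) \<in> elem d T"
    unfolding scheme_def using Dalg_elem[OF F(1), of T] by (intro it_elem) simp
  moreover have "e * weight d 2 x \<le> e * weight d (Suc m) x" for x using e m by (intro mult_left_mono weight_mono) auto
  ultimately have "approx_sol T e (Suc m) (scheme h N (\<lambda>x. F (0, x)))"
    unfolding approx_sol_def using elem_C_k_on hN(5) order_trans by blast
  then show ?thesis unfolding good_def using F hN by blast
qed

lemma good_continuous: "good T \<phi> m e F h N \<Longrightarrow> continuous_on Y (scheme h N (\<lambda>x. F (0, x)))"
proof -
  assume "good T \<phi> m e F h N"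
  then have F: "F \<in> Dalg d" by (simp add: good_def)
  have "continuous_on UNIV (\<lambda>x::nat \<Rightarrow> real. F (0, x))"
    by (rule continuous_on_compose2[OF Dalg_continuous[OF F, of UNIV]]) (auto intro!: continuous_intros)
  then show ?thesis unfolding scheme_def using it_continuous continuous_on_subset by blast
qed

lemma good_tau:
  assumes "good T \<phi> m e F h N" "t \<in> {0..T}"
  shows "0 \<le> 1 / (real N * h) * t" "1 / (real N * h) * t \<le> 1"
  using assms by (auto simp: good_def divide_le_eq_1_pos intro: order_trans)

lemma good_bounded: "good T \<phi> m e F h N \<Longrightarrow> \<exists>B\<ge>0. \<forall>p\<in>{0..T} \<times> Rd d. \<bar>scheme h N (\<lambda>x. F (0, x)) p\<bar> \<le> B * weight d n (snd p)"
proof -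
  assume g: "good T \<phi> m e F h N"
  then have F: "F \<in> Dalg d" by (simp add: good_def)
  obtain B where B: "\<And>p. \<bar>F p\<bar> \<le> B" using Dalg_bounded[OF F] by blast
  then have B0: "0 \<le> B" by (meson abs_ge_zero order_trans)
  have "\<bar>scheme h N (\<lambda>x. F (0, x)) p\<bar> \<le> B * weight d n (snd p)" if "p \<in> {0..T} \<times> Rd d" for p
  proof -
    have "\<bar>scheme h N (\<lambda>x. F (0, x)) p\<bar> \<le> B"
      unfolding scheme_def by (rule abs_it_le) (use that good_tau[OF g, of "fst p"] B in auto)
    also have "\<dots> \<le> B * weight d n (snd p)" using B0 weight_ge_1[of d n "snd p"] by (simp add: mult_le_cancel_left1)
    finally show ?thesis .
  qed
  then show ?thesis using B0 by blast
qed

lemma uminus_scheme_init: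
  "good T \<phi> m e F h N \<Longrightarrow> x \<in> Rd d \<Longrightarrow> \<bar>scheme h N (\<lambda>x. F (0, x)) (0, x) - \<phi> x\<bar> \<le> e * weight d (Suc m) x"
  by (simp add: good_def scheme_0)

lemma solution_near_scheme:
  assumes T: "0 < T" and u: "is_solution T \<phi> m u" and g: "good T \<phi> m e F h N" and e: "0 \<le> e" and p: "p \<in> {0..T} \<times> Rd d"
  shows "\<bar>u p - scheme h N (\<lambda>x. F (0, x)) p\<bar> \<le> e * stab T m * weight d (Suc m) (snd p)"
proof -
  let ?w = "scheme h N (\<lambda>x. F (0, x))"
  obtain t x where tx: "p = (t, x)" "t \<in> {0..T}" "x \<in> Rd d" using p by auto
  obtain A where A: "\<And>p. p\<in>{0..T} \<times> Rd d \<Longrightarrow> \<bar>u p\<bar> \<le> A * weight d m (snd p)" using u unfolding is_solution_def by blast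
  obtain B where B: "\<And>p. p\<in>{0..T} \<times> Rd d \<Longrightarrow> \<bar>?w p\<bar> \<le> B * weight d m (snd p)" using good_bounded[OF g] by blast
  have ap: "approx_sol T e (Suc m) ?w" using g by (simp add: good_def)
  have i: "\<bar>u (0, x) - ?w (0, x)\<bar> \<le> e * weight d (Suc m) x" if "x \<in> Rd d" for x
    using uminus_scheme_init[OF g that] u that by (auto simp: is_solution_def abs_minus_commute)
  have uc: "continuous_on ({0..T} \<times> Rd d) u" using u by (simp add: is_solution_def)
  have 1: "u (t, x) - ?w (t, x) \<le> e * ((1 + T) * exp (growth_rate C (Suc m) * T)) * weight d (Suc m) x"
  proof (rule comparison[OF T uc A _ good_continuous[OF g] B ap _ e _ _ tx(2,3)])
    show "subsol T 0 (Suc m) u" using u by (simp add: is_solution_def)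
    show "u (0, x) - ?w (0, x) \<le> e * weight d (Suc m) x" if "x \<in> Rd d" for x using i[OF that] by linarith
  qed auto
  have 2: "(- u (t, x)) - (- ?w (t, x)) \<le> e * ((1 + T) * exp (growth_rate C (Suc m) * T)) * weight d (Suc m) x"
  proof (rule comparison[where u = "\<lambda>p. - u p" and w = "\<lambda>p. - ?w p", OF T _ _ _ _ _ approx_sol_uminus[OF ap] _ e _ _ tx(2,3)])
    show "continuous_on ({0..T} \<times> Rd d) (\<lambda>p. - u p)" by (intro continuous_intros uc)
    show "continuous_on ({0..T} \<times> Rd d) (\<lambda>p. - ?w p)" by (intro continuous_intros good_continuous[OF g])
    show "subsol T 0 (Suc m) (\<lambda>p. - u p)" using u by (simp add: is_solution_def)
    show "\<bar>- u p\<bar> \<le> A * weight d m (snd p)" if "p\<in>{0..T} \<times> Rd d" for p using A[OF that] by simp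
    show "\<bar>- ?w p\<bar> \<le> B * weight d m (snd p)" if "p\<in>{0..T} \<times> Rd d" for p using B[OF that] by simp
    show "- u (0, x) - - ?w (0, x) \<le> e * weight d (Suc m) x" if "x \<in> Rd d" for x using i[OF that] by linarith
  qed auto
  show ?thesis unfolding tx stab_def using 1 2 by (simp add: abs_le_iff)
qed

lemma stab_nonneg: "0 \<le> T \<Longrightarrow> 0 \<le> stab T m"
  by (simp add: stab_def)

theorem solution_unique:
  assumes T: "0 < T" and \<phi>: "continuous_on (Rd d) \<phi>" "\<And>x. x \<in> Rd d \<Longrightarrow> \<bar>\<phi> x\<bar> \<le> A * weight d m x" and m: "1 \<le> m"
    and u: "is_solution T \<phi> m u" "is_solution T \<phi> m u'" and p: "p \<in> {0..T} \<times> Rd d"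
  shows "u p = u' p"
proof -
  have "\<bar>u p - u' p\<bar> \<le> 0"
  proof (rule le_of_le_add_scaled_epsilon)
    show "0 \<le> 2 * stab T m * weight d (Suc m) (snd p)" using stab_nonneg T by (simp add: less_imp_le)
    fix \<eta> :: real assume e: "0 < \<eta>"
    then obtain F h N where g: "good T \<phi> m \<eta> F h N" using good_exists[OF T \<phi> m] by blast
    show "\<bar>u p - u' p\<bar> \<le> 0 + \<eta> * (2 * stab T m * weight d (Suc m) (snd p))"
      using solution_near_scheme[OF T u(1) g _ p] solution_near_scheme[OF T u(2) g _ p] e by simp
  qed
  then show ?thesis by simp
qed

text \<open>Schemes of accuracy 1/(n+1) form a Cauchy sequence in the weighted sup norm, since each
  can take either role in \<open>comparison\<close>. The limit is controlled only by the weight of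
  degree \<open>Suc m\<close>, which is why the degree of the solution rises.\<close>

theorem solution_exists:
  assumes T: "0 < T" and \<phi>: "continuous_on (Rd d) \<phi>" "\<And>x. x \<in> Rd d \<Longrightarrow> \<bar>\<phi> x\<bar> \<le> A * weight d m x" and m: "1 \<le> m"
  shows "\<exists>u. is_solution T \<phi> (Suc m) u"
proof -
  define e where "e = (\<lambda>n. inverse (real (Suc n)))"
  have e: "e \<longlonglongrightarrow> 0" "\<And>n. 0 < e n" unfolding e_def by (rule LIMSEQ_inverse_real_of_nat) simp
  have "\<forall>n. \<exists>F h N. good T \<phi> m (e n) F h N" using good_exists[OF T \<phi> m] e(2) by blast
  then obtain F h N where g: "\<And>n. good T \<phi> m (e n) (F n) (h n) (N n)" by metis
  define w where "w = (\<lambda>n. scheme (h n) (N n) (\<lambda>x. F n (0, x)))"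
  let ?X = "{0..T} \<times> Rd d"
  have ap: "approx_sol T (e n) (Suc m) (w n)" for n using g by (simp add: good_def w_def)
  have diff: "w n p - w k p \<le> (e n + e k) * stab T m * weight d (Suc m) (snd p)" if p: "p \<in> ?X" for n k p
  proof -
    obtain t x where tx: "p = (t, x)" "t \<in> {0..T}" "x \<in> Rd d" using p by auto
    obtain B where B: "\<And>p. p\<in>?X \<Longrightarrow> \<bar>w n p\<bar> \<le> B * weight d m (snd p)" using good_bounded[OF g] unfolding w_def by blast
    obtain B' where B': "\<And>p. p\<in>?X \<Longrightarrow> \<bar>w k p\<bar> \<le> B' * weight d m (snd p)" using good_bounded[OF g] unfolding w_def by blast
    have wc: "continuous_on ?X (w n)" for n unfolding w_def by (rule good_continuous[OF g])
    have "w n (t, x) - w k (t, x) \<le> (e n + e k) * ((1 + T) * exp (growth_rate C (Suc m) * T)) * weight d (Suc m) x"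
    proof (rule comparison[OF T wc B approx_sol_imp_subsol[OF ap] wc B' ap _ _ _ _ tx(2,3)])
      show "w n (0, x) - w k (0, x) \<le> (e n + e k) * weight d (Suc m) x" if "x \<in> Rd d" for x
        using uminus_scheme_init[OF g that, of n] uminus_scheme_init[OF g that, of k] by (simp add: w_def algebra_simps)
    qed (use e(2) in \<open>auto simp: less_imp_le add_nonneg_nonneg\<close>)
    then show ?thesis by (simp add: tx stab_def)
  qed
  have diff': "\<bar>w n p - w k p\<bar> \<le> (e n + e k) * stab T m * weight d (Suc m) (snd p)" if p: "p \<in> ?X" for n k p
    using diff[OF p, of n k] diff[OF p, of k n] by (simp add: abs_le_iff add.commute)
  define u where "u = (\<lambda>p. lim (\<lambda>n. w n p))"
  have lim: "(\<lambda>n. w n p) \<longlonglongrightarrow> u p" if p: "p \<in> ?X" for p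
  proof -
    let ?Z = "stab T m * weight d (Suc m) (snd p)"
    have Z: "0 \<le> ?Z" using stab_nonneg T by (simp add: less_imp_le)
    have "Cauchy (\<lambda>n. w n p)"
    proof (rule CauchyI)
      fix \<epsilon> :: real assume ep: "0 < \<epsilon>"
      have "(\<lambda>n. e n * ?Z) \<longlonglongrightarrow> 0 * ?Z" by (intro tendsto_intros e)
      then have "\<forall>\<^sub>F n in sequentially. e n * ?Z < \<epsilon> / 2" using ep by (intro order_tendstoD(2)) auto
      then obtain M where M: "\<And>n. n \<ge> M \<Longrightarrow> e n * ?Z < \<epsilon> / 2" by (auto simp: eventually_sequentially)
      have "norm (w n p - w k p) < \<epsilon>" if "n \<ge> M" "k \<ge> M" for n k
      proof -
        have "\<bar>w n p - w k p\<bar> \<le> e n * ?Z + e k * ?Z" using diff'[OF p, of n k] by (simp add: algebra_simps)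
        then show ?thesis using M[OF that(1)] M[OF that(2)] by simp
      qed
      then show "\<exists>M. \<forall>n\<ge>M. \<forall>k\<ge>M. norm (w n p - w k p) < \<epsilon>" by blast
    qed
    then show ?thesis unfolding u_def using Cauchy_convergent convergent_LIMSEQ_iff by blast
  qed
  have near: "\<bar>w n p - u p\<bar> \<le> e n * stab T m * weight d (Suc m) (snd p)" if p: "p \<in> ?X" for n p
  proof (rule LIMSEQ_le)
    show "(\<lambda>k. \<bar>w n p - w k p\<bar>) \<longlonglongrightarrow> \<bar>w n p - u p\<bar>" by (intro tendsto_intros lim[OF p])
    have "(\<lambda>k. (e n + e k) * stab T m * weight d (Suc m) (snd p)) \<longlonglongrightarrow> (e n + 0) * stab T m * weight d (Suc m) (snd p)"
      by (intro tendsto_intros e)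
    then show "(\<lambda>k. (e n + e k) * stab T m * weight d (Suc m) (snd p)) \<longlonglongrightarrow> e n * stab T m * weight d (Suc m) (snd p)" by simp
  qed (use diff'[OF p] in blast)
  have Wc: "continuous_on ?X (\<lambda>p. weight d (Suc m) (snd p))"
    unfolding weight_def nsq_def by (intro continuous_intros continuous_on_snd_coord)
  have Wnz: "weight d (Suc m) x \<noteq> 0" for x using weight_pos[of d "Suc m" x] by (rule less_imp_neq[symmetric])
  \<comment> \<open>Division by the weight turns convergence in the weighted norm into uniform
    convergence, which preserves continuity.\<close>
  have "continuous_on ?X (\<lambda>p. u p / weight d (Suc m) (snd p))"
  proof (rule uniform_limit_theorem[where f = "\<lambda>n p. w n p / weight d (Suc m) (snd p)" and F = sequentially])
    show "\<forall>\<^sub>F n in sequentially. continuous_on ?X (\<lambda>p. w n p / weight d (Suc m) (snd p))"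
      using Wnz by (intro always_eventually allI continuous_intros Wc) (auto simp: w_def Wnz intro: good_continuous[OF g])
    show "uniform_limit ?X (\<lambda>n p. w n p / weight d (Suc m) (snd p)) (\<lambda>p. u p / weight d (Suc m) (snd p)) sequentially"
    proof (rule uniform_limitI)
      fix \<epsilon> :: real assume ep: "0 < \<epsilon>"
      have "(\<lambda>n. e n * stab T m) \<longlonglongrightarrow> 0 * stab T m" by (intro tendsto_intros e)
      then have "\<forall>\<^sub>F n in sequentially. e n * stab T m < \<epsilon>" using ep by (simp add: order_tendstoD)
      then show "\<forall>\<^sub>F n in sequentially. \<forall>p\<in>?X. dist (w n p / weight d (Suc m) (snd p)) (u p / weight d (Suc m) (snd p)) < \<epsilon>"
      proof eventually_elim
        case (elim n)
        show ?case
        proof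
          fix p assume p: "p \<in> ?X"
          have "dist (w n p / weight d (Suc m) (snd p)) (u p / weight d (Suc m) (snd p)) = \<bar>w n p - u p\<bar> / weight d (Suc m) (snd p)"
            by (simp add: dist_real_def diff_divide_distrib[symmetric] abs_divide abs_of_pos[OF weight_pos])
          also have "\<dots> \<le> e n * stab T m" using near[OF p, of n] by (simp add: pos_divide_le_eq)
          finally show "dist (w n p / weight d (Suc m) (snd p)) (u p / weight d (Suc m) (snd p)) < \<epsilon>" using elim by simp
        qed
      qed
    qed
  qed simp
  from continuous_on_mult[OF this Wc] have uc: "continuous_on ?X u" using Wnz by simp
  obtain B where B: "0 \<le> B" "\<And>p. p\<in>?X \<Longrightarrow> \<bar>w 0 p\<bar> \<le> B * weight d (Suc m) (snd p)" using good_bounded[OF g] unfolding w_def by blast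
  have "\<bar>u p\<bar> \<le> (B + e 0 * stab T m) * weight d (Suc m) (snd p)" if p: "p \<in> ?X" for p
    using near[OF p, of 0] B(2)[OF p] by (simp add: algebra_simps)
  moreover have "u (0, x) = \<phi> x" if x: "x \<in> Rd d" for x
  proof -
    have "(\<lambda>n. w n (0, x) - \<phi> x) \<longlonglongrightarrow> 0"
    proof (rule Lim_null_comparison)
      show "\<forall>\<^sub>F n in sequentially. norm (w n (0, x) - \<phi> x) \<le> e n * weight d (Suc m) x"
        using uminus_scheme_init[OF g x] by (intro always_eventually) (simp add: w_def)
      have "(\<lambda>n. e n * weight d (Suc m) x) \<longlonglongrightarrow> 0 * weight d (Suc m) x" by (intro tendsto_intros e)
      then show "(\<lambda>n. e n * weight d (Suc m) x) \<longlonglongrightarrow> 0" by simp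
    qed
    then have "(\<lambda>n. w n (0, x)) \<longlonglongrightarrow> \<phi> x" by (simp add: LIM_zero_iff)
    then show ?thesis using lim[of "(0, x)"] x T LIMSEQ_unique by fastforce
  qed
  moreover have "subsol T 0 (Suc m) u"
    by (rule subsol_limit[where D = "stab T m", OF ap e(1)]) (use e(2) stab_nonneg T near in \<open>auto simp: less_imp_le\<close>)
  moreover have "subsol T 0 (Suc m) (\<lambda>p. - u p)"
  proof (rule subsol_limit[OF approx_sol_uminus[OF ap] e(1), of "stab T m"])
    fix n p assume "p \<in> cyl d T"
    then show "\<bar>- w n p - - u p\<bar> \<le> e n * stab T m * weight d (Suc m) (snd p)"
      using near[of p n] by (auto simp: abs_minus_commute)
  qed (use e(2) stab_nonneg T in \<open>auto simp: less_imp_le\<close>)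
  moreover have "subsol T 0 (Suc (Suc m)) v" if "subsol T 0 (Suc m) v" for v using that by (simp add: subsol_def)
  ultimately have "is_solution T \<phi> (Suc m) u" unfolding is_solution_def using uc by blast
  then show ?thesis by blast
qed

text \<open>Replacing F by \<phi> inside the iteration costs at most a factor exp(K T) in the
  weighted norm, as iterates are averages over affine images. The resulting formula applies the
  mixture to \<phi> itself, which is merely continuous.\<close>

lemma solution_mixture:
  assumes T: "0 < T" and \<phi>: "continuous_on (Rd d) \<phi>" "\<And>x. x \<in> Rd d \<Longrightarrow> \<bar>\<phi> x\<bar> \<le> A * weight d m x" and m: "1 \<le> m"
    and u: "is_solution T \<phi> m u" and e: "0 < e"
  shows "\<exists>h N. 0 < h \<and> h \<le> h_max \<and> 0 < N \<and> T \<le> real N * h \<and>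
    (\<forall>x\<in>Rd d. \<bar>u (T, x) - it h (1 / (real N * h) * T) N \<phi> x\<bar> \<le> e * weight d (Suc m) x)"
proof -
  let ?K = "growth_rate C (Suc m)"
  define Z where "Z = stab T m + exp (?K * T)"
  have Z: "0 < Z" using stab_nonneg[of T m] T by (simp add: Z_def add_nonneg_pos)
  obtain F h N where g: "good T \<phi> m (e / Z) F h N" using good_exists[OF T \<phi> m] e Z by (meson divide_pos_pos)
  have hN: "0 < h" "h \<le> h_max" "0 < N" "T \<le> real N * h" and F: "\<And>x. x \<in> Rd d \<Longrightarrow> \<bar>F (0, x) - \<phi> x\<bar> \<le> e / Z * weight d (Suc m) x"
    using g by (auto simp: good_def)
  let ?\<tau> = "1 / (real N * h) * T"
  have \<tau>: "0 \<le> ?\<tau>" "?\<tau> \<le> 1" using good_tau[OF g, of T] T by auto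
  have "\<bar>u (T, x) - it h ?\<tau> N \<phi> x\<bar> \<le> e * weight d (Suc m) x" if x: "x \<in> Rd d" for x
  proof -
    have "\<bar>u (T, x) - scheme h N (\<lambda>x. F (0, x)) (T, x)\<bar> \<le> e / Z * stab T m * weight d (Suc m) (snd (T, x))"
      by (rule solution_near_scheme[OF T u g]) (use e Z T x in auto)
    then have 1: "\<bar>u (T, x) - it h ?\<tau> N (\<lambda>x. F (0, x)) x\<bar> \<le> e / Z * stab T m * weight d (Suc m) x"
      by (simp add: scheme_def)
    have "\<bar>it h ?\<tau> N (\<lambda>x. F (0, x)) x - it h ?\<tau> N \<phi> x\<bar> \<le> e / Z * it h ?\<tau> N (weight d (Suc m)) x"
      by (rule abs_it_diff_le[OF \<tau> x F])
    also have "\<dots> \<le> e / Z * (exp (?K * T) * weight d (Suc m) x)"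
    proof (rule mult_left_mono)
      have "it h ?\<tau> N (weight d (Suc m)) x \<le> (1 + ?\<tau> * ?K * h) ^ N * weight d (Suc m) x" by (rule it_weight_le[OF \<tau> hN(1,2) x])
      also have "\<dots> \<le> exp (?K * T) * weight d (Suc m) x"
        using one_plus_scaled_power_le_exp[of ?K T h N] growth_rate_nonneg[OF C_ge_1] T hN by (intro mult_right_mono) (auto simp: less_imp_le)
      finally show "it h ?\<tau> N (weight d (Suc m)) x \<le> exp (?K * T) * weight d (Suc m) x" .
    qed (use e Z in auto)
    finally have "\<bar>u (T, x) - it h ?\<tau> N \<phi> x\<bar> \<le> e / Z * stab T m * weight d (Suc m) x + e / Z * (exp (?K * T) * weight d (Suc m) x)"
      using 1 by linarith
    also have "\<dots> = e / Z * (stab T m + exp (?K * T)) * weight d (Suc m) x" by (simp only: distrib_left distrib_right mult.assoc)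
    also have "stab T m + exp (?K * T) = Z" by (simp only: Z_def)
    also have "e / Z * Z = e" using Z by simp
    finally show ?thesis .
  qed
  then show ?thesis using hN by blast
qed

end

section \<open>The Kolmogorov equation\<close>

text \<open>The values at 0 and at the unit vectors determine the matrix. The vector x is built up
  one coordinate at a time, and the functional equation adds x k times a unit vector to the part
  already built.\<close>

lemma affine_representation:
  assumes G: "\<And>x. x \<in> Rd d \<Longrightarrow> G x \<in> Rd d"
    and aff: "\<And>x y b i. x \<in> Rd d \<Longrightarrow> y \<in> Rd d \<Longrightarrow> G (\<lambda>j. b * x j + y j) i + b * G (\<lambda>_. 0) i = b * G x i + G y i"
  shows "\<exists>F. is_affine d F \<and> (\<forall>x\<in>Rd d. F x = G x)"
proof -
  define e where "e k = (\<lambda>j::nat. if j = k then 1 else 0::real)" for k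
  define A where "A i j = G (e j) i - G (\<lambda>_. 0) i" for i j
  have "aff d A (G (\<lambda>_. 0)) x = G x" if x: "x \<in> Rd d" for x
  proof -
    define X where "X k = (\<lambda>j. if j < k then x j else 0)" for k
    have X: "X k \<in> Rd d" for k using x by (auto simp: X_def Rd_def)
    have e: "e k \<in> Rd d" if "k < d" for k using that by (auto simp: e_def Rd_def)
    have step: "G (X k) i = G (\<lambda>_. 0) i + (\<Sum>j<k. A i j * x j)" if "k \<le> d" for k i
      using that
    proof (induction k)
      case 0 then show ?case by (simp add: X_def)
    next
      case (Suc k)
      have "X (Suc k) = (\<lambda>j. x k * e k j + X k j)" by (auto simp: X_def e_def less_Suc_eq)
      then have "G (X (Suc k)) i + x k * G (\<lambda>_. 0) i = x k * G (e k) i + G (X k) i"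
        using aff[OF e X, of k "x k" k i] Suc.prems by simp
      then show ?case using Suc by (simp add: A_def algebra_simps)
    qed
    have "X d = x" using x by (auto simp: X_def Rd_def)
    then have "G x i = G (\<lambda>_. 0) i + (\<Sum>j<d. A i j * x j)" for i using step[of d i] by simp
    moreover have "G x i = 0" if "\<not> i < d" for i using G[OF x] that by (simp add: Rd_def)
    ultimately show ?thesis by (auto simp: aff_def)
  qed
  then show ?thesis by (intro exI[of _ "aff d A (G (\<lambda>_. 0))"]) (auto simp: is_affine_def)
qed

lemma eucl_norm_powr_le:
  assumes "0 \<le> q"
  shows "eucl_norm d x powr q \<le> (1 + nsq d x) powr (q / 2)"
proof (cases "nsq d x = 0")
  case False
  then have "0 < nsq d x" using nsq_nonneg[of d x] by linarith
  then have "eucl_norm d x powr q = nsq d x powr (q / 2)"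
    by (simp add: eucl_norm_eq_sqrt_nsq powr_half_sqrt[symmetric] powr_powr)
  also have "\<dots> \<le> (1 + nsq d x) powr (q / 2)" using assms by (intro powr_mono2) auto
  finally show ?thesis .
qed (simp add: eucl_norm_eq_sqrt_nsq)

lemma one_plus_nsq_powr_ge_1: "0 \<le> a \<Longrightarrow> 1 \<le> (1 + nsq d x) powr a"
  by (rule ge_one_powr_ge_zero) auto

lemma one_plus_eucl_norm_powr_le:
  assumes "0 \<le> q"
  shows "1 + eucl_norm d x powr q \<le> 2 * (1 + nsq d x) powr (q / 2)"
  using eucl_norm_powr_le[OF assms, of x d] one_plus_nsq_powr_ge_1[of "q / 2" d x] assms by simp

lemma one_plus_nsq_powr_le:
  assumes "0 \<le> q"
  shows "(1 + nsq d x) powr (q / 2) \<le> 2 powr (q / 2) * (1 + eucl_norm d x powr q)"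
proof (cases "nsq d x \<le> 1")
  case True
  have "(1 + nsq d x) powr (q / 2) \<le> 2 powr (q / 2) * 1" using True assms by (simp add: powr_mono2)
  also have "\<dots> \<le> 2 powr (q / 2) * (1 + eucl_norm d x powr q)" by (intro mult_left_mono) auto
  finally show ?thesis .
next
  case False
  have "(1 + nsq d x) powr (q / 2) \<le> (2 * nsq d x) powr (q / 2)" using False assms by (intro powr_mono2) auto
  also have "\<dots> = 2 powr (q / 2) * eucl_norm d x powr q"
    using False by (simp add: powr_mult eucl_norm_eq_sqrt_nsq powr_half_sqrt[symmetric] powr_powr)
  also have "\<dots> \<le> 2 powr (q / 2) * (1 + eucl_norm d x powr q)" by (intro mult_left_mono) auto
  finally show ?thesis .
qed

lemma powr_le_weight: "a \<le> real m \<Longrightarrow> (1 + nsq d x) powr a \<le> weight d m x"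
  unfolding weight_def using powr_mono[of a "real m" "1 + nsq d x"] by (simp add: powr_realpow)

text \<open>Finiteness of the infimum provides one real exponent q. Real exponents and integer
  degrees are interchanged at the cost of constants, with m >= q/2 in one direction and q = 2 (m +
  1) in the other.\<close>

lemma at_most_poly_growth_iff:
  "at_most_poly_growth d T u \<longleftrightarrow> (\<exists>A m. \<forall>p\<in>{0..T} \<times> Rd d. \<bar>u p\<bar> \<le> A * weight d m (snd p))"
proof
  assume "at_most_poly_growth d T u"
  then obtain q where q: "0 < q" "(SUP (t, x)\<in>{0..T} \<times> Rd d. ennreal (\<bar>u (t, x)\<bar> / (1 + eucl_norm d x powr q))) < \<infinity>"
    unfolding at_most_poly_growth_def by (auto simp: INF_less_iff)
  define A where "A = enn2real (SUP (t, x)\<in>{0..T} \<times> Rd d. ennreal (\<bar>u (t, x)\<bar> / (1 + eucl_norm d x powr q)))"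
  have A0: "0 \<le> A" by (simp add: A_def)
  obtain m :: nat where m: "q / 2 \<le> real m" using real_arch_simple by blast
  have "\<bar>u p\<bar> \<le> (2 * A) * weight d m (snd p)" if p: "p \<in> {0..T} \<times> Rd d" for p
  proof -
    obtain t x where tx: "p = (t, x)" by force
    have "ennreal (\<bar>u (t, x)\<bar> / (1 + eucl_norm d x powr q)) \<le> (SUP (t, x)\<in>{0..T} \<times> Rd d. ennreal (\<bar>u (t, x)\<bar> / (1 + eucl_norm d x powr q)))"
      using p tx by (intro SUP_upper2[of "(t, x)"]) auto
    also have "\<dots> = ennreal A" using q(2) by (simp add: A_def)
    finally have "\<bar>u (t, x)\<bar> / (1 + eucl_norm d x powr q) \<le> A" using A0 by (simp add: ennreal_le_iff)
    moreover have "0 < 1 + eucl_norm d x powr q" by (simp add: add_pos_nonneg)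
    ultimately have "\<bar>u (t, x)\<bar> \<le> A * (1 + eucl_norm d x powr q)" by (simp add: pos_divide_le_eq)
    also have "\<dots> \<le> A * (2 * weight d m x)"
      using one_plus_eucl_norm_powr_le[of q x d] powr_le_weight[OF m, of d x] q(1) A0 by (intro mult_left_mono) auto
    finally show ?thesis by (simp add: tx mult_ac)
  qed
  then show "\<exists>A m. \<forall>p\<in>{0..T} \<times> Rd d. \<bar>u p\<bar> \<le> A * weight d m (snd p)" by blast
next
  assume "\<exists>A m. \<forall>p\<in>{0..T} \<times> Rd d. \<bar>u p\<bar> \<le> A * weight d m (snd p)"
  then obtain A m where A: "\<And>p. p\<in>{0..T} \<times> Rd d \<Longrightarrow> \<bar>u p\<bar> \<le> A * weight d m (snd p)" by blast
  \<comment> \<open>With \<open>Suc m\<close> in place of m the exponent is positive also for m =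
    0.\<close>
  define q where "q = 2 * real (Suc m)"
  have q: "0 < q" by (simp add: q_def)
  define B where "B = \<bar>A\<bar> * 2 powr (q / 2)"
  have "(SUP (t, x)\<in>{0..T} \<times> Rd d. ennreal (\<bar>u (t, x)\<bar> / (1 + eucl_norm d x powr q))) \<le> ennreal B"
  proof (rule SUP_least, clarify)
    fix t x assume tx: "t \<in> {0..T}" "x \<in> Rd d"
    have "\<bar>u (t, x)\<bar> \<le> A * weight d m x" using A[of "(t, x)"] tx by auto
    also have "\<dots> \<le> \<bar>A\<bar> * weight d m x" by (intro mult_right_mono) (auto simp: less_imp_le)
    also have "\<dots> \<le> \<bar>A\<bar> * weight d (Suc m) x" by (intro mult_left_mono weight_mono) auto
    also have "weight d (Suc m) x = (1 + nsq d x) powr (q / 2)" by (simp add: weight_def q_def powr_realpow del: power_Suc of_nat_Suc)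
    also have "\<bar>A\<bar> * \<dots> \<le> \<bar>A\<bar> * (2 powr (q / 2) * (1 + eucl_norm d x powr q))"
      using q by (intro mult_left_mono one_plus_nsq_powr_le) auto
    finally have "\<bar>u (t, x)\<bar> \<le> B * (1 + eucl_norm d x powr q)" by (simp add: B_def mult_ac)
    moreover have "0 < 1 + eucl_norm d x powr q" by (simp add: add_pos_nonneg)
    ultimately show "ennreal (\<bar>u (t, x)\<bar> / (1 + eucl_norm d x powr q)) \<le> ennreal B"
      by (intro ennreal_leI) (simp add: pos_divide_le_eq)
  qed
  then have "(INF q\<in>{0<..}. SUP (t, x)\<in>{0..T} \<times> Rd d. ennreal (\<bar>u (t, x)\<bar> / (1 + eucl_norm d x powr q))) \<le> ennreal B"
    using q by (intro INF_lower2[of q]) auto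
  then show "at_most_poly_growth d T u" unfolding at_most_poly_growth_def by (rule le_less_trans) simp
qed

section \<open>Identification with solutions of the Kolmogorov equation\<close>

context affine_coeffs
begin

text \<open>The trace of a product pairs the entries (i, l) and (l, i), which yields the second
  partial derivatives exactly in the order of differentiation used by \<open>dir2\<close>.\<close>

lemma generator_eq_gen:
  assumes "\<mu> x = L x" "\<sigma> x \<in> carrier_mat d d" "\<And>i k. i < d \<Longrightarrow> k < d \<Longrightarrow> S k x i = \<sigma> x $$ (i, k)"
  shows "generator d \<mu> \<sigma> h (t, x) = gen h (t, x)"
proof -
  let ?H = "\<lambda>l i. partial (Some l) (partial (Some i) h) (t, x)"
  have dims: "dim_row (\<sigma> x) = d" "dim_col (\<sigma> x) = d" using assms(2) by auto
  have "mat_trace (\<sigma> x * transpose_mat (\<sigma> x) * Hess_x d h (t, x))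
      = (\<Sum>i<d. \<Sum>l<d. (\<Sum>k<d. \<sigma> x $$ (i, k) * \<sigma> x $$ (l, k)) * ?H l i)"
    unfolding mat_trace_def using dims
    by (auto simp: scalar_prod_def Hess_x_def lessThan_atLeast0 intro!: sum.cong)
  also have "\<dots> = (\<Sum>i<d. \<Sum>l<d. \<Sum>k<d. S k x i * (S k x l * ?H l i))"
    using assms(3) by (intro sum.cong refl) (auto simp: sum_distrib_right mult.assoc)
  also have "\<dots> = (\<Sum>k<d. \<Sum>i<d. \<Sum>l<d. S k x i * (S k x l * ?H l i))"
    by (subst (2) sum.swap, subst sum.swap) (rule refl)
  also have "\<dots> = (\<Sum>k<d. dir2 d h (t, x) (S k x))" by (simp add: dir2_def dir1_def sum_distrib_left)
  finally show ?thesis by (simp add: generator_def gen_def dir1_def assms(1) mult.commute)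
qed

lemma subsol_uminus_iff:
  "subsol T 0 m (\<lambda>p. - u p) \<longleftrightarrow> (\<forall>p\<in>cyl d T. \<forall>h. C_k_on 2 d T h \<and> (\<forall>q\<in>cyl d T. h q \<le> u q) \<and> h p = u p \<longrightarrow>
     partial None h p \<ge> gen h p)"
proof
  assume s: "subsol T 0 m (\<lambda>p. - u p)"
  show "\<forall>p\<in>cyl d T. \<forall>h. C_k_on 2 d T h \<and> (\<forall>q\<in>cyl d T. h q \<le> u q) \<and> h p = u p \<longrightarrow> partial None h p \<ge> gen h p"
  proof (intro ballI allI impI)
    fix p h assume p: "p \<in> cyl d T" and h: "C_k_on 2 d T h \<and> (\<forall>q\<in>cyl d T. h q \<le> u q) \<and> h p = u p"
    have "\<forall>q\<in>cyl d T. - u q \<le> - h q" "- h p = - u p" using h by auto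
    then have "partial None (\<lambda>q. - h q) p \<le> gen (\<lambda>q. - h q) p + 0 * weight d m (snd p)"
      using s p C2_uminus(1)[of T h] h unfolding subsol_def by blast
    then show "partial None h p \<ge> gen h p" using C2_uminus(2,3)[of T h p] h p by simp
  qed
next
  assume s: "\<forall>p\<in>cyl d T. \<forall>h. C_k_on 2 d T h \<and> (\<forall>q\<in>cyl d T. h q \<le> u q) \<and> h p = u p \<longrightarrow> partial None h p \<ge> gen h p"
  show "subsol T 0 m (\<lambda>p. - u p)" unfolding subsol_def
  proof (intro ballI allI impI)
    fix p h assume p: "p \<in> cyl d T" and h: "C_k_on 2 d T h \<and> (\<forall>q\<in>cyl d T. - u q \<le> h q) \<and> h p = - u p"
    have "\<forall>q\<in>cyl d T. - h q \<le> u q" "- h p = u p" using h by (auto simp: minus_le_iff)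
    then have "partial None (\<lambda>q. - h q) p \<ge> gen (\<lambda>q. - h q) p"
      using s p C2_uminus(1)[of T h] h by blast
    then show "partial None h p \<le> gen h p + 0 * weight d m (snd p)" using C2_uminus(2,3)[of T h p] h p by simp
  qed
qed

lemma is_solution_mono: "is_solution T \<phi> m u \<Longrightarrow> m \<le> m' \<Longrightarrow> is_solution T \<phi> m' u"
proof -
  assume u: "is_solution T \<phi> m u" and m: "m \<le> m'"
  obtain A where A: "\<And>p. p\<in>{0..T} \<times> Rd d \<Longrightarrow> \<bar>u p\<bar> \<le> A * weight d m (snd p)" using u unfolding is_solution_def by blast
  have "\<bar>u p\<bar> \<le> \<bar>A\<bar> * weight d m' (snd p)" if "p\<in>{0..T} \<times> Rd d" for p
  proof -
    have "\<bar>u p\<bar> \<le> \<bar>A\<bar> * weight d m (snd p)"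
      using A[OF that] mult_right_mono[OF abs_ge_self[of A] less_imp_le[OF weight_pos[of d m "snd p"]]] by linarith
    also have "\<dots> \<le> \<bar>A\<bar> * weight d m' (snd p)" using m by (intro mult_left_mono weight_mono) auto
    finally show ?thesis .
  qed
  moreover have "subsol T 0 (Suc m') v" if "subsol T 0 (Suc m) v" for v using that by (simp add: subsol_def)
  ultimately show ?thesis using u unfolding is_solution_def by blast
qed

lemma kolmogorov_solution_iff:
  assumes "\<And>x. x \<in> Rd d \<Longrightarrow> \<mu> x = L x" "\<And>x. x \<in> Rd d \<Longrightarrow> \<sigma> x \<in> carrier_mat d d"
    "\<And>x i k. x \<in> Rd d \<Longrightarrow> i < d \<Longrightarrow> k < d \<Longrightarrow> S k x i = \<sigma> x $$ (i, k)"
  shows "kolmogorov_solution d T \<phi> \<mu> \<sigma> u \<longleftrightarrow> (\<exists>m. is_solution T \<phi> m u)"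
proof -
  have g: "generator d \<mu> \<sigma> h p = gen h p" if "p \<in> cyl d T" for h p
    using that assms by (cases p) (auto intro!: generator_eq_gen)
  have sub: "subsol T 0 m u \<longleftrightarrow> (\<forall>p\<in>cyl d T. \<forall>h. C_k_on 2 d T h \<and> (\<forall>q\<in>cyl d T. h q \<ge> u q) \<and> h p = u p \<longrightarrow> partial None h p \<le> gen h p)" for m
    by (simp add: subsol_def)
  have v: "viscosity_solution d T \<mu> \<sigma> u \<longleftrightarrow> continuous_on (cyl d T) u \<and> subsol T 0 m u \<and> subsol T 0 m (\<lambda>p. - u p)" for m
    unfolding viscosity_solution_def subsol_uminus_iff sub using g by (simp only: ball_conj_distrib cong: ball_cong)
  have c: "continuous_on ({0..T} \<times> Rd d) u \<Longrightarrow> continuous_on (cyl d T) u" by (erule continuous_on_subset) auto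
  show ?thesis unfolding kolmogorov_solution_def at_most_poly_growth_iff is_solution_def
    using v c by blast
qed

lemma is_solution_cong:
  assumes "is_solution T \<phi> m u" "\<And>p. p \<in> {0..T} \<times> Rd d \<Longrightarrow> u p = w p" "0 < T"
  shows "is_solution T \<phi> m w"
proof -
  have c: "u p = w p" if "p \<in> cyl d T" for p using that assms(2) by auto
  have "continuous_on ({0..T} \<times> Rd d) w" using assms(1,2) continuous_on_cong[of "{0..T} \<times> Rd d" _ u w] by (auto simp: is_solution_def)
  moreover have "subsol T 0 (Suc m) w" "subsol T 0 (Suc m) (\<lambda>p. - w p)"
    using assms(1) c unfolding is_solution_def subsol_def by auto
  ultimately show ?thesis using assms unfolding is_solution_def by auto
qed

end

section \<open>Approximation of the solution by averages over affine maps\<close>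

lemma abs_add3_powr_le:
  fixes a b c p :: real
  assumes "0 \<le> p"
  shows "\<bar>a + b + c\<bar> powr p \<le> 3 powr p * (\<bar>a\<bar> powr p + \<bar>b\<bar> powr p + \<bar>c\<bar> powr p)"
proof -
  define M where "M = max \<bar>a\<bar> (max \<bar>b\<bar> \<bar>c\<bar>)"
  have "\<bar>a\<bar> \<le> M" "\<bar>b\<bar> \<le> M" "\<bar>c\<bar> \<le> M" by (auto simp: M_def)
  then have "\<bar>a + b + c\<bar> \<le> 3 * M" by linarith
  then have "\<bar>a + b + c\<bar> powr p \<le> (3 * M) powr p" using assms by (intro powr_mono2) auto
  also have "\<dots> = 3 powr p * M powr p" by (simp add: powr_mult M_def)
  also have "M powr p \<le> \<bar>a\<bar> powr p + \<bar>b\<bar> powr p + \<bar>c\<bar> powr p" by (auto simp: M_def max_def)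
  finally show ?thesis by simp
qed

lemma le_abs_mult:
  fixes h K r :: real
  shows "h \<le> K * r \<Longrightarrow> 0 \<le> r \<Longrightarrow> h \<le> \<bar>K\<bar> * r"
  by (meson abs_ge_self mult_right_mono order_trans)

lemma is_affine_growth:
  assumes "is_affine d F" shows "\<exists>K\<ge>1. \<forall>x. 1 + nsq d (F x) \<le> K * (1 + nsq d x)"
proof -
  obtain B where B: "0 \<le> B" "\<And>x. nsq d (\<lambda>i. F x i - F (\<lambda>_. 0) i) \<le> B * nsq d x"
    using is_affine_linear_bound[OF assms] by blast
  let ?b = "nsq d (F (\<lambda>_. 0))"
  have "1 + nsq d (F x) \<le> (1 + 2 * B + 2 * ?b) * (1 + nsq d x)" for x
  proof -
    have sq: "(u + w)\<^sup>2 \<le> 2 * u\<^sup>2 + 2 * w\<^sup>2" for u w :: real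
      using zero_le_power2[of "u - w"] by (simp add: power2_eq_square algebra_simps)
    have "nsq d (F x) \<le> (\<Sum>i<d. 2 * (F x i - F (\<lambda>_. 0) i)\<^sup>2 + 2 * (F (\<lambda>_. 0) i)\<^sup>2)"
      unfolding nsq_def
    proof (rule sum_mono)
      fix i show "(F x i)\<^sup>2 \<le> 2 * (F x i - F (\<lambda>_. 0) i)\<^sup>2 + 2 * (F (\<lambda>_. 0) i)\<^sup>2"
        using sq[of "F x i - F (\<lambda>_. 0) i" "F (\<lambda>_. 0) i"] by simp
    qed
    also have "\<dots> = 2 * nsq d (\<lambda>i. F x i - F (\<lambda>_. 0) i) + 2 * ?b"
      by (simp add: nsq_def sum.distrib sum_distrib_left)
    also have "\<dots> \<le> 2 * (B * nsq d x) + 2 * ?b" using B(2) by simp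
    finally have 1: "nsq d (F x) \<le> 2 * (B * nsq d x) + 2 * ?b" .
    have 0: "0 \<le> B + ?b * nsq d x" using B by simp
    have eq: "(1 + 2 * B + 2 * ?b) * (1 + nsq d x) = 1 + nsq d x + (2 * (B * nsq d x) + 2 * ?b) + 2 * (B + ?b * nsq d x)"
      by (simp add: algebra_simps)
    have "1 + y \<le> 1 + n + (2 * k + 2 * b) + 2 * z" if "y \<le> 2 * k + 2 * b" "0 \<le> z" "0 \<le> n" for y n k b z :: real
      using that by linarith
    from this[OF 1 0 nsq_nonneg] show ?thesis unfolding eq .
  qed
  then show ?thesis using B(1) nsq_nonneg[of d "F (\<lambda>_. 0)"] by (intro exI[of _ "1 + 2 * B + 2 * ?b"]) auto
qed

lemma borel_measurable_Rd:
  assumes "sets \<nu> = sets (restrict_space borel (Rd d))" "continuous_on (Rd d) (g :: (nat \<Rightarrow> real) \<Rightarrow> real)"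
  shows "g \<in> borel_measurable \<nu>"
  using borel_measurable_continuous_on_restrict[OF assms(2)] measurable_cong_sets[OF assms(1) refl] by blast

lemma space_Rd: "sets \<nu> = sets (restrict_space borel (Rd d)) \<Longrightarrow> space \<nu> = Rd d"
  by (drule sets_eq_imp_space_eq) (simp add: space_restrict_space)

lemma integrable_powr_of_bound:
  assumes \<nu>: "sets \<nu> = sets (restrict_space borel (Rd d))" and J: "integrable \<nu> (\<lambda>x. (1 + nsq d x) powr (s * p))"
    and H: "continuous_on (Rd d) H" "\<And>x. x \<in> Rd d \<Longrightarrow> \<bar>H x\<bar> \<le> K * (1 + nsq d x) powr s" and p: "0 < p"
  shows "integrable \<nu> (\<lambda>x. \<bar>H x\<bar> powr p)" "0 \<le> K \<Longrightarrow> (\<integral>x. \<bar>H x\<bar> powr p \<partial>\<nu>) \<le> K powr p * (\<integral>x. (1 + nsq d x) powr (s * p) \<partial>\<nu>)"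
    "\<And>x. x \<in> Rd d \<Longrightarrow> 0 \<le> K \<Longrightarrow> \<bar>H x\<bar> powr p \<le> K powr p * (1 + nsq d x) powr (s * p)"
proof -
  have b: "\<bar>H x\<bar> powr p \<le> \<bar>K\<bar> powr p * (1 + nsq d x) powr (s * p)" if x: "x \<in> Rd d" for x
  proof -
    have "\<bar>H x\<bar> \<le> \<bar>K\<bar> * (1 + nsq d x) powr s"
      by (rule le_abs_mult[OF H(2)[OF x]]) simp
    then have "\<bar>H x\<bar> powr p \<le> (\<bar>K\<bar> * (1 + nsq d x) powr s) powr p" using p by (intro powr_mono2) auto
    then show ?thesis by (simp add: powr_mult powr_powr)
  qed
  have Hm: "H \<in> borel_measurable \<nu>" by (rule borel_measurable_Rd[OF \<nu> H(1)])
  have i: "integrable \<nu> (\<lambda>x. \<bar>K\<bar> powr p * (1 + nsq d x) powr (s * p))" using J by simp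
  show int: "integrable \<nu> (\<lambda>x. \<bar>H x\<bar> powr p)"
    by (rule Bochner_Integration.integrable_bound[OF i]) (use Hm b space_Rd[OF \<nu>] in \<open>auto intro!: AE_I2\<close>)
  show "0 \<le> K \<Longrightarrow> (\<integral>x. \<bar>H x\<bar> powr p \<partial>\<nu>) \<le> K powr p * (\<integral>x. (1 + nsq d x) powr (s * p) \<partial>\<nu>)"
    using integral_mono[OF int i] b space_Rd[OF \<nu>] by simp
  show "\<And>x. x \<in> Rd d \<Longrightarrow> 0 \<le> K \<Longrightarrow> \<bar>H x\<bar> powr p \<le> K powr p * (1 + nsq d x) powr (s * p)"
    using b by simp
qed

context affine_coeffs
begin

text \<open>One mixture serves all exponents a <= M: the bound for the weight of degree M passes to
  a by Jensen's inequality with exponent a/M <= 1, and the constant, being at least 1, may keep its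
  full power.\<close>

lemma solution_mixture_moments:
  assumes T: "0 < T" and \<phi>: "continuous_on (Rd d) \<phi>" "\<And>x. x \<in> Rd d \<Longrightarrow> \<bar>\<phi> x\<bar> \<le> A * weight d m x" and m: "1 \<le> m"
    and u: "is_solution T \<phi> m u" and e: "0 < e"
  shows "\<exists>(I :: (nat \<times> real) option list set) q F. finite_distribution I q \<and> (\<forall>i\<in>I. is_affine d (F i)) \<and>
    (\<forall>x\<in>Rd d. \<bar>u (T, x) - (\<Sum>i\<in>I. q i * \<phi> (F i x))\<bar> \<le> e * weight d (Suc m) x) \<and>
    (\<forall>x\<in>Rd d. \<forall>a. 0 \<le> a \<and> a \<le> real M \<longrightarrow>
       (\<Sum>i\<in>I. q i * (1 + nsq d (F i x)) powr a) \<le> exp (growth_rate C M * T) * (1 + nsq d x) powr a)"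
proof -
  obtain h N where hN: "0 < h" "h \<le> h_max" "0 < N" "T \<le> real N * h"
    "\<And>x. x \<in> Rd d \<Longrightarrow> \<bar>u (T, x) - it h (1 / (real N * h) * T) N \<phi> x\<bar> \<le> e * weight d (Suc m) x"
    using solution_mixture[OF T \<phi> m u e] by blast
  let ?\<tau> = "1 / (real N * h) * T"
  have \<tau>: "0 \<le> ?\<tau>" "?\<tau> \<le> 1" using hN T by (auto simp: divide_le_eq_1_pos)
  obtain I :: "(nat \<times> real) option list set" and q F where I: "finite I" "\<And>i. i \<in> I \<Longrightarrow> 0 \<le> q i" "\<And>i. i \<in> I \<Longrightarrow> is_affine d (F i)"
    "(\<Sum>i\<in>I. q i) = 1" "\<And>f x. x \<in> Rd d \<Longrightarrow> it h ?\<tau> N f x = (\<Sum>i\<in>I. q i * f (F i x))"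
    using it_mixture[OF \<tau>, of h N] by blast
  interpret finite_distribution I q by standard (use I in auto)
  let ?D = "exp (growth_rate C M * T)"
  have D: "1 \<le> ?D" using growth_rate_nonneg[OF C_ge_1] T by simp
  have "(\<Sum>i\<in>I. q i * (1 + nsq d (F i x)) powr a) \<le> ?D * (1 + nsq d x) powr a"
    if x: "x \<in> Rd d" and a: "0 \<le> a" "a \<le> real M" for x a
  proof (cases "a = 0")
    case True then show ?thesis using D I(4) by (simp add: add_nonneg_pos)
  next
    case False
    then have M: "0 < real M" using a by linarith
    have "(\<Sum>i\<in>I. q i * weight d M (F i x)) \<le> (1 + ?\<tau> * growth_rate C M * h) ^ N * weight d M x"
      using it_weight_le[OF \<tau> hN(1,2) x, of N M] I(5)[OF x] by simp
    also have "\<dots> \<le> ?D * weight d M x"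
      using one_plus_scaled_power_le_exp[of "growth_rate C M" T h N] growth_rate_nonneg[OF C_ge_1] T hN
      by (intro mult_right_mono) (auto simp: less_imp_le)
    finally have le: "(\<Sum>i\<in>I. q i * weight d M (F i x)) \<le> ?D * weight d M x" .
    have Wp: "weight d M y powr (a / real M) = (1 + nsq d y) powr a" for y
      using M by (simp add: weight_def powr_realpow[symmetric] powr_powr)
    have "(\<Sum>i\<in>I. q i * weight d M (F i x) powr (a / real M)) \<le> (?D * weight d M x) powr (a / real M)"
      by (rule mean_powr_le) (use le a M in \<open>auto simp: less_imp_le\<close>)
    also have "\<dots> = ?D powr (a / real M) * (1 + nsq d x) powr a"
      by (simp only: powr_mult Wp)
    also have "\<dots> \<le> ?D * (1 + nsq d x) powr a"
    proof (rule mult_right_mono)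
      have "?D powr (a / real M) \<le> ?D powr 1" using D a M by (intro powr_mono) auto
      then show "?D powr (a / real M) \<le> ?D" by simp
    qed simp
    finally show ?thesis by (simp add: Wp)
  qed
  moreover have "finite_distribution I q" by standard (use I in auto)
  ultimately show ?thesis using I(3) hN(5) I(5)[of _ \<phi>] by (intro exI[of _ I] exI[of _ q] exI[of _ F]) auto
qed

text \<open>The error is split into u against a mixture of \<phi>, this mixture against the same
  mixture of f, and the latter against the arithmetic mean of n sampled terms;
  \<open>3 powr p\<close> pays for the three parts. The moments of the affine maps enter through
  \<open>D1\<close> alone, which does not depend on d.\<close>

theorem affine_average_approximation:
  fixes f \<phi> :: "(nat \<Rightarrow> real) \<Rightarrow> real" and M k n :: nat and p s \<eta> c1 c2 A T :: real
  defines "D1 \<equiv> exp (growth_rate C M * T)"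
  assumes T: "0 < T" and \<phi>: "continuous_on (Rd d) \<phi>" "\<And>x. x \<in> Rd d \<Longrightarrow> \<bar>\<phi> x\<bar> \<le> A * (1 + nsq d x) powr s"
    and u: "is_solution T \<phi> m u"
    and f: "continuous_on (Rd d) f" "\<And>x. x \<in> Rd d \<Longrightarrow> \<bar>f x\<bar> \<le> c1 * (1 + nsq d x) powr s" "0 < c1"
    and f\<phi>: "\<And>x. x \<in> Rd d \<Longrightarrow> \<bar>\<phi> x - f x\<bar> \<le> c2 * (1 + nsq d x) powr s" "0 \<le> c2"
    and \<nu>: "sets \<nu> = sets (restrict_space borel (Rd d))"
    and J: "integrable \<nu> (\<lambda>x. (1 + nsq d x) powr (s * p))"
    and p: "0 < p" "p \<le> 2 * real k" and s: "0 \<le> s" "2 * s * real k \<le> real M" and \<eta>: "0 < \<eta>" and n: "1 \<le> n"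
  shows "\<exists>G. (\<forall>k<n. is_affine d (G k)) \<and> integrable \<nu> (\<lambda>x. \<bar>u (T, x) - (\<Sum>k<n. f (G k x)) / real n\<bar> powr p) \<and>
    (\<integral>x. \<bar>u (T, x) - (\<Sum>k<n. f (G k x)) / real n\<bar> powr p \<partial>\<nu>)
     \<le> 3 powr p * (\<eta> + (c2 * D1) powr p * (\<integral>x. (1 + nsq d x) powr (s * p) \<partial>\<nu>) +
        moment_const k powr (p / (2 * real k)) * real n powr (- p / 2) * ((8 * (c1 * D1)\<^sup>2) powr (p / 2) * (\<integral>x. (1 + nsq d x) powr (s * p) \<partial>\<nu>)))"
proof -
  let ?\<rho> = "\<lambda>x. 1 + nsq d x"
  let ?J = "\<integral>x. ?\<rho> x powr (s * p) \<partial>\<nu>"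
  note sp = space_Rd[OF \<nu>]
  have D1: "1 \<le> D1" using growth_rate_nonneg[OF C_ge_1] T by (simp add: D1_def)
  have k: "1 \<le> real k" using p by (cases k) auto
  have sM: "s \<le> real M" using s k mult_left_mono[OF k, of s] by linarith
  obtain m0 :: nat where m0: "s \<le> real m0" using real_arch_simple by blast
  define m' where "m' = max 1 (max m m0)"
  have u': "is_solution T \<phi> m' u" by (rule is_solution_mono[OF u]) (simp add: m'_def)
  have \<phi>W: "\<bar>\<phi> x\<bar> \<le> \<bar>A\<bar> * weight d m' x" if x: "x \<in> Rd d" for x
  proof -
    have "\<bar>\<phi> x\<bar> \<le> \<bar>A\<bar> * ?\<rho> x powr s"
      by (rule le_abs_mult[OF \<phi>(2)[OF x]]) simp
    also have "\<dots> \<le> \<bar>A\<bar> * weight d m' x" using m0 by (intro mult_left_mono powr_le_weight) (auto simp: m'_def)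
    finally show ?thesis .
  qed
  define ok where "ok j (I :: (nat \<times> real) option list set) q F \<longleftrightarrow> finite_distribution I q \<and> (\<forall>i\<in>I. is_affine d (F i)) \<and>
    (\<forall>x\<in>Rd d. \<bar>u (T, x) - (\<Sum>i\<in>I. q i * \<phi> (F i x))\<bar> \<le> inverse (real (Suc j)) * weight d (Suc m') x) \<and>
    (\<forall>x\<in>Rd d. \<forall>a. 0 \<le> a \<and> a \<le> real M \<longrightarrow> (\<Sum>i\<in>I. q i * ?\<rho> (F i x) powr a) \<le> D1 * ?\<rho> x powr a)"
    for j I q F
  have "\<exists>I q F. ok j I q F" for j
    unfolding ok_def D1_def by (rule solution_mixture_moments[OF T \<phi>(1) \<phi>W _ u']) (auto simp: m'_def)
  then obtain I q F where "\<And>j. ok j (I j) (q j) (F j)" by metis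
  then have fd: "\<And>j. finite_distribution (I j) (q j)" and aff: "\<And>j i. i \<in> I j \<Longrightarrow> is_affine d (F j i)"
    and uQ: "\<And>j x. x \<in> Rd d \<Longrightarrow> \<bar>u (T, x) - (\<Sum>i\<in>I j. q j i * \<phi> (F j i x))\<bar> \<le> inverse (real (Suc j)) * weight d (Suc m') x"
    and mom: "\<And>j x a. x \<in> Rd d \<Longrightarrow> 0 \<le> a \<Longrightarrow> a \<le> real M \<Longrightarrow> (\<Sum>i\<in>I j. q j i * ?\<rho> (F j i x) powr a) \<le> D1 * ?\<rho> x powr a"
    unfolding ok_def by simp_all
  have weighted: "\<bar>\<Sum>i\<in>I j. q j i * g (F j i x)\<bar> \<le> c * D1 * ?\<rho> x powr s"
    if x: "x \<in> Rd d" and c: "0 \<le> c" and g: "\<And>y. y \<in> Rd d \<Longrightarrow> \<bar>g y\<bar> \<le> c * ?\<rho> y powr s" for j x c g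
  proof -
    interpret finite_distribution "I j" "q j" by (rule fd)
    have "\<bar>\<Sum>i\<in>I j. q j i * g (F j i x)\<bar> \<le> (\<Sum>i\<in>I j. q j i * (c * ?\<rho> (F j i x) powr s))"
      by (rule order_trans[OF sum_abs sum_mono])
        (use q_nonneg g is_affine_Rd[OF aff] in \<open>auto simp: abs_mult intro!: mult_left_mono\<close>)
    also have "\<dots> = c * (\<Sum>i\<in>I j. q j i * ?\<rho> (F j i x) powr s)" by (simp add: sum_distrib_left mult_ac)
    also have "\<dots> \<le> c * (D1 * ?\<rho> x powr s)" using mom[OF x s(1) sM] c by (intro mult_left_mono)
    finally show ?thesis by (simp add: mult.assoc)
  qed
  have contF: "continuous_on (Rd d) (\<lambda>x. g (G x))" if "continuous_on (Rd d) g" "is_affine d G" for g :: "(nat \<Rightarrow> real) \<Rightarrow> real" and G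
    by (rule continuous_on_compose2[OF that(1) is_affine_continuous[OF that(2)]]) (use is_affine_Rd[OF that(2)] in auto)
  have contQ: "continuous_on (Rd d) (\<lambda>x. \<Sum>i\<in>I j. q j i * g (F j i x))" if "continuous_on (Rd d) g" for g :: "(nat \<Rightarrow> real) \<Rightarrow> real" and j
    using contF[OF that aff] by (intro continuous_intros) auto
  have uc: "continuous_on (Rd d) (\<lambda>x. u (T, x))"
    by (rule continuous_on_compose2[of "{0..T} \<times> Rd d" u]) (use u T in \<open>auto simp: is_solution_def intro!: continuous_intros\<close>)
  define Q where "Q j x = (\<Sum>i\<in>I j. q j i * \<phi> (F j i x))" for j x
  have Qlim: "(\<lambda>j. Q j x) \<longlonglongrightarrow> u (T, x)" if x: "x \<in> Rd d" for x
  proof -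
    have "(\<lambda>j. Q j x - u (T, x)) \<longlonglongrightarrow> 0"
    proof (rule Lim_null_comparison)
      show "\<forall>\<^sub>F j in sequentially. norm (Q j x - u (T, x)) \<le> inverse (real (Suc j)) * weight d (Suc m') x"
        using uQ[OF x] by (intro always_eventually) (simp add: Q_def abs_minus_commute)
      have "(\<lambda>j. inverse (real (Suc j)) * weight d (Suc m') x) \<longlonglongrightarrow> 0 * weight d (Suc m') x"
        by (intro tendsto_intros LIMSEQ_inverse_real_of_nat)
      then show "(\<lambda>j. inverse (real (Suc j)) * weight d (Suc m') x) \<longlonglongrightarrow> 0" by simp
    qed
    then show ?thesis by (simp add: LIM_zero_iff)
  qed
  let ?A = "\<bar>A\<bar> * D1"
  have Qb: "\<bar>Q j x\<bar> \<le> ?A * ?\<rho> x powr s" if x: "x \<in> Rd d" for j x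
    unfolding Q_def
  proof (rule weighted[OF x])
    fix y assume "y \<in> Rd d"
    then show "\<bar>\<phi> y\<bar> \<le> \<bar>A\<bar> * ?\<rho> y powr s"
      by (intro le_abs_mult \<phi>(2)) auto
  qed simp
  have ub: "\<bar>u (T, x)\<bar> \<le> ?A * ?\<rho> x powr s" if x: "x \<in> Rd d" for x
    using Qb[OF x] tendsto_rabs[OF Qlim[OF x]] by (intro LIMSEQ_le_const2[of "\<lambda>j. \<bar>Q j x\<bar>"]) auto
  have dQ: "\<bar>u (T, x) - Q j x\<bar> \<le> (2 * ?A) * ?\<rho> x powr s" if x: "x \<in> Rd d" for j x
    using Qb[OF x, of j] ub[OF x] by (simp add: abs_le_iff)
  have dQc: "continuous_on (Rd d) (\<lambda>x. u (T, x) - Q j x)" for j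
    unfolding Q_def by (intro continuous_intros uc contQ \<phi>(1))
  have A0: "0 \<le> 2 * ?A" using D1 by simp
  have dQi: "integrable \<nu> (\<lambda>x. \<bar>u (T, x) - Q j x\<bar> powr p)" for j
    by (rule integrable_powr_of_bound(1)[OF \<nu> J dQc _ p(1)]) (rule dQ)
  have dQb: "\<bar>u (T, x) - Q j x\<bar> powr p \<le> (2 * ?A) powr p * ?\<rho> x powr (s * p)" if "x \<in> Rd d" for j x
    by (rule integrable_powr_of_bound(3)[OF \<nu> J dQc _ p(1) that A0]) (rule dQ)
  \<comment> \<open>The bound \<open>uQ\<close> has a weight of high degree that \<nu> need not
    integrate. Convergence of the integrals is therefore obtained by domination, with the moment
    bound of degree s, which holds for both u and \<open>Q j\<close>.\<close>
  have "(\<lambda>j. \<integral>x. \<bar>u (T, x) - Q j x\<bar> powr p \<partial>\<nu>) \<longlonglongrightarrow> (\<integral>x. 0 \<partial>\<nu>)"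
  proof (rule integral_dominated_convergence[where w = "\<lambda>x. (2 * ?A) powr p * ?\<rho> x powr (s * p)"])
    show "AE x in \<nu>. (\<lambda>j. \<bar>u (T, x) - Q j x\<bar> powr p) \<longlonglongrightarrow> 0"
    proof (rule AE_I2)
      fix x assume "x \<in> space \<nu>"
      then have x: "x \<in> Rd d" using sp by simp
      have "(\<lambda>j. \<bar>u (T, x) - Q j x\<bar>) \<longlonglongrightarrow> \<bar>u (T, x) - u (T, x)\<bar>" by (intro tendsto_intros Qlim x)
      then have "(\<lambda>j. \<bar>u (T, x) - Q j x\<bar>) \<longlonglongrightarrow> 0" by simp
      from tendsto_powr'[OF this tendsto_const[of p]] show "(\<lambda>j. \<bar>u (T, x) - Q j x\<bar> powr p) \<longlonglongrightarrow> 0"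
        using p(1) by simp
    qed
    show "AE x in \<nu>. norm (\<bar>u (T, x) - Q j x\<bar> powr p) \<le> (2 * ?A) powr p * ?\<rho> x powr (s * p)" for j
      using dQb sp by (intro AE_I2) simp
    show "(\<lambda>x. \<bar>u (T, x) - Q j x\<bar> powr p) \<in> borel_measurable \<nu>" for j
      using dQi[of j] by (rule borel_measurable_integrable)
  qed (use J in simp_all)
  then have "\<forall>\<^sub>F j in sequentially. (\<integral>x. \<bar>u (T, x) - Q j x\<bar> powr p \<partial>\<nu>) < \<eta>"
    using \<eta> by (intro order_tendstoD(2)) simp_all
  then obtain j where j: "(\<integral>x. \<bar>u (T, x) - Q j x\<bar> powr p \<partial>\<nu>) < \<eta>" using eventually_happens'[OF sequentially_bot] by blast
  interpret FD: finite_distribution "I j" "q j" by (rule fd)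
  define mean where "mean x = (\<Sum>i\<in>I j. q j i * f (F j i x))" for x
  have meanc: "continuous_on (Rd d) mean" unfolding mean_def by (rule contQ[OF f(1)])
  have "\<bar>Q j x - mean x\<bar> \<le> c2 * D1 * ?\<rho> x powr s" if x: "x \<in> Rd d" for x
    using weighted[OF x f\<phi>(2), of "\<lambda>y. \<phi> y - f y" j] f\<phi>(1)
    by (simp add: Q_def mean_def sum_subtractf[symmetric] right_diff_distrib)
  note Bint = integrable_powr_of_bound[OF \<nu> J _ this p(1)]
  have Qc: "continuous_on (Rd d) (\<lambda>x. Q j x - mean x)" unfolding Q_def by (intro continuous_intros meanc contQ \<phi>(1))
  have stepB: "integrable \<nu> (\<lambda>x. \<bar>Q j x - mean x\<bar> powr p)" "(\<integral>x. \<bar>Q j x - mean x\<bar> powr p \<partial>\<nu>) \<le> (c2 * D1) powr p * ?J"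
    using Bint(1,2)[OF Qc] f\<phi>(2) D1 by auto
  have meanb: "\<bar>mean x\<bar> \<le> c1 * D1 * ?\<rho> x powr s" if x: "x \<in> Rd d" for x
    unfolding mean_def using weighted[OF x _ f(2)] f(3) by simp
  have listsum: "sum_list (map g l) = (\<Sum>k<length l. g (l ! k))" for g :: "(nat \<times> real) option list \<Rightarrow> real" and l
    by (simp add: sum_list_sum_nth lessThan_atLeast0)
  \<comment> \<open>A deviation is at most twice the larger of the bounds for f and for the mean.
    With b = c1 D1 \<rho>^s this leads to 2 * 4^i b^(2i) <= (8 b^2)^i for the moment of order
    2i.\<close>
  define B where "B x = 8 * (c1 * D1 * ?\<rho> x powr s)\<^sup>2" for x
  have Bp: "B x powr (p / 2) = (8 * (c1 * D1)\<^sup>2) powr (p / 2) * ?\<rho> x powr (s * p)" for x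
  proof -
    have "B x = (8 * (c1 * D1)\<^sup>2) * ?\<rho> x powr (2 * s)"
      by (simp add: B_def power_mult_distrib power2_eq_square powr_add[symmetric])
    then show ?thesis by (simp add: powr_mult powr_powr)
  qed
  have ch: "continuous_on (Rd d) (\<lambda>x. sum_list (map (\<lambda>i. f (F j i x)) l) / real n - mean x) \<and>
      (\<exists>K. \<forall>x\<in>Rd d. \<bar>sum_list (map (\<lambda>i. f (F j i x)) l) / real n - mean x\<bar> \<le> K * ?\<rho> x powr s)"
    if l: "length l = n" "set l \<subseteq> I j" for l
  proof
    have lI: "l ! k \<in> I j" if "k < n" for k using l that by auto
    show "continuous_on (Rd d) (\<lambda>x. sum_list (map (\<lambda>i. f (F j i x)) l) / real n - mean x)"
      unfolding listsum l(1) using contF[OF f(1) aff[OF lI]] n by (intro continuous_intros meanc) auto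
    have "\<exists>K. \<forall>x\<in>Rd d. \<bar>f (F j (l ! k) x)\<bar> \<le> K * ?\<rho> x powr s" if k: "k < n" for k
    proof -
      obtain K where K: "1 \<le> K" "\<And>x. ?\<rho> (F j (l ! k) x) \<le> K * ?\<rho> x" using is_affine_growth[OF aff[OF lI[OF k]]] by blast
      have "\<bar>f (F j (l ! k) x)\<bar> \<le> c1 * K powr s * ?\<rho> x powr s" for x
      proof -
        have "\<bar>f (F j (l ! k) x)\<bar> \<le> c1 * ?\<rho> (F j (l ! k) x) powr s" by (rule f(2)[OF is_affine_Rd[OF aff[OF lI[OF k]]]])
        also have "\<dots> \<le> c1 * (K * ?\<rho> x) powr s" using K(2) s f(3) by (intro mult_left_mono powr_mono2) auto
        finally show ?thesis using K(1) by (simp add: powr_mult mult.assoc)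
      qed
      then show ?thesis by blast
    qed
    then obtain K where K: "\<And>k x. k < n \<Longrightarrow> x \<in> Rd d \<Longrightarrow> \<bar>f (F j (l ! k) x)\<bar> \<le> K k * ?\<rho> x powr s" by metis
    have "\<bar>sum_list (map (\<lambda>i. f (F j i x)) l) / real n - mean x\<bar> \<le> ((\<Sum>k<n. K k) / real n + c1 * D1) * ?\<rho> x powr s"
      if x: "x \<in> Rd d" for x
    proof -
      have "\<bar>\<Sum>k<n. f (F j (l ! k) x)\<bar> \<le> (\<Sum>k<n. K k) * ?\<rho> x powr s"
        unfolding sum_distrib_right by (rule order_trans[OF sum_abs sum_mono]) (use K x in auto)
      then have "\<bar>\<Sum>k<n. f (F j (l ! k) x)\<bar> / real n \<le> (\<Sum>k<n. K k) * ?\<rho> x powr s / real n" by (intro divide_right_mono) auto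
      then have "\<bar>(\<Sum>k<n. f (F j (l ! k) x)) / real n\<bar> \<le> (\<Sum>k<n. K k) / real n * ?\<rho> x powr s" by (simp add: abs_divide)
      then have "\<bar>(\<Sum>k<n. f (F j (l ! k) x)) / real n - mean x\<bar> \<le> (\<Sum>k<n. K k) / real n * ?\<rho> x powr s + c1 * D1 * ?\<rho> x powr s"
        using meanb[OF x] by linarith
      then show ?thesis unfolding listsum l(1) by (simp add: distrib_right)
    qed
    then show "\<exists>K. \<forall>x\<in>Rd d. \<bar>sum_list (map (\<lambda>i. f (F j i x)) l) / real n - mean x\<bar> \<le> K * ?\<rho> x powr s" by blast
  qed
  have li: "integrable \<nu> (\<lambda>x. \<bar>sum_list (map (\<lambda>i. f (F j i x)) l) / real n - mean x\<bar> powr p)"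
    if l: "length l = n" "set l \<subseteq> I j" for l
    using ch[OF l] integrable_powr_of_bound(1)[OF \<nu> J _ _ p(1)] by blast
  have "\<exists>l. length l = n \<and> set l \<subseteq> I j \<and>
    (\<integral>x. \<bar>sum_list (map (\<lambda>i. f (F j i x)) l) / real n - mean x\<bar> powr p \<partial>\<nu>)
      \<le> moment_const k powr (p / (2 * real k)) * real n powr (- p / 2) * (\<integral>x. B x powr (p / 2) \<partial>\<nu>)"
  proof (rule FD.monte_carlo[OF _ _ _ p n li])
    show "mean x = (\<Sum>i\<in>I j. q j i * f (F j i x))" for x by (simp add: mean_def)
    show "0 < B x" for x using f(3) D1 by (simp add: B_def add_pos_nonneg)
    show "integrable \<nu> (\<lambda>x. B x powr (p / 2))" unfolding Bp using J by simp
    fix x and i :: nat assume x: "x \<in> space \<nu>" and i: "1 \<le> i" "i \<le> k"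
    have xR: "x \<in> Rd d" using x sp by simp
    define b where "b = c1 * D1 * ?\<rho> x powr s"
    have b0: "0 \<le> b" using f(3) D1 by (simp add: b_def)
    have term_le: "(f (F j l x) - mean x) ^ (2 * i) \<le> 4 ^ i * (c1 ^ (2 * i) * ?\<rho> (F j l x) powr (2 * s * real i) + b ^ (2 * i))"
      if l: "l \<in> I j" for l
    proof -
      let ?g = "c1 * ?\<rho> (F j l x) powr s"
      have g0: "0 \<le> ?g" using f(3) by simp
      have fg: "\<bar>f (F j l x)\<bar> \<le> ?g" by (rule f(2)[OF is_affine_Rd[OF aff[OF l]]])
      have "(f (F j l x) - mean x) ^ (2 * i) = \<bar>f (F j l x) - mean x\<bar> ^ (2 * i)" by (simp add: power_even_abs)
      also have "\<dots> \<le> (2 * max ?g b) ^ (2 * i)"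
        using fg meanb[OF xR] by (intro power_mono) (auto simp: b_def)
      also have "\<dots> = 4 ^ i * (max ?g b) ^ (2 * i)" by (simp add: power_mult_distrib power_mult)
      also have "\<dots> \<le> 4 ^ i * (?g ^ (2 * i) + b ^ (2 * i))"
        using g0 b0 by (intro mult_left_mono) (auto simp: max_def)
      also have "?g ^ (2 * i) = c1 ^ (2 * i) * ?\<rho> (F j l x) powr (2 * s * real i)"
        by (simp add: power_mult_distrib powr_realpow[symmetric] powr_powr add_pos_nonneg mult_ac)
      finally show ?thesis .
    qed
    have "(\<Sum>l\<in>I j. q j l * (f (F j l x) - mean x) ^ (2 * i))
        \<le> (\<Sum>l\<in>I j. q j l * (4 ^ i * (c1 ^ (2 * i) * ?\<rho> (F j l x) powr (2 * s * real i) + b ^ (2 * i))))"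
      using term_le FD.q_nonneg by (intro sum_mono mult_left_mono) auto
    also have "\<dots> = 4 ^ i * (c1 ^ (2 * i) * (\<Sum>l\<in>I j. q j l * ?\<rho> (F j l x) powr (2 * s * real i)) + (\<Sum>l\<in>I j. q j l) * b ^ (2 * i))"
      by (simp add: distrib_left sum.distrib sum_distrib_left sum_distrib_right mult_ac)
    also have "\<dots> \<le> 4 ^ i * (b ^ (2 * i) + b ^ (2 * i))"
    proof (rule mult_left_mono)
      have "2 * s * real i \<le> 2 * s * real k" using i s by (intro mult_left_mono) auto
      then have "2 * s * real i \<le> real M" using s(2) by linarith
      then have "c1 ^ (2 * i) * (\<Sum>l\<in>I j. q j l * ?\<rho> (F j l x) powr (2 * s * real i)) \<le> c1 ^ (2 * i) * (D1 * ?\<rho> x powr (2 * s * real i))"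
        using s f(3) by (intro mult_left_mono mom xR) auto
      also have "\<dots> \<le> c1 ^ (2 * i) * (D1 ^ (2 * i) * ?\<rho> x powr (2 * s * real i))"
        using D1 f(3) i by (intro mult_left_mono mult_right_mono self_le_power) auto
      also have "\<dots> = b ^ (2 * i)"
        by (simp add: b_def power_mult_distrib powr_realpow[symmetric] powr_powr add_pos_nonneg mult_ac)
      finally show "c1 ^ (2 * i) * (\<Sum>l\<in>I j. q j l * ?\<rho> (F j l x) powr (2 * s * real i)) + (\<Sum>l\<in>I j. q j l) * b ^ (2 * i) \<le> b ^ (2 * i) + b ^ (2 * i)"
        by (simp add: FD.q_sum)
    qed simp
    also have "\<dots> = 2 * 4 ^ i * b ^ (2 * i)" by simp
    also have "\<dots> \<le> 8 ^ i * b ^ (2 * i)"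
    proof (rule mult_right_mono)
      have "(2::real) * 4 ^ i \<le> 2 ^ i * 4 ^ i" using i self_le_power[of "2::real" i] by (intro mult_right_mono) auto
      also have "\<dots> = 8 ^ i" by (simp add: power_mult_distrib[symmetric])
      finally show "(2::real) * 4 ^ i \<le> 8 ^ i" .
    qed (use b0 in simp)
    also have "\<dots> = B x ^ i" by (simp add: B_def b_def power_mult_distrib power_mult)
    finally show "(\<Sum>l\<in>I j. q j l * (f (F j l x) - mean x) ^ (2 * i)) \<le> B x ^ i" .
  qed
  then obtain l where l: "length l = n" "set l \<subseteq> I j" and lb:
    "(\<integral>x. \<bar>sum_list (map (\<lambda>i. f (F j i x)) l) / real n - mean x\<bar> powr p \<partial>\<nu>)
      \<le> moment_const k powr (p / (2 * real k)) * real n powr (- p / 2) * (\<integral>x. B x powr (p / 2) \<partial>\<nu>)" by blast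
  have BJ: "(\<integral>x. B x powr (p / 2) \<partial>\<nu>) = (8 * (c1 * D1)\<^sup>2) powr (p / 2) * ?J" unfolding Bp by simp
  define S' where "S' x = (\<Sum>k<n. f (F j (l ! k) x)) / real n" for x
  have S': "sum_list (map (\<lambda>i. f (F j i x)) l) / real n = S' x" for x by (simp add: S'_def listsum l(1))
  have lI: "l ! k \<in> I j" if "k < n" for k using l that by auto
  let ?R = "\<lambda>x. 3 powr p * (\<bar>u (T, x) - Q j x\<bar> powr p + \<bar>Q j x - mean x\<bar> powr p + \<bar>S' x - mean x\<bar> powr p)"
  have Ri: "integrable \<nu> ?R" using dQi[of j] stepB(1) li[OF l] unfolding S' by simp
  have pt: "\<bar>u (T, x) - S' x\<bar> powr p \<le> ?R x" for x
    using abs_add3_powr_le[of p "u (T, x) - Q j x" "Q j x - mean x" "mean x - S' x"] p(1)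
    by (simp add: abs_minus_commute)
  have S'c: "continuous_on (Rd d) S'" unfolding S'_def using contF[OF f(1) aff[OF lI]] n by (intro continuous_intros) auto
  have m: "(\<lambda>x. \<bar>u (T, x) - S' x\<bar> powr p) \<in> borel_measurable \<nu>"
  proof -
    have "(\<lambda>x. u (T, x) - S' x) \<in> borel_measurable \<nu>" by (rule borel_measurable_Rd[OF \<nu>]) (intro continuous_intros uc S'c)
    then show ?thesis by measurable
  qed
  have fin: "integrable \<nu> (\<lambda>x. \<bar>u (T, x) - S' x\<bar> powr p)"
    by (rule Bochner_Integration.integrable_bound[OF Ri m]) (use pt in \<open>auto intro!: AE_I2 order_trans[OF _ abs_ge_self]\<close>)
  have "(\<integral>x. \<bar>u (T, x) - S' x\<bar> powr p \<partial>\<nu>) \<le> (\<integral>x. ?R x \<partial>\<nu>)" by (rule integral_mono[OF fin Ri pt])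
  also have "\<dots> = 3 powr p * ((\<integral>x. \<bar>u (T, x) - Q j x\<bar> powr p \<partial>\<nu>) + (\<integral>x. \<bar>Q j x - mean x\<bar> powr p \<partial>\<nu>) + (\<integral>x. \<bar>S' x - mean x\<bar> powr p \<partial>\<nu>))"
    using dQi[of j] stepB(1) li[OF l] unfolding S' by simp
  also have "\<dots> \<le> 3 powr p * (\<eta> + (c2 * D1) powr p * ?J + moment_const k powr (p / (2 * real k)) * real n powr (- p / 2) * ((8 * (c1 * D1)\<^sup>2) powr (p / 2) * ?J))"
    using j stepB(2) lb unfolding S' BJ by (intro mult_left_mono add_mono) auto
  finally show ?thesis using fin aff[OF lI] unfolding S'_def by (intro exI[of _ "\<lambda>k. F j (l ! k)"]) auto
qed

end

section \<open>Choice of the parameters\<close>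

text \<open>Here x stands for the dimension. In the accuracy \<kappa> x^(-(w+\<theta>)) \<epsilon>
  the exponent -w cancels the growth of the approximation error and -\<theta> that of the moment
  integral J. The bound is one of three equal shares of \<epsilon>^p / 3^p.\<close>

lemma bias_le:
  fixes c D \<kappa> \<epsilon> x w \<theta> p J CJ :: real
  assumes pos: "0 < c" "0 < D" "0 < \<kappa>" "0 < \<epsilon>" "1 \<le> x" and J: "J \<le> CJ * x powr (\<theta> * p)"
    and \<kappa>: "(2 * c * D * \<kappa>) powr p * CJ \<le> 1 / 3 powr (p + 1)"
  shows "(2 * (c * x powr w * (\<kappa> * x powr (- (w + \<theta>)) * \<epsilon>)) * D) powr p * J \<le> \<epsilon> powr p / 3 powr (p + 1)"
proof -
  have x: "x powr w * x powr (- (w + \<theta>)) = x powr (- \<theta>)" by (simp add: powr_add[symmetric])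
  have "2 * (c * x powr w * (\<kappa> * x powr (- (w + \<theta>)) * \<epsilon>)) * D = (2 * c * D * \<kappa>) * \<epsilon> * (x powr w * x powr (- (w + \<theta>)))"
    by (simp only: mult_ac)
  then have e: "(2 * (c * x powr w * (\<kappa> * x powr (- (w + \<theta>)) * \<epsilon>)) * D) powr p = (2 * c * D * \<kappa>) powr p * \<epsilon> powr p * x powr (- \<theta> * p)"
    unfolding x using pos by (simp only: powr_mult powr_powr)
  have "(2 * c * D * \<kappa>) powr p * \<epsilon> powr p * x powr (- \<theta> * p) * J
      \<le> (2 * c * D * \<kappa>) powr p * \<epsilon> powr p * x powr (- \<theta> * p) * (CJ * x powr (\<theta> * p))"
    using J by (intro mult_left_mono) auto
  also have "\<dots> = ((2 * c * D * \<kappa>) powr p * CJ) * \<epsilon> powr p * (x powr (- \<theta> * p) * x powr (\<theta> * p))"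
    by (simp only: mult_ac)
  also have "x powr (- \<theta> * p) * x powr (\<theta> * p) = 1" using pos by (simp add: powr_add[symmetric])
  also have "((2 * c * D * \<kappa>) powr p * CJ) * \<epsilon> powr p * 1 \<le> 1 / 3 powr (p + 1) * \<epsilon> powr p * 1"
    using \<kappa> by (intro mult_right_mono) auto
  finally show ?thesis unfolding e by simp
qed

text \<open>A sample size n of order x^(2v+2\<theta>) \<epsilon>^(-2) gives n^(-p/2) the factor
  x^(-(v+\<theta>)p) \<epsilon>^p, which cancels the growth x^(vp) of the networks and x^(\<theta>p)
  of J.\<close>

lemma variance_le:
  fixes c D \<epsilon> x v \<theta> p J CJ Cn n b :: real
  assumes pos: "0 < c" "0 < D" "0 < \<epsilon>" "1 \<le> x" "0 < p" "0 < b" "0 < Cn" and J: "J \<le> CJ * x powr (\<theta> * p)"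
    and n: "Cn * x powr (2 * v + 2 * \<theta>) * \<epsilon> powr (- 2) \<le> n"
    and Cn: "b * CJ * (32 * c\<^sup>2 * D\<^sup>2 / Cn) powr (p / 2) \<le> 1 / 3 powr (p + 1)" and CJ: "0 \<le> CJ"
  shows "b * n powr (- p / 2) * ((8 * (2 * (c * x powr v) * D)\<^sup>2) powr (p / 2) * J) \<le> \<epsilon> powr p / 3 powr (p + 1)"
proof -
  let ?X = "Cn * x powr (2 * v + 2 * \<theta>) * \<epsilon> powr (- 2)"
  have X: "0 < ?X" using pos by simp
  have "n powr (- p / 2) \<le> ?X powr (- p / 2)" using n X pos by (intro powr_mono2') auto
  also have "?X powr (- p / 2) = Cn powr (- p / 2) * x powr (- (v + \<theta>) * p) * \<epsilon> powr p"
    using pos by (simp only: powr_mult powr_powr) (simp add: algebra_simps)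
  finally have 1: "n powr (- p / 2) \<le> Cn powr (- p / 2) * x powr (- (v + \<theta>) * p) * \<epsilon> powr p" .
  have "8 * (2 * (c * x powr v) * D)\<^sup>2 = (32 * c\<^sup>2 * D\<^sup>2) * x powr (2 * v)"
    by (simp add: power_mult_distrib power2_eq_square powr_add[symmetric])
  then have 2: "(8 * (2 * (c * x powr v) * D)\<^sup>2) powr (p / 2) = (32 * c\<^sup>2 * D\<^sup>2) powr (p / 2) * x powr (v * p)"
    by (simp only: powr_mult powr_powr) (simp add: powr_mult)
  have "b * n powr (- p / 2) * ((8 * (2 * (c * x powr v) * D)\<^sup>2) powr (p / 2) * J)
     \<le> b * n powr (- p / 2) * ((32 * c\<^sup>2 * D\<^sup>2) powr (p / 2) * x powr (v * p) * (CJ * x powr (\<theta> * p)))"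
    unfolding 2 using J pos by (intro mult_left_mono) auto
  also have "\<dots> \<le> b * (Cn powr (- p / 2) * x powr (- (v + \<theta>) * p) * \<epsilon> powr p) * ((32 * c\<^sup>2 * D\<^sup>2) powr (p / 2) * x powr (v * p) * (CJ * x powr (\<theta> * p)))"
    using 1 pos CJ by (intro mult_right_mono mult_left_mono) auto
  also have "\<dots> = (b * CJ * ((32 * c\<^sup>2 * D\<^sup>2) powr (p / 2) * Cn powr (- p / 2))) * \<epsilon> powr p * (x powr (- (v + \<theta>) * p) * (x powr (v * p) * x powr (\<theta> * p)))"
    by (simp only: mult_ac)
  finally have le: "b * n powr (- p / 2) * ((8 * (2 * (c * x powr v) * D)\<^sup>2) powr (p / 2) * J) \<le> \<dots>" .
  have "x powr (- (v + \<theta>) * p) * (x powr (v * p) * x powr (\<theta> * p)) = x powr (- (v + \<theta>) * p + (v * p + \<theta> * p))"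
    by (simp only: powr_add)
  also have "- (v + \<theta>) * p + (v * p + \<theta> * p) = 0" by (simp add: algebra_simps)
  finally have x1: "x powr (- (v + \<theta>) * p) * (x powr (v * p) * x powr (\<theta> * p)) = 1" using pos by simp
  have q: "(32 * c\<^sup>2 * D\<^sup>2) powr (p / 2) * Cn powr (- p / 2) = (32 * c\<^sup>2 * D\<^sup>2 / Cn) powr (p / 2)"
  proof -
    have "Cn powr (- p / 2) = 1 / Cn powr (p / 2)" using powr_minus_divide[of Cn "p / 2"] by simp
    then show ?thesis using pos by (subst powr_divide) auto
  qed
  have "b * CJ * (32 * c\<^sup>2 * D\<^sup>2 / Cn) powr (p / 2) * \<epsilon> powr p \<le> 1 / 3 powr (p + 1) * \<epsilon> powr p"
    using Cn by (intro mult_right_mono) auto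
  moreover have "1 / 3 powr (p + 1) * \<epsilon> powr p = \<epsilon> powr p / 3 powr (p + 1)" by simp
  ultimately show ?thesis using le unfolding x1 q mult_1_right by linarith
qed

text \<open>The case j = 2 is for all parameters and j = 1 for the nonzero ones, with n^j from the
  parallel copies. Sampling contributes 2 j \<theta> <= 4 \<theta> and the network accuracy
  contributes \<open>zz\<close> \<theta>, both within (5 + \<open>zz\<close>) \<theta>. The factor 2
  of \<open>Cn\<close> comes from rounding n up.\<close>

lemma size_le:
  fixes c \<kappa> \<epsilon> x v w z zz \<theta> Cn n N :: real and P :: real and j :: nat
  assumes pos: "0 < c" "0 < \<kappa>" "0 < \<epsilon>" "1 \<le> x" "0 < Cn" "0 \<le> n" "0 \<le> \<theta>" and j: "1 \<le> j" "j \<le> 2"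
    and n: "n \<le> 2 * (Cn * x powr (2 * v + 2 * \<theta>) * \<epsilon> powr (- 2))"
    and N: "N \<le> c * x powr z * (\<kappa> * x powr (- (w + \<theta>)) * \<epsilon>) powr (- zz)" and P: "P \<le> n ^ j * N"
  shows "P \<le> (2 * Cn) ^ j * c * \<kappa> powr (- zz) * x powr ((5 + zz) * \<theta> + z + w * zz + 2 * real j * v) * \<epsilon> powr (- (2 * real j) - zz)"
proof -
  have \<delta>: "(\<kappa> * x powr (- (w + \<theta>)) * \<epsilon>) powr (- zz) = \<kappa> powr (- zz) * x powr ((w + \<theta>) * zz) * \<epsilon> powr (- zz)"
    using pos by (simp only: powr_mult powr_powr) (simp add: algebra_simps)
  let ?X = "2 * (Cn * x powr (2 * v + 2 * \<theta>) * \<epsilon> powr (- 2))"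
  have X: "0 < ?X" using pos by simp
  have "P \<le> n ^ j * (c * x powr z * (\<kappa> powr (- zz) * x powr ((w + \<theta>) * zz) * \<epsilon> powr (- zz)))"
    using P mult_left_mono[OF N, of "n ^ j"] pos unfolding \<delta> by simp
  also have "\<dots> \<le> ?X ^ j * (c * x powr z * (\<kappa> powr (- zz) * x powr ((w + \<theta>) * zz) * \<epsilon> powr (- zz)))"
    using n pos by (intro mult_right_mono power_mono) auto
  also have "?X ^ j = (2 * Cn) ^ j * x powr ((2 * v + 2 * \<theta>) * real j) * \<epsilon> powr (- 2 * real j)"
  proof -
    have "(x powr (2 * v + 2 * \<theta>)) ^ j = x powr ((2 * v + 2 * \<theta>) * real j)" "(\<epsilon> powr (- 2)) ^ j = \<epsilon> powr (- 2 * real j)"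
      using pos by (simp_all only: powr_powr[symmetric]) (subst powr_realpow; simp)+
    then show ?thesis by (simp only: power_mult_distrib mult_ac)
  qed
  also have "(2 * Cn) ^ j * x powr ((2 * v + 2 * \<theta>) * real j) * \<epsilon> powr (- 2 * real j) * (c * x powr z * (\<kappa> powr (- zz) * x powr ((w + \<theta>) * zz) * \<epsilon> powr (- zz)))
     = ((2 * Cn) ^ j * c * \<kappa> powr (- zz)) * (x powr ((2 * v + 2 * \<theta>) * real j) * (x powr z * x powr ((w + \<theta>) * zz))) * (\<epsilon> powr (- 2 * real j) * \<epsilon> powr (- zz))"
    by (simp only: mult_ac)
  also have "\<epsilon> powr (- 2 * real j) * \<epsilon> powr (- zz) = \<epsilon> powr (- (2 * real j) - zz)" by (simp add: powr_add[symmetric])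
  also have "x powr ((2 * v + 2 * \<theta>) * real j) * (x powr z * x powr ((w + \<theta>) * zz)) = x powr ((2 * v + 2 * \<theta>) * real j + (z + (w + \<theta>) * zz))"
    by (simp only: powr_add)
  also have "(2 * Cn) ^ j * c * \<kappa> powr (- zz) * x powr ((2 * v + 2 * \<theta>) * real j + (z + (w + \<theta>) * zz)) * \<epsilon> powr (- (2 * real j) - zz)
     \<le> (2 * Cn) ^ j * c * \<kappa> powr (- zz) * x powr ((5 + zz) * \<theta> + z + w * zz + 2 * real j * v) * \<epsilon> powr (- (2 * real j) - zz)"
  proof (intro mult_right_mono mult_left_mono powr_mono)
    have "\<theta> * real j \<le> \<theta> * 2" using j pos by (intro mult_left_mono) auto
    then show "(2 * v + 2 * \<theta>) * real j + (z + (w + \<theta>) * zz) \<le> (5 + zz) * \<theta> + z + w * zz + 2 * real j * v"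
      using pos by (simp add: algebra_simps)
  qed (use pos in auto)
  finally show ?thesis .
qed

text \<open>The columns of \<sigma> inherit the affine identity entrywise, and their squared lengths
  add up to the squared Hilbert-Schmidt norm. The constant 2 c^2 arises from (1 + |x|)^2 <= 2 (1 +
  |x|^2).\<close>

lemma affine_coeffs_exist:
  fixes \<mu> :: "(nat \<Rightarrow> real) \<Rightarrow> nat \<Rightarrow> real" and \<sigma> :: "(nat \<Rightarrow> real) \<Rightarrow> real mat"
  assumes d: "1 \<le> d" and c: "1 \<le> c"
    and \<mu>: "\<And>x. x \<in> Rd d \<Longrightarrow> \<mu> x \<in> Rd d" and \<sigma>: "\<And>x. x \<in> Rd d \<Longrightarrow> \<sigma> x \<in> carrier_mat d d"
    and \<mu>_aff: "\<And>x y b i. x \<in> Rd d \<Longrightarrow> y \<in> Rd d \<Longrightarrow> \<mu> (\<lambda>j. b * x j + y j) i + b * \<mu> (\<lambda>_. 0) i = b * \<mu> x i + \<mu> y i"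
    and \<sigma>_aff: "\<And>x y b. x \<in> Rd d \<Longrightarrow> y \<in> Rd d \<Longrightarrow>
           \<sigma> (\<lambda>j. b * x j + y j) + b \<cdot>\<^sub>m \<sigma> (\<lambda>_. 0) = b \<cdot>\<^sub>m \<sigma> x + \<sigma> y"
    and growth: "\<And>x. x \<in> Rd d \<Longrightarrow> eucl_norm d (\<mu> x) + HS_norm (\<sigma> x) \<le> c * (1 + eucl_norm d x)"
  shows "\<exists>L S. affine_coeffs d L S (2 * c\<^sup>2) \<and> (\<forall>x\<in>Rd d. \<mu> x = L x) \<and>
    (\<forall>x\<in>Rd d. \<forall>i<d. \<forall>k<d. S k x i = \<sigma> x $$ (i, k))"
proof -
  obtain L where L: "is_affine d L" "\<And>x. x \<in> Rd d \<Longrightarrow> L x = \<mu> x"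
    using affine_representation[of d \<mu>, OF \<mu> \<mu>_aff] by blast
  define col where "col k x = (\<lambda>i. if i < d then \<sigma> x $$ (i, k) else 0)" for k x
  have "\<exists>F. is_affine d F \<and> (\<forall>x\<in>Rd d. F x = col k x)" if k: "k < d" for k
  proof (rule affine_representation)
    show "col k x \<in> Rd d" for x by (simp add: col_def Rd_def)
    fix x y :: "nat \<Rightarrow> real" and b i assume xy: "x \<in> Rd d" "y \<in> Rd d"
    have z: "(\<lambda>j. b * x j + y j) \<in> Rd d" using xy by (simp add: Rd_def)
    show "col k (\<lambda>j. b * x j + y j) i + b * col k (\<lambda>_. 0) i = b * col k x i + col k y i"
    proof (cases "i < d")
      case True
      have "(\<sigma> (\<lambda>j. b * x j + y j) + b \<cdot>\<^sub>m \<sigma> (\<lambda>_. 0)) $$ (i, k) = (b \<cdot>\<^sub>m \<sigma> x + \<sigma> y) $$ (i, k)"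
        by (simp only: \<sigma>_aff[OF xy])
      then show ?thesis using True k \<sigma>[OF z] \<sigma>[OF xy(1)] \<sigma>[OF xy(2)] \<sigma>[OF Rd_zero] by (simp add: col_def)
    qed (simp add: col_def)
  qed
  then obtain S where S: "\<And>k. k < d \<Longrightarrow> is_affine d (S k)" "\<And>k x. k < d \<Longrightarrow> x \<in> Rd d \<Longrightarrow> S k x = col k x" by metis
  have bound: "nsq d (\<mu> x) \<le> 2 * c\<^sup>2 * (1 + nsq d x)" "(HS_norm (\<sigma> x))\<^sup>2 \<le> 2 * c\<^sup>2 * (1 + nsq d x)"
    if x: "x \<in> Rd d" for x
  proof -
    let ?e = "eucl_norm d x"
    have "(1 + ?e)\<^sup>2 \<le> 2 * (1 + ?e\<^sup>2)" using zero_le_power2[of "1 - ?e"] by (simp add: power2_eq_square algebra_simps)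
    also have "?e\<^sup>2 = nsq d x" by (simp add: eucl_norm_eq_sqrt_nsq)
    finally have "c\<^sup>2 * (1 + ?e)\<^sup>2 \<le> c\<^sup>2 * (2 * (1 + nsq d x))" by (intro mult_left_mono) auto
    then have e: "(c * (1 + ?e))\<^sup>2 \<le> 2 * c\<^sup>2 * (1 + nsq d x)" unfolding power_mult_distrib by (simp only: mult_ac)
    have h: "0 \<le> HS_norm (\<sigma> x)" "0 \<le> eucl_norm d (\<mu> x)" by (simp_all add: HS_norm_def)
    have g: "eucl_norm d (\<mu> x) \<le> c * (1 + ?e)" "HS_norm (\<sigma> x) \<le> c * (1 + ?e)" using growth[OF x] h by linarith+
    have "(eucl_norm d (\<mu> x))\<^sup>2 \<le> (c * (1 + ?e))\<^sup>2" by (rule power_mono[OF g(1) h(2)])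
    then show "nsq d (\<mu> x) \<le> 2 * c\<^sup>2 * (1 + nsq d x)" using e by (simp add: eucl_norm_eq_sqrt_nsq)
    have "(HS_norm (\<sigma> x))\<^sup>2 \<le> (c * (1 + ?e))\<^sup>2" by (rule power_mono[OF g(2) h(1)])
    then show "(HS_norm (\<sigma> x))\<^sup>2 \<le> 2 * c\<^sup>2 * (1 + nsq d x)" using e by simp
  qed
  have HS: "(\<Sum>k<d. nsq d (S k x)) = (HS_norm (\<sigma> x))\<^sup>2" if x: "x \<in> Rd d" for x
  proof -
    have "(\<Sum>k<d. nsq d (S k x)) = (\<Sum>k<d. \<Sum>i<d. (\<sigma> x $$ (i, k))\<^sup>2)"
      using S(2)[OF _ x] by (simp add: nsq_def col_def)
    also have "\<dots> = (\<Sum>i<d. \<Sum>k<d. (\<sigma> x $$ (i, k))\<^sup>2)" by (rule sum.swap)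
    also have "\<dots> = (HS_norm (\<sigma> x))\<^sup>2"
      using \<sigma>[OF x] by (simp add: HS_norm_def L2_set_def sum_nonneg sum.cartesian_product')
    finally show ?thesis .
  qed
  have "affine_coeffs d L S (2 * c\<^sup>2)"
  proof
    show "1 \<le> 2 * c\<^sup>2" using one_le_power[OF c, of 2] by simp
    show "nsq d (L x) \<le> 2 * c\<^sup>2 * (1 + nsq d x)" if "x \<in> Rd d" for x using bound(1) L(2) that by simp
    show "(\<Sum>k<d. nsq d (S k x)) \<le> 2 * c\<^sup>2 * (1 + nsq d x)" if "x \<in> Rd d" for x using bound(2) HS that by simp
  qed (use d L S in auto)
  then show ?thesis using L(2) S(2) by (intro exI[of _ L] exI[of _ S]) (auto simp: col_def)
qed

theorem theorem3p14:
  fixes T r R v w z zz \<theta> c vv p :: real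
    and \<nu> :: "nat \<Rightarrow> (nat \<Rightarrow> real) measure"
    and \<phi> :: "nat \<Rightarrow> (nat \<Rightarrow> real) \<Rightarrow> real"
    and \<mu> :: "nat \<Rightarrow> (nat \<Rightarrow> real) \<Rightarrow> nat \<Rightarrow> real"
    and \<sigma> :: "nat \<Rightarrow> (nat \<Rightarrow> real) \<Rightarrow> real mat"
    and a :: "real \<Rightarrow> real"
    and \<Phi> :: "nat \<Rightarrow> real \<Rightarrow> network"
  assumes "0 < T" "0 < r" "0 < R"
    and "0 \<le> v" "0 \<le> w" "0 \<le> z" "0 \<le> zz" "0 \<le> \<theta>"
    and "1 \<le> c" "2 \<le> vv" "2 \<le> p"
    and "\<And>d. 1 \<le> d \<Longrightarrow> prob_space (\<nu> d)"
    and "\<And>d. 1 \<le> d \<Longrightarrow> sets (\<nu> d) = sets (restrict_space borel (Rd d))"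
    and "(SUP d\<in>{1..}. ennreal (real d powr (- \<theta> * p)) *
            (\<integral>\<^sup>+ x. ennreal (eucl_norm d x powr (p * vv)) \<partial>\<nu> d)) < \<infinity>"
    and "\<And>d. 1 \<le> d \<Longrightarrow> continuous_on (Rd d) (\<phi> d)"
    and "\<And>d x. 1 \<le> d \<Longrightarrow> x \<in> Rd d \<Longrightarrow> \<mu> d x \<in> Rd d"
    and "\<And>d x. 1 \<le> d \<Longrightarrow> x \<in> Rd d \<Longrightarrow> \<sigma> d x \<in> carrier_mat d d"
    and "\<And>d x y b i. 1 \<le> d \<Longrightarrow> x \<in> Rd d \<Longrightarrow> y \<in> Rd d \<Longrightarrow>
           \<mu> d (\<lambda>j. b * x j + y j) i + b * \<mu> d (\<lambda>_. 0) i = b * \<mu> d x i + \<mu> d y i"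
    and "\<And>d x y b. 1 \<le> d \<Longrightarrow> x \<in> Rd d \<Longrightarrow> y \<in> Rd d \<Longrightarrow>
           \<sigma> d (\<lambda>j. b * x j + y j) + b \<cdot>\<^sub>m \<sigma> d (\<lambda>_. 0) = b \<cdot>\<^sub>m \<sigma> d x + \<sigma> d y"
    and "\<And>d x. 1 \<le> d \<Longrightarrow> x \<in> Rd d \<Longrightarrow>
           eucl_norm d (\<mu> d x) + HS_norm (\<sigma> d x) \<le> c * (1 + eucl_norm d x)"
    and "continuous_on UNIV a"
    and "\<And>d \<delta>. 1 \<le> d \<Longrightarrow> \<delta> \<in> {0<..r} \<Longrightarrow> \<Phi> d \<delta> \<in> networks"
    and "\<And>d \<delta>. 1 \<le> d \<Longrightarrow> \<delta> \<in> {0<..r} \<Longrightarrow>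
           real (param_count (\<Phi> d \<delta>)) \<le> c * real d powr z * \<delta> powr (- zz)"
    and "\<And>d \<delta>. 1 \<le> d \<Longrightarrow> \<delta> \<in> {0<..r} \<Longrightarrow> realization_in_C a (\<Phi> d \<delta>) d"
    and "\<And>d \<delta> x. 1 \<le> d \<Longrightarrow> \<delta> \<in> {0<..r} \<Longrightarrow> x \<in> Rd d \<Longrightarrow>
           \<bar>realization a (\<Phi> d \<delta>) x\<bar> \<le> c * real d powr v * (1 + eucl_norm d x powr vv)"
    and "\<And>d \<delta> x. 1 \<le> d \<Longrightarrow> \<delta> \<in> {0<..r} \<Longrightarrow> x \<in> Rd d \<Longrightarrow>
           \<bar>\<phi> d x - realization a (\<Phi> d \<delta>) x\<bar>
             \<le> c * real d powr w * \<delta> * (1 + eucl_norm d x powr vv)"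
  shows "(\<exists>!u. u \<in> (\<Pi>\<^sub>E d\<in>{1..}. {0..T} \<times> Rd d \<rightarrow>\<^sub>E UNIV) \<and>
               (\<forall>d\<ge>1. kolmogorov_solution d T (\<phi> d) (\<mu> d) (\<sigma> d) (u d))) \<and>
         (\<forall>u. (\<forall>d\<ge>1. kolmogorov_solution d T (\<phi> d) (\<mu> d) (\<sigma> d) (u d)) \<longrightarrow>
           (\<exists>C>0. \<exists>\<Psi> :: nat \<Rightarrow> real \<Rightarrow> network. \<forall>d\<ge>1. \<forall>\<epsilon>\<in>{0<..R}.
              \<Psi> d \<epsilon> \<in> networks \<and>
              real (param_count (\<Psi> d \<epsilon>))
                \<le> C * real d powr ((5 + zz) * \<theta> + z + w * zz + 4 * v) * \<epsilon> powr (- 4 - zz) \<and>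
              real (nz_param_count (\<Psi> d \<epsilon>))
                \<le> C * real d powr ((5 + zz) * \<theta> + z + w * zz + 2 * v) * \<epsilon> powr (- 2 - zz) \<and>
              realization_in_C a (\<Psi> d \<epsilon>) d \<and>
              integrable (\<nu> d) (\<lambda>x. \<bar>u d (T, x) - realization a (\<Psi> d \<epsilon>) x\<bar> powr p) \<and>
              (\<integral>x. \<bar>u d (T, x) - realization a (\<Psi> d \<epsilon>) x\<bar> powr p \<partial>\<nu> d) powr (1 / p) \<le> \<epsilon>))"
proof -
  define A where "A d = 2 * (c * real d powr v + c * real d powr w * r)" for d :: nat
  have A0: "0 \<le> A d" for d using assms(2,9) by (simp add: A_def)
  have \<phi>_bd: "\<bar>\<phi> d x\<bar> \<le> A d * (1 + nsq d x) powr (vv / 2)" if d: "1 \<le> d" and x: "x \<in> Rd d" for d x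
  proof -
    \<comment> \<open>One network, of accuracy r, bounds \<phi>: its growth plus its distance to
      \<phi>. The resulting \<open>A d\<close> depends on d, which is harmless because it serves
      only for existence, uniqueness and domination.\<close>
    have rr: "r \<in> {0<..r}" using assms(2) by simp
    have "\<bar>\<phi> d x\<bar> \<le> (c * real d powr v + c * real d powr w * r) * (1 + eucl_norm d x powr vv)"
      using assms(25)[OF d rr x] assms(26)[OF d rr x] by (simp add: distrib_right)
    also have "\<dots> \<le> (c * real d powr v + c * real d powr w * r) * (2 * (1 + nsq d x) powr (vv / 2))"
      using one_plus_eucl_norm_powr_le[of vv x d] assms(2,9,10) by (intro mult_left_mono) auto
    finally show ?thesis unfolding A_def by (simp only: mult_ac)
  qed
  define ok where "ok d L S \<longleftrightarrow> affine_coeffs d L S (2 * c\<^sup>2) \<and> (\<forall>x\<in>Rd d. \<mu> d x = L x) \<and>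
    (\<forall>x\<in>Rd d. \<forall>i<d. \<forall>k<d. S k x i = \<sigma> d x $$ (i, k))" for d L S
  have "\<exists>L S. ok d L S" if d: "1 \<le> d" for d
    unfolding ok_def
    by (rule affine_coeffs_exist[OF d assms(9) assms(16)[OF d] assms(17)[OF d] assms(18)[OF d] assms(19)[OF d] assms(20)[OF d]])
  then obtain L S where "\<And>d. 1 \<le> d \<Longrightarrow> ok d (L d) (S d)" by metis
  then have ac: "\<And>d. 1 \<le> d \<Longrightarrow> affine_coeffs d (L d) (S d) (2 * c\<^sup>2)"
    and L: "\<And>d x. 1 \<le> d \<Longrightarrow> x \<in> Rd d \<Longrightarrow> \<mu> d x = L d x"
    and S: "\<And>d x i k. 1 \<le> d \<Longrightarrow> x \<in> Rd d \<Longrightarrow> i < d \<Longrightarrow> k < d \<Longrightarrow> S d k x i = \<sigma> d x $$ (i, k)"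
    unfolding ok_def by simp_all
  let ?K = "\<lambda>d. kolmogorov_solution d T (\<phi> d) (\<mu> d) (\<sigma> d)"
  let ?X = "\<lambda>d. {0..T} \<times> Rd d"
  have iff: "?K d u \<longleftrightarrow> (\<exists>m. affine_coeffs.is_solution d (L d) (S d) T (\<phi> d) m u)" if d: "1 \<le> d" for d u
    by (rule affine_coeffs.kolmogorov_solution_iff[OF ac[OF d] L[OF d] assms(17)[OF d] S[OF d]])
  obtain m0 :: nat where m0: "max 1 (vv / 2) \<le> real m0" using real_arch_simple by blast
  have m01: "1 \<le> m0" "vv / 2 \<le> real m0" using m0 by auto
  have \<phi>_W: "\<bar>\<phi> d x\<bar> \<le> A d * weight d m x" if d: "1 \<le> d" and x: "x \<in> Rd d" and m: "m0 \<le> m" for d x m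
  proof -
    have "vv / 2 \<le> real m" using m01 m by linarith
    then have "A d * (1 + nsq d x) powr (vv / 2) \<le> A d * weight d m x" using A0 by (intro mult_left_mono powr_le_weight) auto
    then show ?thesis using \<phi>_bd[OF d x] by linarith
  qed
  have ex: "\<exists>u. ?K d u" if d: "1 \<le> d" for d
    using affine_coeffs.solution_exists[OF ac[OF d] assms(1) assms(15)[OF d] \<phi>_W[OF d _ order_refl] m01(1)] iff[OF d] by blast
  have uniq: "u p = u' p" if d: "1 \<le> d" and u: "?K d u" "?K d u'" and p: "p \<in> ?X d" for d u u' p
  proof -
    obtain m m' where m: "affine_coeffs.is_solution d (L d) (S d) T (\<phi> d) m u" "affine_coeffs.is_solution d (L d) (S d) T (\<phi> d) m' u'"
      using u iff[OF d] by blast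
    let ?m = "max m0 (max m m')"
    have sol: "affine_coeffs.is_solution d (L d) (S d) T (\<phi> d) ?m u" "affine_coeffs.is_solution d (L d) (S d) T (\<phi> d) ?m u'"
      using affine_coeffs.is_solution_mono[OF ac[OF d] m(1)] affine_coeffs.is_solution_mono[OF ac[OF d] m(2)] by simp_all
    have m: "m0 \<le> ?m" "1 \<le> ?m" using m01 by simp_all
    show ?thesis
      by (rule affine_coeffs.solution_unique[OF ac[OF d] assms(1) assms(15)[OF d] \<phi>_W[OF d _ m(1)] m(2) sol p])
  qed
  have cong: "?K d w" if d: "1 \<le> d" and u: "?K d u" and w: "\<And>p. p \<in> ?X d \<Longrightarrow> u p = w p" for d u w
  proof -
    obtain m where m: "affine_coeffs.is_solution d (L d) (S d) T (\<phi> d) m u" using u iff[OF d] by blast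
    have "affine_coeffs.is_solution d (L d) (S d) T (\<phi> d) m w"
      by (rule affine_coeffs.is_solution_cong[OF ac[OF d] m _ assms(1)]) (rule w)
    then show ?thesis using iff[OF d] by blast
  qed
  have "\<exists>!u. u \<in> (\<Pi>\<^sub>E d\<in>{1..}. ?X d \<rightarrow>\<^sub>E UNIV) \<and> (\<forall>d\<ge>1. ?K d (u d))"
  proof -
    define U where "U d = (SOME u. ?K d u)" for d
    have U: "?K d (U d)" if "1 \<le> d" for d unfolding U_def by (rule someI_ex[OF ex[OF that]])
    \<comment> \<open>Uniqueness concerns functions on [0,T] times \<open>Rd d\<close>, modelled as
      extensional functions; hence the chosen solutions are restricted.\<close>
    define u where "u = (\<lambda>d\<in>{1..}. restrict (U d) (?X d))"
    have Ku: "?K d (u d)" if d: "1 \<le> d" for d by (rule cong[OF d U[OF d]]) (use d in \<open>simp add: u_def\<close>)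
    have uP: "u \<in> (\<Pi>\<^sub>E d\<in>{1..}. ?X d \<rightarrow>\<^sub>E UNIV)" by (auto simp: u_def)
    have uq: "w = u" if w: "w \<in> (\<Pi>\<^sub>E d\<in>{1..}. ?X d \<rightarrow>\<^sub>E UNIV)" "\<forall>d\<ge>1. ?K d (w d)" for w
    proof (rule PiE_ext[OF w(1)])
      show "u \<in> (\<Pi>\<^sub>E d\<in>{1..}. ?X d \<rightarrow>\<^sub>E UNIV)" by (rule uP)
      fix d :: nat assume "d \<in> {1..}"
      then have d: "1 \<le> d" by simp
      show "w d = u d"
      proof (rule PiE_ext)
        show "w d \<in> ?X d \<rightarrow>\<^sub>E UNIV" using w(1) d by (auto dest: PiE_mem)
        show "u d \<in> ?X d \<rightarrow>\<^sub>E UNIV" using d by (simp add: u_def)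
        show "w d p = u d p" if "p \<in> ?X d" for p
          using uniq[OF d _ U[OF d] that, of "w d"] w(2) d that by (simp add: u_def)
      qed
    qed
    show ?thesis
    proof (rule ex1I)
      show "u \<in> (\<Pi>\<^sub>E d\<in>{1..}. ?X d \<rightarrow>\<^sub>E UNIV) \<and> (\<forall>d\<ge>1. ?K d (u d))"
        by (intro conjI allI impI uP Ku)
      show "w = u" if "w \<in> (\<Pi>\<^sub>E d\<in>{1..}. ?X d \<rightarrow>\<^sub>E UNIV) \<and> (\<forall>d\<ge>1. ?K d (w d))" for w
        by (rule uq[OF conjunct1[OF that] conjunct2[OF that]])
    qed
  qed
  moreover have "\<exists>C>0. \<exists>\<Psi> :: nat \<Rightarrow> real \<Rightarrow> network. \<forall>d\<ge>1. \<forall>\<epsilon>\<in>{0<..R}.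
              \<Psi> d \<epsilon> \<in> networks \<and>
              real (param_count (\<Psi> d \<epsilon>))
                \<le> C * real d powr ((5 + zz) * \<theta> + z + w * zz + 4 * v) * \<epsilon> powr (- 4 - zz) \<and>
              real (nz_param_count (\<Psi> d \<epsilon>))
                \<le> C * real d powr ((5 + zz) * \<theta> + z + w * zz + 2 * v) * \<epsilon> powr (- 2 - zz) \<and>
              realization_in_C a (\<Psi> d \<epsilon>) d \<and>
              integrable (\<nu> d) (\<lambda>x. \<bar>u d (T, x) - realization a (\<Psi> d \<epsilon>) x\<bar> powr p) \<and>
              (\<integral>x. \<bar>u d (T, x) - realization a (\<Psi> d \<epsilon>) x\<bar> powr p \<partial>\<nu> d) powr (1 / p) \<le> \<epsilon>"
    if u: "\<forall>d\<ge>1. ?K d (u d)" for u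
  proof -
    have p0: "0 < p" using assms(11) by simp
    define s where "s = vv / 2"
    have s0: "0 \<le> s" using assms(10) by (simp add: s_def)
    \<comment> \<open>The even exponent 2 k is at least p, so moments can be expanded;
      \<open>M\<close> then covers the moments of order 2 s k of the affine maps.\<close>
    obtain k :: nat where k: "p \<le> 2 * real k" using real_arch_simple[of "p / 2"] by (auto simp: field_simps)
    have k0: "0 < real k" using k p0 by linarith
    obtain M :: nat where M: "2 * s * real k \<le> real M" using real_arch_simple by blast
    define D where "D = exp (dimension.growth_rate (2 * c\<^sup>2) M * T)"
    have D0: "0 < D" by (simp add: D_def)
    define C0 where "C0 = enn2real (SUP d\<in>{1..}. ennreal (real d powr (- \<theta> * p)) *
            (\<integral>\<^sup>+ x. ennreal (eucl_norm d x powr (p * vv)) \<partial>\<nu> d))"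
    have C0: "0 \<le> C0" by (simp add: C0_def)
    define CJ where "CJ = 2 powr (vv * p / 2) * (1 + C0)"
    have CJ0: "0 < CJ" using C0 by (simp add: CJ_def)
    have J: "integrable (\<nu> d) (\<lambda>x. (1 + nsq d x) powr (s * p)) \<and>
        (\<integral>x. (1 + nsq d x) powr (s * p) \<partial>\<nu> d) \<le> CJ * real d powr (\<theta> * p)" if d: "1 \<le> d" for d
    proof -
      interpret prob_space "\<nu> d" by (rule assms(12)[OF d])
      let ?f = "\<lambda>x. eucl_norm d x powr (p * vv)"
      have d1: "1 \<le> real d powr (\<theta> * p)" using d assms(8) p0 by (intro ge_one_powr_ge_zero) auto
      have nc: "continuous_on (Rd d) (nsq d)" unfolding nsq_def[abs_def] by (intro continuous_intros continuous_on_coord)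
      have nm: "nsq d \<in> borel_measurable (\<nu> d)" by (rule borel_measurable_Rd[OF assms(13)[OF d] nc])
      have fm: "?f \<in> borel_measurable (\<nu> d)" unfolding eucl_norm_eq_sqrt_nsq using nm by measurable
      have "ennreal (real d powr (- \<theta> * p)) * (\<integral>\<^sup>+ x. ennreal (?f x) \<partial>\<nu> d) \<le> ennreal C0"
      proof -
        have "ennreal (real d powr (- \<theta> * p)) * (\<integral>\<^sup>+ x. ennreal (?f x) \<partial>\<nu> d) \<le> (SUP d\<in>{1..}. ennreal (real d powr (- \<theta> * p)) *
            (\<integral>\<^sup>+ x. ennreal (eucl_norm d x powr (p * vv)) \<partial>\<nu> d))"
          using d by (intro SUP_upper) simp
        also have "\<dots> = ennreal C0" using assms(14) by (simp add: C0_def)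
        finally show ?thesis .
      qed
      then have "ennreal (real d powr (\<theta> * p)) * (ennreal (real d powr (- \<theta> * p)) * (\<integral>\<^sup>+ x. ennreal (?f x) \<partial>\<nu> d)) \<le> ennreal (real d powr (\<theta> * p)) * ennreal C0"
        by (rule mult_left_mono) simp
      moreover have "ennreal (real d powr (\<theta> * p)) * ennreal (real d powr (- \<theta> * p)) = 1"
        using d by (simp add: ennreal_mult[symmetric] powr_add[symmetric])
      ultimately have nn: "(\<integral>\<^sup>+ x. ennreal (?f x) \<partial>\<nu> d) \<le> ennreal (real d powr (\<theta> * p) * C0)"
        using C0 by (simp add: mult.assoc[symmetric] ennreal_mult)
      have fi: "integrable (\<nu> d) ?f"
        by (rule integrableI_nonneg[OF fm]) (use nn in \<open>auto intro: le_less_trans\<close>)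
      have "ennreal (\<integral>x. ?f x \<partial>\<nu> d) \<le> ennreal (real d powr (\<theta> * p) * C0)"
        using nn nn_integral_eq_integral[OF fi] by simp
      then have fJ: "(\<integral>x. ?f x \<partial>\<nu> d) \<le> real d powr (\<theta> * p) * C0" using C0 by (simp add: ennreal_le_iff)
      have le: "(1 + nsq d x) powr (s * p) \<le> 2 powr (vv * p / 2) * (1 + ?f x)" for x
        using one_plus_nsq_powr_le[of "p * vv" d x] p0 assms(10) by (simp add: s_def mult_ac)
      have gi: "integrable (\<nu> d) (\<lambda>x. 2 powr (vv * p / 2) * (1 + ?f x))" using fi by simp
      have int: "integrable (\<nu> d) (\<lambda>x. (1 + nsq d x) powr (s * p))"
        by (rule Bochner_Integration.integrable_bound[OF gi]) (use nm le in \<open>auto intro!: AE_I2 order_trans[OF _ abs_ge_self]\<close>)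
      have "(\<integral>x. (1 + nsq d x) powr (s * p) \<partial>\<nu> d) \<le> (\<integral>x. 2 powr (vv * p / 2) * (1 + ?f x) \<partial>\<nu> d)"
        by (rule integral_mono[OF int gi le])
      also have "\<dots> = 2 powr (vv * p / 2) * (1 + (\<integral>x. ?f x \<partial>\<nu> d))" using fi by (simp add: prob_space)
      also have "\<dots> \<le> 2 powr (vv * p / 2) * (real d powr (\<theta> * p) + real d powr (\<theta> * p) * C0)"
        using fJ d1 by (intro mult_left_mono add_mono) auto
      also have "\<dots> = CJ * real d powr (\<theta> * p)" by (simp add: CJ_def algebra_simps)
      finally show ?thesis using int by blast
    qed
    define b where "b = moment_const k powr (p / (2 * real k))"
    have b0: "0 < b" using moment_const_ge_1[of k] by (simp add: b_def)
    \<comment> \<open>The first term of the minimum ensures \<delta> <= r for all \<epsilon> <= R;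
      the second solves the requirement of \<open>bias_le\<close>.\<close>
    define \<kappa> where "\<kappa> = min (r / R) (1 / (2 * c * D * (3 powr (p + 1) * CJ) powr (1 / p)))"
    have \<kappa>0: "0 < \<kappa>" using assms(2,3,9) D0 CJ0 by (simp add: \<kappa>_def)
    have \<kappa>: "(2 * c * D * \<kappa>) powr p * CJ \<le> 1 / 3 powr (p + 1)"
    proof -
      let ?Z = "(3 powr (p + 1) * CJ) powr (1 / p)"
      have Z: "0 < ?Z" using CJ0 by simp
      have "2 * c * D * \<kappa> \<le> 2 * c * D * (1 / (2 * c * D * ?Z))"
        using assms(9) D0 by (intro mult_left_mono) (auto simp: \<kappa>_def)
      also have "\<dots> = 1 / ?Z" using assms(9) D0 by simp
      finally have "(2 * c * D * \<kappa>) powr p \<le> (1 / ?Z) powr p" using assms(9) D0 \<kappa>0 p0 by (intro powr_mono2) auto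
      also have "\<dots> = 1 / (3 powr (p + 1) * CJ)" using Z CJ0 p0 by (simp add: powr_divide powr_powr)
      finally have "(2 * c * D * \<kappa>) powr p * CJ \<le> 1 / (3 powr (p + 1) * CJ) * CJ" using CJ0 by (intro mult_right_mono) auto
      then show ?thesis using CJ0 by simp
    qed
    \<comment> \<open>The term R^2 makes the prescribed sample size at least 1, so that rounding up
      at most doubles it; the other term solves the requirement of
      \<open>variance_le\<close>.\<close>
    define Cn where "Cn = max (R\<^sup>2) (32 * c\<^sup>2 * D\<^sup>2 * (b * 3 powr (p + 1) * CJ) powr (2 / p))"
    have Cn0: "0 < Cn" "R\<^sup>2 \<le> Cn" using assms(3) by (auto simp: Cn_def less_max_iff_disj)
    have Cn: "b * CJ * (32 * c\<^sup>2 * D\<^sup>2 / Cn) powr (p / 2) \<le> 1 / 3 powr (p + 1)"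
    proof -
      let ?Z = "(b * 3 powr (p + 1) * CJ) powr (2 / p)"
      have Z: "0 < ?Z" using CJ0 b0 by simp
      have "32 * c\<^sup>2 * D\<^sup>2 * ?Z \<le> Cn" by (simp add: Cn_def)
      then have "32 * c\<^sup>2 * D\<^sup>2 / Cn \<le> 1 / ?Z" using Z Cn0 by (simp add: field_simps)
      then have "(32 * c\<^sup>2 * D\<^sup>2 / Cn) powr (p / 2) \<le> (1 / ?Z) powr (p / 2)" using p0 Cn0 by (intro powr_mono2) auto
      also have "\<dots> = 1 / (b * 3 powr (p + 1) * CJ)" using Z CJ0 p0 b0 by (simp add: powr_divide powr_powr)
      finally have "b * CJ * (32 * c\<^sup>2 * D\<^sup>2 / Cn) powr (p / 2) \<le> b * CJ * (1 / (b * 3 powr (p + 1) * CJ))"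
        using CJ0 b0 by (intro mult_left_mono) auto
      then show ?thesis using CJ0 b0 by simp
    qed
    define K1 where "K1 j = (2 * Cn) ^ j * c * \<kappa> powr (- zz)" for j :: nat
    have K1: "0 < K1 j" for j using Cn0 assms(9) \<kappa>0 by (simp add: K1_def)
    \<comment> \<open>The sum dominates the constants of both size bounds, as both are
      positive.\<close>
    let ?C = "K1 1 + K1 2"
    define good_net where "good_net d \<epsilon> \<Psi> \<longleftrightarrow> \<Psi> \<in> networks \<and>
              real (param_count \<Psi>) \<le> ?C * real d powr ((5 + zz) * \<theta> + z + w * zz + 4 * v) * \<epsilon> powr (- 4 - zz) \<and>
              real (nz_param_count \<Psi>) \<le> ?C * real d powr ((5 + zz) * \<theta> + z + w * zz + 2 * v) * \<epsilon> powr (- 2 - zz) \<and>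
              realization_in_C a \<Psi> d \<and>
              integrable (\<nu> d) (\<lambda>x. \<bar>u d (T, x) - realization a \<Psi> x\<bar> powr p) \<and>
              (\<integral>x. \<bar>u d (T, x) - realization a \<Psi> x\<bar> powr p \<partial>\<nu> d) powr (1 / p) \<le> \<epsilon>" for d \<epsilon> \<Psi>
    have main: "\<exists>\<Psi>. good_net d \<epsilon> \<Psi>"
      if d: "1 \<le> d" and \<epsilon>: "\<epsilon> \<in> {0<..R}" for d \<epsilon>
    proof -
      have e0: "0 < \<epsilon>" "\<epsilon> \<le> R" using \<epsilon> by auto
      have d1: "1 \<le> real d" using d by simp
      define \<delta> where "\<delta> = \<kappa> * real d powr (- (w + \<theta>)) * \<epsilon>"
      have \<delta>: "\<delta> \<in> {0<..r}"
      proof -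
        have "real d powr (- (w + \<theta>)) \<le> 1" using d1 assms(5,8) powr_mono[of "- (w + \<theta>)" 0 "real d"] by simp
        then have "\<delta> \<le> (r / R) * 1 * R"
          unfolding \<delta>_def using e0 \<kappa>0 assms(2,3) by (intro mult_mono) (auto simp: \<kappa>_def)
        then show ?thesis using e0 \<kappa>0 d1 assms(3) by (simp add: \<delta>_def)
      qed
      define X where "X = Cn * real d powr (2 * v + 2 * \<theta>) * \<epsilon> powr (- 2)"
      have X1: "1 \<le> X"
      proof -
        have "1 * 1 \<le> (Cn * \<epsilon> powr (- 2)) * real d powr (2 * v + 2 * \<theta>)"
        proof (rule mult_mono)
          have "\<epsilon>\<^sup>2 \<le> R\<^sup>2" using e0 by (intro power_mono) auto
          then have "\<epsilon>\<^sup>2 \<le> Cn" using Cn0 by linarith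
          moreover have "\<epsilon> powr (- 2) = 1 / \<epsilon>\<^sup>2" using e0 by (simp add: powr_minus divide_inverse)
          ultimately show "1 \<le> Cn * \<epsilon> powr (- 2)" using e0 by simp
          show "1 \<le> real d powr (2 * v + 2 * \<theta>)" using d1 assms(4,8) by (intro ge_one_powr_ge_zero) auto
        qed (use Cn0 in auto)
        then show ?thesis by (simp add: X_def mult_ac)
      qed
      define n where "n = nat \<lceil>X\<rceil>"
      have n: "X \<le> real n" "real n \<le> 2 * X" "1 \<le> n" using X1 by (simp_all add: n_def) linarith+
      interpret ac: affine_coeffs d "L d" "S d" "2 * c\<^sup>2" by (rule ac[OF d])
      obtain m where sol: "ac.is_solution T (\<phi> d) m (u d)" using u d iff[OF d] by blast
      let ?f = "realization a (\<Phi> d \<delta>)"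
      let ?J = "\<integral>x. (1 + nsq d x) powr (s * p) \<partial>\<nu> d"
      have fc: "continuous_on (Rd d) ?f" and id: "input_dim (\<Phi> d \<delta>) = d"
        using assms(24)[OF d \<delta>] by (auto simp: realization_in_C_def)
      have two: "1 + eucl_norm d x powr vv \<le> 2 * (1 + nsq d x) powr s" for x
        using one_plus_eucl_norm_powr_le[of vv x d] assms(10) by (simp add: s_def)
      have fb: "\<bar>?f x\<bar> \<le> 2 * (c * real d powr v) * (1 + nsq d x) powr s" if "x \<in> Rd d" for x
      proof -
        have "c * real d powr v * (1 + eucl_norm d x powr vv) \<le> c * real d powr v * (2 * (1 + nsq d x) powr s)"
          using assms(9) by (intro mult_left_mono two) auto
        then show ?thesis using assms(25)[OF d \<delta> that] by (simp add: mult_ac)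
      qed
      have df: "\<bar>\<phi> d x - ?f x\<bar> \<le> 2 * (c * real d powr w * \<delta>) * (1 + nsq d x) powr s" if "x \<in> Rd d" for x
      proof -
        have "c * real d powr w * \<delta> * (1 + eucl_norm d x powr vv) \<le> c * real d powr w * \<delta> * (2 * (1 + nsq d x) powr s)"
          using assms(9) \<delta> by (intro mult_left_mono two) auto
        then show ?thesis using assms(26)[OF d \<delta> that] by (simp add: mult_ac)
      qed
      \<comment> \<open>Each of the three errors receives this share: 3 powr p times three shares is
        \<epsilon> powr p.\<close>
      define \<eta> where "\<eta> = \<epsilon> powr p / 3 powr (p + 1)"
      have \<eta>: "0 < \<eta>" using e0 by (simp add: \<eta>_def)
      have "\<exists>G. (\<forall>k<n. is_affine d (G k)) \<and> integrable (\<nu> d) (\<lambda>x. \<bar>u d (T, x) - (\<Sum>k<n. ?f (G k x)) / real n\<bar> powr p) \<and>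
        (\<integral>x. \<bar>u d (T, x) - (\<Sum>k<n. ?f (G k x)) / real n\<bar> powr p \<partial>\<nu> d)
         \<le> 3 powr p * (\<eta> + (2 * (c * real d powr w * \<delta>) * D) powr p * ?J +
            b * real n powr (- p / 2) * ((8 * (2 * (c * real d powr v) * D)\<^sup>2) powr (p / 2) * ?J))"
        unfolding D_def b_def
        by (rule ac.affine_average_approximation[OF assms(1) assms(15)[OF d] \<phi>_bd[OF d, folded s_def] sol fc fb _ df _ assms(13)[OF d] conjunct1[OF J[OF d]] p0 k s0 M \<eta> n(3)])
          (use assms(9) d1 \<delta> in auto)
      then obtain G where G: "\<And>k. k < n \<Longrightarrow> is_affine d (G k)"
        and Gi: "integrable (\<nu> d) (\<lambda>x. \<bar>u d (T, x) - (\<Sum>k<n. ?f (G k x)) / real n\<bar> powr p)"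
        and Gb: "(\<integral>x. \<bar>u d (T, x) - (\<Sum>k<n. ?f (G k x)) / real n\<bar> powr p \<partial>\<nu> d)
         \<le> 3 powr p * (\<eta> + (2 * (c * real d powr w * \<delta>) * D) powr p * ?J +
            b * real n powr (- p / 2) * ((8 * (2 * (c * real d powr v) * D)\<^sup>2) powr (p / 2) * ?J))" by blast
      have c0: "0 < c" using assms(9) by simp
      have t1: "(2 * (c * real d powr w * \<delta>) * D) powr p * ?J \<le> \<eta>"
        unfolding \<delta>_def \<eta>_def by (rule bias_le[OF c0 D0 \<kappa>0 e0(1) d1 conjunct2[OF J[OF d]] \<kappa>])
      have t2: "b * real n powr (- p / 2) * ((8 * (2 * (c * real d powr v) * D)\<^sup>2) powr (p / 2) * ?J) \<le> \<eta>"
        unfolding \<eta>_def by (rule variance_le[OF c0 D0 e0(1) d1 p0 b0 Cn0(1) conjunct2[OF J[OF d]] n(1)[unfolded X_def] Cn less_imp_le[OF CJ0]])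
      have "3 powr p * (\<eta> + (2 * (c * real d powr w * \<delta>) * D) powr p * ?J +
            b * real n powr (- p / 2) * ((8 * (2 * (c * real d powr v) * D)\<^sup>2) powr (p / 2) * ?J)) \<le> 3 powr p * (\<eta> + \<eta> + \<eta>)"
        using t1 t2 by (intro mult_left_mono) auto
      also have "\<dots> = \<epsilon> powr p" by (simp add: \<eta>_def powr_add)
      finally have err: "(\<integral>x. \<bar>u d (T, x) - (\<Sum>k<n. ?f (G k x)) / real n\<bar> powr p \<partial>\<nu> d) \<le> \<epsilon> powr p"
        using Gb by linarith
      obtain \<Psi> where \<Psi>: "\<Psi> \<in> networks" "input_dim \<Psi> = d" "param_count \<Psi> \<le> n\<^sup>2 * param_count (\<Phi> d \<delta>)"
        "nz_param_count \<Psi> \<le> n * param_count (\<Phi> d \<delta>)" "\<And>x. realization a \<Psi> x = (\<Sum>k<n. ?f (G k x)) / real n"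
        using average_network_exists[where a = a and F = G, OF assms(22)[OF d \<delta>] id n(3) G] by blast
      have \<Psi>c: "continuous_on (Rd d) (realization a \<Psi>)"
      proof -
        have "continuous_on (Rd d) (\<lambda>x. ?f (G k x))" if "k < n" for k
          by (rule continuous_on_compose2[OF fc is_affine_continuous[OF G[OF that]]]) (use is_affine_Rd[OF G[OF that]] in auto)
        then have "continuous_on (Rd d) (\<lambda>x. (\<Sum>k<n. ?f (G k x)) / real n)" using n(3) by (intro continuous_intros) auto
        then show ?thesis by (simp add: \<Psi>(5)[abs_def])
      qed
      have N: "real (param_count (\<Phi> d \<delta>)) \<le> c * real d powr z * (\<kappa> * real d powr (- (w + \<theta>)) * \<epsilon>) powr (- zz)"
        using assms(23)[OF d \<delta>] by (simp add: \<delta>_def)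
      have grow: "K1 j * y1 * y2 \<le> ?C * y1 * y2" if "j = 1 \<or> j = 2" "0 \<le> y1" "0 \<le> y2" for j and y1 y2 :: real
        using that K1 by (intro mult_right_mono) (auto simp: less_imp_le)
      have size: "Q \<le> K1 j * real d powr ((5 + zz) * \<theta> + z + w * zz + 2 * real j * v) * \<epsilon> powr (- (2 * real j) - zz)"
        if "Q \<le> real n ^ j * real (param_count (\<Phi> d \<delta>))" "j = 1 \<or> j = 2" for Q j
        unfolding K1_def
        by (rule size_le[OF c0 \<kappa>0 e0(1) d1 Cn0(1) _ assms(8) _ _ n(2)[unfolded X_def] N that(1)]) (use that(2) in auto)
      have "real (param_count \<Psi>) \<le> real (n\<^sup>2 * param_count (\<Phi> d \<delta>))" using \<Psi>(3) by (simp only: of_nat_le_iff)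
      then have "real (param_count \<Psi>) \<le> K1 2 * real d powr ((5 + zz) * \<theta> + z + w * zz + 4 * v) * \<epsilon> powr (- 4 - zz)"
        using size[of "real (param_count \<Psi>)" 2] by simp
      then have P1: "real (param_count \<Psi>) \<le> ?C * real d powr ((5 + zz) * \<theta> + z + w * zz + 4 * v) * \<epsilon> powr (- 4 - zz)"
        using grow[of 2 "real d powr ((5 + zz) * \<theta> + z + w * zz + 4 * v)" "\<epsilon> powr (- 4 - zz)"] by simp
      have "real (nz_param_count \<Psi>) \<le> real (n * param_count (\<Phi> d \<delta>))" using \<Psi>(4) by (simp only: of_nat_le_iff)
      then have "real (nz_param_count \<Psi>) \<le> K1 1 * real d powr ((5 + zz) * \<theta> + z + w * zz + 2 * v) * \<epsilon> powr (- 2 - zz)"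
        using size[of "real (nz_param_count \<Psi>)" 1] by simp
      then have P2: "real (nz_param_count \<Psi>) \<le> ?C * real d powr ((5 + zz) * \<theta> + z + w * zz + 2 * v) * \<epsilon> powr (- 2 - zz)"
        using grow[of 1 "real d powr ((5 + zz) * \<theta> + z + w * zz + 2 * v)" "\<epsilon> powr (- 2 - zz)"] by simp
      have "(\<integral>x. \<bar>u d (T, x) - realization a \<Psi> x\<bar> powr p \<partial>\<nu> d) powr (1 / p) \<le> (\<epsilon> powr p) powr (1 / p)"
        unfolding \<Psi>(5) using err p0 by (intro powr_mono2 integral_nonneg) auto
      also have "\<dots> = \<epsilon>" using e0 p0 by (simp add: powr_powr)
      finally show ?thesis using \<Psi>(1,2) \<Psi>c P1 P2 Gi unfolding \<Psi>(5)[symmetric]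
        unfolding good_net_def realization_in_C_def by blast
    qed
    then obtain \<Psi> where "\<And>d \<epsilon>. 1 \<le> d \<Longrightarrow> \<epsilon> \<in> {0<..R} \<Longrightarrow> good_net d \<epsilon> (\<Psi> d \<epsilon>)" by metis
    moreover have "0 < ?C" using K1[of 1] K1[of 2] by simp
    ultimately show ?thesis unfolding good_net_def by blast
  qed
  ultimately show ?thesis by blast
qed

end
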